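(* Let $n\ge 0$ be a fixed integer and let $A\in\mathbb C$ be fixed. Let $\mathcal X\subset\mathbb C\setminus\{0,1\}$ be a small open set, assumed simply connected to allow for a choice of a canonical homology basis $\{a,b\}$ on the surfaces $\mathcal L(x)$ such that the projections $u(a)$ and $u(b)$ are fixed for all $x\in\mathcal X$. On each surface $\mathcal L(x)$, $x\in\mathcal X$, let $$\Omega(P)=W^{(n)}(P,Q_0)+A\,\omega(P),\qquad P\in\mathcal L(x),$$ be the meromorphic differential of the second kind with its pole at $Q_0\in\mathcal L(x)$, where $Q_0$ is different from the ramification points. Let the position $Q_0=Q_0(x)\in\mathcal L(x)$ of the pole of $\Omega$ be defined by the conditions $\oint_a\Omega=\mathrm{const}$ and $\oint_b\Omega=\mathrm{const}$ (i.e. both periods are independent of $x\in\mathcal X$). Then the $u$-coordinate $y_0=u(Q_0)$ of the pole, as a function of $x$, satisfies the following second order ordinary differential equation: $$\begin{aligned} y_0''=&-(y_0')^2\frac{L_{n+2}}{L_{n+1}}-y_0'\left(\frac1x+\frac1{x-1}+\frac1{y_0-x}\right)+y_0'\,\frac{(n+1)!}{(x-y_0)^{n+2}L_{n+1}}\sum_{s=0}^{n}\frac{L_s(x-y_0)^s}{s!}\\ &+\frac{n!\left(\frac1x+\frac1{x-1}+\frac2{y_0-x}\right)}{2(x-y_0)^{n+1}L_{n+1}}\sum_{s=0}^{n-1}\frac{L_s(x-y_0)^s}{s!}-\frac{n!}{2(x-y_0)^{n+2}L_{n+1}}\sum_{s=0}^{n-1}\frac{(n-s)L_s(x-y_0)^s}{s!}\\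 &-\frac{n!}{4(x-y_0)^{n+2}L_{n+1}}\sum_{s=1}^{n-1}\sum_{k=0}^{s-1}\frac{L_k(x-y_0)^k}{k!}\\ &-\frac{L_n}{4L_{n+1}}\left(\frac{2}{y_0-x}\left(\frac1x+\frac1{x-1}\right)+\frac{3}{(y_0-x)^2}+\frac1{x-1}-\frac1x\right), \end{aligned}$$ where primes denote $d/dx$, the $L_l=L_l(x,y_0)$ are the functions defined in the context, and empty sums are zero.
   Context: For $x\in\mathbb C\setminus\{0,1\}$, $\mathcal L(x)$ is the compact genus one Riemann surface of the curve $v^2=u(u-1)(u-x)$, with points $P=(u(P),v(P))$. The degree two covering $u:\mathcal L(x)\to\mathbb{CP}^1$ is ramified at $P_0=(0,0)$, $P_1=(1,0)$, $P_x=(x,0)$, $P_\infty=(\infty,\infty)$ (the ramification points). Given a canonical homology basis $\{a,b\}$ on $\mathcal L(x)$, $\omega$ is the holomorphic differential with $\oint_a\omega=1$. For a point $Q_0$ that is not a ramification point, with $y_0=u(Q_0)$, $W^{(n)}(P,Q_0)$ denotes the Abelian differential of the second kind in $P$ with $\oint_a W^{(n)}(\cdot,Q_0)=0$, whose only pole is at $P=Q_0$, where $$W^{(n)}(P,Q_0)=\left(\frac1{(u(P)-y_0)^{n+2}}+\mathcal O(1)\right)du(P).$$ For integers $k\ge 0$ put $$\Sigma_k=\frac1{(-y_0)^k}+\frac1{(1-y_0)^k}+\frac1{(x-y_0)^k},$$ and for integers $l\ge0$ $$L_l=\sum_{\substack{p_1+2p_2+\dots+lp_l=l\\ p_1,\dots,p_l\ge0}}\frac{l!\,\Sigma_1^{p_1}\Sigma_2^{p_2}\cdots\Sigma_l^{p_l}}{2^{p_1+\dots+p_l}\,\prod_{k=1}^l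 p_k!\,\prod_{k=1}^l k^{p_k}},\qquad L_0=1 .$$ *)

theory Defs
  imports "HOL-Complex_Analysis.Complex_Analysis" "HOL-Homology.Homology"
    "HOL-Library.Landau_Symbols" "HOL-Library.FuncSet"
begin

definition affine_curve :: "complex \<Rightarrow> (complex \<times> complex) set" where
  "affine_curve x = {(u, v). v\<^sup>2 = u * (u - 1) * (u - x)}"

definition unramified :: "complex \<Rightarrow> (complex \<times> complex) set" where
  "unramified x = {(u, v) \<in> affine_curve x. v \<noteq> 0}"

text \<open>The compact surface: the affine curve is closed in \<open>\<complex>\<^sup>2\<close> and has a single
  end, so its one-point compactification is the smooth projective model; \<open>None\<close> is
  the point over \<open>u = \<infinity>\<close>.\<close>

definition surface :: "complex \<Rightarrow> (complex \<times> complex) option topology" where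
  "surface x = Alexandroff_compactification (top_of_set (affine_curve x))"

text \<open>The complex structure is given by the standard local parameters: \<open>u - y\<close> at an
  unramified point, \<open>\<surd>(u - y)\<close> at a finite ramification point, \<open>1/\<surd>u\<close> at
  infinity. Here \<open>\<phi>\<close> is the inverse of such a parameter near \<open>P\<close>. The limit
  condition selects the sheet at an unramified point; elsewhere the two possible \<open>\<phi>\<close>
  differ by the substitution \<open>\<zeta> \<mapsto> -\<zeta>\<close>. The value of \<open>\<phi>\<close> at \<open>0\<close> is immaterial.\<close>

definition local_param ::
  "complex \<Rightarrow> (complex \<times> complex) option \<Rightarrow> (complex \<Rightarrow> complex \<times> complex) \<Rightarrow> bool" where
  "local_param x P \<phi> \<longleftrightarrow>
     (\<forall>\<zeta>. fst (\<phi> \<zeta>) = (case P of None \<Rightarrow> 1 / \<zeta>\<^sup>2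
                          | Some (y, w) \<Rightarrow> if w = 0 then y + \<zeta>\<^sup>2 else y + \<zeta>)) \<and>
     (\<exists>r>0. (snd \<circ> \<phi>) holomorphic_on (ball 0 r - {0}) \<and>
            (\<forall>\<zeta>\<in>ball 0 r - {0}. \<phi> \<zeta> \<in> affine_curve x)) \<and>
     limitin (surface x) (\<lambda>\<zeta>. Some (\<phi> \<zeta>)) P (at 0)"

text \<open>A differential is represented by its coefficient \<open>h\<close> with respect to \<open>du\<close>, a
  function on the unramified part of the curve. It is holomorphic at \<open>P\<close> if
  \<open>h du = g d\<zeta>\<close> with \<open>g\<close> analytic at \<open>\<zeta> = 0\<close>. The last conjunct fixes the value
  of \<open>h\<close> at an unramified \<open>P\<close>, where \<open>du = d\<zeta>\<close>; values of \<open>h\<close> at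
  ramification points are never used.\<close>

definition holomorphic_at ::
  "complex \<Rightarrow> (complex \<times> complex \<Rightarrow> complex) \<Rightarrow> (complex \<times> complex) option \<Rightarrow> bool" where
  "holomorphic_at x h P \<longleftrightarrow>
     (\<exists>\<phi> g. local_param x P \<phi> \<and> g analytic_on {0} \<and>
        (\<forall>\<^sub>F \<zeta> in at 0. h (\<phi> \<zeta>) * deriv (fst \<circ> \<phi>) \<zeta> = g \<zeta>) \<and>
        (\<forall>y w. P = Some (y, w) \<and> w \<noteq> 0 \<longrightarrow> h (y, w) = g 0))"

definition curve_loop :: "complex \<Rightarrow> (real \<Rightarrow> complex \<times> complex) \<Rightarrow> bool" where
  "curve_loop x \<gamma> \<longleftrightarrow> path \<gamma> \<and> pathfinish \<gamma> = pathstart \<gamma> \<and>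
     path_image \<gamma> \<subseteq> unramified x \<and> valid_path (fst \<circ> \<gamma>)"

definition homology_class ::
  "complex \<Rightarrow> (real \<Rightarrow> complex \<times> complex) \<Rightarrow> (complex \<times> complex) option chain set" where
  "homology_class x \<gamma> = homologous_rel_set 1 (surface x) {}
     (frag_of (restrict (\<lambda>z. Some (\<gamma> (z 1))) (standard_simplex 1)))"

definition curve_integral ::
  "(real \<Rightarrow> complex \<times> complex) \<Rightarrow> (complex \<times> complex \<Rightarrow> complex) \<Rightarrow> complex" where
  "curve_integral \<gamma> h =
     integral {0..1} (\<lambda>t. h (\<gamma> t) * vector_derivative (fst \<circ> \<gamma>) (at t within {0..1}))"

text \<open>The period of \<open>h du\<close> over a homology class: the integral over a representing loop
  that avoids the poles. For differentials with vanishing residues it does not depend on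
  the representative.\<close>

definition has_period ::
  "complex \<Rightarrow> (complex \<times> complex \<Rightarrow> complex) \<Rightarrow> (complex \<times> complex) option chain set \<Rightarrow>
     complex \<Rightarrow> bool" where
  "has_period x h c I \<longleftrightarrow>
     (\<exists>\<gamma>. curve_loop x \<gamma> \<and> homology_class x \<gamma> = c \<and>
          (\<forall>t\<in>{0..1}. holomorphic_at x h (Some (\<gamma> t))) \<and> curve_integral \<gamma> h = I)"

definition crossings :: "(real \<Rightarrow> 'a) \<Rightarrow> (real \<Rightarrow> 'a) \<Rightarrow> (real \<times> real) set" where
  "crossings \<gamma> \<delta> = {(s, t) \<in> {0..1} \<times> {0..1}. \<gamma> s = \<delta> t}"

text \<open>Away from ramification points \<open>u\<close> is an orientation-preserving chart, so the sign
  of a crossing can be read off the tangent vectors of the projections.\<close>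

definition crossing_det ::
  "(real \<Rightarrow> complex \<times> complex) \<Rightarrow> (real \<Rightarrow> complex \<times> complex) \<Rightarrow> real \<times> real \<Rightarrow> real" where
  "crossing_det \<gamma> \<delta> = (\<lambda>(s, t). Im (cnj (vector_derivative (fst \<circ> \<gamma>) (at s)) *
                                      vector_derivative (fst \<circ> \<delta>) (at t)))"

definition transversal ::
  "(real \<Rightarrow> complex \<times> complex) \<Rightarrow> (real \<Rightarrow> complex \<times> complex) \<Rightarrow> bool" where
  "transversal \<gamma> \<delta> \<longleftrightarrow> finite (crossings \<gamma> \<delta>) \<and>
     (\<forall>(s, t)\<in>crossings \<gamma> \<delta>. s \<in> {0<..<1} \<and> t \<in> {0<..<1} \<and>
        (fst \<circ> \<gamma>) differentiable (at s) \<and> (fst \<circ> \<delta>) differentiable (at t) \<and>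
        crossing_det \<gamma> \<delta> (s, t) \<noteq> 0)"

definition intersection_index ::
  "(real \<Rightarrow> complex \<times> complex) \<Rightarrow> (real \<Rightarrow> complex \<times> complex) \<Rightarrow> real" where
  "intersection_index \<gamma> \<delta> = (\<Sum>p\<in>crossings \<gamma> \<delta>. sgn (crossing_det \<gamma> \<delta> p))"

text \<open>A basis of \<open>H\<^sub>1\<close> over the integers with intersection number \<open>a \<cdot> b = 1\<close>, the
  latter computed on transversal representatives of the two classes.\<close>

definition canonical_basis ::
  "complex \<Rightarrow> (real \<Rightarrow> complex \<times> complex) \<Rightarrow> (real \<Rightarrow> complex \<times> complex) \<Rightarrow> bool" where
  "canonical_basis x a b \<longleftrightarrow> curve_loop x a \<and> curve_loop x b \<and>
     (let H = homology_group 1 (surface x) in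
        bij_betw (\<lambda>(j::int, k::int).
            (homology_class x a [^]\<^bsub>H\<^esub> j) \<otimes>\<^bsub>H\<^esub> (homology_class x b [^]\<^bsub>H\<^esub> k))
          UNIV (carrier H)) \<and>
     (\<exists>\<gamma> \<delta>. curve_loop x \<gamma> \<and> curve_loop x \<delta> \<and>
        homology_class x \<gamma> = homology_class x a \<and> homology_class x \<delta> = homology_class x b \<and>
        transversal \<gamma> \<delta> \<and> intersection_index \<gamma> \<delta> = 1)"

definition normalized_holomorphic ::
  "complex \<Rightarrow> (real \<Rightarrow> complex \<times> complex) \<Rightarrow> (complex \<times> complex \<Rightarrow> complex) \<Rightarrow> bool" where
  "normalized_holomorphic x a \<omega> \<longleftrightarrow>
     (\<forall>P\<in>topspace (surface x). holomorphic_at x \<omega> P) \<and>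
     has_period x \<omega> (homology_class x a) 1"

text \<open>The differential \<open>W\<^sup>(\<^sup>n\<^sup>)(\<cdot>, Q)\<close> for an unramified point \<open>Q\<close>.\<close>

definition normalized_second_kind ::
  "nat \<Rightarrow> complex \<Rightarrow> (real \<Rightarrow> complex \<times> complex) \<Rightarrow> complex \<times> complex \<Rightarrow>
     (complex \<times> complex \<Rightarrow> complex) \<Rightarrow> bool" where
  "normalized_second_kind n x a Q W \<longleftrightarrow>
     (\<forall>P\<in>topspace (surface x) - {Some Q}. holomorphic_at x W P) \<and>
     (\<exists>\<phi>. local_param x (Some Q) \<phi> \<and>
        (\<lambda>\<zeta>. W (\<phi> \<zeta>) - 1 / (fst (\<phi> \<zeta>) - fst Q) ^ (n + 2)) \<in> O[at 0](\<lambda>_. 1)) \<and>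
     has_period x W (homology_class x a) 0"

definition Sig :: "nat \<Rightarrow> complex \<Rightarrow> complex \<Rightarrow> complex" where
  "Sig k x y = 1 / (- y) ^ k + 1 / (1 - y) ^ k + 1 / (x - y) ^ k"

definition L :: "nat \<Rightarrow> complex \<Rightarrow> complex \<Rightarrow> complex" where
  "L l x y = (\<Sum>p \<in> {p \<in> {1..l} \<rightarrow>\<^sub>E (UNIV :: nat set). (\<Sum>k=1..l. k * p k) = l}.
      fact l * (\<Prod>k=1..l. Sig k x y ^ p k) /
      (2 ^ (\<Sum>k=1..l. p k) * (\<Prod>k=1..l. fact (p k)) * (\<Prod>k=1..l. of_nat k ^ p k)))"

lemma L_0: "L 0 x y = 1"
  by (simp add: L_def)

end

theory Submission imports Defs begin

text \<open>Write \<open>f = v\<^sup>-\<^sup>1\<close> near the pole \<open>Q\<^sub>0 = (y, w)\<close> and let \<open>T\<^sub>l\<close> be its Taylor coefficients in \<open>u - y\<close>, so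
  that \<open>T\<^sub>l = L\<^sub>l / (l! w)\<close>. Subtracting exact differentials from \<open>W\<^sup>(\<^sup>n\<^sup>)\<close> leaves \<open>(l + m u) du / v\<close> with
  \<open>m = T\<^sub>n / (4 (n + 1))\<close>. The prescribed periods and the Legendre relation (the determinant of the periods of
  \<open>du / v\<close> and \<open>u du / v\<close> is a nonzero constant in \<open>x\<close>) therefore make \<open>T\<^sub>n\<close> a linear combination with
  constant coefficients of the two periods of \<open>du / v\<close>, and so \<open>T\<^sub>n\<close> satisfies their Picard--Fuchs equation
  \<open>x (1 - x) T'' + (1 - 2 x) T' - T / 4 = 0\<close>. Expressing the derivatives of \<open>T\<^sub>n\<close> along \<open>y = y\<^sub>0(x)\<close> by
  the \<open>T\<^sub>l\<close> turns this into the equation for \<open>y\<^sub>0\<close>.\<close>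

section \<open>Sums over subdivided paths and homology invariance\<close>

text \<open>Periods belong to homology classes of the compact surface, but singular simplices are
  merely continuous and may cross ramification points, where no integral in \<open>u\<close> is at
  hand. Differentials are therefore replaced by cochains \<open>\<delta> P Q\<close> that locally
  are increments of primitives; on a fine enough bisection their sums are exact, not approximate, so
  homology invariance needs no smoothing. This covers \<open>u du / v\<close> as well, whose pole at
  infinity has no residue. The Legendre determinant is never evaluated: its derivative vanishes by
  Picard-Fuchs, and it is nonzero because \<open>(l + m u) du / v\<close> with zero periods has a
  primitive whose odd part, divided by \<open>v\<close>, is a function of \<open>u\<close> that
  Liouville forces to vanish. The 4 in \<open>m\<close> is a product of two factors 2: one from
  splitting off the part odd in \<open>v\<close>, one from \<open>v d(v / (u - y)) / du\<close>
  growing like \<open>u / 2\<close>. The pole position is only continuous by assumption. It becomes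
  differentiable by solving the formula for T_n for \<open>y\<close>, whose partial derivative in
  \<open>y\<close> is (n + 1) T_(n+1); this is where \<open>L (n + 1)\<close> must not
  vanish.\<close>

primrec dyadic_sum :: "nat \<Rightarrow> ('a::real_vector \<Rightarrow> 'a \<Rightarrow> complex) \<Rightarrow> 'a \<Rightarrow> 'a \<Rightarrow> complex" where
  "dyadic_sum 0 d a b = d a b"
| "dyadic_sum (Suc N) d a b = dyadic_sum N d a (midpoint a b) + dyadic_sum N d (midpoint a b) b"

lemma midpoint_in_convex:
  assumes "convex K" "a \<in> K" "b \<in> K"
  shows "midpoint a b \<in> K"
  using assms unfolding midpoint_def scaleR_add_right
  by (intro convexD) auto

lemma dist_midpoint_common:
  fixes a b c :: "'a::real_normed_vector"
  shows "dist (midpoint a b) (midpoint a c) = dist b c / 2"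
    and "dist (midpoint a b) (midpoint c b) = dist a c / 2"
    and "dist (midpoint a b) (midpoint b c) = dist a c / 2"
  unfolding midpoint_def dist_norm
  by (simp_all add: scaleR_diff_right [symmetric])

text \<open>The edge midpoints cut the triangle into four of half the size, and the induction
  hypothesis on each lets the inner edges be exchanged: \<open>a p q\<close>, \<open>p b r\<close>,
  \<open>p q r\<close> and \<open>q r c\<close>. Every edge is always traversed in the same
  direction, so \<open>d\<close> need not be antisymmetric.\<close>

lemma dyadic_sum_triangle:
  fixes K :: "'a::real_normed_vector set"
  assumes "convex K"
    and small: "\<And>a b c. \<lbrakk>a \<in> K; b \<in> K; c \<in> K; dist a b \<le> \<eta>; dist a c \<le> \<eta>; dist b c \<le> \<eta>\<rbrakk>
                  \<Longrightarrow> d a b + d b c = d a c"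
  shows "\<lbrakk>a \<in> K; b \<in> K; c \<in> K; dist a b \<le> 2 ^ N * \<eta>; dist a c \<le> 2 ^ N * \<eta>; dist b c \<le> 2 ^ N * \<eta>\<rbrakk>
          \<Longrightarrow> dyadic_sum N d a b + dyadic_sum N d b c = dyadic_sum N d a c"
proof (induction N arbitrary: a b c)
  case 0
  then show ?case using small[of a b c] by simp
next
  case (Suc N)
  define p q r where "p = midpoint a b" and "q = midpoint a c" and "r = midpoint b c"
  have mem: "p \<in> K" "q \<in> K" "r \<in> K"
    using Suc.prems \<open>convex K\<close> by (auto simp: p_def q_def r_def intro: midpoint_in_convex)
  have d: "dist a p = dist a b / 2" "dist p b = dist a b / 2" "dist a q = dist a c / 2"
     "dist q c = dist a c / 2" "dist b r = dist b c / 2" "dist r c = dist b c / 2"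
     by (simp_all add: p_def q_def r_def dist_midpoint)
  have e: "dist p q = dist b c / 2" "dist p r = dist a c / 2" "dist q r = dist a b / 2"
    unfolding p_def q_def r_def using dist_midpoint_common[of a b c] dist_midpoint_common[of a c b]
    by (auto simp: dist_commute midpoint_sym)
  have 1: "dyadic_sum N d a p + dyadic_sum N d p q = dyadic_sum N d a q"
    by (rule Suc.IH) (use mem d e Suc.prems in auto)
  have 2: "dyadic_sum N d p b + dyadic_sum N d b r = dyadic_sum N d p r"
    by (rule Suc.IH) (use mem d e Suc.prems in auto)
  have 3: "dyadic_sum N d q r + dyadic_sum N d r c = dyadic_sum N d q c"
    by (rule Suc.IH) (use mem d e Suc.prems in auto)
  have 4: "dyadic_sum N d p q + dyadic_sum N d q r = dyadic_sum N d p r"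
    by (rule Suc.IH) (use mem d e Suc.prems in auto)
  show ?case
    unfolding dyadic_sum.simps p_def [symmetric] q_def [symmetric] r_def [symmetric]
      1 [symmetric] 3 [symmetric]
    using 2 4 by (metis (no_types) add.assoc)
qed

lemma dyadic_sum_eventually:
  fixes K :: "'a::real_normed_vector set"
  assumes "convex K" "\<eta> > 0"
    and small: "\<And>a b c. \<lbrakk>a \<in> K; b \<in> K; c \<in> K; dist a b \<le> \<eta>; dist a c \<le> \<eta>; dist b c \<le> \<eta>\<rbrakk>
                  \<Longrightarrow> d a b + d b c = d a c"
    and "a \<in> K" "b \<in> K" "c \<in> K"
  shows "\<forall>\<^sub>F N in sequentially. dyadic_sum N d a b + dyadic_sum N d b c = dyadic_sum N d a c"
proof -
  define M where "M = max (dist a b) (max (dist a c) (dist b c))"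
  obtain N0 where N0: "M / \<eta> < 2 ^ N0"
    using real_arch_pow[of 2 "M / \<eta>"] by auto
  have "dyadic_sum N d a b + dyadic_sum N d b c = dyadic_sum N d a c" if "N \<ge> N0" for N
  proof -
    have "M < 2 ^ N0 * \<eta>" using N0 \<open>\<eta> > 0\<close> by (simp add: pos_divide_less_eq)
    also have "\<dots> \<le> 2 ^ N * \<eta>" using that \<open>\<eta> > 0\<close> by simp
    finally show ?thesis
      by (intro dyadic_sum_triangle[OF assms(1) small]) (use assms M_def in auto)
  qed
  then show ?thesis unfolding eventually_sequentially by blast
qed

text \<open>One further bisection applies the triangle identity to the degenerate triangle
  \<open>a\<close>, \<open>midpoint a b\<close>, \<open>b\<close>, so for large \<open>N\<close> the
  sum stops changing.\<close>

lemma dyadic_sum_stable: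
  fixes K :: "'a::real_normed_vector set"
  assumes "convex K" "\<eta> > 0"
    and small: "\<And>a b c. \<lbrakk>a \<in> K; b \<in> K; c \<in> K; dist a b \<le> \<eta>; dist a c \<le> \<eta>; dist b c \<le> \<eta>\<rbrakk>
                  \<Longrightarrow> d a b + d b c = d a c"
    and "a \<in> K" "b \<in> K"
  shows "\<exists>l. \<forall>\<^sub>F N in sequentially. dyadic_sum N d a b = l"
proof -
  have "\<forall>\<^sub>F N in sequentially. dyadic_sum (Suc N) d a b = dyadic_sum N d a b"
    using dyadic_sum_eventually[OF assms(1-3) \<open>a \<in> K\<close> midpoint_in_convex[OF \<open>convex K\<close> assms(4,5)] \<open>b \<in> K\<close>]
    by (auto elim: eventually_mono)
  then obtain N0 where N0: "\<And>N. N \<ge> N0 \<Longrightarrow> dyadic_sum (Suc N) d a b = dyadic_sum N d a b"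
    unfolding eventually_sequentially by auto
  have "dyadic_sum N d a b = dyadic_sum N0 d a b" if "N \<ge> N0" for N
    using that by (induction rule: dec_induct) (simp_all only: N0)
  then show ?thesis unfolding eventually_sequentially by blast
qed

lemma dyadic_sum_affine:
  assumes "\<And>a b. h (midpoint a b) = midpoint (h a) (h b)"
  shows "dyadic_sum N (\<lambda>s t. d (h s) (h t)) a b = dyadic_sum N d (h a) (h b)"
  by (induction N arbitrary: a b) (simp_all add: assms)

lemma dyadic_sum_cong:
  assumes "convex K" "\<And>a b. \<lbrakk>a \<in> K; b \<in> K\<rbrakk> \<Longrightarrow> d a b = d' a b" "a \<in> K" "b \<in> K"
  shows "dyadic_sum N d a b = dyadic_sum N d' a b"
  using assms(3,4) by (induction N arbitrary: a b) (simp_all add: assms(1,2) midpoint_in_convex)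

lemma dyadic_sum_telescope:
  "dyadic_sum N (\<lambda>s t. f t - f s) a b = f b - f a"
  by (induction N arbitrary: a b) simp_all

section \<open>Cocycles and their sums along continuous paths\<close>

text \<open>An Alexander--Spanier 1-cocycle; the cochain itself may be discontinuous.\<close>

definition local_cocycle :: "'b topology \<Rightarrow> ('b \<Rightarrow> 'b \<Rightarrow> complex) \<Rightarrow> bool" where
  "local_cocycle S \<delta> \<longleftrightarrow> (\<forall>Z\<in>topspace S. \<exists>N. openin S N \<and> Z \<in> N \<and>
      (\<forall>P\<in>N. \<forall>Q\<in>N. \<forall>T\<in>N. \<delta> P Q + \<delta> Q T = \<delta> P T))"

text \<open>For a continuous path and a local cocycle the sequence is eventually constant, so
  \<open>lim\<close> merely names the stable value and no mesh has to be chosen.\<close>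

definition path_sum :: "('b \<Rightarrow> 'b \<Rightarrow> complex) \<Rightarrow> (real \<Rightarrow> 'b) \<Rightarrow> complex" where
  "path_sum \<delta> p = lim (\<lambda>N. dyadic_sum N (\<lambda>s t. \<delta> (p s) (p t)) 0 1)"

text \<open>A Lebesgue number for the preimages of the good open sets. It is halved because the
  conclusion uses closed balls.\<close>

lemma compact_map_Lebesgue:
  fixes K :: "'a::real_normed_vector set"
  assumes "compact K" and cm: "continuous_map (top_of_set K) S \<sigma>"
    and loc: "\<And>Z. Z \<in> topspace S \<Longrightarrow> \<exists>N. openin S N \<and> Z \<in> N \<and> Pr N"
  obtains \<eta> where "\<eta> > 0" "\<And>a. a \<in> K \<Longrightarrow> \<exists>N. openin S N \<and> Pr N \<and> (\<forall>b\<in>K. dist a b \<le> \<eta> \<longrightarrow> \<sigma> b \<in> N)"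
proof -
  define G where "G = {V. open V \<and> (\<exists>N. openin S N \<and> Pr N \<and> \<sigma> ` (K \<inter> V) \<subseteq> N)}"
  have "\<exists>V\<in>G. a \<in> V" if "a \<in> K" for a
  proof -
    have "\<sigma> a \<in> topspace S" using cm that by (auto simp: continuous_map_def)
    then obtain N where N: "openin S N" "\<sigma> a \<in> N" "Pr N" using loc by blast
    have "openin (top_of_set K) {z \<in> K. \<sigma> z \<in> N}"
      using openin_continuous_map_preimage[OF cm N(1)] by simp
    then obtain V where "open V" "{z \<in> K. \<sigma> z \<in> N} = K \<inter> V"
      unfolding openin_open by blast
    have "a \<in> V" using \<open>{z \<in> K. \<sigma> z \<in> N} = K \<inter> V\<close> N(2) that by auto
    moreover have "\<sigma> ` (K \<inter> V) \<subseteq> N" unfolding \<open>{z \<in> K. \<sigma> z \<in> N} = K \<inter> V\<close> [symmetric] by auto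
    ultimately show ?thesis using N \<open>open V\<close> unfolding G_def by auto
  qed
  then have sub: "K \<subseteq> \<Union>G" by blast
  have op: "open V" if "V \<in> G" for V using that by (simp add: G_def)
  obtain e where e: "0 < e" "\<And>a. a \<in> K \<Longrightarrow> \<exists>V\<in>G. ball a e \<subseteq> V"
    using Heine_Borel_lemma[OF \<open>compact K\<close> sub op] by metis
  show ?thesis
  proof
    show "e / 2 > 0" using e by simp
    fix a assume "a \<in> K"
    then obtain V where "V \<in> G" "ball a e \<subseteq> V" using e by blast
    then obtain N where "openin S N" "Pr N" "\<sigma> ` (K \<inter> V) \<subseteq> N" unfolding G_def by blast
    moreover have "\<sigma> b \<in> N" if "b \<in> K" "dist a b \<le> e / 2" for b
    proof -
      have "b \<in> ball a e" using that e(1) by auto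
      then show ?thesis using \<open>ball a e \<subseteq> V\<close> \<open>\<sigma> ` (K \<inter> V) \<subseteq> N\<close> that by blast
    qed
    ultimately show "\<exists>N. openin S N \<and> Pr N \<and> (\<forall>b\<in>K. dist a b \<le> e / 2 \<longrightarrow> \<sigma> b \<in> N)" by blast
  qed
qed

lemma local_cocycle_small:
  fixes K :: "'a::real_normed_vector set"
  assumes "compact K" "continuous_map (top_of_set K) S \<sigma>" "local_cocycle S \<delta>"
  obtains \<eta> where "\<eta> > 0" "\<And>a b c. \<lbrakk>a \<in> K; b \<in> K; c \<in> K; dist a b \<le> \<eta>; dist a c \<le> \<eta>; dist b c \<le> \<eta>\<rbrakk>
        \<Longrightarrow> \<delta> (\<sigma> a) (\<sigma> b) + \<delta> (\<sigma> b) (\<sigma> c) = \<delta> (\<sigma> a) (\<sigma> c)"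
proof -
  have *: "\<exists>N. openin S N \<and> Z \<in> N \<and> (\<forall>P\<in>N. \<forall>Q\<in>N. \<forall>T\<in>N. \<delta> P Q + \<delta> Q T = \<delta> P T)"
    if "Z \<in> topspace S" for Z
    using that assms(3) by (auto simp: local_cocycle_def)
  obtain \<eta> where \<eta>: "\<eta> > 0" "\<And>a. a \<in> K \<Longrightarrow> \<exists>N. openin S N \<and> (\<forall>P\<in>N. \<forall>Q\<in>N. \<forall>T\<in>N. \<delta> P Q + \<delta> Q T = \<delta> P T) \<and>
      (\<forall>b\<in>K. dist a b \<le> \<eta> \<longrightarrow> \<sigma> b \<in> N)"
    by (rule compact_map_Lebesgue[OF assms(1,2), where Pr = "\<lambda>N. \<forall>P\<in>N. \<forall>Q\<in>N. \<forall>T\<in>N. \<delta> P Q + \<delta> Q T = \<delta> P T", OF *]) blast+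
  show ?thesis
  proof (rule that[OF \<eta>(1)])
    fix a b c assume abc: "a \<in> K" "b \<in> K" "c \<in> K" "dist a b \<le> \<eta>" "dist a c \<le> \<eta>" "dist b c \<le> \<eta>"
    obtain N where N: "\<forall>P\<in>N. \<forall>Q\<in>N. \<forall>T\<in>N. \<delta> P Q + \<delta> Q T = \<delta> P T" "\<forall>b\<in>K. dist a b \<le> \<eta> \<longrightarrow> \<sigma> b \<in> N"
      using \<eta>(2)[OF abc(1)] by blast
    then have "\<sigma> a \<in> N" "\<sigma> b \<in> N" "\<sigma> c \<in> N" using abc \<eta>(1) by auto
    with N(1) show "\<delta> (\<sigma> a) (\<sigma> b) + \<delta> (\<sigma> b) (\<sigma> c) = \<delta> (\<sigma> a) (\<sigma> c)" by blast
  qed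
qed

text \<open>Affine maps commute with midpoints, so bisecting a segment in \<open>K\<close> and
  bisecting its parameter interval give the same sum. This transfers identities between points of
  \<open>K\<close> to path sums.\<close>

lemma path_sum_segment:
  fixes K :: "'a::real_normed_vector set"
  assumes "compact K" "convex K" "continuous_map (top_of_set K) S \<sigma>" "local_cocycle S \<delta>"
    and ab: "a \<in> K" "b \<in> K"
    and q: "\<And>t. t \<in> {0..1} \<Longrightarrow> q t = \<sigma> (a + t *\<^sub>R (b - a))"
  shows "\<forall>\<^sub>F N in sequentially. dyadic_sum N (\<lambda>s t. \<delta> (\<sigma> s) (\<sigma> t)) a b = path_sum \<delta> q"
proof -
  obtain \<eta> where \<eta>: "\<eta> > 0" "\<And>a b c. \<lbrakk>a \<in> K; b \<in> K; c \<in> K; dist a b \<le> \<eta>; dist a c \<le> \<eta>; dist b c \<le> \<eta>\<rbrakk>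
        \<Longrightarrow> \<delta> (\<sigma> a) (\<sigma> b) + \<delta> (\<sigma> b) (\<sigma> c) = \<delta> (\<sigma> a) (\<sigma> c)"
    using local_cocycle_small[OF assms(1,3,4)] by blast
  obtain l where l: "\<forall>\<^sub>F N in sequentially. dyadic_sum N (\<lambda>s t. \<delta> (\<sigma> s) (\<sigma> t)) a b = l"
    using dyadic_sum_stable[OF \<open>convex K\<close> \<eta>(1), of "\<lambda>s t. \<delta> (\<sigma> s) (\<sigma> t)" a b] \<eta>(2) ab by blast
  let ?h = "\<lambda>t::real. a + t *\<^sub>R (b - a)"
  have eq: "dyadic_sum N (\<lambda>s t. \<delta> (q s) (q t)) 0 1 = dyadic_sum N (\<lambda>s t. \<delta> (\<sigma> s) (\<sigma> t)) a b" for N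
  proof -
    have "dyadic_sum N (\<lambda>s t. \<delta> (q s) (q t)) 0 1 = dyadic_sum N (\<lambda>s t. \<delta> (\<sigma> (?h s)) (\<sigma> (?h t))) 0 1"
      by (rule dyadic_sum_cong[of "{0..1}"]) (simp_all add: q)
    also have "\<dots> = dyadic_sum N (\<lambda>s t. \<delta> (\<sigma> s) (\<sigma> t)) (?h 0) (?h 1)"
    proof (rule dyadic_sum_affine[where h = ?h and d = "\<lambda>s t. \<delta> (\<sigma> s) (\<sigma> t)"])
      fix s t :: real
      have "?h s + ?h t = 2 *\<^sub>R a + (s + t) *\<^sub>R (b - a)"
        by (simp add: scaleR_add_left scaleR_2)
      then have "midpoint (?h s) (?h t) = a + ((s + t) / 2) *\<^sub>R (b - a)"
        by (simp add: midpoint_def scaleR_add_right)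
      then show "?h (midpoint s t) = midpoint (?h s) (?h t)"
        by (simp add: midpoint_def)
    qed
    finally show ?thesis by simp
  qed
  have "(\<lambda>N. dyadic_sum N (\<lambda>s t. \<delta> (q s) (q t)) 0 1) \<longlonglongrightarrow> l"
    unfolding eq using l by (rule tendsto_eventually)
  then have "path_sum \<delta> q = l" unfolding path_sum_def by (rule limI)
  with l show ?thesis by simp
qed

lemma path_sum_eventually:
  assumes "continuous_map (top_of_set {0..1::real}) S p" "local_cocycle S \<delta>"
  shows "\<forall>\<^sub>F N in sequentially. dyadic_sum N (\<lambda>s t. \<delta> (p s) (p t)) 0 1 = path_sum \<delta> p"
  by (rule path_sum_segment[OF _ _ assms]) auto

lemma path_sum_unique:
  assumes "continuous_map (top_of_set {0..1::real}) S p" "local_cocycle S \<delta>"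
    "\<forall>\<^sub>F N in sequentially. dyadic_sum N (\<lambda>s t. \<delta> (p s) (p t)) 0 1 = l"
  shows "path_sum \<delta> p = l"
  using eventually_conj[OF path_sum_eventually[OF assms(1,2)] assms(3)]
  by (metis (mono_tags, lifting) eventually_happens' sequentially_bot)

lemma path_sum_cong:
  assumes "\<And>t. t \<in> {0..1} \<Longrightarrow> p t = q t"
  shows "path_sum \<delta> p = path_sum \<delta> q"
proof -
  have "dyadic_sum N (\<lambda>s t. \<delta> (p s) (p t)) 0 1 = dyadic_sum N (\<lambda>s t. \<delta> (q s) (q t)) 0 1" for N
    by (rule dyadic_sum_cong[of "{0..1}"]) (use assms in auto)
  then show ?thesis unfolding path_sum_def by simp
qed

text \<open>Stokes on a filled triangle: \<open>\<sigma>\<close> extends continuously over the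
  convex compact set \<open>K\<close>, hence small triangles are closed for \<open>\<delta>\<close>
  and \<open>dyadic_sum_triangle\<close> applies at all fine levels.\<close>

lemma path_sum_triangle:
  fixes K :: "'a::real_normed_vector set"
  assumes "compact K" "convex K" "continuous_map (top_of_set K) S \<sigma>" "local_cocycle S \<delta>"
    and abc: "a \<in> K" "b \<in> K" "c \<in> K"
  shows "path_sum \<delta> (\<lambda>t. \<sigma> (a + t *\<^sub>R (b - a))) + path_sum \<delta> (\<lambda>t. \<sigma> (b + t *\<^sub>R (c - b)))
       = path_sum \<delta> (\<lambda>t. \<sigma> (a + t *\<^sub>R (c - a)))"
proof -
  obtain \<eta> where \<eta>: "\<eta> > 0" "\<And>a b c. \<lbrakk>a \<in> K; b \<in> K; c \<in> K; dist a b \<le> \<eta>; dist a c \<le> \<eta>; dist b c \<le> \<eta>\<rbrakk>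
        \<Longrightarrow> \<delta> (\<sigma> a) (\<sigma> b) + \<delta> (\<sigma> b) (\<sigma> c) = \<delta> (\<sigma> a) (\<sigma> c)"
    using local_cocycle_small[OF assms(1,3,4)] by blast
  have *: "\<forall>\<^sub>F N in sequentially. dyadic_sum N (\<lambda>s t. \<delta> (\<sigma> s) (\<sigma> t)) a b + dyadic_sum N (\<lambda>s t. \<delta> (\<sigma> s) (\<sigma> t)) b c
        = dyadic_sum N (\<lambda>s t. \<delta> (\<sigma> s) (\<sigma> t)) a c"
    by (rule dyadic_sum_eventually[OF \<open>convex K\<close> \<eta>(1)]) (use \<eta>(2) abc in auto)
  note ps = path_sum_segment[OF assms(1-4)]
  have "\<forall>\<^sub>F N::nat in sequentially. path_sum \<delta> (\<lambda>t. \<sigma> (a + t *\<^sub>R (b - a))) + path_sum \<delta> (\<lambda>t. \<sigma> (b + t *\<^sub>R (c - b)))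
       = path_sum \<delta> (\<lambda>t. \<sigma> (a + t *\<^sub>R (c - a)))"
    using * ps[OF abc(1,2) refl] ps[OF abc(2,3) refl] ps[OF abc(1,3) refl]
    by eventually_elim simp
  then show ?thesis by simp
qed

text \<open>Stated for an arbitrary type \<open>'b\<close>, since the surface is a value of type
  \<open>topology\<close> and not a type-class space.\<close>

definition concat_path :: "(real \<Rightarrow> 'b) \<Rightarrow> (real \<Rightarrow> 'b) \<Rightarrow> real \<Rightarrow> 'b" where
  "concat_path p q t = (if t \<le> 1/2 then p (2 * t) else q (2 * t - 1))"

lemma path_sum_concat_path:
  assumes p: "continuous_map (top_of_set {0..1::real}) S p" and q: "continuous_map (top_of_set {0..1::real}) S q"
    and "p 1 = q 0" and \<delta>: "local_cocycle S \<delta>"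
  shows "continuous_map (top_of_set {0..1::real}) S (concat_path p q)"
    and "path_sum \<delta> (concat_path p q) = path_sum \<delta> p + path_sum \<delta> q"
proof -
  let ?r = "concat_path p q"
  let ?T01 = "top_of_set {0..1::real}"
  let ?g = "\<lambda>x. if x \<le> 1/2 then (p \<circ> (\<lambda>t. 2 * t)) x else (q \<circ> (\<lambda>t. 2 * t - 1)) x"
  have "continuous_map ?T01 S ?g"
  proof (intro continuous_map_cases_le continuous_map_compose, force, force)
    show "continuous_map (subtopology ?T01 {x \<in> topspace ?T01. x \<le> 1/2}) ?T01 ((*) 2)"
      by (auto simp: continuous_map_in_subtopology continuous_map_from_subtopology)
    have "continuous_map
           (subtopology (top_of_set {0..1}) {x. 0 \<le> x \<and> x \<le> 1 \<and> 1 \<le> x * 2})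
           euclideanreal (\<lambda>t. 2 * t - 1)"
      by (intro continuous_intros) (force intro: continuous_map_from_subtopology)
    then show "continuous_map (subtopology ?T01 {x \<in> topspace ?T01. 1/2 \<le> x}) ?T01 (\<lambda>t. 2 * t - 1)"
      by (force simp: continuous_map_in_subtopology)
    show "(p \<circ> (*) 2) x = (q \<circ> (\<lambda>t. 2 * t - 1)) x" if "x \<in> topspace ?T01" "x = 1/2" for x
      using that assms(3) by (simp add: mult.commute)
  qed (use p q in auto)
  moreover have "?g = ?r" by (simp add: concat_path_def fun_eq_iff)
  ultimately show r: "continuous_map ?T01 S ?r" by simp
  have P: "\<forall>\<^sub>F N in sequentially. dyadic_sum N (\<lambda>s t. \<delta> (?r s) (?r t)) 0 (1/2) = path_sum \<delta> p"
    by (rule path_sum_segment[OF _ _ r \<delta>]) (auto simp: concat_path_def)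
  have Q: "\<forall>\<^sub>F N in sequentially. dyadic_sum N (\<lambda>s t. \<delta> (?r s) (?r t)) (1/2) 1 = path_sum \<delta> q"
    by (rule path_sum_segment[OF _ _ r \<delta>]) (auto simp: concat_path_def assms(3))
  have m: "midpoint 0 1 = (1/2::real)" by (simp add: midpoint_def)
  \<comment> \<open>The first bisection cuts \<open>{0..1}\<close> exactly where the two paths meet,
    so level \<open>Suc N\<close> of the joined path is level \<open>N\<close> of each part.\<close>
  have "\<forall>\<^sub>F N in sequentially. dyadic_sum (Suc N) (\<lambda>s t. \<delta> (?r s) (?r t)) 0 1 = path_sum \<delta> p + path_sum \<delta> q"
    using P Q by eventually_elim (simp add: m)
  then have "\<forall>\<^sub>F N in sequentially. dyadic_sum N (\<lambda>s t. \<delta> (?r s) (?r t)) 0 1 = path_sum \<delta> p + path_sum \<delta> q"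
    by (rule eventually_sequentially_Suc [where P = "\<lambda>N. dyadic_sum N (\<lambda>s t. \<delta> (?r s) (?r t)) 0 1 = path_sum \<delta> p + path_sum \<delta> q", THEN iffD1])
  then show "path_sum \<delta> ?r = path_sum \<delta> p + path_sum \<delta> q"
    by (rule path_sum_unique[OF r \<delta>])
qed

section \<open>Pairing a cocycle with singular 1-chains\<close>

definition edge :: "real \<Rightarrow> nat \<Rightarrow> real" where
  "edge t = (\<lambda>i. if i = 0 then 1 - t else if i = 1 then t else 0)"

definition chain_sum :: "('b \<Rightarrow> 'b \<Rightarrow> complex) \<Rightarrow> 'b chain \<Rightarrow> complex" where
  "chain_sum \<delta> c = (\<Sum>f\<in>Poly_Mapping.keys c. of_int (Poly_Mapping.lookup c f) * path_sum \<delta> (f \<circ> edge))"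

lemma chain_sum_superset:
  assumes "finite F" "Poly_Mapping.keys c \<subseteq> F"
  shows "chain_sum \<delta> c = (\<Sum>f\<in>F. of_int (Poly_Mapping.lookup c f) * path_sum \<delta> (f \<circ> edge))"
  unfolding chain_sum_def using assms
  by (intro sum.mono_neutral_left) (auto simp: in_keys_iff)

lemma chain_sum_add: "chain_sum \<delta> (c + d) = chain_sum \<delta> c + chain_sum \<delta> d"
proof -
  let ?F = "Poly_Mapping.keys c \<union> Poly_Mapping.keys d"
  have "Poly_Mapping.keys (c + d) \<subseteq> ?F" by (rule Poly_Mapping.keys_add)
  then show ?thesis
    using chain_sum_superset[of ?F "c + d" \<delta>] chain_sum_superset[of ?F c \<delta>] chain_sum_superset[of ?F d \<delta>]
    by (simp add: lookup_add sum.distrib algebra_simps)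
qed

lemma chain_sum_of [simp]: "chain_sum \<delta> (frag_of f) = path_sum \<delta> (f \<circ> edge)"
  by (simp add: chain_sum_def)

lemma chain_sum_0 [simp]: "chain_sum \<delta> 0 = 0"
  by (simp add: chain_sum_def)

lemma chain_sum_minus: "chain_sum \<delta> (- c) = - chain_sum \<delta> c"
  using chain_sum_add[of \<delta> c "- c"] by (simp add: eq_neg_iff_add_eq_0 add.commute)

lemma chain_sum_diff: "chain_sum \<delta> (c - d) = chain_sum \<delta> c - chain_sum \<delta> d"
  using chain_sum_add[of \<delta> c "- d"] by (simp add: chain_sum_minus)

lemma edge_simplex: "t \<in> {0..1} \<Longrightarrow> edge t \<in> standard_simplex 1"
  by (auto simp: edge_def standard_simplex_def)

text \<open>A singular 2-simplex is a continuous image of a filled plane triangle, so the triangle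
  identity says that the alternating sum over its three faces is zero; linearity does the
  rest.\<close>

lemma chain_sum_boundary:
  assumes "local_cocycle S \<delta>" "singular_chain 2 S c"
  shows "chain_sum \<delta> (chain_boundary 2 c) = 0"
  using assms(2)[unfolded singular_chain_def]
proof (induction rule: frag_induction)
  case zero
  then show ?case by simp
next
  case (one f)
  \<comment> \<open>Barycentric coordinates on the plane triangle with vertices
    \<open>(0,0)\<close>, \<open>(1,0)\<close>, \<open>(0,1)\<close>; compactness and convexity are
    needed in a normed space, which the space of functions \<open>nat \<Rightarrow> real\<close> is
    not.\<close>
  let ?\<iota> = "\<lambda>(s, t) i. if i = 0 then 1 - s - t else if i = 1 then s else if i = 2 then t else (0::real)"
  define K where "K = {(s, t). 0 \<le> s \<and> 0 \<le> t \<and> s + t \<le> (1::real)}"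
  define \<sigma> where "\<sigma> = f \<circ> ?\<iota>"
  have K: "K = (({0..1} \<times> {0..1}) \<inter> {p. fst p + snd p \<le> 1})"
    by (auto simp: K_def)
  have "compact K"
    unfolding K by (intro compact_Int_closed compact_Times closed_Collect_le continuous_intros) auto
  have "convex K"
  proof (rule convexI)
    fix p q :: "real \<times> real" and u v :: real
    assume pq: "p \<in> K" "q \<in> K" "0 \<le> u" "0 \<le> v" "u + v = 1"
    have "u * (fst p + snd p) + v * (fst q + snd q) \<le> u * 1 + v * 1"
      using pq by (intro add_mono mult_left_mono) (auto simp: K_def)
    then show "u *\<^sub>R p + v *\<^sub>R q \<in> K"
      using pq by (auto simp: K_def case_prod_unfold algebra_simps)
  qed
  have sf: "continuous_map (subtopology (powertop_real UNIV) (standard_simplex 2)) S f"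
    using one by (simp add: singular_simplex_def)
  have comp: "continuous_map (top_of_set K) euclideanreal (\<lambda>p. ?\<iota> p i)" for i
    by (cases "i = 0"; cases "i = 1"; cases "i = 2") (auto simp: case_prod_unfold intro!: continuous_intros)
  have "continuous_map (top_of_set K) (powertop_real UNIV) ?\<iota>"
    using comp by (simp only: continuous_map_componentwise_UNIV) blast
  moreover have "?\<iota> p \<in> standard_simplex 2" if "p \<in> K" for p
    using that by (auto simp: K_def standard_simplex_def numeral_2_eq_2)
  ultimately have "continuous_map (top_of_set K) (subtopology (powertop_real UNIV) (standard_simplex 2)) ?\<iota>"
    by (auto simp: continuous_map_in_subtopology)
  then have \<sigma>: "continuous_map (top_of_set K) S \<sigma>"
    unfolding \<sigma>_def using continuous_map_compose sf by blast
  have face: "path_sum \<delta> (singular_face 2 k f \<circ> edge) = path_sum \<delta> (\<lambda>t. \<sigma> (a + t *\<^sub>R (b - a)))"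
    if "\<And>t. simplical_face k (edge t) = ?\<iota> (a + t *\<^sub>R (b - a))" for k a b
    by (rule path_sum_cong) (use that edge_simplex in \<open>auto simp: singular_face_def \<sigma>_def\<close>)
  \<comment> \<open>Face \<open>k\<close> omits vertex \<open>k\<close>: faces 2, 0, 1 are the edges
    01, 12, 02, each run from the smaller to the larger vertex, as the triangle identity
    requires.\<close>
  have "path_sum \<delta> (singular_face 2 2 f \<circ> edge) = path_sum \<delta> (\<lambda>t. \<sigma> ((0,0) + t *\<^sub>R ((1,0) - (0,0))))"
       "path_sum \<delta> (singular_face 2 0 f \<circ> edge) = path_sum \<delta> (\<lambda>t. \<sigma> ((1,0) + t *\<^sub>R ((0,1) - (1,0))))"
       "path_sum \<delta> (singular_face 2 1 f \<circ> edge) = path_sum \<delta> (\<lambda>t. \<sigma> ((0,0) + t *\<^sub>R ((0,1) - (0,0))))"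
    by (rule face; force simp: fun_eq_iff simplical_face_def edge_def)+
  moreover have "(0,0) \<in> K" "(1,0) \<in> K" "(0,1) \<in> K" by (auto simp: K_def)
  ultimately have "path_sum \<delta> (singular_face 2 2 f \<circ> edge) + path_sum \<delta> (singular_face 2 0 f \<circ> edge)
      = path_sum \<delta> (singular_face 2 1 f \<circ> edge)"
    using path_sum_triangle[OF \<open>compact K\<close> \<open>convex K\<close> \<sigma> assms(1), of "(0,0)" "(1,0)" "(0,1)"]
    by (simp only:)
  moreover have "chain_boundary 2 (frag_of f) = frag_of (singular_face 2 0 f)
      + (- frag_of (singular_face 2 1 f) + frag_of (singular_face 2 2 f))"
    by (simp add: chain_boundary_of numeral_2_eq_2)
  ultimately show ?case
    by (simp only: chain_sum_add chain_sum_minus chain_sum_of) (simp add: algebra_simps)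
next
  case (diff a b)
  then show ?case by (simp add: chain_boundary_diff chain_sum_diff)
qed

lemma chain_sum_homologous:
  assumes "local_cocycle S \<delta>" "homologous_rel 1 S {} c d"
  shows "chain_sum \<delta> c = chain_sum \<delta> d"
proof -
  obtain e where "singular_chain 2 S e" "chain_boundary 2 e = c - d"
    using assms(2) by (auto simp: homologous_rel_def singular_boundary numeral_2_eq_2)
  then show ?thesis using chain_sum_boundary[OF assms(1)] by (metis chain_sum_diff eq_iff_diff_eq_0)
qed

text \<open>The classes all of whose representatives have sum zero form a subgroup; it contains both
  generators, hence everything. Vanishing is required on all representatives so that it is a
  property of the class.\<close>

lemma chain_sum_zero_generators:
  fixes S :: "'b topology"
  defines "H \<equiv> homology_group 1 S"
  assumes \<delta>: "local_cocycle S \<delta>"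
    and cyc: "singular_relcycle 1 S {} za" "singular_relcycle 1 S {} zb"
    and bij: "bij_betw (\<lambda>(j::int, k::int). (homologous_rel_set 1 S {} za [^]\<^bsub>H\<^esub> j) \<otimes>\<^bsub>H\<^esub>
                 (homologous_rel_set 1 S {} zb [^]\<^bsub>H\<^esub> k)) UNIV (carrier H)"
    and z0: "chain_sum \<delta> za = 0" "chain_sum \<delta> zb = 0"
    and "singular_relcycle 1 S {} z"
  shows "chain_sum \<delta> z = 0"
proof -
  have carr: "carrier H = homologous_rel_set 1 S {} ` singular_relcycle_set 1 S {}"
    using carrier_relative_homology_group[of 1 S "{}"] by (simp add: H_def)
  define K where "K = {c \<in> carrier H. \<forall>z\<in>c. chain_sum \<delta> z = 0}"
  interpret H: group H by (simp add: H_def)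
  have mult: "x \<otimes>\<^bsub>H\<^esub> y = (\<Union>r\<in>x. \<Union>s\<in>y. {r + s})" for x y
    using fun_cong[OF fun_cong[OF mult_relative_homology_group[of 1 S "{}"]], of x y] by (simp add: H_def)
  have sub: "subgroup K H"
  proof (rule H.subgroupI)
    have "\<one>\<^bsub>H\<^esub> \<in> carrier H" by simp
    moreover have "\<one>\<^bsub>H\<^esub> = singular_relboundary_set 1 S {}"
      using one_relative_homology_group[of 1 S "{}"] by (simp add: H_def)
    moreover have "chain_sum \<delta> z = 0" if "singular_relboundary 1 S {} z" for z
      using chain_sum_homologous[OF \<delta>, of z 0] that by (simp add: homologous_rel_def)
    ultimately have "\<one>\<^bsub>H\<^esub> \<in> K" by (auto simp: K_def)
    then show "K \<noteq> {}" by blast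
    show "inv\<^bsub>H\<^esub> c \<in> K" if "c \<in> K" for c
    proof -
      have "c \<in> carrier H" using that by (simp add: K_def)
      then have "inv\<^bsub>H\<^esub> c = uminus ` c"
        using inv_relative_homology_group[of c 1 S "{}"] by (simp add: H_def)
      moreover have "inv\<^bsub>H\<^esub> c \<in> carrier H" using \<open>c \<in> carrier H\<close> by simp
      ultimately show ?thesis using that by (auto simp: K_def chain_sum_minus)
    qed
    show "c \<otimes>\<^bsub>H\<^esub> d \<in> K" if "c \<in> K" "d \<in> K" for c d
    proof -
      have "c \<otimes>\<^bsub>H\<^esub> d \<in> carrier H" using that by (simp add: K_def)
      then show ?thesis using that by (auto simp: K_def mult chain_sum_add)
    qed
  qed (auto simp: K_def)
  have inK: "homologous_rel_set 1 S {} w \<in> K" if "singular_relcycle 1 S {} w" "chain_sum \<delta> w = 0" for w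
    using that chain_sum_homologous[OF \<delta>, of w] by (auto simp: K_def carr)
  have pow: "c [^]\<^bsub>H\<^esub> (j::int) \<in> K" if "c \<in> K" for c j
    using H.subgroup_int_pow_closed[OF sub that] .
  have "homologous_rel_set 1 S {} z \<in> carrier H"
    using assms(8) by (auto simp: carr)
  then have "homologous_rel_set 1 S {} z \<in> (\<lambda>(j::int, k::int). (homologous_rel_set 1 S {} za [^]\<^bsub>H\<^esub> j) \<otimes>\<^bsub>H\<^esub>
                 (homologous_rel_set 1 S {} zb [^]\<^bsub>H\<^esub> k)) ` UNIV"
    using bij by (simp add: bij_betw_def)
  then have "homologous_rel_set 1 S {} z \<in> K"
    using pow[OF inK[OF cyc(1) z0(1)]] pow[OF inK[OF cyc(2) z0(2)]] subgroup.m_closed[OF sub] by auto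
  then show ?thesis by (auto simp: K_def)
qed

section \<open>Gluing local primitives into one cocycle\<close>

text \<open>Local functions that differ by locally constant functions glue to a cocycle: assign to
  each point one member of a finite cover by closed sets subordinate to the domains.\<close>

lemma glue_local_cocycle:
  fixes S :: "'b topology" and f :: "'b \<Rightarrow> 'b \<Rightarrow> complex"
  assumes "compact_space S" "Hausdorff_space S"
    and V: "\<And>Z. Z \<in> topspace S \<Longrightarrow> openin S (V Z) \<and> Z \<in> V Z"
    and diff: "\<And>Z Z' T. \<lbrakk>Z \<in> topspace S; Z' \<in> topspace S; T \<in> V Z; T \<in> V Z'\<rbrakk> \<Longrightarrow>
       \<exists>N. openin S N \<and> T \<in> N \<and> N \<subseteq> V Z \<inter> V Z' \<and> (\<forall>P\<in>N. f Z P - f Z' P = f Z T - f Z' T)"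
  obtains \<delta> where "\<And>T. T \<in> topspace S \<Longrightarrow> \<exists>N Z. openin S N \<and> T \<in> N \<and> Z \<in> topspace S \<and> N \<subseteq> V Z \<and>
       (\<forall>P\<in>N. \<forall>Q\<in>N. \<delta> P Q = f Z Q - f Z P)"
proof -
  have "\<exists>W C. openin S W \<and> closedin S C \<and> Z \<in> W \<and> W \<subseteq> C \<and> C \<subseteq> V Z" if "Z \<in> topspace S" for Z
  proof -
    have "regular_space S" using assms compact_Hausdorff_imp_regular_space by blast
    then have "neighbourhood_base_of (closedin S) S" using neighbourhood_base_of_closedin by blast
    then show ?thesis using V[OF that] unfolding neighbourhood_base_of by blast
  qed
  then obtain W C where WC: "\<And>Z. Z \<in> topspace S \<Longrightarrow> openin S (W Z) \<and> closedin S (C Z) \<and> Z \<in> W Z \<and> W Z \<subseteq> C Z \<and> C Z \<subseteq> V Z"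
    by metis
  have "\<exists>\<F>. finite \<F> \<and> \<F> \<subseteq> W ` topspace S \<and> topspace S \<subseteq> \<Union>\<F>"
    by (rule compactinD[of S "topspace S" "W ` topspace S"])
      (use WC assms(1) in \<open>auto simp: compact_space_def\<close>)
  then obtain I where I: "finite I" "I \<subseteq> topspace S" "topspace S \<subseteq> (\<Union>Z\<in>I. W Z)"
    by (metis finite_subset_image)
  then obtain i where i: "\<And>P. P \<in> topspace S \<Longrightarrow> i P \<in> I \<and> P \<in> W (i P)"
    by (metis UN_E subsetD)
  \<comment> \<open>The primitive is selected by the first argument alone. So
    \<open>\<delta>\<close> jumps with \<open>i\<close>, but near any point all admissible
    selections have equal increments.\<close>
  define \<delta> where "\<delta> P Q = f (i P) Q - f (i P) P" for P Q
  show ?thesis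
  proof (rule that)
    fix T assume T: "T \<in> topspace S"
    define Z where "Z = i T"
    have Z: "Z \<in> I" "T \<in> W Z" "T \<in> V Z" "Z \<in> topspace S"
      using i[OF T] WC I(2) by (auto simp: Z_def)
    \<comment> \<open>Each index \<open>j\<close> is handled separately. If \<open>T\<close> lies in
      the closed set \<open>C j\<close>, then \<open>f j\<close> and \<open>f Z\<close> differ by a
      constant near \<open>T\<close>; otherwise a neighbourhood of \<open>T\<close> misses
      \<open>C j\<close>, hence \<open>W j\<close>, and \<open>j\<close> is never selected there.
      Finitely many neighbourhoods can then be intersected.\<close>
    have "\<exists>N. openin S N \<and> T \<in> N \<and> N \<subseteq> V Z \<and> (\<forall>P\<in>N. P \<in> W j \<longrightarrow> (\<forall>Q\<in>N. f j Q - f j P = f Z Q - f Z P))"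
      if "j \<in> I" for j
    proof (cases "T \<in> C j")
      case True
      have j: "j \<in> topspace S" using that I(2) by auto
      then obtain N where N: "openin S N" "T \<in> N" "N \<subseteq> V j \<inter> V Z" "\<forall>P\<in>N. f j P - f Z P = f j T - f Z T"
        using diff[OF j Z(4) _ Z(3)] True WC[OF j] by blast
      then have "f j Q - f j P = f Z Q - f Z P" if "P \<in> N" "Q \<in> N" for P Q
      proof -
        have "f j P - f Z P = f j Q - f Z Q" using N(4) that by simp
        then show ?thesis by (simp add: algebra_simps)
      qed
      with N show ?thesis by blast
    next
      case False
      have j: "j \<in> topspace S" using that I(2) by auto
      have "openin S (V Z \<inter> (topspace S - C j))"
        using V[OF Z(4)] WC[OF j] by (blast intro: openin_Int)
      moreover have "T \<in> V Z \<inter> (topspace S - C j)" using False Z T by auto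
      ultimately show ?thesis using WC[OF j] by blast
    qed
    then obtain N where N: "\<And>j. j \<in> I \<Longrightarrow> openin S (N j) \<and> T \<in> N j \<and> N j \<subseteq> V Z \<and>
        (\<forall>P\<in>N j. P \<in> W j \<longrightarrow> (\<forall>Q\<in>N j. f j Q - f j P = f Z Q - f Z P))"
      by metis
    let ?N = "\<Inter>j\<in>I. N j"
    have "openin S ?N" by (rule openin_INT2) (use N I Z in auto)
    moreover have "T \<in> ?N" using N by blast
    moreover have "?N \<subseteq> V Z" using N Z(1) by blast
    moreover have "\<delta> P Q = f Z Q - f Z P" if PQ: "P \<in> ?N" "Q \<in> ?N" for P Q
    proof -
      have "P \<in> topspace S" using PQ \<open>openin S ?N\<close> openin_subset by blast
      then have "i P \<in> I" "P \<in> W (i P)" using i by auto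
      then show ?thesis using N PQ unfolding \<delta>_def by blast
    qed
    ultimately have "openin S ?N \<and> T \<in> ?N \<and> Z \<in> topspace S \<and> ?N \<subseteq> V Z \<and>
       (\<forall>P\<in>?N. \<forall>Q\<in>?N. \<delta> P Q = f Z Q - f Z P)"
      using Z(4) by (intro conjI ballI)
    then show "\<exists>N Z. openin S N \<and> T \<in> N \<and> Z \<in> topspace S \<and> N \<subseteq> V Z \<and>
       (\<forall>P\<in>N. \<forall>Q\<in>N. \<delta> P Q = f Z Q - f Z P)"
      by (rule exI[THEN exI[of "\<lambda>N. \<exists>Z. openin S N \<and> T \<in> N \<and> Z \<in> topspace S \<and> N \<subseteq> V Z \<and>
       (\<forall>P\<in>N. \<forall>Q\<in>N. \<delta> P Q = f Z Q - f Z P)" ?N]])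
  qed
qed

lemma local_cocycleI:
  assumes "\<And>T. T \<in> topspace S \<Longrightarrow> \<exists>N g. openin S N \<and> T \<in> N \<and> (\<forall>P\<in>N. \<forall>Q\<in>N. \<delta> P Q = g Q - g P)"
  shows "local_cocycle S \<delta>"
  unfolding local_cocycle_def
proof
  fix T assume "T \<in> topspace S"
  from assms[OF this] obtain N g
    where "openin S N \<and> T \<in> N \<and> (\<forall>P\<in>N. \<forall>Q\<in>N. \<delta> P Q = g Q - g P)"
    by (elim exE) (rule that)
  then have g: "openin S N" "T \<in> N" "\<And>P Q. P \<in> N \<Longrightarrow> Q \<in> N \<Longrightarrow> \<delta> P Q = g Q - g P"
    by (simp_all only: )
  have "\<delta> P Q + \<delta> Q R = \<delta> P R" if "P \<in> N" "Q \<in> N" "R \<in> N" for P Q R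
    unfolding g(3)[OF that(1,2)] g(3)[OF that(2,3)] g(3)[OF that(1,3)] by simp
  with g(1,2) show "\<exists>N. openin S N \<and> T \<in> N \<and> (\<forall>P\<in>N. \<forall>Q\<in>N. \<forall>T\<in>N. \<delta> P Q + \<delta> Q T = \<delta> P T)"
    by blast
qed

section \<open>Branches and primitives on the curve\<close>

text \<open>Equal squares leave only \<open>f = g\<close> or \<open>f = - g\<close>, and the second
  is excluded because \<open>f + g\<close> tends to \<open>2 c\<close>.\<close>

lemma square_eq_eventually_eq:
  fixes f g :: "'a \<Rightarrow> complex"
  assumes "(f \<longlongrightarrow> c) F" "(g \<longlongrightarrow> c) F" "c \<noteq> 0" "\<forall>\<^sub>F z in F. (f z)\<^sup>2 = (g z)\<^sup>2"
  shows "\<forall>\<^sub>F z in F. f z = g z"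
proof -
  have "((\<lambda>z. f z + g z) \<longlongrightarrow> c + c) F" by (intro tendsto_intros assms)
  moreover have "c + c \<noteq> 0" using assms(3) by simp
  ultimately have "\<forall>\<^sub>F z in F. f z + g z \<noteq> 0" by (rule tendsto_imp_eventually_ne)
  with assms(4) show ?thesis
    by eventually_elim (auto simp: power2_eq_iff)
qed

lemma isCont_eventually_mem:
  assumes "isCont f a" "open S" "f a \<in> S"
  shows "\<forall>\<^sub>F z in nhds a. f z \<in> S"
  using topological_tendstoD[of f "f a" "at a" S] assms
  by (simp add: isCont_def eventually_nhds_conv_at)

definition cubic :: "complex \<Rightarrow> complex \<Rightarrow> complex" where
  "cubic x u = u * (u - 1) * (u - x)"

lemma cubic_eq_0_iff: "cubic x u = 0 \<longleftrightarrow> u = 0 \<or> u = 1 \<or> u = x"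
  by (auto simp: cubic_def)

lemma mem_affine_curve: "(u, v) \<in> affine_curve x \<longleftrightarrow> v\<^sup>2 = cubic x u"
  by (simp add: affine_curve_def cubic_def)

lemma mem_unramified: "(u, v) \<in> unramified x \<longleftrightarrow> v\<^sup>2 = cubic x u \<and> v \<noteq> 0"
  by (simp add: unramified_def mem_affine_curve)

lemma unramified_sub_affine: "unramified x \<subseteq> affine_curve x"
  by (auto simp: unramified_def)

lemma holomorphic_cubic [holomorphic_intros]:
  "f holomorphic_on A \<Longrightarrow> (\<lambda>z. cubic x (f z)) holomorphic_on A"
  unfolding cubic_def by (intro holomorphic_intros)

lemma continuous_on_cubic [continuous_intros]:
  "continuous_on A g \<Longrightarrow> continuous_on A f \<Longrightarrow> continuous_on A (\<lambda>z. cubic (g z) (f z))"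
  unfolding cubic_def by (intro continuous_intros)

lemma has_field_derivative_cubic:
  "(cubic x has_field_derivative ((z - 1) * (z - x) + z * (z - x) + z * (z - 1))) (at z)"
  unfolding cubic_def [abs_def] by (auto intro!: derivative_eq_intros simp: algebra_simps)

text \<open>The radicand is 1 at the base point, far from the cut of \<open>csqrt\<close>, so a
  single formula gives the local lift through every unramified \<open>P\<close>. Its square is right
  for all \<open>z\<close>; only analyticity is local.\<close>

definition branch :: "complex \<Rightarrow> complex \<times> complex \<Rightarrow> complex \<Rightarrow> complex" where
  "branch x P z = snd P * csqrt (cubic x z / cubic x (fst P))"

lemma branch_base: "P \<in> unramified x \<Longrightarrow> branch x P (fst P) = snd P"
  by (cases P) (auto simp: branch_def mem_unramified)

lemma branch_square: "P \<in> unramified x \<Longrightarrow> (branch x P z)\<^sup>2 = cubic x z"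
  by (cases P) (auto simp: branch_def mem_unramified power_mult_distrib)

lemma branch_holomorphic:
  assumes "P \<in> unramified x"
  obtains r where "r > 0" "branch x P holomorphic_on ball (fst P) r"
    "\<And>z. z \<in> ball (fst P) r \<Longrightarrow> branch x P z \<noteq> 0 \<and> (z, branch x P z) \<in> unramified x"
proof -
  let ?q = "\<lambda>z. cubic x z / cubic x (fst P)"
  have nz: "cubic x (fst P) \<noteq> 0" using assms by (cases P) (auto simp: mem_unramified)
  have "isCont ?q (fst P)"
    using nz unfolding cubic_def by (intro continuous_intros) auto
  moreover have "?q (fst P) = 1" using nz by simp
  ultimately have "\<forall>\<^sub>F z in nhds (fst P). ?q z \<in> ball 1 1"
    by (intro isCont_eventually_mem) auto
  then have "\<forall>\<^sub>F z in nhds (fst P). dist (?q z) 1 < 1"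
    by (simp add: dist_commute)
  then obtain r where r: "r > 0" "\<And>z. dist z (fst P) < r \<Longrightarrow> dist (?q z) 1 < 1"
    unfolding eventually_nhds_metric by blast
  have np: "?q z \<notin> \<real>\<^sub>\<le>\<^sub>0" if "z \<in> ball (fst P) r" for z
  proof
    assume "?q z \<in> \<real>\<^sub>\<le>\<^sub>0"
    then obtain s where s: "?q z = complex_of_real s" "s \<le> 0" by (auto elim!: nonpos_Reals_cases)
    have "dist (?q z) 1 < 1" using r(2)[of z] that by (simp add: dist_commute)
    moreover have "dist (complex_of_real s) 1 = \<bar>s - 1\<bar>"
      by (metis dist_of_real of_real_1 dist_real_def)
    ultimately show False using s by simp
  qed
  have "branch x P holomorphic_on ball (fst P) r"
    unfolding branch_def using np by (intro holomorphic_intros) auto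
  moreover have "branch x P z \<noteq> 0 \<and> (z, branch x P z) \<in> unramified x" if "z \<in> ball (fst P) r" for z
  proof -
    have "cubic x z \<noteq> 0" using np[OF that] by auto
    then have "branch x P z \<noteq> 0" using branch_square[OF assms, of z] by auto
    then show ?thesis using branch_square[OF assms, of z] by (simp add: mem_unramified)
  qed
  ultimately show ?thesis using that r(1) by blast
qed

lemma branch_isCont:
  assumes "P \<in> unramified x"
  shows "isCont (branch x P) (fst P)"
  using branch_holomorphic[OF assms]
  by (metis centre_in_ball holomorphic_on_imp_continuous_on continuous_on_interior interior_ball)

text \<open>A curve through \<open>P\<close> on the surface is locally the lift of its projection.\<close>

lemma branch_unique:
  assumes P: "P \<in> unramified x"
    and lim: "(p \<longlongrightarrow> fst P) F" "(q \<longlongrightarrow> snd P) F"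
    and ev: "\<forall>\<^sub>F t in F. (p t, q t) \<in> affine_curve x"
  shows "\<forall>\<^sub>F t in F. q t = branch x P (p t)"
proof (rule square_eq_eventually_eq[OF lim(2)])
  show "((\<lambda>t. branch x P (p t)) \<longlongrightarrow> snd P) F"
    using isCont_tendsto_compose[OF branch_isCont[OF P] lim(1)] by (simp add: branch_base[OF P])
  show "snd P \<noteq> 0" using P by (cases P) (simp add: mem_unramified)
  show "\<forall>\<^sub>F t in F. (q t)\<^sup>2 = (branch x P (p t))\<^sup>2"
    using ev by eventually_elim (simp add: branch_square[OF P] mem_affine_curve)
qed

lemma branch_local_eq:
  assumes "P \<in> unramified x" "isCont s (fst P)" "s (fst P) = snd P" "\<forall>\<^sub>F z in nhds (fst P). (s z)\<^sup>2 = cubic x z"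
  shows "\<forall>\<^sub>F z in nhds (fst P). s z = branch x P z"
  using branch_unique[OF assms(1), of "\<lambda>z. z" "nhds (fst P)" s] assms(2-4)
  by (simp add: mem_affine_curve isCont_def tendsto_nhds_iff filterlim_ident)

lemma has_field_derivative_branch:
  assumes "P \<in> unramified x"
  shows "(branch x P has_field_derivative
    ((fst P - 1) * (fst P - x) + fst P * (fst P - x) + fst P * (fst P - 1)) / (2 * snd P)) (at (fst P))"
    (is "(_ has_field_derivative ?c / _) _")
proof -
  obtain r where r: "r > 0" "branch x P holomorphic_on ball (fst P) r"
    using branch_holomorphic[OF assms] by blast
  then obtain d where d: "(branch x P has_field_derivative d) (at (fst P))"
    by (metis centre_in_ball field_differentiable_def holomorphic_on_imp_differentiable_at open_ball)
  have "((\<lambda>z. (branch x P z)\<^sup>2) has_field_derivative 2 * snd P * d) (at (fst P))"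
    by (auto intro!: derivative_eq_intros d simp: branch_base[OF assms])
  then have "(cubic x has_field_derivative 2 * snd P * d) (at (fst P))"
    by (simp add: branch_square[OF assms])
  then have "2 * snd P * d = ?c"
    using has_field_derivative_cubic DERIV_unique by blast
  moreover have "snd P \<noteq> 0" using assms by (cases P) (simp add: mem_unramified)
  ultimately have "d = ?c / (2 * snd P)" by (simp add: field_simps)
  with d show ?thesis by simp
qed

text \<open>The derivative in the chart \<open>u\<close>, taken along the lift through
  \<open>P\<close>. Since local lifts are unique, any continuous section through \<open>P\<close>
  may replace \<open>branch\<close>.\<close>

definition primitive_at ::
  "complex \<Rightarrow> (complex \<times> complex \<Rightarrow> complex) \<Rightarrow> (complex \<times> complex \<Rightarrow> complex) \<Rightarrow> complex \<times> complex \<Rightarrow> bool" where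
  "primitive_at x h f P \<longleftrightarrow> ((\<lambda>z. f (z, branch x P z)) has_field_derivative h P) (at (fst P))"

lemma primitive_at_section:
  assumes "P \<in> unramified x" "isCont s (fst P)" "s (fst P) = snd P" "\<forall>\<^sub>F z in nhds (fst P). (s z)\<^sup>2 = cubic x z"
  shows "primitive_at x h f P \<longleftrightarrow> ((\<lambda>z. f (z, s z)) has_field_derivative h P) (at (fst P))"
proof -
  have "\<forall>\<^sub>F z in nhds (fst P). f (z, branch x P z) = f (z, s z)"
    using branch_local_eq[OF assms] by eventually_elim simp
  then show ?thesis unfolding primitive_at_def by (intro DERIV_cong_ev refl) auto
qed

lemma primitive_at_branch:
  assumes P: "P \<in> unramified x" and r: "branch x P holomorphic_on ball (fst P) r"
    "\<And>z. z \<in> ball (fst P) r \<Longrightarrow> (z, branch x P z) \<in> unramified x" and z: "z \<in> ball (fst P) r"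
  shows "primitive_at x h f (z, branch x P z) \<longleftrightarrow>
    ((\<lambda>z. f (z, branch x P z)) has_field_derivative h (z, branch x P z)) (at z)"
proof -
  have "isCont (branch x P) z"
    using r(1) z by (meson holomorphic_on_imp_continuous_on continuous_on_interior interior_ball open_ball continuous_on_eq_continuous_at)
  then show ?thesis
    using primitive_at_section[OF r(2)[OF z], of "branch x P" h f] by (simp add: branch_square[OF P])
qed

definition sheet :: "complex \<Rightarrow> complex \<times> complex \<Rightarrow> real \<Rightarrow> (complex \<times> complex) set" where
  "sheet x P r = (\<lambda>z. (z, branch x P z)) ` ball (fst P) r"

lemma openin_sheet:
  assumes P: "P \<in> unramified x" and r: "branch x P holomorphic_on ball (fst P) r"
    "\<And>z. z \<in> ball (fst P) r \<Longrightarrow> branch x P z \<noteq> 0"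
  shows "openin (top_of_set (affine_curve x)) (sheet x P r)"
proof -
  let ?B = "ball (fst P) r \<times> (UNIV :: complex set)"
  \<comment> \<open>Over \<open>z\<close> the two candidates are \<open>branch x P z\<close> and its
    negative; the inequality keeps the one that is nearer, an open condition.\<close>
  let ?O = "?B \<inter> (\<lambda>(z, w). norm (w + branch x P z) - norm (w - branch x P z)) -` {0<..}"
  have cont: "continuous_on ?B (\<lambda>p. branch x P (fst p))"
    by (intro continuous_on_compose2[OF holomorphic_on_imp_continuous_on[OF r(1)]] continuous_intros) auto
  have "open ?O"
    unfolding case_prod_unfold
    by (intro continuous_open_preimage continuous_intros cont open_Times) auto
  moreover have "sheet x P r = affine_curve x \<inter> ?O"
  proof (intro subset_antisym subsetI)
    fix p assume "p \<in> sheet x P r"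
    then obtain z where "p = (z, branch x P z)" "z \<in> ball (fst P) r" by (auto simp: sheet_def)
    then show "p \<in> affine_curve x \<inter> ?O"
      using r(2)[of z] branch_square[OF P, of z] by (auto simp: mem_affine_curve)
  next
    fix p assume "p \<in> affine_curve x \<inter> ?O"
    then obtain z w where zw: "p = (z, w)" "z \<in> ball (fst P) r" "w\<^sup>2 = cubic x z"
        "norm (w + branch x P z) > norm (w - branch x P z)"
      by (cases p) (auto simp: mem_affine_curve)
    then have "w\<^sup>2 = (branch x P z)\<^sup>2" by (simp add: branch_square[OF P])
    then have "w = branch x P z" using zw(4) by (auto simp: power2_eq_iff)
    then show "p \<in> sheet x P r" using zw by (auto simp: sheet_def)
  qed
  ultimately show ?thesis using openin_open_Int[of ?O "affine_curve x"] by simp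
qed

lemma unramified_open:
  assumes "P \<in> unramified x" "openin (top_of_set (affine_curve x)) N" "P \<in> N"
  obtains r where "r > 0" "branch x P holomorphic_on ball (fst P) r" "sheet x P r \<subseteq> N"
    "\<And>z. z \<in> ball (fst P) r \<Longrightarrow> branch x P z \<noteq> 0 \<and> (z, branch x P z) \<in> unramified x"
proof -
  obtain r where r: "r > 0" "branch x P holomorphic_on ball (fst P) r"
    "\<And>z. z \<in> ball (fst P) r \<Longrightarrow> branch x P z \<noteq> 0 \<and> (z, branch x P z) \<in> unramified x"
    using branch_holomorphic[OF assms(1)] by blast
  obtain O' where O': "open O'" "N = affine_curve x \<inter> O'" using assms(2) by (auto simp: openin_open)
  have "isCont (\<lambda>z. (z, branch x P z)) (fst P)"
    by (intro continuous_intros branch_isCont assms)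
  moreover have "(fst P, branch x P (fst P)) \<in> O'" using O' assms by (simp add: branch_base)
  ultimately have "\<forall>\<^sub>F z in nhds (fst P). (z, branch x P z) \<in> O'"
    using O'(1) by (intro isCont_eventually_mem)
  then obtain e where e: "e > 0" "\<And>z. dist z (fst P) < e \<Longrightarrow> (z, branch x P z) \<in> O'"
    unfolding eventually_nhds_metric by blast
  show ?thesis
  proof (rule that[of "min r e"])
    show "branch x P holomorphic_on ball (fst P) (min r e)"
      by (rule holomorphic_on_subset[OF r(2)]) auto
    show "sheet x P (min r e) \<subseteq> N"
      using e(2) r(3) unramified_sub_affine by (force simp: sheet_def O'(2) dist_commute)
  qed (use r e in auto)
qed

text \<open>Their difference has zero derivative along the sheet, which is parametrised by a disc.
  This is the compatibility needed for gluing.\<close>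

lemma primitives_differ_locally:
  assumes P: "P \<in> unramified x" and N: "openin (top_of_set (affine_curve x)) N" "P \<in> N"
    and f: "\<And>Q. Q \<in> N \<Longrightarrow> Q \<in> unramified x \<Longrightarrow> primitive_at x h f Q"
    and g: "\<And>Q. Q \<in> N \<Longrightarrow> Q \<in> unramified x \<Longrightarrow> primitive_at x h g Q"
  shows "\<exists>M. openin (top_of_set (affine_curve x)) M \<and> P \<in> M \<and> M \<subseteq> N \<inter> unramified x \<and> (\<forall>Q\<in>M. f Q - g Q = f P - g P)"
proof -
  obtain r where r: "r > 0" "branch x P holomorphic_on ball (fst P) r" "sheet x P r \<subseteq> N"
    "\<And>z. z \<in> ball (fst P) r \<Longrightarrow> branch x P z \<noteq> 0 \<and> (z, branch x P z) \<in> unramified x"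
    using unramified_open[OF P N] by blast
  let ?s = "\<lambda>z. (z, branch x P z)"
  have "((\<lambda>z. f (?s z) - g (?s z)) has_field_derivative 0) (at z within ball (fst P) r)"
    if "z \<in> ball (fst P) r" for z
  proof -
    have "?s z \<in> N" using r(3) that by (auto simp: sheet_def)
    moreover have "?s z \<in> unramified x" using r(4) that by blast
    ultimately have "((\<lambda>z. f (?s z)) has_field_derivative h (?s z)) (at z)"
      "((\<lambda>z. g (?s z)) has_field_derivative h (?s z)) (at z)"
      using f[of "?s z"] g[of "?s z"] primitive_at_branch[OF P r(2) conjunct2[OF r(4)] that] by blast+
    from DERIV_diff[OF this] show ?thesis by (simp add: has_field_derivative_at_within)
  qed
  then obtain c where c: "\<And>z. z \<in> ball (fst P) r \<Longrightarrow> f (?s z) - g (?s z) = c"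
    using has_field_derivative_zero_constant[OF convex_ball] by (metis (no_types, lifting))
  have "f P - g P = c" using c[of "fst P"] r(1) by (simp add: branch_base[OF P])
  moreover have "P \<in> sheet x P r"
    using r(1) branch_base[OF P] by (auto simp: sheet_def image_iff intro!: bexI[of _ "fst P"])
  moreover have "openin (top_of_set (affine_curve x)) (sheet x P r)"
    using openin_sheet[OF P r(2)] r(4) by blast
  ultimately show ?thesis using c r(3,4) by (intro exI[of _ "sheet x P r"]) (auto simp: sheet_def)
qed

text \<open>The span of the holomorphic \<open>du / v\<close> and of \<open>u du / v\<close>, which
  has a double pole without residue at infinity: two representatives of the de Rham cohomology of
  the curve.\<close>

definition elliptic_form :: "complex \<Rightarrow> complex \<Rightarrow> complex \<times> complex \<Rightarrow> complex" where
  "elliptic_form l m P = (l + m * fst P) / snd P"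

section \<open>Topology of the compactified curve\<close>

lemma closed_affine_curve: "closed (affine_curve x)"
proof -
  have "affine_curve x = {p. (snd p)\<^sup>2 = cubic x (fst p)}"
    by (auto simp: affine_curve_def cubic_def)
  then show ?thesis by (simp add: closed_Collect_eq continuous_intros)
qed

lemma topspace_surface: "topspace (surface x) = insert None (Some ` affine_curve x)"
  by (simp add: surface_def)

lemma compact_space_surface: "compact_space (surface x)"
  by (simp add: surface_def)

lemma Hausdorff_space_surface: "Hausdorff_space (surface x)"
proof -
  have "locally_compact_space (top_of_set (affine_curve x))"
    by (intro locally_compact_space_closed_subset locally_compact_space_euclidean)
      (simp add: closed_affine_curve)
  then show ?thesis
    by (simp add: surface_def Hausdorff_space_Alexandroff_compactification Hausdorff_space_subtopology)
qed

lemma openin_surface_Some: "openin (surface x) (Some ` N) \<longleftrightarrow> openin (top_of_set (affine_curve x)) N"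
  by (simp add: surface_def)

lemma openin_surface_vimage:
  assumes "openin (surface x) V"
  shows "openin (top_of_set (affine_curve x)) {P \<in> affine_curve x. Some P \<in> V}"
  using openin_continuous_map_preimage[OF continuous_map_Some[of "top_of_set (affine_curve x)"], of V] assms
  by (simp add: surface_def)

lemma continuous_map_Some_surface: "continuous_map (top_of_set (affine_curve x)) (surface x) Some"
  by (simp add: surface_def continuous_map_Some)

text \<open>On the curve a bound on \<open>u\<close> bounds \<open>v\<close>, because the square of
  \<open>v\<close> is a polynomial in \<open>u\<close>. Thus the complement is a compact part of the
  affine curve.\<close>

lemma openin_near_infinity:
  "openin (surface x) (insert None (Some ` {P \<in> affine_curve x. norm (fst P) > M}))"
proof -
  define C where "C = {P \<in> affine_curve x. norm (fst P) \<le> M}"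
  have "compact (cubic x ` cball 0 M)"
    by (intro compact_continuous_image continuous_intros compact_cball)
  then obtain B where B: "\<And>u. u \<in> cball 0 M \<Longrightarrow> norm (cubic x u) \<le> B"
    by (metis bounded_iff compact_imp_bounded imageI)
  have "norm v \<le> 1 + \<bar>B\<bar>" if "(u, v) \<in> C" for u v
  proof (rule ccontr)
    assume *: "\<not> norm v \<le> 1 + \<bar>B\<bar>"
    have "norm v ^ 2 = norm (cubic x u)" using that by (simp add: C_def mem_affine_curve flip: norm_power)
    also have "\<dots> \<le> B" using that B by (simp add: C_def)
    also have "B < norm v * 1" using * by simp
    also have "norm v * 1 \<le> norm v * norm v" using * by (intro mult_left_mono) auto
    finally show False by (simp add: power2_eq_square)
  qed
  then have "C \<subseteq> cball 0 M \<times> cball 0 (1 + \<bar>B\<bar>)"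
    by (auto simp: C_def)
  then have "C = (cball 0 M \<times> cball 0 (1 + \<bar>B\<bar>)) \<inter> (affine_curve x)" by (auto simp: C_def)
  then have "compact C"
    by (metis closed_affine_curve compact_Int_closed compact_Times compact_cball)
  moreover have "C \<subseteq> affine_curve x" by (auto simp: C_def)
  ultimately have "compactin (top_of_set (affine_curve x)) C" "closedin (top_of_set (affine_curve x)) C"
    by (auto simp: compactin_subtopology closed_subset compact_imp_closed)
  moreover have "{P \<in> affine_curve x. norm (fst P) > M} = topspace (top_of_set (affine_curve x)) - C"
    by (auto simp: C_def)
  ultimately show ?thesis
    unfolding surface_def openin_Alexandroff_compactification by blast
qed

section \<open>Local parameters and primitives at the special points\<close>

lemma factor_cubic:
  assumes "x \<noteq> 0" "x \<noteq> 1" "cubic x e = 0"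
  obtains p q where "p \<noteq> 0" "q \<noteq> 0" "\<And>w. cubic x (e + w) = w * ((w + p) * (w + q))"
proof -
  consider "e = 0" | "e = 1" | "e = x" using assms by (auto simp: cubic_eq_0_iff)
  then show ?thesis
  proof cases
    case 1 then show ?thesis using assms by (intro that[of "-1" "-x"]) (auto simp: cubic_def)
  next
    case 2 then show ?thesis using assms by (intro that[of 1 "1 - x"]) (auto simp: cubic_def algebra_simps)
  next
    case 3 then show ?thesis using assms by (intro that[of x "x - 1"]) (auto simp: cubic_def algebra_simps)
  qed
qed

text \<open>Up to the distance of the two other roots the cofactor of \<open>w\<close> has no zero,
  so it has a holomorphic square root \<open>s\<close> on the disc. Then
  \<open>v / s (u - e)\<close> is a local parameter whose square is \<open>u - e\<close>.\<close>

lemma branch_point_chart: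
  assumes "x \<noteq> 0" "x \<noteq> 1" "cubic x e = 0"
  obtains r s where "r > 0" "s holomorphic_on ball 0 r"
    "\<And>w. w \<in> ball 0 r \<Longrightarrow> s w \<noteq> 0 \<and> cubic x (e + w) = w * (s w)\<^sup>2"
proof -
  obtain p q where pq: "p \<noteq> 0" "q \<noteq> 0" "\<And>w. cubic x (e + w) = w * ((w + p) * (w + q))"
    using factor_cubic[OF assms] by blast
  define r where "r = min (norm p) (norm q)"
  have nz: "(w + p) * (w + q) \<noteq> 0" if "w \<in> ball 0 r" for w
  proof
    assume "(w + p) * (w + q) = 0"
    then have "w = - p \<or> w = - q" by (auto simp: eq_neg_iff_add_eq_0)
    then show False using that by (auto simp: r_def)
  qed
  obtain s where s: "s holomorphic_on ball 0 r" "\<And>w. w \<in> ball 0 r \<Longrightarrow> (w + p) * (w + q) = (s w)\<^sup>2"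
  proof (rule contractible_imp_holomorphic_sqrt[of "\<lambda>w. (w + p) * (w + q)" "ball 0 r"])
    show "(\<lambda>w. (w + p) * (w + q)) holomorphic_on ball 0 r" by (intro holomorphic_intros)
  qed (use nz convex_imp_contractible[OF convex_ball] in auto)
  show ?thesis
  proof (rule that[OF _ s(1)])
    show "r > 0" using pq by (simp add: r_def)
    show "s w \<noteq> 0 \<and> cubic x (e + w) = w * (s w)\<^sup>2" if "w \<in> ball 0 r" for w
      using s(2)[OF that] nz[OF that] pq(3)[of w] by auto
  qed
qed

text \<open>With \<open>w = 1 / u\<close> the cubic is \<open>u ^ 3 * (1 - w) * (1 - x * w)\<close>.
  The radius \<open>1 / (1 + norm x)\<close> keeps \<open>w\<close> away from 1 and from
  \<open>1 / x\<close>.\<close>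

lemma infinity_chart:
  obtains r s where "r > 0" "s holomorphic_on ball 0 r"
    "\<And>w. w \<in> ball 0 r \<Longrightarrow> s w \<noteq> 0 \<and> (s w)\<^sup>2 = (1 - w) * (1 - x * w)"
proof -
  define r where "r = 1 / (1 + norm x)"
  have r: "0 < r" "r \<le> 1" by (auto simp: r_def add_pos_nonneg field_simps)
  have nz: "(1 - w) * (1 - x * w) \<noteq> 0" if "w \<in> ball 0 r" for w
  proof
    have w: "norm w < r" using that by simp
    have "norm x * norm w \<le> norm x * r" using w by (intro mult_left_mono) auto
    also have "\<dots> < 1" by (simp add: r_def field_simps add_pos_nonneg)
    finally have "norm (x * w) < 1" by (simp add: norm_mult)
    then have "x * w \<noteq> 1" by auto
    moreover have "w \<noteq> 1" using w r by auto
    moreover assume "(1 - w) * (1 - x * w) = 0"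
    ultimately show False by auto
  qed
  obtain s where s: "s holomorphic_on ball 0 r" "\<And>w. w \<in> ball 0 r \<Longrightarrow> (1 - w) * (1 - x * w) = (s w)\<^sup>2"
  proof (rule contractible_imp_holomorphic_sqrt[of "\<lambda>w. (1 - w) * (1 - x * w)" "ball 0 r"])
    show "(\<lambda>w. (1 - w) * (1 - x * w)) holomorphic_on ball 0 r" by (intro holomorphic_intros)
  qed (use nz convex_imp_contractible[OF convex_ball] in auto)
  show ?thesis
    using that[OF r(1) s(1)] s(2) nz by (metis power_zero_numeral)
qed

lemma holomorphic_on_ball_primitive:
  assumes "f holomorphic_on ball c r"
  obtains F where "\<And>z. z \<in> ball c r \<Longrightarrow> (F has_field_derivative f z) (at z)"
  using holomorphic_convex_primitive'[OF convex_ball open_ball assms]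
  by (metis at_within_open open_ball)

lemma holomorphic_on_deriv_exists:
  assumes "f holomorphic_on S" "open S" "z \<in> S"
  obtains d where "(f has_field_derivative d) (at z)"
  using assms by (metis field_differentiable_def holomorphic_on_imp_differentiable_at)

lemma elliptic_form_primitive_ordinary:
  assumes P: "P \<in> unramified x"
  shows "\<exists>N f. openin (top_of_set (affine_curve x)) N \<and> P \<in> N \<and> N \<subseteq> unramified x \<and>
    (\<forall>Q\<in>N. primitive_at x (elliptic_form l m) f Q)"
proof -
  obtain r where r: "r > 0" "branch x P holomorphic_on ball (fst P) r"
    "\<And>z. z \<in> ball (fst P) r \<Longrightarrow> branch x P z \<noteq> 0 \<and> (z, branch x P z) \<in> unramified x"
    using branch_holomorphic[OF P] by blast
  have "(\<lambda>z. (l + m * z) / branch x P z) holomorphic_on ball (fst P) r"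
    using r by (intro holomorphic_intros) auto
  then obtain F where F: "\<And>z. z \<in> ball (fst P) r \<Longrightarrow> (F has_field_derivative (l + m * z) / branch x P z) (at z)"
    using holomorphic_on_ball_primitive by blast
  have "primitive_at x (elliptic_form l m) (F \<circ> fst) (z, branch x P z)" if "z \<in> ball (fst P) r" for z
    using primitive_at_branch[OF P r(2) conjunct2[OF r(3)] that, of "elliptic_form l m" "F \<circ> fst"] F[OF that]
    by (simp add: elliptic_form_def)
  moreover have "openin (top_of_set (affine_curve x)) (sheet x P r)"
    using openin_sheet[OF P r(2)] r(3) by blast
  moreover have "P \<in> sheet x P r"
    using r(1) branch_base[OF P] by (auto simp: sheet_def image_iff intro!: bexI[of _ "fst P"])
  ultimately show ?thesis
    using r(3) by (intro exI[of _ "sheet x P r"] exI[of _ "F \<circ> fst"]) (auto simp: sheet_def)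
qed

text \<open>In the parameter \<open>\<zeta> = v / s (u - e)\<close> the form is
  \<open>2 (l + m u) d\<zeta> / s\<close>, regular at \<open>\<zeta> = 0\<close>. A primitive in
  \<open>\<zeta>\<close> is one on the whole punctured neighbourhood, without a choice of
  sheet.\<close>

lemma elliptic_form_primitive_branch_point:
  assumes "x \<noteq> 0" "x \<noteq> 1" "cubic x e = 0"
  shows "\<exists>r>0. \<exists>f. \<forall>P\<in>affine_curve x. norm (fst P - e) < r \<and> fst P \<noteq> e \<longrightarrow>
     P \<in> unramified x \<and> primitive_at x (elliptic_form l m) f P"
proof -
  obtain r s where rs: "r > 0" "s holomorphic_on ball 0 r"
    "\<And>w. w \<in> ball 0 r \<Longrightarrow> s w \<noteq> 0 \<and> cubic x (e + w) = w * (s w)\<^sup>2"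
    using branch_point_chart[OF assms] by blast
  have sq: "\<zeta>\<^sup>2 \<in> ball 0 r" if "\<zeta> \<in> ball 0 (sqrt r)" for \<zeta> :: complex
  proof -
    have "norm \<zeta> ^ 2 < (sqrt r) ^ 2" using that by (intro power_strict_mono) auto
    then show ?thesis using rs(1) by (simp add: norm_power)
  qed
  have "(\<lambda>\<zeta>. 2 * (l + m * (e + \<zeta>\<^sup>2)) / s (\<zeta>\<^sup>2)) holomorphic_on ball 0 (sqrt r)"
    using rs sq by (intro holomorphic_intros holomorphic_on_compose_gen[OF _ rs(2), unfolded o_def]) auto
  then obtain F where F: "\<And>\<zeta>. \<zeta> \<in> ball 0 (sqrt r) \<Longrightarrow>
      (F has_field_derivative 2 * (l + m * (e + \<zeta>\<^sup>2)) / s (\<zeta>\<^sup>2)) (at \<zeta>)"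
    using holomorphic_on_ball_primitive by blast
  define f where "f = (\<lambda>(u, v). F (v / s (u - e)))"
  have "P \<in> unramified x \<and> primitive_at x (elliptic_form l m) f P"
    if P: "P \<in> affine_curve x" "norm (fst P - e) < r" "fst P \<noteq> e" for P
  proof -
    obtain u v where uv: "P = (u, v)" by (cases P)
    have w: "u - e \<in> ball 0 r" "u \<noteq> e" using P uv by auto
    have v2: "v\<^sup>2 = (u - e) * (s (u - e))\<^sup>2"
      using P(1) rs(3)[OF w(1)] by (simp add: uv mem_affine_curve)
    then have nz: "v \<noteq> 0" "s (u - e) \<noteq> 0" using w rs(3)[OF w(1)] by auto
    then have un: "P \<in> unramified x" using P(1) by (simp add: uv mem_unramified mem_affine_curve)
    define \<zeta> where "\<zeta> z = branch x P z / s (z - e)" for z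
    obtain r' where r': "r' > 0" "branch x P holomorphic_on ball u r'"
      using branch_holomorphic[OF un] uv by auto
    define B where "B = ball u r' \<inter> ball e r"
    have "open B" "u \<in> B" using w r' by (auto simp: B_def dist_norm norm_minus_commute)
    have sub: "z - e \<in> ball 0 r" if "z \<in> B" for z
      using that by (auto simp: B_def dist_norm norm_minus_commute)
    have "\<zeta> holomorphic_on B"
      unfolding \<zeta>_def
      by (intro holomorphic_intros holomorphic_on_subset[OF r'(2)] holomorphic_on_compose_gen[OF _ rs(2), unfolded o_def])
        (use sub rs(3) in \<open>auto simp: B_def\<close>)
    then obtain d where d: "(\<zeta> has_field_derivative d) (at u)"
      using holomorphic_on_deriv_exists \<open>open B\<close> \<open>u \<in> B\<close> by blast
    have \<zeta>u: "\<zeta> u = v / s (u - e)" using branch_base[OF un] by (simp add: \<zeta>_def uv)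
    have sqz: "(\<zeta> z)\<^sup>2 = z - e" if "z \<in> B" for z
      using rs(3)[OF sub[OF that]] branch_square[OF un, of z] by (simp add: \<zeta>_def power_divide)
    have "((\<lambda>z. (\<zeta> z)\<^sup>2) has_field_derivative 2 * \<zeta> u * d) (at u)"
      by (auto intro!: derivative_eq_intros d)
    moreover have "((\<lambda>z. (\<zeta> z)\<^sup>2) has_field_derivative 1) (at u)"
      by (rule DERIV_cong_ev[THEN iffD2, OF refl _ refl, of _ "\<lambda>z. z - e"])
        (use sqz \<open>open B\<close> \<open>u \<in> B\<close> in \<open>auto simp: eventually_nhds intro!: derivative_eq_intros\<close>)
    ultimately have d1: "2 * \<zeta> u * d = 1" by (rule DERIV_unique)
    have in_ball: "\<zeta> u \<in> ball 0 (sqrt r)"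
    proof -
      have "norm (\<zeta> u) ^ 2 < r" using sqz[OF \<open>u \<in> B\<close>] w by (simp flip: norm_power)
      then show ?thesis using real_less_rsqrt by simp
    qed
    have "(F has_field_derivative 2 * (l + m * u) / s (u - e)) (at (\<zeta> u))"
      using F[OF in_ball] sqz[OF \<open>u \<in> B\<close>] by simp
    from DERIV_chain2[OF this d]
    have "((\<lambda>z. F (\<zeta> z)) has_field_derivative 2 * (l + m * u) / s (u - e) * d) (at u)" .
    moreover have "2 * (l + m * u) / s (u - e) * d = (l + m * u) / v"
    proof -
      have "\<zeta> u \<noteq> 0" using d1 by auto
      then have "d = 1 / (2 * \<zeta> u)" using d1 by (simp add: field_simps)
      then have "d = s (u - e) / (2 * v)" by (simp add: \<zeta>u)
      then have "2 * k / s (u - e) * d = k / v" for k using nz by simp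
      then show ?thesis .
    qed
    ultimately have "primitive_at x (elliptic_form l m) f P"
      by (simp add: primitive_at_def f_def \<zeta>_def elliptic_form_def uv)
    with un show ?thesis by blast
  qed
  with rs(1) show ?thesis by blast
qed

text \<open>Near infinity \<open>u du/v\<close> equals \<open>2 d(v/u) + (x/u) du/v\<close>, and \<open>(1/u) du/v\<close> is holomorphic there.\<close>

lemma elliptic_form_primitive_infinity:
  "\<exists>M. \<exists>f. \<forall>P\<in>affine_curve x. norm (fst P) > M \<longrightarrow>
     P \<in> unramified x \<and> primitive_at x (elliptic_form l m) f P"
proof -
  obtain r s where rs: "r > 0" "s holomorphic_on ball 0 r"
    "\<And>w. w \<in> ball 0 r \<Longrightarrow> s w \<noteq> 0 \<and> (s w)\<^sup>2 = (1 - w) * (1 - x * w)"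
    by (rule infinity_chart[of x]) blast
  have sq: "\<zeta>\<^sup>2 \<in> ball 0 r" if "\<zeta> \<in> ball 0 (sqrt r)" for \<zeta> :: complex
  proof -
    have "norm \<zeta> ^ 2 < (sqrt r) ^ 2" using that by (intro power_strict_mono) auto
    then show ?thesis using rs(1) by (simp add: norm_power)
  qed
  \<comment> \<open>With \<open>\<zeta>\<^sup>2 = 1 / u\<close> and
    \<open>v = u * s / \<zeta>\<close> one gets \<open>du / v = - 2 d\<zeta> / s\<close>. The
    growing term \<open>m * u\<close> has become \<open>m * x / u\<close>, at the price of the exact
    term \<open>2 * m * v / u\<close> in \<open>f\<close>.\<close>
  have "(\<lambda>\<zeta>. - 2 * (l + m * x * \<zeta>\<^sup>2) / s (\<zeta>\<^sup>2)) holomorphic_on ball 0 (sqrt r)"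
    using rs sq by (intro holomorphic_intros holomorphic_on_compose_gen[OF _ rs(2), unfolded o_def]) auto
  then obtain F where F: "\<And>\<zeta>. \<zeta> \<in> ball 0 (sqrt r) \<Longrightarrow>
      (F has_field_derivative - 2 * (l + m * x * \<zeta>\<^sup>2) / s (\<zeta>\<^sup>2)) (at \<zeta>)"
    using holomorphic_on_ball_primitive by blast
  define f where "f = (\<lambda>(u, v). 2 * m * v / u + F (u * s (1 / u) / v))"
  have inv: "1 / u \<in> ball 0 r \<and> u \<noteq> 0" if "norm u > 1 / r" for u :: complex
  proof -
    have "norm u > 0" using that rs(1) by (meson less_trans zero_less_divide_1_iff)
    then show ?thesis using that rs(1) by (simp add: norm_divide field_simps)
  qed
  have cub: "cubic x u = u ^ 3 * (s (1 / u))\<^sup>2" if "norm u > 1 / r" for u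
  proof -
    have "(s (1 / u))\<^sup>2 = (1 - 1 / u) * (1 - x * (1 / u))" using inv[OF that] rs(3)[of "1 / u"] by blast
    then show ?thesis using inv[OF that]
      by (simp only:) (simp add: cubic_def divide_simps power3_eq_cube)
  qed
  have "P \<in> unramified x \<and> primitive_at x (elliptic_form l m) f P"
    if P: "P \<in> affine_curve x" "norm (fst P) > 1 / r" for P
  proof -
    obtain u v where uv: "P = (u, v)" by (cases P)
    have u: "norm u > 1 / r" using P uv by auto
    note w = inv[OF u]
    have v2: "v\<^sup>2 = u ^ 3 * (s (1 / u))\<^sup>2" using P(1) cub[OF u] by (simp add: uv mem_affine_curve)
    then have nz: "v \<noteq> 0" "s (1 / u) \<noteq> 0" "u \<noteq> 0" using w rs(3)[of "1 / u"] by auto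
    then have un: "P \<in> unramified x" using P(1) by (simp add: uv mem_unramified mem_affine_curve)
    define \<zeta> where "\<zeta> z = z * s (1 / z) / branch x P z" for z
    have "fst P = u" by (simp add: uv)
    obtain r' where r0: "r' > 0" "branch x P holomorphic_on ball (fst P) r'"
      "\<And>z. z \<in> ball (fst P) r' \<Longrightarrow> branch x P z \<noteq> 0 \<and> (z, branch x P z) \<in> unramified x"
      using branch_holomorphic[OF un] by blast
    note r' = r0(1) r0(2)[unfolded \<open>fst P = u\<close>] r0(3)[unfolded \<open>fst P = u\<close>, THEN conjunct1]
    define B where "B = ball u r' \<inter> {z. norm z > 1 / r}"
    have "open B" "u \<in> B"
      using u r' by (auto simp: B_def intro!: open_Int open_Collect_less continuous_intros)
    have sub: "norm z > 1 / r" if "z \<in> B" for z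
      using that by (auto simp: B_def)
    have "\<zeta> holomorphic_on B"
      unfolding \<zeta>_def
      by (intro holomorphic_intros holomorphic_on_subset[OF r'(2)] holomorphic_on_compose_gen[OF _ rs(2), unfolded o_def])
        (use inv[OF sub] r'(3) in \<open>auto simp: B_def\<close>)
    then obtain d where d: "(\<zeta> has_field_derivative d) (at u)"
      using holomorphic_on_deriv_exists \<open>open B\<close> \<open>u \<in> B\<close> by blast
    have \<zeta>u: "\<zeta> u = u * s (1 / u) / v" using branch_base[OF un] by (simp add: \<zeta>_def uv)
    have sqz: "(\<zeta> z)\<^sup>2 = 1 / z" if "z \<in> B" for z
    proof -
      have "s (1 / z) \<noteq> 0" "z \<noteq> 0" using rs(3)[of "1 / z"] inv[OF sub[OF that]] by auto
      moreover have "(\<zeta> z)\<^sup>2 = (z * s (1 / z))\<^sup>2 / (z ^ 3 * (s (1 / z))\<^sup>2)"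
        using cub[OF sub[OF that]] by (simp add: \<zeta>_def power_divide branch_square[OF un])
      ultimately show ?thesis by (simp add: power2_eq_square power3_eq_cube)
    qed
    have "((\<lambda>z. (\<zeta> z)\<^sup>2) has_field_derivative 2 * \<zeta> u * d) (at u)"
      by (auto intro!: derivative_eq_intros d)
    moreover have "((\<lambda>z. (\<zeta> z)\<^sup>2) has_field_derivative - 1 / u\<^sup>2) (at u)"
      by (rule DERIV_cong_ev[THEN iffD2, OF refl _ refl, of _ "\<lambda>z. 1 / z"])
        (use sqz \<open>open B\<close> \<open>u \<in> B\<close> nz in \<open>auto simp: eventually_nhds power2_eq_square intro!: derivative_eq_intros\<close>)
    ultimately have d1: "2 * \<zeta> u * d = - 1 / u\<^sup>2" by (rule DERIV_unique)
    have in_ball: "\<zeta> u \<in> ball 0 (sqrt r)"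
    proof -
      have "norm (\<zeta> u) ^ 2 < r" using sqz[OF \<open>u \<in> B\<close>] w by (simp flip: norm_power)
      then show ?thesis using real_less_rsqrt by simp
    qed
    let ?c = "(u - 1) * (u - x) + u * (u - x) + u * (u - 1)"
    have "(F has_field_derivative - 2 * (l + m * x / u) / s (1 / u)) (at (\<zeta> u))"
      using F[OF in_ball] sqz[OF \<open>u \<in> B\<close>] by simp
    from DERIV_chain2[OF this d]
    have "((\<lambda>z. F (\<zeta> z)) has_field_derivative - 2 * (l + m * x / u) / s (1 / u) * d) (at u)" .
    moreover have "((\<lambda>z. 2 * m * branch x P z / z) has_field_derivative
        2 * m * (?c / (2 * v) * u - v) / u\<^sup>2) (at u)"
    proof -
      define C where "C = ?c / (2 * v)"
      have "(branch x P has_field_derivative C) (at u)"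
        using has_field_derivative_branch[OF un] unfolding C_def by (simp only: uv fst_conv snd_conv)
      then have "((\<lambda>z. 2 * m * branch x P z / z) has_field_derivative
          ((2 * m * C) * u - (2 * m * branch x P u) * 1) / (u * u)) (at u)"
        by (intro DERIV_divide DERIV_cmult DERIV_ident nz)
      moreover have "branch x P u = v" using branch_base[OF un] by (simp add: uv)
      ultimately show ?thesis unfolding C_def [symmetric] by (simp add: power2_eq_square algebra_simps)
    qed
    ultimately have D: "((\<lambda>z. 2 * m * branch x P z / z + F (\<zeta> z)) has_field_derivative
       2 * m * (?c / (2 * v) * u - v) / u\<^sup>2 + (- 2 * (l + m * x / u) / s (1 / u) * d)) (at u)"
      by (intro DERIV_add)
    have "2 * m * (?c / (2 * v) * u - v) / u\<^sup>2 + (- 2 * (l + m * x / u) / s (1 / u) * d) = (l + m * u) / v"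
    proof -
      have "\<zeta> u \<noteq> 0" using nz by (simp add: \<zeta>u)
      then have "d = - 1 / (2 * \<zeta> u * u\<^sup>2)" using d1 nz by (simp add: field_simps)
      then have "d = - v / (2 * u ^ 3 * s (1 / u))"
        by (simp add: \<zeta>u power2_eq_square power3_eq_cube ac_simps)
      then have "- 2 * k / s (1 / u) * d = k * v / (u ^ 3 * (s (1 / u))\<^sup>2)" for k
        by (simp add: power2_eq_square)
      then have "- 2 * (l + m * x / u) / s (1 / u) * d = (l + m * x / u) * v / (u ^ 3 * (s (1 / u))\<^sup>2)" .
      also have "\<dots> = (l + m * x / u) / v"
        using nz by (simp flip: v2) (simp add: power2_eq_square)
      finally have 1: "- 2 * (l + m * x / u) / s (1 / u) * d = (l + m * x / u) / v" .
      have v2': "v * v = u * (u - 1) * (u - x)"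
        using P(1) by (simp add: uv mem_affine_curve cubic_def power2_eq_square)
      have "C / (2 * v) * u - v = (C * u - 2 * (v * v)) / (2 * v)" for C
        using nz by (simp add: field_simps)
      then have "2 * m * (?c / (2 * v) * u - v) / u\<^sup>2 = m * (?c * u - 2 * (v * v)) / (v * u\<^sup>2)"
        by simp
      also have "?c * u - 2 * (v * v) = u * (u\<^sup>2 - x)"
        unfolding v2' by (simp add: algebra_simps power2_eq_square)
      also have "m * (u * (u\<^sup>2 - x)) / (v * u\<^sup>2) = (m * u - m * x / u) / v"
        using nz by (simp add: divide_simps power2_eq_square) (simp add: algebra_simps)
      finally show ?thesis unfolding 1 by (simp add: diff_divide_distrib add_divide_distrib)
    qed
    with D have "primitive_at x (elliptic_form l m) f P"
      by (simp add: primitive_at_def f_def \<zeta>_def elliptic_form_def uv)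
    with un show ?thesis by blast
  qed
  then show ?thesis by blast
qed

text \<open>The last conjunct makes the centre the only possibly ramified point of its
  neighbourhood, so that two different neighbourhoods overlap in the unramified part only, where
  primitives can be compared.\<close>

lemma elliptic_form_local_primitive:
  assumes "x \<noteq> 0" "x \<noteq> 1" "Z \<in> topspace (surface x)"
  shows "\<exists>V f. openin (surface x) V \<and> Z \<in> V \<and>
    (\<forall>P\<in>unramified x. Some P \<in> V \<longrightarrow> primitive_at x (elliptic_form l m) (\<lambda>P. f (Some P)) P) \<and>
    (\<forall>T\<in>V. T \<noteq> Z \<longrightarrow> T \<in> Some ` unramified x)"
proof (cases Z)
  case None
  obtain M f where Mf: "\<forall>P\<in>affine_curve x. norm (fst P) > M \<longrightarrow>
     P \<in> unramified x \<and> primitive_at x (elliptic_form l m) f P"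
    using elliptic_form_primitive_infinity by blast
  show ?thesis
    by (rule exI[of _ "insert None (Some ` {P \<in> affine_curve x. norm (fst P) > M})"], rule exI[of _ "f \<circ> the"])
      (use Mf openin_near_infinity None in auto)
next
  case (Some P)
  then have P: "P \<in> affine_curve x" using assms(3) by (auto simp: topspace_surface)
  show ?thesis
  proof (cases "P \<in> unramified x")
    case True
    obtain N f where "openin (top_of_set (affine_curve x)) N \<and> P \<in> N \<and> N \<subseteq> unramified x \<and>
      (\<forall>Q\<in>N. primitive_at x (elliptic_form l m) f Q)"
      using elliptic_form_primitive_ordinary[OF True, of l m] by (elim exE) (rule that)
    then show ?thesis
      by (intro exI[of _ "Some ` N"] exI[of _ "f \<circ> the"]) (auto simp: openin_surface_Some Some)
  next
    case False
    obtain e where e: "P = (e, 0)" "cubic x e = 0"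
      using P False by (cases P) (auto simp: mem_affine_curve mem_unramified)
    obtain r f where r: "r > 0" and f: "\<forall>P\<in>affine_curve x. norm (fst P - e) < r \<and> fst P \<noteq> e \<longrightarrow>
     P \<in> unramified x \<and> primitive_at x (elliptic_form l m) f P"
      using elliptic_form_primitive_branch_point[OF assms(1,2) e(2), of l m] by blast
    let ?N = "affine_curve x \<inter> {p. norm (fst p - e) < r}"
    have "openin (top_of_set (affine_curve x)) ?N"
      by (intro openin_open_Int open_Collect_less continuous_intros)
    moreover have "Q = (e, 0)" if "Q \<in> affine_curve x" "fst Q = e" for Q
      using that e(2) by (cases Q) (auto simp: mem_affine_curve)
    moreover have "(e, v) \<notin> unramified x" for v using e(2) by (simp add: mem_unramified)
    ultimately have N: "openin (surface x) (Some ` ?N)" "\<And>Q. Q \<in> ?N \<Longrightarrow> Q \<noteq> (e, 0) \<Longrightarrow> Q \<in> unramified x"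
        "\<And>Q. Q \<in> ?N \<Longrightarrow> Q \<in> unramified x \<Longrightarrow> primitive_at x (elliptic_form l m) f Q"
      using f by (auto simp: openin_surface_Some)
    have "Z \<in> Some ` ?N" using Some e P r by auto
    then show ?thesis
      using N(1) N(3) N(2) e(1) by (intro exI[of _ "Some ` ?N"] exI[of _ "f \<circ> the"]) (auto simp: Some)
  qed
qed

text \<open>Links the two readings of \<open>\<delta>\<close>: the primitives integrate
  \<open>h du\<close> over loops in the unramified part, while the cocycle pairs with all singular
  chains of the compact surface.\<close>

definition local_primitives ::
    "complex \<Rightarrow> (complex \<times> complex \<Rightarrow> complex) \<Rightarrow> ((complex \<times> complex) option \<Rightarrow> (complex \<times> complex) option \<Rightarrow> complex) \<Rightarrow> bool" where
  "local_primitives x h \<delta> \<longleftrightarrow> (\<forall>T\<in>topspace (surface x). \<exists>N g. openin (surface x) N \<and> T \<in> N \<and>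
     (\<forall>P\<in>N. \<forall>Q\<in>N. \<delta> P Q = g Q - g P) \<and>
     (\<forall>P\<in>unramified x. Some P \<in> N \<longrightarrow> primitive_at x h (\<lambda>P. g (Some P)) P))"

lemma local_primitivesD:
  assumes "local_primitives x h \<delta>" "T \<in> topspace (surface x)"
  obtains N g where "openin (surface x) N" "T \<in> N" "\<And>P Q. P \<in> N \<Longrightarrow> Q \<in> N \<Longrightarrow> \<delta> P Q = g Q - g P"
     "\<And>P. P \<in> unramified x \<Longrightarrow> Some P \<in> N \<Longrightarrow> primitive_at x h (\<lambda>P. g (Some P)) P"
proof -
  from assms obtain N g where "openin (surface x) N \<and> T \<in> N \<and>
     (\<forall>P\<in>N. \<forall>Q\<in>N. \<delta> P Q = g Q - g P) \<and>
     (\<forall>P\<in>unramified x. Some P \<in> N \<longrightarrow> primitive_at x h (\<lambda>P. g (Some P)) P)"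
    unfolding local_primitives_def by (elim ballE exE) auto
  then show ?thesis by (intro that[of N g]) (simp_all only:)
qed

lemma local_primitives_cocycle:
  assumes "local_primitives x h \<delta>"
  shows "local_cocycle (surface x) \<delta>"
proof (rule local_cocycleI)
  fix T assume "T \<in> topspace (surface x)"
  then obtain N g where "openin (surface x) N" "T \<in> N" "\<And>P Q. P \<in> N \<Longrightarrow> Q \<in> N \<Longrightarrow> \<delta> P Q = g Q - g P"
    using local_primitivesD[OF assms] by metis
  then show "\<exists>N g. openin (surface x) N \<and> T \<in> N \<and> (\<forall>P\<in>N. \<forall>Q\<in>N. \<delta> P Q = g Q - g P)"
    by (intro exI[of _ N] exI[of _ g] conjI ballI)
qed

lemma elliptic_form_cocycle:
  assumes "x \<noteq> 0" "x \<noteq> 1"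
  obtains \<delta> where "local_primitives x (elliptic_form l m) \<delta>"
proof -
  let ?S = "surface x"
  have "\<forall>Z. \<exists>V f. Z \<in> topspace ?S \<longrightarrow> openin ?S V \<and> Z \<in> V \<and>
    (\<forall>P\<in>unramified x. Some P \<in> V \<longrightarrow> primitive_at x (elliptic_form l m) (\<lambda>P. f (Some P)) P) \<and>
    (\<forall>T\<in>V. T \<noteq> Z \<longrightarrow> T \<in> Some ` unramified x)"
  proof
    fix Z
    show "\<exists>V f. Z \<in> topspace ?S \<longrightarrow> openin ?S V \<and> Z \<in> V \<and>
    (\<forall>P\<in>unramified x. Some P \<in> V \<longrightarrow> primitive_at x (elliptic_form l m) (\<lambda>P. f (Some P)) P) \<and>
    (\<forall>T\<in>V. T \<noteq> Z \<longrightarrow> T \<in> Some ` unramified x)"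
    proof (cases "Z \<in> topspace ?S")
      case True
      from elliptic_form_local_primitive[OF assms this, of l m] show ?thesis
        by (simp only: True simp_thms)
    qed simp
  qed
  from this[THEN choice] obtain V where "\<forall>Z. \<exists>f. Z \<in> topspace ?S \<longrightarrow> openin ?S (V Z) \<and> Z \<in> V Z \<and>
    (\<forall>P\<in>unramified x. Some P \<in> V Z \<longrightarrow> primitive_at x (elliptic_form l m) (\<lambda>P. f (Some P)) P) \<and>
    (\<forall>T\<in>V Z. T \<noteq> Z \<longrightarrow> T \<in> Some ` unramified x)" ..
  from this[THEN choice] obtain f where f: "\<forall>Z. Z \<in> topspace ?S \<longrightarrow> openin ?S (V Z) \<and> Z \<in> V Z \<and>
    (\<forall>P\<in>unramified x. Some P \<in> V Z \<longrightarrow> primitive_at x (elliptic_form l m) (\<lambda>P. f Z (Some P)) P) \<and>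
    (\<forall>T\<in>V Z. T \<noteq> Z \<longrightarrow> T \<in> Some ` unramified x)" ..
  have fV: "openin ?S (V Z)" "Z \<in> V Z" if "Z \<in> topspace ?S" for Z
    using f that by simp_all
  have fp: "primitive_at x (elliptic_form l m) (\<lambda>P. f Z (Some P)) P"
    if "Z \<in> topspace ?S" "P \<in> unramified x" "Some P \<in> V Z" for Z P
    using f that by simp
  have fu: "T \<in> Some ` unramified x" if "Z \<in> topspace ?S" "T \<in> V Z" "T \<noteq> Z" for Z T
    using f that by simp
  obtain \<delta> where \<delta>: "\<And>T. T \<in> topspace ?S \<Longrightarrow> \<exists>N Z. openin ?S N \<and> T \<in> N \<and> Z \<in> topspace ?S \<and> N \<subseteq> V Z \<and>
       (\<forall>P\<in>N. \<forall>Q\<in>N. \<delta> P Q = f Z Q - f Z P)"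
  proof (rule glue_local_cocycle[OF compact_space_surface Hausdorff_space_surface, of x V f])
    fix Z Z' T assume ZT: "Z \<in> topspace ?S" "Z' \<in> topspace ?S" "T \<in> V Z" "T \<in> V Z'"
    show "\<exists>N. openin ?S N \<and> T \<in> N \<and> N \<subseteq> V Z \<inter> V Z' \<and> (\<forall>P\<in>N. f Z P - f Z' P = f Z T - f Z' T)"
    proof (cases "Z = Z'")
      case True
      then show ?thesis using fV(1)[OF ZT(1)] ZT(3) by (intro exI[of _ "V Z"]) simp
    next
      case False
      \<comment> \<open>\<open>T\<close> cannot be the centre of both neighbourhoods, hence it is
        unramified.\<close>
      then have "T \<in> Some ` unramified x" using fu[OF ZT(1,3)] fu[OF ZT(2,4)] by metis
      then obtain P where P: "T = Some P" "P \<in> unramified x" by blast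
      let ?N = "{P \<in> affine_curve x. Some P \<in> V Z \<inter> V Z'}"
      have "openin (top_of_set (affine_curve x)) ?N"
        using fV(1) ZT by (intro openin_surface_vimage openin_Int) auto
      moreover have "P \<in> ?N" using P ZT unramified_sub_affine by blast
      ultimately have "\<exists>M. openin (top_of_set (affine_curve x)) M \<and> P \<in> M \<and> M \<subseteq> ?N \<inter> unramified x \<and>
          (\<forall>Q\<in>M. f Z (Some Q) - f Z' (Some Q) = f Z (Some P) - f Z' (Some P))"
        using fp[OF ZT(1)] fp[OF ZT(2)]
        by (intro primitives_differ_locally[OF P(2), of ?N "elliptic_form l m" "\<lambda>P. f Z (Some P)" "\<lambda>P. f Z' (Some P)"])
          simp_all
      then obtain M where M0: "openin (top_of_set (affine_curve x)) M \<and> P \<in> M \<and> M \<subseteq> ?N \<inter> unramified x \<and>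
          (\<forall>Q\<in>M. f Z (Some Q) - f Z' (Some Q) = f Z (Some P) - f Z' (Some P))" by (elim exE) (rule that)
      note M = M0[THEN conjunct1] M0[THEN conjunct2, THEN conjunct1] M0[THEN conjunct2, THEN conjunct2, THEN conjunct1]
        M0[THEN conjunct2, THEN conjunct2, THEN conjunct2, THEN bspec]
      have "\<forall>T'\<in>Some ` M. f Z T' - f Z' T' = f Z T - f Z' T" unfolding P(1) by (intro ballI, elim imageE, simp only:) (rule M(4))
      moreover have "Some ` M \<subseteq> V Z \<inter> V Z'" using M(3) by auto
      moreover have "openin ?S (Some ` M)" "T \<in> Some ` M" using M P by (auto simp: openin_surface_Some)
      ultimately show ?thesis by (intro exI[of _ "Some ` M"]) simp
    qed
  qed (use fV in auto)
  have "local_primitives x (elliptic_form l m) \<delta>"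
    unfolding local_primitives_def
  proof
    fix T assume "T \<in> topspace ?S"
    from \<delta>[OF this] obtain N Z where N: "openin ?S N \<and> T \<in> N \<and> Z \<in> topspace ?S \<and> N \<subseteq> V Z \<and>
       (\<forall>P\<in>N. \<forall>Q\<in>N. \<delta> P Q = f Z Q - f Z P)" by (elim exE) (rule that)
    then have Z: "\<And>P. P \<in> unramified x \<Longrightarrow> Some P \<in> V Z \<Longrightarrow> primitive_at x (elliptic_form l m) (\<lambda>P. f Z (Some P)) P"
      using fp by simp
    have "openin ?S N \<and> T \<in> N \<and> (\<forall>P\<in>N. \<forall>Q\<in>N. \<delta> P Q = f Z Q - f Z P) \<and>
     (\<forall>P\<in>unramified x. Some P \<in> N \<longrightarrow> primitive_at x (elliptic_form l m) (\<lambda>P. f Z (Some P)) P)"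
    proof (intro conjI)
      show "\<forall>P\<in>unramified x. Some P \<in> N \<longrightarrow> primitive_at x (elliptic_form l m) (\<lambda>P. f Z (Some P)) P"
      proof (intro ballI impI)
        fix P assume "P \<in> unramified x" "Some P \<in> N"
        then show "primitive_at x (elliptic_form l m) (\<lambda>P. f Z (Some P)) P"
          using N by (intro Z) auto
      qed
    qed (insert N, (elim conjE, assumption)+)
    then show "\<exists>N g. openin ?S N \<and> T \<in> N \<and> (\<forall>P\<in>N. \<forall>Q\<in>N. \<delta> P Q = g Q - g P) \<and>
     (\<forall>P\<in>unramified x. Some P \<in> N \<longrightarrow> primitive_at x (elliptic_form l m) (\<lambda>P. g (Some P)) P)"
      by (intro exI[of _ N] exI[of _ "f Z"])
  qed
  then show ?thesis by (rule that)
qed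

section \<open>Integrals of elliptic differentials along loops\<close>

lemma curve_loopD:
  assumes "curve_loop x \<gamma>"
  shows "continuous_on {0..1} \<gamma>" "\<gamma> 0 = \<gamma> 1" "\<And>t. t \<in> {0..1} \<Longrightarrow> \<gamma> t \<in> unramified x"
    "continuous_on {0..1} (\<lambda>t. fst (\<gamma> t))" "continuous_on {0..1} (\<lambda>t. snd (\<gamma> t))"
  using assms
  by (auto simp: curve_loop_def path_def pathfinish_def pathstart_def path_image_def intro!: continuous_intros)

lemma lift_eq_branch:
  assumes "curve_loop x \<gamma>" "\<tau> \<in> {0..1}"
  shows "\<forall>\<^sub>F t in at \<tau> within {0..1}. snd (\<gamma> t) = branch x (\<gamma> \<tau>) (fst (\<gamma> t))"
proof (rule branch_unique)
  note g = curve_loopD[OF assms(1)]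
  show "\<gamma> \<tau> \<in> unramified x" using g(3) assms(2) by blast
  show "((\<lambda>t. fst (\<gamma> t)) \<longlongrightarrow> fst (\<gamma> \<tau>)) (at \<tau> within {0..1})"
    "((\<lambda>t. snd (\<gamma> t)) \<longlongrightarrow> snd (\<gamma> \<tau>)) (at \<tau> within {0..1})"
    using g(4,5) assms(2) by (simp_all add: continuous_on_def)
  show "\<forall>\<^sub>F t in at \<tau> within {0..1}. (fst (\<gamma> t), snd (\<gamma> t)) \<in> affine_curve x"
    using g(3) subsetD[OF unramified_sub_affine] by (auto simp: eventually_at_filter)
qed

text \<open>Only the projection of \<open>\<gamma>\<close> is piecewise smooth, so near each
  parameter \<open>f \<circ> \<gamma>\<close> is rewritten as a function of \<open>u\<close> along
  the lift and the chain rule is applied there; continuity covers the finitely many exceptional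
  parameters.\<close>

lemma has_integral_primitive:
  assumes \<gamma>: "curve_loop x \<gamma>" and st: "0 \<le> s" "s \<le> t" "t \<le> 1"
    and prim: "\<And>\<tau>. \<tau> \<in> {s..t} \<Longrightarrow> primitive_at x h f (\<gamma> \<tau>)"
  shows "((\<lambda>\<tau>. h (\<gamma> \<tau>) * vector_derivative (fst \<circ> \<gamma>) (at \<tau> within {0..1})) has_integral f (\<gamma> t) - f (\<gamma> s)) {s..t}"
proof -
  note g = curve_loopD[OF \<gamma>]
  have "(fst \<circ> \<gamma>) piecewise_C1_differentiable_on {0..1}"
    using \<gamma> by (simp add: curve_loop_def valid_path_def)
  then obtain S where S0: "finite S" "(fst \<circ> \<gamma>) C1_differentiable_on {0..1} - S"
    unfolding piecewise_C1_differentiable_on_def by auto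
  from S0(2) obtain D where "\<forall>\<tau>\<in>{0..1} - S. ((fst \<circ> \<gamma>) has_vector_derivative D \<tau>) (at \<tau>)"
    unfolding C1_differentiable_on_def by (elim exE conjE) (rule that)
  note S = S0(1) this[THEN bspec]
  let ?b = "\<lambda>\<tau> z. f (z, branch x (\<gamma> \<tau>) z)"
  have near: "\<forall>\<^sub>F t in at \<tau> within {0..1}. f (\<gamma> t) = ?b \<tau> (fst (\<gamma> t))" if "\<tau> \<in> {0..1}" for \<tau>
    using lift_eq_branch[OF \<gamma> that]
  proof eventually_elim
    case (elim t)
    then show ?case by (simp flip: elim)
  qed
  have base: "?b \<tau> (fst (\<gamma> \<tau>)) = f (\<gamma> \<tau>)" if "\<tau> \<in> {0..1}" for \<tau>
    using branch_base[OF g(3)[OF that]] by simp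
  have prim': "(?b \<tau> has_field_derivative h (\<gamma> \<tau>)) (at (fst (\<gamma> \<tau>)))" if "\<tau> \<in> {s..t}" for \<tau>
    using prim[OF that] by (simp add: primitive_at_def)
  have "((\<lambda>\<tau>. h (\<gamma> \<tau>) * vector_derivative (fst \<circ> \<gamma>) (at \<tau> within {0..1}))
        has_integral (f \<circ> \<gamma>) t - (f \<circ> \<gamma>) s) {s..t}"
  proof (rule fundamental_theorem_of_calculus_interior_strong[OF S(1) st(2)])
    fix \<tau> assume \<tau>: "\<tau> \<in> {s<..<t} - S"
    then have \<tau>': "\<tau> \<in> {0..1}" "\<tau> \<in> {s..t}" "\<tau> \<in> {0<..<1}" "\<tau> \<notin> S" using st by auto
    have vd: "((fst \<circ> \<gamma>) has_vector_derivative D \<tau>) (at \<tau>)" using S(2) \<tau>' by blast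
    then have eqD: "vector_derivative (fst \<circ> \<gamma>) (at \<tau> within {0..1}) = D \<tau>"
      using \<tau>'(1) by (intro vector_derivative_at_within_ivl) auto
    have "((?b \<tau> \<circ> (fst \<circ> \<gamma>)) has_vector_derivative D \<tau> * h (\<gamma> \<tau>)) (at \<tau>)"
      by (rule field_vector_diff_chain_at[OF vd]) (use prim'[OF \<tau>'(2)] in simp)
    moreover have "at \<tau> within {0..1} = at \<tau>"
      using \<tau>'(3) by (intro at_within_Icc_at) auto
    then have "\<forall>\<^sub>F t in nhds \<tau>. f (\<gamma> t) = ?b \<tau> (fst (\<gamma> t))"
      using near[OF \<tau>'(1)] base[OF \<tau>'(1)] by (simp add: eventually_nhds_conv_at)
    then obtain T where "open T" "\<tau> \<in> T" "\<And>t. t \<in> T \<Longrightarrow> f (\<gamma> t) = ?b \<tau> (fst (\<gamma> t))"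
      unfolding eventually_nhds by blast
    ultimately have "((f \<circ> \<gamma>) has_vector_derivative D \<tau> * h (\<gamma> \<tau>)) (at \<tau>)"
      by (elim has_vector_derivative_transform_within_open) auto
    then show "((f \<circ> \<gamma>) has_vector_derivative h (\<gamma> \<tau>) * vector_derivative (fst \<circ> \<gamma>) (at \<tau> within {0..1})) (at \<tau>)"
      by (simp add: eqD mult.commute)
  next
    show "continuous_on {s..t} (f \<circ> \<gamma>)"
      unfolding continuous_on_def
    proof
      fix \<tau> assume \<tau>: "\<tau> \<in> {s..t}"
      then have \<tau>': "\<tau> \<in> {0..1}" using st by auto
      have "isCont (?b \<tau>) (fst (\<gamma> \<tau>))" using prim'[OF \<tau>] DERIV_isCont by blast
      then have "((\<lambda>t. ?b \<tau> (fst (\<gamma> t))) \<longlongrightarrow> ?b \<tau> (fst (\<gamma> \<tau>))) (at \<tau> within {0..1})"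
        by (rule isCont_tendsto_compose) (use g(4) \<tau>' in \<open>simp add: continuous_on_def\<close>)
      then have "((\<lambda>t. f (\<gamma> t)) \<longlongrightarrow> f (\<gamma> \<tau>)) (at \<tau> within {0..1})"
        unfolding base[OF \<tau>'] by (rule Lim_transform_eventually) (use near[OF \<tau>'] in \<open>auto elim: eventually_mono\<close>)
      then show "((f \<circ> \<gamma>) \<longlongrightarrow> (f \<circ> \<gamma>) \<tau>) (at \<tau> within {s..t})"
        unfolding o_def by (rule tendsto_within_subset) (use st in auto)
    qed
  qed
  then show ?thesis by simp
qed

lemma curve_integral_primitive:
  assumes "curve_loop x \<gamma>" "\<And>t. t \<in> {0..1} \<Longrightarrow> primitive_at x h f (\<gamma> t)"
  shows "((\<lambda>\<tau>. h (\<gamma> \<tau>) * vector_derivative (fst \<circ> \<gamma>) (at \<tau> within {0..1})) has_integral 0) {0..1}"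
  using has_integral_primitive[OF assms(1), of 0 1 h f] assms(2) curve_loopD(2)[OF assms(1)] by simp

lemma continuous_map_curve_surface:
  assumes "continuous_on {0..1::real} \<gamma>" "\<And>t. t \<in> {0..1} \<Longrightarrow> \<gamma> t \<in> affine_curve x"
  shows "continuous_map (top_of_set {0..1}) (surface x) (\<lambda>t. Some (\<gamma> t))"
proof -
  have "continuous_map (top_of_set {0..1}) (top_of_set (affine_curve x)) \<gamma>"
    using assms by (auto simp: continuous_map_in_subtopology)
  from continuous_map_compose[OF this continuous_map_Some_surface] show ?thesis by (simp add: o_def)
qed

lemma curve_loop_continuous_map:
  assumes "curve_loop x \<gamma>"
  shows "continuous_map (top_of_set {0..1}) (surface x) (\<lambda>t. Some (\<gamma> t))"
  by (rule continuous_map_curve_surface)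
    (use curve_loopD[OF assms] subsetD[OF unramified_sub_affine] in auto)

text \<open>On a fine bisection each piece of the loop stays where \<open>\<delta>\<close> is the
  increment of one primitive, so each term is exactly the integral over that piece.\<close>

lemma curve_integral_eq_path_sum:
  assumes \<delta>: "local_primitives x h \<delta>" and \<gamma>: "curve_loop x \<gamma>"
  shows "((\<lambda>\<tau>. h (\<gamma> \<tau>) * vector_derivative (fst \<circ> \<gamma>) (at \<tau> within {0..1}))
           has_integral path_sum \<delta> (\<lambda>t. Some (\<gamma> t))) {0..1}"
proof -
  let ?\<phi> = "\<lambda>\<tau>. h (\<gamma> \<tau>) * vector_derivative (fst \<circ> \<gamma>) (at \<tau> within {0..1})"
  let ?d = "\<lambda>s t. \<delta> (Some (\<gamma> s)) (Some (\<gamma> t))"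
  define Pr where "Pr N \<longleftrightarrow> (\<exists>g. (\<forall>P\<in>N. \<forall>Q\<in>N. \<delta> P Q = g Q - g P) \<and>
     (\<forall>P\<in>unramified x. Some P \<in> N \<longrightarrow> primitive_at x h (\<lambda>P. g (Some P)) P))" for N
  note cm = curve_loop_continuous_map[OF \<gamma>]
  have *: "\<exists>N. openin (surface x) N \<and> T \<in> N \<and> Pr N" if "T \<in> topspace (surface x)" for T
    using bspec[OF \<delta>[unfolded local_primitives_def] that]
    by (elim exE conjE) (intro exI conjI; (unfold Pr_def)?; (intro exI conjI)?; assumption)
  obtain \<eta> where \<eta>: "\<eta> > 0" "\<And>a. a \<in> {0..1::real} \<Longrightarrow> \<exists>N. openin (surface x) N \<and> Pr N \<and>
      (\<forall>b\<in>{0..1}. dist a b \<le> \<eta> \<longrightarrow> Some (\<gamma> b) \<in> N)"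
    by (rule compact_map_Lebesgue[OF compact_Icc cm, where Pr = Pr, OF *]) blast+
  have small: "(?\<phi> has_integral ?d a b) {a..b}" if ab: "0 \<le> a" "a \<le> b" "b \<le> 1" "b - a \<le> \<eta>" for a b
  proof -
    obtain N where N: "Pr N" "\<forall>b\<in>{0..1}. dist a b \<le> \<eta> \<longrightarrow> Some (\<gamma> b) \<in> N"
      using \<eta>(2)[of a] ab by auto
    from N(1) obtain g where g: "\<forall>P\<in>N. \<forall>Q\<in>N. \<delta> P Q = g Q - g P"
      "\<forall>P\<in>unramified x. Some P \<in> N \<longrightarrow> primitive_at x h (\<lambda>P. g (Some P)) P"
      unfolding Pr_def by (elim exE conjE) (rule that)
    have inN: "Some (\<gamma> \<tau>) \<in> N" if "\<tau> \<in> {a..b}" for \<tau>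
      using N(2) that ab by (auto simp: dist_real_def)
    have "(?\<phi> has_integral g (Some (\<gamma> b)) - g (Some (\<gamma> a))) {a..b}"
      by (rule has_integral_primitive[OF \<gamma> ab(1-3), of h "\<lambda>P. g (Some P)"])
        (use g(2) inN curve_loopD(3)[OF \<gamma>] ab in auto)
    moreover have "?d a b = g (Some (\<gamma> b)) - g (Some (\<gamma> a))"
      using g(1) inN[of a] inN[of b] ab(2) by (elim ballE) auto
    ultimately show ?thesis by (simp only:)
  qed
  have dy: "\<lbrakk>0 \<le> a; a \<le> b; b \<le> 1; b - a \<le> 2 ^ N * \<eta>\<rbrakk> \<Longrightarrow> (?\<phi> has_integral dyadic_sum N ?d a b) {a..b}" for N a b
  proof (induction N arbitrary: a b)
    case 0
    have "b - a \<le> \<eta>" using 0 by simp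
    with 0 show ?case unfolding dyadic_sum.simps by (intro small)
  next
    case (Suc N)
    have m: "midpoint a b = (a + b) / 2" by (simp add: midpoint_def)
    show ?case
      unfolding dyadic_sum.simps
    proof (rule has_integral_combine[of a "midpoint a b" b])
      show "(?\<phi> has_integral dyadic_sum N ?d a (midpoint a b)) {a..midpoint a b}"
        by (rule Suc.IH) (use Suc.prems m in auto)
      show "(?\<phi> has_integral dyadic_sum N ?d (midpoint a b) b) {midpoint a b..b}"
        by (rule Suc.IH) (use Suc.prems m in auto)
    qed (use Suc.prems m in auto)
  qed
  have "\<forall>\<^sub>F N in sequentially. (?\<phi> has_integral dyadic_sum N ?d 0 1) {0..1}"
  proof -
    obtain N0 where N0: "1 / \<eta> < 2 ^ N0" using real_arch_pow[of 2 "1 / \<eta>"] by auto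
    have "(?\<phi> has_integral dyadic_sum N ?d 0 1) {0..1}" if "N \<ge> N0" for N
    proof (rule dy)
      have "1 < 2 ^ N0 * \<eta>" using N0 \<eta>(1) by (simp add: pos_divide_less_eq)
      also have "\<dots> \<le> 2 ^ N * \<eta>" using that \<eta>(1) by simp
      finally show "1 - 0 \<le> 2 ^ N * \<eta>" by simp
    qed auto
    then show ?thesis unfolding eventually_sequentially by blast
  qed
  moreover have "\<forall>\<^sub>F N in sequentially. dyadic_sum N ?d 0 1 = path_sum \<delta> (\<lambda>t. Some (\<gamma> t))"
    by (rule path_sum_eventually[OF cm local_primitives_cocycle[OF \<delta>]])
  ultimately have "\<forall>\<^sub>F N::nat in sequentially. (?\<phi> has_integral path_sum \<delta> (\<lambda>t. Some (\<gamma> t))) {0..1}"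
    by eventually_elim simp
  then show ?thesis by simp
qed

section \<open>Loops as singular cycles\<close>

definition loop_simplex :: "(real \<Rightarrow> 'b) \<Rightarrow> 'b chain" where
  "loop_simplex p = frag_of (restrict (\<lambda>z. p (z 1)) (standard_simplex 1))"

lemma chain_sum_loop_simplex: "chain_sum \<delta> (loop_simplex p) = path_sum \<delta> p"
  unfolding loop_simplex_def chain_sum_of
  by (rule path_sum_cong) (use edge_simplex in \<open>auto simp: edge_def\<close>)

lemma loop_simplex_cycle:
  assumes p: "continuous_map (top_of_set {0..1}) S p" and "p 0 = p 1"
  shows "singular_relcycle 1 S {} (loop_simplex p)"
proof -
  let ?f = "restrict (\<lambda>z::nat \<Rightarrow> real. p (z 1)) (standard_simplex 1)"
  have "continuous_map (subtopology (powertop_real UNIV) (standard_simplex 1)) euclideanreal (\<lambda>z. z 1)"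
    by (intro continuous_map_from_subtopology continuous_map_product_projection) auto
  then have "continuous_map (subtopology (powertop_real UNIV) (standard_simplex 1)) (top_of_set {0..1}) (\<lambda>z. z 1)"
    by (auto simp: continuous_map_in_subtopology standard_simplex_def)
  from continuous_map_compose[OF this p]
  have "singular_simplex 1 S ?f"
    by (auto simp: singular_simplex_def o_def intro: continuous_map_eq)
  moreover have "chain_boundary 1 (frag_of ?f) = frag_of (singular_face 1 0 ?f) - frag_of (singular_face 1 1 ?f)"
    by (simp add: chain_boundary_of)
  moreover have "singular_face 1 0 ?f = singular_face 1 1 ?f"
  proof
    fix z :: "nat \<Rightarrow> real"
    show "singular_face 1 0 ?f z = singular_face 1 1 ?f z"
    proof (cases "z \<in> standard_simplex 0")
      case True
      then have z0: "z 0 = 1" by (simp add: standard_simplex_def)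
      have "singular_face 1 k ?f z = p (simplical_face k z 1)" if "k \<le> 1" for k
        using simplical_face_in_standard_simplex[of 1 k z] that True by (simp add: singular_face_def)
      from this[of 0] this[of 1] show ?thesis using assms(2) z0 by (simp add: simplical_face_def)
    qed (simp add: singular_face_def)
  qed
  ultimately show ?thesis
    by (simp only: singular_cycle loop_simplex_def singular_chain_of diff_self simp_thms)
qed

lemma homology_class_loop_simplex:
  "homology_class x \<gamma> = homologous_rel_set 1 (surface x) {} (loop_simplex (\<lambda>t. Some (\<gamma> t)))"
  by (simp add: homology_class_def loop_simplex_def)

text \<open>Homology is taken on the compact surface, so a bounding chain may cross ramification
  points and the pole of \<open>u du / v\<close> at infinity; the cocycle is defined there
  too.\<close>

lemma elliptic_integral_homologous:
  assumes "x \<noteq> 0" "x \<noteq> 1" "curve_loop x \<gamma>" "curve_loop x \<gamma>'" "homology_class x \<gamma> = homology_class x \<gamma>'"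
  shows "curve_integral \<gamma> (elliptic_form l m) = curve_integral \<gamma>' (elliptic_form l m)"
proof -
  obtain \<delta> where \<delta>: "local_primitives x (elliptic_form l m) \<delta>"
    using elliptic_form_cocycle[OF assms(1,2)] by blast
  have "curve_integral \<gamma> (elliptic_form l m) = chain_sum \<delta> (loop_simplex (\<lambda>t. Some (\<gamma> t)))"
    if "curve_loop x \<gamma>" for \<gamma>
    using integral_unique[OF curve_integral_eq_path_sum[OF \<delta> that]]
    by (simp add: curve_integral_def chain_sum_loop_simplex)
  moreover have "homologous_rel 1 (surface x) {} (loop_simplex (\<lambda>t. Some (\<gamma> t))) (loop_simplex (\<lambda>t. Some (\<gamma>' t)))"
    using assms(5) unfolding homology_class_loop_simplex homologous_rel_set_eq .
  ultimately show ?thesis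
    using chain_sum_homologous[OF local_primitives_cocycle[OF \<delta>]] assms(3,4) by metis
qed

lemma elliptic_form_integrable:
  assumes "x \<noteq> 0" "x \<noteq> 1" "curve_loop x \<gamma>"
  shows "(\<lambda>\<tau>. elliptic_form l m (\<gamma> \<tau>) * vector_derivative (fst \<circ> \<gamma>) (at \<tau> within {0..1})) integrable_on {0..1}"
  using elliptic_form_cocycle[OF assms(1,2), of l m] curve_integral_eq_path_sum[OF _ assms(3)]
  by (metis has_integral_integrable)

text \<open>The loop \<open>p\<close> is any continuous loop on the compact surface. This freedom is
  used when paths are compared, where no smoothness is available.\<close>

lemma all_periods_zero:
  assumes "canonical_basis x a b" and \<delta>: "local_primitives x h \<delta>"
    and "curve_integral a h = 0" "curve_integral b h = 0"
    and p: "continuous_map (top_of_set {0..1}) (surface x) p" "p 0 = p 1"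
  shows "path_sum \<delta> p = 0"
proof -
  have ab: "curve_loop x a" "curve_loop x b" using assms(1) by (auto simp: canonical_basis_def)
  have z: "chain_sum \<delta> (loop_simplex (\<lambda>t. Some (\<gamma> t))) = 0" if "curve_loop x \<gamma>" "curve_integral \<gamma> h = 0" for \<gamma>
    using integral_unique[OF curve_integral_eq_path_sum[OF \<delta> that(1)]] that(2)
    by (simp add: curve_integral_def chain_sum_loop_simplex)
  have cyc: "singular_relcycle 1 (surface x) {} (loop_simplex (\<lambda>t. Some (\<gamma> t)))" if "curve_loop x \<gamma>" for \<gamma>
    using loop_simplex_cycle[OF curve_loop_continuous_map[OF that]] curve_loopD(2)[OF that] by simp
  have "chain_sum \<delta> (loop_simplex p) = 0"
    by (rule chain_sum_zero_generators[OF local_primitives_cocycle[OF \<delta>] cyc[OF ab(1)] cyc[OF ab(2)] _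
          z[OF ab(1) assms(3)] z[OF ab(2) assms(4)] loop_simplex_cycle[OF p]])
      (use assms(1) in \<open>simp add: canonical_basis_def Let_def homology_class_loop_simplex\<close>)
  then show ?thesis by (simp add: chain_sum_loop_simplex)
qed

section \<open>Growth estimates and removable singularities\<close>

lemma primitive_at_chart:
  assumes "primitive_at x h f P" and P: "P \<in> unramified x"
    and p: "(p has_field_derivative p') (at c)" "p c = fst P" and q: "isCont q c" "q c = snd P"
    and ev: "\<forall>\<^sub>F t in nhds c. (p t, q t) \<in> affine_curve x"
  shows "((\<lambda>t. f (p t, q t)) has_field_derivative h P * p') (at c)"
proof -
  have "\<forall>\<^sub>F t in nhds c. q t = branch x P (p t)"
    by (rule branch_unique[OF P _ _ ev])
      (use DERIV_isCont[OF p(1)] q p(2) in \<open>auto simp: isCont_def tendsto_nhds_iff\<close>)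
  then have "\<forall>\<^sub>F t in nhds c. f (p t, branch x P (p t)) = f (p t, q t)"
    by eventually_elim simp
  moreover have "((\<lambda>t. f (p t, branch x P (p t))) has_field_derivative h P * p') (at c)"
    using assms(1) by (intro DERIV_chain2[OF _ p(1)]) (simp add: primitive_at_def p(2))
  ultimately show ?thesis
    using DERIV_cong_ev[OF refl _ refl, of "\<lambda>t. f (p t, branch x P (p t))" "\<lambda>t. f (p t, q t)"] by blast
qed

text \<open>On the radial segment from \<open>\<zeta>\<close> out to the circle of radius
  \<open>\<sigma>\<close> the norm never drops below \<open>norm \<zeta>\<close>, so the mean value
  inequality uses the derivative bound at the inner end. No power of \<open>\<zeta>\<close> is
  gained, but a later division by \<open>v\<close> absorbs the loss.\<close>

lemma punctured_disc_growth:
  fixes K :: "complex \<Rightarrow> complex"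
  assumes D: "\<And>\<zeta>. \<zeta> \<in> ball 0 \<rho> - {0} \<Longrightarrow> (K has_field_derivative K' \<zeta>) (at \<zeta>)"
    and C: "\<And>\<zeta>. \<zeta> \<in> ball 0 \<rho> - {0} \<Longrightarrow> norm (K' \<zeta>) \<le> C / norm \<zeta> ^ k"
    and \<sigma>: "0 < \<sigma>" "\<sigma> < \<rho>"
  obtains B where "\<And>\<zeta>. \<zeta> \<in> ball 0 \<sigma> - {0} \<Longrightarrow> norm (K \<zeta>) \<le> B + \<sigma> * C / norm \<zeta> ^ k"
proof -
  have "continuous_on (sphere 0 \<sigma>) K"
  proof (intro continuous_at_imp_continuous_on ballI)
    fix z :: complex assume "z \<in> sphere 0 \<sigma>"
    then have "z \<in> ball 0 \<rho> - {0}" using \<sigma> by auto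
    then show "isCont K z" using D DERIV_isCont by blast
  qed
  then have "compact (K ` sphere 0 \<sigma>)" by (intro compact_continuous_image) auto
  then obtain B where B: "\<And>z. z \<in> sphere 0 \<sigma> \<Longrightarrow> norm (K z) \<le> B"
    by (metis bounded_iff compact_imp_bounded imageI)
  have C0: "C \<ge> 0"
  proof -
    have "(of_real \<sigma> :: complex) \<in> ball 0 \<rho> - {0}" using \<sigma> by auto
    from C[OF this] have "norm (K' (of_real \<sigma>)) \<le> C / \<sigma> ^ k" using \<sigma> by simp
    then have "0 \<le> C / \<sigma> ^ k" using norm_ge_zero[of "K' (of_real \<sigma>)"] by linarith
    then have "0 \<le> C / \<sigma> ^ k * \<sigma> ^ k" using \<sigma> by (intro mult_nonneg_nonneg) auto
    then show ?thesis using \<sigma> by simp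
  qed
  show ?thesis
  proof (rule that[of B])
    fix \<zeta> :: complex assume \<zeta>: "\<zeta> \<in> ball 0 \<sigma> - {0}"
    define w where "w = of_real (\<sigma> / norm \<zeta>) * \<zeta>"
    have nw: "norm w = \<sigma>" using \<zeta> \<sigma> by (simp add: w_def norm_mult norm_divide)
    have seg: "norm \<zeta> \<le> norm z \<and> norm z \<le> \<sigma>" if z: "z \<in> closed_segment \<zeta> w" for z
    proof -
      obtain t where t: "0 \<le> t" "t \<le> 1" "z = (1 - t) *\<^sub>R \<zeta> + t *\<^sub>R w" using z by (auto simp: in_segment)
      have "z = of_real (1 - t + t * (\<sigma> / norm \<zeta>)) * \<zeta>"
        by (simp add: t w_def scaleR_conv_of_real algebra_simps)
      then have "norm z = \<bar>1 - t + t * (\<sigma> / norm \<zeta>)\<bar> * norm \<zeta>" by (simp only: norm_mult norm_of_real)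
      also have "\<dots> = (1 - t) * norm \<zeta> + t * \<sigma>"
      proof -
        have "0 \<le> 1 - t + t * (\<sigma> / norm \<zeta>)" using t \<sigma> by simp
        then show ?thesis using \<zeta> by (simp add: field_simps)
      qed
      finally have nz: "norm z = (1 - t) * norm \<zeta> + t * \<sigma>" .
      have "norm \<zeta> \<le> \<sigma>" using \<zeta> by simp
      then have "t * norm \<zeta> \<le> t * \<sigma>" "(1 - t) * norm \<zeta> \<le> (1 - t) * \<sigma>"
        using t by (simp_all add: mult_left_mono)
      then show ?thesis using nz by (simp add: algebra_simps)
    qed
    have "norm (K \<zeta> - K w) \<le> C / norm \<zeta> ^ k * norm (\<zeta> - w)"
    proof (rule field_differentiable_bound[OF convex_closed_segment[of \<zeta> w], of K K'])
      fix z assume z: "z \<in> closed_segment \<zeta> w"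
      then have z': "z \<in> ball 0 \<rho> - {0}" using seg[OF z] \<zeta> \<sigma> by auto
      show "(K has_field_derivative K' z) (at z within closed_segment \<zeta> w)"
        using D[OF z'] has_field_derivative_at_within by blast
      have "C / norm z ^ k \<le> C / norm \<zeta> ^ k"
        using seg[OF z] \<zeta> z' C0 by (intro divide_left_mono power_mono mult_pos_pos zero_less_power) auto
      then show "norm (K' z) \<le> C / norm \<zeta> ^ k" using C[OF z'] by linarith
    qed auto
    moreover have "norm (\<zeta> - w) \<le> \<sigma>"
    proof -
      have "\<zeta> - w = of_real (1 - \<sigma> / norm \<zeta>) * \<zeta>" by (simp add: w_def algebra_simps)
      then have "norm (\<zeta> - w) = \<bar>1 - \<sigma> / norm \<zeta>\<bar> * norm \<zeta>" by (simp only: norm_mult norm_of_real)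
      also have "\<dots> = \<sigma> - norm \<zeta>" using \<zeta> by (auto simp: abs_if field_simps)
      finally show ?thesis by simp
    qed
    then have "C / norm \<zeta> ^ k * norm (\<zeta> - w) \<le> C / norm \<zeta> ^ k * \<sigma>"
      using C0 by (intro mult_left_mono) auto
    ultimately have "norm (K \<zeta> - K w) \<le> C / norm \<zeta> ^ k * \<sigma>" by linarith
    moreover have "norm (K w) \<le> B" using B nw by simp
    moreover have "norm (K \<zeta>) \<le> norm (K w) + norm (K \<zeta> - K w)"
      using norm_triangle_ineq[of "K w" "K \<zeta> - K w"] by simp
    ultimately show "norm (K \<zeta>) \<le> B + \<sigma> * C / norm \<zeta> ^ k" by (simp add: mult.commute)
  qed
qed

text \<open>The limit condition at \<open>e\<close> is Riemann's criterion; the points are filled in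
  one at a time, and filling one changes neither the limits at the others nor the behaviour at
  infinity.\<close>

lemma Liouville_removable:
  assumes "finite F" "f holomorphic_on - F" "\<And>e. e \<in> F \<Longrightarrow> ((\<lambda>z. (z - e) * f z) \<longlongrightarrow> 0) (at e)"
    "(f \<longlongrightarrow> l) at_infinity" "z \<notin> F"
  shows "f z = l"
  using assms
proof (induction F arbitrary: f rule: finite_induct)
  case empty
  then show ?case using Liouville_weak[of f l z] by simp
next
  case (insert e F)
  have eq: "- F - {e} = - insert e F" by auto
  have "open (- F)" using insert.hyps(1) by (simp add: finite_imp_closed open_Compl)
  then have "e \<in> interior (- F)" using insert.hyps(2) by (simp add: interior_open)
  then obtain g where g: "g holomorphic_on - F" "\<And>z. z \<in> - F - {e} \<Longrightarrow> g z = f z"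
    using holomorphic_on_extend_lim[of f "- F" e] insert.prems(1) insert.prems(2)[of e] unfolding eq by auto
  have ev: "\<forall>\<^sub>F z in at c. g z = f z" for c
  proof -
    have "finite (insert e F - {c})" using insert.hyps(1) by simp
    then have "open (- (insert e F - {c}))" by (intro open_Compl finite_imp_closed)
    moreover have "c \<in> - (insert e F - {c})" by simp
    ultimately
    show ?thesis unfolding eventually_at_topological using g(2) by (intro exI[of _ "- (insert e F - {c})"]) auto
  qed
  have "bounded (insert e F)" using insert.hyps(1) by (simp add: finite_imp_bounded)
  then obtain b where b: "\<And>z. z \<in> insert e F \<Longrightarrow> norm z \<le> b" unfolding bounded_iff by blast
  have "g z = l"
  proof (rule insert.IH[OF g(1)])
    show "((\<lambda>z. (z - c) * g z) \<longlongrightarrow> 0) (at c)" if "c \<in> F" for c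
    proof -
      have "((\<lambda>z. (z - c) * f z) \<longlongrightarrow> 0) (at c)" using insert.prems(2)[of c] that by simp
      moreover have "\<forall>\<^sub>F z in at c. (z - c) * f z = (z - c) * g z" using ev[of c] by eventually_elim simp
      ultimately show ?thesis by (rule Lim_transform_eventually)
    qed
    have "\<forall>\<^sub>F z in at_infinity. f z = g z"
      unfolding eventually_at_infinity
    proof (intro exI allI impI)
      fix z :: complex assume "b + 1 \<le> norm z"
      then have "z \<notin> insert e F" using b[of z] by linarith
      then show "f z = g z" using g(2)[of z] by simp
    qed
    then show "(g \<longlongrightarrow> l) at_infinity" using insert.prems(3) by (rule Lim_transform_eventually[rotated])
    show "z \<notin> F" using insert.prems(4) by simp
  qed
  then show ?case using g(2)[of z] insert.prems(4) by simp
qed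

text \<open>\<open>csqrt\<close> jumps between the two roots across its cut, but an even function of
  \<open>v\<close> does not notice; near \<open>fst P\<close> the root may be replaced by the
  analytic branch.\<close>

lemma even_function_descends:
  assumes even: "\<And>u v. (u, v) \<in> unramified x \<Longrightarrow> k (u, - v) = k (u, v)"
    and P: "P \<in> unramified x" and D: "(\<lambda>z. k (z, branch x P z)) field_differentiable at (fst P)"
  shows "(\<lambda>z. k (z, csqrt (cubic x z))) field_differentiable at (fst P)"
proof -
  obtain r where r: "r > 0" "branch x P holomorphic_on ball (fst P) r"
    "\<And>z. z \<in> ball (fst P) r \<Longrightarrow> branch x P z \<noteq> 0 \<and> (z, branch x P z) \<in> unramified x"
    using branch_holomorphic[OF P] by blast
  have "k (z, branch x P z) = k (z, csqrt (cubic x z))" if "z \<in> ball (fst P) r" for z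
  proof -
    have "(csqrt (cubic x z))\<^sup>2 = (branch x P z)\<^sup>2" by (simp add: branch_square[OF P])
    then consider "csqrt (cubic x z) = branch x P z" | "csqrt (cubic x z) = - branch x P z"
      using power2_eq_iff[THEN iffD1] by blast
    then show ?thesis using even r(3)[OF that] by cases auto
  qed
  then have "\<forall>\<^sub>F z in nhds (fst P). k (z, branch x P z) = k (z, csqrt (cubic x z))"
    using r(1) by (auto simp: eventually_nhds intro!: exI[of _ "ball (fst P) r"])
  then have iff: "((\<lambda>z. k (z, branch x P z)) has_field_derivative d) (at (fst P)) \<longleftrightarrow>
      ((\<lambda>z. k (z, csqrt (cubic x z))) has_field_derivative d) (at (fst P))" for d
    by (intro DERIV_cong_ev refl)
  show ?thesis using D unfolding field_differentiable_def iff .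
qed

lemma csqrt_cubic_unramified: "cubic x u \<noteq> 0 \<Longrightarrow> (u, csqrt (cubic x u)) \<in> unramified x"
  by (simp add: mem_unramified)

text \<open>Only the norm matters, and its square no longer contains the discontinuous root.\<close>

lemma norm_over_csqrt_tendsto_0:
  assumes "((\<lambda>u. (f u)\<^sup>2 / g u) \<longlongrightarrow> 0) F"
  shows "((\<lambda>u. f u / csqrt (g u)) \<longlongrightarrow> 0) F"
proof -
  have "((\<lambda>u. sqrt (norm ((f u)\<^sup>2 / g u))) \<longlongrightarrow> sqrt (norm (0::complex))) F"
    by (intro tendsto_intros assms)
  moreover have "sqrt (norm ((f u)\<^sup>2 / g u)) = norm (f u / csqrt (g u))" for u
  proof -
    have "(f u)\<^sup>2 / g u = (f u / csqrt (g u))\<^sup>2" by (simp add: power_divide)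
    then show ?thesis by (simp only: norm_power real_sqrt_abs abs_norm_cancel)
  qed
  ultimately show ?thesis by (simp add: tendsto_norm_zero_iff)
qed

lemma over_csqrt_cubic_branch_point:
  assumes "x \<noteq> 0" "x \<noteq> 1" "cubic x e = 0"
  shows "((\<lambda>u. (u - e) / csqrt (cubic x u)) \<longlongrightarrow> 0) (at e)"
proof (rule norm_over_csqrt_tendsto_0)
  obtain p q where pq: "p \<noteq> 0" "q \<noteq> 0" "\<And>w. cubic x (e + w) = w * ((w + p) * (w + q))"
    using factor_cubic[OF assms] by blast
  have "((\<lambda>u. (u - e) / ((u - e + p) * (u - e + q))) \<longlongrightarrow> (e - e) / ((e - e + p) * (e - e + q))) (at e)"
    by (intro tendsto_intros) (use pq in auto)
  then have *: "((\<lambda>u. (u - e) / ((u - e + p) * (u - e + q))) \<longlongrightarrow> 0) (at e)" by simp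
  have "\<forall>\<^sub>F u in at e. (u - e) / ((u - e + p) * (u - e + q)) = (u - e)\<^sup>2 / cubic x u"
    unfolding eventually_at_filter
  proof (intro always_eventually allI impI)
    fix u assume "u \<noteq> e"
    then show "(u - e) / ((u - e + p) * (u - e + q)) = (u - e)\<^sup>2 / cubic x u"
      using pq(3)[of "u - e"] by (simp add: power2_eq_square)
  qed
  then show "((\<lambda>u. (u - e)\<^sup>2 / cubic x u) \<longlongrightarrow> 0) (at e)"
    using * by (rule Lim_transform_eventually[rotated])
qed

lemma over_csqrt_cubic_infinity:
  "((\<lambda>u. u / csqrt (cubic x u)) \<longlongrightarrow> 0) at_infinity" "((\<lambda>u. 1 / csqrt (cubic x u)) \<longlongrightarrow> 0) at_infinity"
proof -
  have *: "((\<lambda>z. f (inverse z)) \<longlongrightarrow> 0) at_infinity" if "isCont f 0" "f 0 = 0" for f :: "complex \<Rightarrow> complex"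
    using isCont_tendsto_compose[OF that(1) tendsto_inverse_0] that(2) by simp
  have nz: "\<forall>\<^sub>F u in at_infinity. u \<noteq> (0::complex)" by (rule eventually_not_equal_at_infinity)
  show "((\<lambda>u. u / csqrt (cubic x u)) \<longlongrightarrow> 0) at_infinity"
  proof (rule norm_over_csqrt_tendsto_0)
    have "((\<lambda>u. (\<lambda>w. w / ((1 - w) * (1 - x * w))) (inverse u)) \<longlongrightarrow> 0) at_infinity"
      by (rule *) (auto intro!: continuous_intros)
    moreover have "\<forall>\<^sub>F u in at_infinity. (\<lambda>w. w / ((1 - w) * (1 - x * w))) (inverse u) = u\<^sup>2 / cubic x u"
      using nz by eventually_elim (simp add: cubic_def divide_simps power2_eq_square)
    ultimately show "((\<lambda>u. u\<^sup>2 / cubic x u) \<longlongrightarrow> 0) at_infinity" by (rule Lim_transform_eventually)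
  qed
  show "((\<lambda>u. 1 / csqrt (cubic x u)) \<longlongrightarrow> 0) at_infinity"
  proof (rule norm_over_csqrt_tendsto_0)
    have "((\<lambda>u. (\<lambda>w. w ^ 3 / ((1 - w) * (1 - x * w))) (inverse u)) \<longlongrightarrow> 0) at_infinity"
      by (rule *) (auto intro!: continuous_intros)
    moreover have "\<forall>\<^sub>F u in at_infinity. (\<lambda>w. w ^ 3 / ((1 - w) * (1 - x * w))) (inverse u) = 1\<^sup>2 / cubic x u"
      using nz by eventually_elim (simp add: cubic_def divide_simps power3_eq_cube)
    ultimately show "((\<lambda>u. 1\<^sup>2 / cubic x u) \<longlongrightarrow> 0) at_infinity" by (rule Lim_transform_eventually)
  qed
qed

text \<open>Paths avoiding the three roots lift to the curve, which reaches one of the two points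
  over a fixed \<open>u\<close>. A half turn of the local parameter at the branch point 0 sends
  \<open>\<zeta>\<close> to \<open>- \<zeta>\<close> and joins these two points.\<close>

lemma path_connected_unramified:
  assumes "x \<noteq> 0" "x \<noteq> 1"
  shows "path_connected (unramified x)"
proof -
  obtain r s where rs: "r > 0" "s holomorphic_on ball 0 r"
    "\<And>w. w \<in> ball 0 r \<Longrightarrow> s w \<noteq> 0 \<and> cubic x (0 + w) = w * (s w)\<^sup>2"
    using branch_point_chart[OF assms, of 0] by (auto simp: cubic_def)
  define \<rho> where "\<rho> = sqrt (r / 2)"
  have \<rho>: "\<rho> > 0" "\<rho>\<^sup>2 < r" using rs(1) by (auto simp: \<rho>_def)
  define \<zeta> where "\<zeta> t = of_real \<rho> * exp (\<i> * of_real (pi * t))" for t :: real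
  have n\<zeta>: "norm (\<zeta> t) = \<rho>" for t using \<rho> by (simp add: \<zeta>_def norm_mult)
  have \<zeta>2: "(\<zeta> t)\<^sup>2 \<in> ball 0 r" for t using \<rho> by (simp add: norm_power n\<zeta>)
  have \<zeta>0: "\<zeta> t \<noteq> 0" for t using n\<zeta>[of t] \<rho> by auto
  define \<phi> where "\<phi> t = ((\<zeta> t)\<^sup>2, \<zeta> t * s ((\<zeta> t)\<^sup>2))" for t
  have \<phi>_unr: "\<phi> t \<in> unramified x" for t
    using rs(3)[OF \<zeta>2[of t]] \<zeta>0[of t] by (simp add: \<phi>_def mem_unramified power_mult_distrib)
  have "continuous_on {0..1} \<zeta>" unfolding \<zeta>_def by (intro continuous_intros)
  then have "continuous_on {0..1} \<phi>"
    unfolding \<phi>_def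
    by (intro continuous_intros continuous_on_compose2[OF holomorphic_on_imp_continuous_on[OF rs(2)]])
      (use \<zeta>2 in auto)
  then have p\<phi>: "path_component (unramified x) (\<phi> 0) (\<phi> 1)"
    unfolding path_component_def using \<phi>_unr
    by (intro exI[of _ \<phi>]) (auto simp: path_def path_image_def pathstart_def pathfinish_def)
  have \<phi>1: "\<phi> 1 = (fst (\<phi> 0), - snd (\<phi> 0))" by (simp add: \<phi>_def \<zeta>_def)
  have conn: "path_connected (- {u. cubic x u = 0})"
    by (rule path_connected_complement_countable) (auto simp: cubic_eq_0_iff Collect_disj_eq)
  have to: "path_component (unramified x) P (\<phi> 0)" if P: "P \<in> unramified x" for P
  proof -
    have "fst P \<in> - {u. cubic x u = 0}" "fst (\<phi> 0) \<in> - {u. cubic x u = 0}"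
      using P \<phi>_unr[of 0] by (cases P; cases "\<phi> 0"; auto simp: mem_unramified)+
    with conn obtain c where c: "path c" "path_image c \<subseteq> - {u. cubic x u = 0}" "c 0 = fst P" "c 1 = fst (\<phi> 0)"
      unfolding path_connected_def pathstart_def pathfinish_def by blast
    have "continuous_on {0..1} c" using c by (simp add: path_def)
    then have "continuous_on {0..1} (\<lambda>t. cubic x (c t))" by (intro continuous_intros)
    moreover have cnz: "cubic x (c t) \<noteq> 0" if "t \<in> {0..1}" for t using c(2) that unfolding path_image_def by blast
    ultimately obtain w where w: "continuous_on {0..1} w" "\<And>t. t \<in> {0..1} \<Longrightarrow> cubic x (c t) = (w t)\<^sup>2"
      using continuous_sqrt_on_contractible[of "{0..1}" "\<lambda>t. cubic x (c t)"] by (auto simp: convex_imp_contractible)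
    have "(w 0)\<^sup>2 = (snd P)\<^sup>2" using w(2)[of 0] P c(3) by (cases P) (auto simp: mem_unramified)
    \<comment> \<open>The continuous square root along \<open>c\<close> is determined only up to
      sign; \<open>\<epsilon>\<close> makes the lift start at \<open>P\<close>.\<close>
    then obtain \<epsilon> where \<epsilon>: "\<epsilon>\<^sup>2 = 1" "\<epsilon> * w 0 = snd P"
      by (metis mult_1 mult_minus1 power2_eq_iff power2_minus power_one)
    define \<gamma> where "\<gamma> t = (c t, \<epsilon> * w t)" for t
    have unr: "\<gamma> t \<in> unramified x" if "t \<in> {0..1}" for t
      using w(2)[OF that] \<epsilon>(1) cnz[OF that] by (auto simp: \<gamma>_def mem_unramified power_mult_distrib)
    have "continuous_on {0..1} \<gamma>" unfolding \<gamma>_def by (intro continuous_intros w \<open>continuous_on {0..1} c\<close>)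
    then have "path_component (unramified x) (\<gamma> 0) (\<gamma> 1)"
      unfolding path_component_def using unr
      by (intro exI[of _ \<gamma>]) (auto simp: path_def path_image_def pathstart_def pathfinish_def)
    moreover have "\<gamma> 0 = P" using \<epsilon> c by (simp add: \<gamma>_def)
    moreover have "\<gamma> 1 = \<phi> 0 \<or> \<gamma> 1 = \<phi> 1"
    proof -
      have "fst (\<gamma> 1) = fst (\<phi> 0)" by (simp add: \<gamma>_def c)
      moreover have "(snd (\<gamma> 1))\<^sup>2 = (snd (\<phi> 0))\<^sup>2"
        using unr[of 1] \<phi>_unr[of 0] calculation by (cases "\<gamma> 1"; cases "\<phi> 0") (auto simp: mem_unramified)
      ultimately show ?thesis unfolding \<phi>1 by (auto simp: power2_eq_iff prod_eq_iff)
    qed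
    ultimately show ?thesis using p\<phi> path_component_sym path_component_trans by metis
  qed
  show ?thesis
    unfolding path_connected_component using to path_component_sym path_component_trans by metis
qed

text \<open>Since \<open>t\<close> is even, \<open>\<zeta> \<mapsto> - \<zeta>\<close> is the
  exchange of sheets; this is what later identifies an arbitrary \<open>local_param\<close> with
  this one up to sign.\<close>

lemma branch_point_param:
  assumes "x \<noteq> 0" "x \<noteq> 1" "cubic x e = 0"
  obtains r t where "r > 0" "t holomorphic_on ball 0 r" "\<And>\<zeta>. \<zeta> \<in> ball 0 r \<Longrightarrow> t \<zeta> \<noteq> 0"
    "\<And>\<zeta>. \<zeta> \<in> ball 0 r - {0} \<Longrightarrow> (e + \<zeta>\<^sup>2, \<zeta> * t \<zeta>) \<in> unramified x"
    "\<And>u v. (u, v) \<in> affine_curve x \<Longrightarrow> norm (u - e) < r\<^sup>2 \<Longrightarrow> \<exists>\<zeta>\<in>ball 0 r. u = e + \<zeta>\<^sup>2 \<and> v = \<zeta> * t \<zeta>"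
    "\<And>\<zeta>. t (- \<zeta>) = t \<zeta>"
proof -
  obtain r s where rs: "r > 0" "s holomorphic_on ball 0 r"
    "\<And>w. w \<in> ball 0 r \<Longrightarrow> s w \<noteq> 0 \<and> cubic x (e + w) = w * (s w)\<^sup>2"
    using branch_point_chart[OF assms] by blast
  have r2: "(sqrt r)\<^sup>2 = r" using rs(1) by simp
  have sq: "\<zeta>\<^sup>2 \<in> ball 0 r" if "\<zeta> \<in> ball 0 (sqrt r)" for \<zeta> :: complex
  proof -
    have "norm \<zeta> ^ 2 < (sqrt r) ^ 2" using that by (intro power_strict_mono) auto
    then show ?thesis using r2 by (simp add: norm_power)
  qed
  show ?thesis
  proof (rule that[of "sqrt r" "\<lambda>\<zeta>. s (\<zeta>\<^sup>2)"])
    show "(\<lambda>\<zeta>. s (\<zeta>\<^sup>2)) holomorphic_on ball 0 (sqrt r)"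
      using sq by (intro holomorphic_on_compose_gen[OF _ rs(2), unfolded o_def] holomorphic_intros) auto
    show "(e + \<zeta>\<^sup>2, \<zeta> * s (\<zeta>\<^sup>2)) \<in> unramified x" if "\<zeta> \<in> ball 0 (sqrt r) - {0}" for \<zeta>
      using rs(3)[OF sq, of \<zeta>] that by (simp add: mem_unramified power_mult_distrib)
    fix u v assume uv: "(u, v) \<in> affine_curve x" "norm (u - e) < (sqrt r)\<^sup>2"
    then have w: "u - e \<in> ball 0 r" by (simp add: r2)
    define \<zeta> where "\<zeta> = v / s (u - e)"
    have \<zeta>2: "\<zeta>\<^sup>2 = u - e"
      using uv(1) rs(3)[OF w] by (simp add: \<zeta>_def power_divide mem_affine_curve)
    have "norm \<zeta> ^ 2 < r" using \<zeta>2 w by (simp flip: norm_power)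
    then have "\<zeta> \<in> ball 0 (sqrt r)" using real_less_rsqrt by simp
    moreover have "u = e + \<zeta>\<^sup>2 \<and> v = \<zeta> * s (\<zeta>\<^sup>2)" unfolding \<zeta>2 using rs(3)[OF w] by (simp add: \<zeta>_def)
    ultimately show "\<exists>\<zeta>\<in>ball 0 (sqrt r). u = e + \<zeta>\<^sup>2 \<and> v = \<zeta> * s (\<zeta>\<^sup>2)" by blast
  qed (use rs sq in auto)
qed

lemma infinity_param:
  obtains r t where "r > 0" "t holomorphic_on ball 0 r" "\<And>\<zeta>. \<zeta> \<in> ball 0 r \<Longrightarrow> t \<zeta> \<noteq> 0"
    "\<And>\<zeta>. \<zeta> \<in> ball 0 r - {0} \<Longrightarrow> (1 / \<zeta>\<^sup>2, t \<zeta> / \<zeta> ^ 3) \<in> unramified x"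
    "\<And>u v. (u, v) \<in> affine_curve x \<Longrightarrow> norm u > 1 / r\<^sup>2 \<Longrightarrow> \<exists>\<zeta>\<in>ball 0 r - {0}. u = 1 / \<zeta>\<^sup>2 \<and> v = t \<zeta> / \<zeta> ^ 3"
    "\<And>\<zeta>. t (- \<zeta>) = t \<zeta>"
proof -
  obtain r s where rs: "r > 0" "s holomorphic_on ball 0 r"
    "\<And>w. w \<in> ball 0 r \<Longrightarrow> s w \<noteq> 0 \<and> (s w)\<^sup>2 = (1 - w) * (1 - x * w)"
    by (rule infinity_chart[of x]) blast
  have r2: "(sqrt r)\<^sup>2 = r" using rs(1) by simp
  have sq: "\<zeta>\<^sup>2 \<in> ball 0 r" if "\<zeta> \<in> ball 0 (sqrt r)" for \<zeta> :: complex
  proof -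
    have "norm \<zeta> ^ 2 < (sqrt r) ^ 2" using that by (intro power_strict_mono) auto
    then show ?thesis using r2 by (simp add: norm_power)
  qed
  show ?thesis
  proof (rule that[of "sqrt r" "\<lambda>\<zeta>. s (\<zeta>\<^sup>2)"])
    show "(\<lambda>\<zeta>. s (\<zeta>\<^sup>2)) holomorphic_on ball 0 (sqrt r)"
      using sq by (intro holomorphic_on_compose_gen[OF _ rs(2), unfolded o_def] holomorphic_intros) auto
    show "(1 / \<zeta>\<^sup>2, s (\<zeta>\<^sup>2) / \<zeta> ^ 3) \<in> unramified x" if "\<zeta> \<in> ball 0 (sqrt r) - {0}" for \<zeta>
    proof -
      have "\<zeta> \<noteq> 0" using that by simp
      moreover have "(s (\<zeta>\<^sup>2))\<^sup>2 = (1 - \<zeta>\<^sup>2) * (1 - x * \<zeta>\<^sup>2)" "s (\<zeta>\<^sup>2) \<noteq> 0" using rs(3)[OF sq, of \<zeta>] that by auto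
      moreover have "cubic x (1 / w) = (1 - w) * (1 - x * w) / w ^ 3" if "w \<noteq> 0" for w
        using that by (simp add: cubic_def divide_simps power3_eq_cube)
      moreover have "(\<zeta> ^ 3)\<^sup>2 = (\<zeta>\<^sup>2) ^ 3" by (simp flip: power_mult)
      ultimately show ?thesis by (simp add: mem_unramified power_divide)
    qed
    fix u v assume uv: "(u, v) \<in> affine_curve x" "norm u > 1 / (sqrt r)\<^sup>2"
    then have u: "norm u > 1 / r" by (simp add: r2)
    have "norm u > 0" using u rs(1) by (meson less_trans zero_less_divide_1_iff)
    then have u0: "u \<noteq> 0" and w: "1 / u \<in> ball 0 r" using u rs(1) by (auto simp: norm_divide field_simps)
    define \<zeta> where "\<zeta> = u * s (1 / u) / v"
    have s1: "s (1 / u) \<noteq> 0" "(s (1 / u))\<^sup>2 = (1 - 1 / u) * (1 - x * (1 / u))" using rs(3)[OF w] by auto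
    have cub: "v\<^sup>2 = u ^ 3 * (s (1 / u))\<^sup>2"
      unfolding s1(2) using uv(1) u0 by (simp add: mem_affine_curve cubic_def divide_simps power3_eq_cube)
    have v0: "v \<noteq> 0" using cub u0 s1 by auto
    have \<zeta>2: "\<zeta>\<^sup>2 = 1 / u"
      using u0 s1(1) by (simp add: \<zeta>_def power_divide power_mult_distrib cub) (simp add: power2_eq_square power3_eq_cube)
    have "norm \<zeta> ^ 2 < r" using \<zeta>2 w by (simp flip: norm_power)
    then have "\<zeta> \<in> ball 0 (sqrt r) - {0}" using real_less_rsqrt u0 s1 v0 by (simp add: \<zeta>_def)
    moreover have "u = 1 / \<zeta>\<^sup>2" using u0 by (simp add: \<zeta>2)
    moreover have "v = s (\<zeta>\<^sup>2) / \<zeta> ^ 3"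
    proof -
      have "\<zeta> ^ 3 = \<zeta> * \<zeta>\<^sup>2" by (simp add: power3_eq_cube power2_eq_square)
      also have "\<dots> = s (1 / u) / v" unfolding \<zeta>2 using u0 by (simp add: \<zeta>_def)
      finally show ?thesis unfolding \<zeta>2 using s1 v0 by simp
    qed
    ultimately show "\<exists>\<zeta>\<in>ball 0 (sqrt r) - {0}. u = 1 / \<zeta>\<^sup>2 \<and> v = s (\<zeta>\<^sup>2) / \<zeta> ^ 3" by blast
  qed (use rs sq in auto)
qed

section \<open>Exactness and nondegeneracy of the periods\<close>

lemma path_sum_primitive:
  assumes "\<And>t. t \<in> {0..1} \<Longrightarrow> p t \<in> N" "\<And>P Q. P \<in> N \<Longrightarrow> Q \<in> N \<Longrightarrow> \<delta> P Q = g Q - g P"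
  shows "path_sum \<delta> p = g (p 1) - g (p 0)"
proof -
  have "dyadic_sum N (\<lambda>s t. \<delta> (p s) (p t)) 0 1 = dyadic_sum N (\<lambda>s t. g (p t) - g (p s)) 0 1" for N
  proof (rule dyadic_sum_cong[of "{0..1}"])
    fix a b :: real assume "a \<in> {0..1}" "b \<in> {0..1}"
    then show "\<delta> (p a) (p b) = g (p b) - g (p a)" by (intro assms(2) assms(1))
  qed auto
  then show ?thesis unfolding path_sum_def dyadic_sum_telescope by simp
qed

text \<open>The primitive is the path sum from a base point along a chosen path. Zero loop sums make
  it independent of the path, and near \<open>P\<close> a choice through \<open>P\<close> followed
  by a lifted segment compares it with the local primitive.\<close>

lemma exact_if_periods_zero:
  assumes "x \<noteq> 0" "x \<noteq> 1" and \<delta>: "local_primitives x h \<delta>"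
    and loops: "\<And>p. continuous_map (top_of_set {0..1}) (surface x) p \<Longrightarrow> p 0 = p 1 \<Longrightarrow> path_sum \<delta> p = 0"
  obtains G where "\<And>P. P \<in> unramified x \<Longrightarrow> primitive_at x h G P"
proof (cases "unramified x = {}")
  case True
  then show ?thesis using that by blast
next
  case False
  then obtain P0 where P0: "P0 \<in> unramified x" by blast
  define inU where "inU p \<longleftrightarrow> continuous_on {0..1::real} p \<and> (\<forall>t\<in>{0..1}. p t \<in> unramified x)" for p
  note coc = local_primitives_cocycle[OF \<delta>]
  have cm: "continuous_map (top_of_set {0..1}) (surface x) (\<lambda>t. Some (p t))" if "inU p" for p
    by (rule continuous_map_curve_surface) (use that subsetD[OF unramified_sub_affine] in \<open>auto simp: inU_def\<close>)
  have "\<exists>p. inU p \<and> p 0 = P0 \<and> p 1 = P" if "P \<in> unramified x" for P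
  proof -
    from path_connected_unramified[OF assms(1,2), unfolded path_connected_def, rule_format, OF P0 that]
    obtain g where "path g \<and> path_image g \<subseteq> unramified x \<and> pathstart g = P0 \<and> pathfinish g = P"
      by (elim exE) (rule that)
    then have "inU g" "g 0 = P0" "g 1 = P"
      by (auto simp: inU_def path_def path_image_def pathstart_def pathfinish_def)
    then show ?thesis by blast
  qed
  then obtain p where p: "\<And>P. P \<in> unramified x \<Longrightarrow> inU (p P) \<and> p P 0 = P0 \<and> p P 1 = P" by metis
  define G where "G P = path_sum \<delta> (\<lambda>t. Some (p P t))" for P
  have join: "path_sum \<delta> (concat_path (\<lambda>t. Some (p t)) (\<lambda>t. Some (q t))) = path_sum \<delta> (\<lambda>t. Some (p t)) + path_sum \<delta> (\<lambda>t. Some (q t))"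
    "continuous_map (top_of_set {0..1}) (surface x) (concat_path (\<lambda>t. Some (p t)) (\<lambda>t. Some (q t)))"
    if "inU p" "inU q" "p 1 = q 0" for p q
    using path_sum_concat_path[OF cm[OF that(1)] cm[OF that(2)] _ coc] that(3) by simp_all
  have indep: "path_sum \<delta> (\<lambda>t. Some (q t)) = path_sum \<delta> (\<lambda>t. Some (q' t))"
    if q: "inU q" "inU q'" "q 0 = q' 0" "q 1 = q' 1" for q q'
  proof -
    \<comment> \<open>The same return path closes both \<open>q\<close> and \<open>q'\<close>, and
      its contribution cancels. Thus no rule for the sum along a reversed path is required.\<close>
    let ?r = "\<lambda>t. q (1 - t)"
    have "continuous_on {0..1} ?r"
      by (rule continuous_on_compose2[of "{0..1}" q]) (use q in \<open>auto simp: inU_def intro!: continuous_intros\<close>)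
    then have r: "inU ?r" using q by (auto simp: inU_def)
    have "path_sum \<delta> (concat_path (\<lambda>t. Some (q t)) (\<lambda>t. Some (?r t))) = 0"
      by (rule loops[OF join(2)[OF q(1) r]]) (simp_all add: concat_path_def)
    moreover have "path_sum \<delta> (concat_path (\<lambda>t. Some (q' t)) (\<lambda>t. Some (?r t))) = 0"
      by (rule loops[OF join(2)[OF q(2) r]]) (simp_all add: concat_path_def q)
    ultimately have "path_sum \<delta> (\<lambda>t. Some (q t)) + path_sum \<delta> (\<lambda>t. Some (?r t))
        = path_sum \<delta> (\<lambda>t. Some (q' t)) + path_sum \<delta> (\<lambda>t. Some (?r t))"
      using join(1)[OF q(1) r] join(1)[OF q(2) r] q(4) by simp
    then show ?thesis by (rule add_right_imp_eq)
  qed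
  show ?thesis
  proof (rule that[of G])
    fix P assume P: "P \<in> unramified x"
    have "Some P \<in> topspace (surface x)" using P unramified_sub_affine by (auto simp: topspace_surface)
    then obtain N g where N: "openin (surface x) N" "Some P \<in> N" and g: "\<And>P Q. P \<in> N \<Longrightarrow> Q \<in> N \<Longrightarrow> \<delta> P Q = g Q - g P"
     "\<And>P. P \<in> unramified x \<Longrightarrow> Some P \<in> N \<Longrightarrow> primitive_at x h (\<lambda>P. g (Some P)) P"
      by (rule local_primitivesD[OF \<delta>]) (rule that)
    have "P \<in> {Q \<in> affine_curve x. Some Q \<in> N}" using P N unramified_sub_affine by blast
    then obtain r where r: "r > 0" "branch x P holomorphic_on ball (fst P) r" "sheet x P r \<subseteq> {Q \<in> affine_curve x. Some Q \<in> N}"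
      "\<And>z. z \<in> ball (fst P) r \<Longrightarrow> branch x P z \<noteq> 0 \<and> (z, branch x P z) \<in> unramified x"
      using unramified_open[OF P openin_surface_vimage[OF N(1)]] by blast
    have loc: "G (z, branch x P z) = g (Some (z, branch x P z)) + (G P - g (Some P))" if z: "z \<in> ball (fst P) r" for z
    proof -
      let ?c = "\<lambda>t::real. fst P + of_real t * (z - fst P)"
      let ?l = "\<lambda>t. (?c t, branch x P (?c t))"
      have c: "?c t \<in> ball (fst P) r" if "t \<in> {0..1}" for t
      proof -
        have "norm (?c t - fst P) = t * norm (z - fst P)" using that by (simp add: norm_mult)
        also have "\<dots> \<le> 1 * norm (z - fst P)" using that by (intro mult_right_mono) auto
        also have "\<dots> < r" using z by (simp add: dist_norm norm_minus_commute)
        finally show ?thesis by (simp add: dist_norm norm_minus_commute)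
      qed
      have "continuous_on {0..1} ?l"
        by (intro continuous_intros continuous_on_compose2[OF holomorphic_on_imp_continuous_on[OF r(2)]]) (use c in auto)
      then have l: "inU ?l" using r(4) c by (simp add: inU_def)
      have inN: "Some (?l t) \<in> N" if "t \<in> {0..1}" for t
      proof -
        have "?l t \<in> sheet x P r" unfolding sheet_def using c[OF that] by (rule imageI)
        then show ?thesis using r(3) by blast
      qed
      have "path_sum \<delta> (\<lambda>t. Some (?l t)) = g (Some (?l 1)) - g (Some (?l 0))"
        by (rule path_sum_primitive[OF inN g(1)])
      moreover have "?l 0 = P" using branch_base[OF P] by simp
      moreover have "?l 1 = (z, branch x P z)" by simp
      ultimately have 1: "path_sum \<delta> (\<lambda>t. Some (?l t)) = g (Some (z, branch x P z)) - g (Some P)" by simp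
      have zU: "(z, branch x P z) \<in> unramified x" using r(4)[OF z] by blast
      have "continuous_on {0..1} (p P +++ ?l)"
        using p[OF P] l \<open>?l 0 = P\<close> continuous_on_joinpaths[of "p P" ?l]
        by (simp add: inU_def pathstart_def pathfinish_def)
      moreover have "(p P +++ ?l) t \<in> unramified x" if "t \<in> {0..1}" for t
      proof (cases "t \<le> 1 / 2")
        case True
        then have "(p P +++ ?l) t = p P (2 * t)" by (simp add: joinpaths_def)
        then show ?thesis using p[OF P] True that by (simp add: inU_def)
      next
        case False
        then have "(p P +++ ?l) t = ?l (2 * t - 1)" by (simp only: joinpaths_def if_False)
        moreover have "2 * t - 1 \<in> {0..1}" using False that by auto
        ultimately show ?thesis using l unfolding inU_def by metis
      qed
      ultimately have j: "inU (p P +++ ?l)" by (simp add: inU_def)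
      have "G (z, branch x P z) = path_sum \<delta> (\<lambda>t. Some ((p P +++ ?l) t))"
        unfolding G_def by (rule indep) (use p[OF zU] p[OF P] j in \<open>auto simp: joinpaths_def\<close>)
      also have "(\<lambda>t. Some ((p P +++ ?l) t)) = concat_path (\<lambda>t. Some (p P t)) (\<lambda>t. Some (?l t))"
        by (auto simp: joinpaths_def concat_path_def)
      also have "path_sum \<delta> \<dots> = path_sum \<delta> (\<lambda>t. Some (p P t)) + path_sum \<delta> (\<lambda>t. Some (?l t))"
        by (rule join) (use p[OF P] l \<open>?l 0 = P\<close> in auto)
      finally show ?thesis using 1 by (simp add: G_def)
    qed
    have "((\<lambda>z. g (Some (z, branch x P z)) + (G P - g (Some P))) has_field_derivative h P) (at (fst P))"
      using g(2)[OF P N(2)] by (auto simp: primitive_at_def intro!: derivative_eq_intros)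
    moreover have "\<forall>\<^sub>F z in nhds (fst P). g (Some (z, branch x P z)) + (G P - g (Some P)) = G (z, branch x P z)"
      unfolding eventually_nhds by (rule exI[of _ "ball (fst P) r"]) (use r(1) in \<open>simp add: loc\<close>)
    ultimately show "primitive_at x h G P"
      unfolding primitive_at_def by (simp only: DERIV_cong_ev[OF refl _ refl])
  qed
qed

lemma unramified_infinite_base: "infinite (- {u. cubic x u = 0})"
proof -
  have "{u. cubic x u = 0} = {0, 1, x}" by (auto simp: cubic_eq_0_iff)
  then have "finite {u. cubic x u = 0}" by simp
  then show ?thesis by (simp add: Compl_eq_Diff_UNIV infinite_UNIV_char_0)
qed

text \<open>With zero periods the form has a primitive, whose odd part \<open>H\<close> is again a
  primitive because the form is odd in \<open>v\<close>. Then \<open>H / v\<close> is a function of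
  \<open>u\<close> alone, with removable singularities and limit 0 at infinity; so it vanishes, and
  with it the form.\<close>

lemma elliptic_periods_nondegenerate:
  assumes x: "x \<noteq> 0" "x \<noteq> 1" and basis: "canonical_basis x a b"
    and per: "curve_integral a (elliptic_form l m) = 0" "curve_integral b (elliptic_form l m) = 0"
  shows "l = 0 \<and> m = 0"
proof -
  let ?\<theta> = "elliptic_form l m"
  obtain \<delta> where \<delta>: "local_primitives x ?\<theta> \<delta>" using elliptic_form_cocycle[OF x] by blast
  obtain G where G: "\<And>P. P \<in> unramified x \<Longrightarrow> primitive_at x ?\<theta> G P"
    using exact_if_periods_zero[OF x \<delta> all_periods_zero[OF basis \<delta> per]] by blast
  define H where "H = (\<lambda>(u, v). (G (u, v) - G (u, - v)) / 2)"
  have H: "primitive_at x ?\<theta> H P" if P: "P \<in> unramified x" for P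
  proof -
    let ?Q = "(fst P, - snd P)"
    have Q: "?Q \<in> unramified x" using P by (cases P) (simp add: mem_unramified)
    have "branch x ?Q z = - branch x P z" for z by (simp add: branch_def)
    then have "((\<lambda>z. G (z, - branch x P z)) has_field_derivative - ?\<theta> P) (at (fst P))"
      using G[OF Q] by (simp add: primitive_at_def elliptic_form_def)
    then show ?thesis using G[OF P] unfolding primitive_at_def H_def
      by (auto intro!: derivative_eq_intros)
  qed
  define f where "f u = H (u, csqrt (cubic x u)) / csqrt (cubic x u)" for u
  have Hf: "H (u, v) / v = f u" if "(u, v) \<in> unramified x" for u v
  proof -
    have "v\<^sup>2 = (csqrt (cubic x u))\<^sup>2" using that by (simp add: mem_unramified)
    then consider "v = csqrt (cubic x u)" | "v = - csqrt (cubic x u)" using power2_eq_iff[THEN iffD1] by blast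
    then show ?thesis by cases (simp_all add: f_def H_def minus_divide_left)
  qed
  have fin: "finite {u. cubic x u = 0}"
  proof -
    have "{u. cubic x u = 0} = {0, 1, x}" by (auto simp: cubic_eq_0_iff)
    then show ?thesis by simp
  qed
  have f0: "f z = 0" if z: "cubic x z \<noteq> 0" for z
  proof (rule Liouville_removable[where f = f and l = 0 and z = z, OF fin])
    show "f holomorphic_on - {u. cubic x u = 0}"
    proof -
      have "f field_differentiable at u" if "cubic x u \<noteq> 0" for u
      proof -
        define P where "P = (u, csqrt (cubic x u))"
        have P: "P \<in> unramified x" using csqrt_cubic_unramified[OF that] by (simp add: P_def)
        have "((\<lambda>z. H (z, branch x P z) / branch x P z)) field_differentiable at (fst P)"
          using H[OF P] has_field_derivative_branch[OF P] P branch_base[OF P]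
          by (intro field_differentiable_divide)
            (auto simp: field_differentiable_def primitive_at_def P_def mem_unramified)
        then have D: "(\<lambda>z. (\<lambda>(u, v). H (u, v) / v) (z, branch x P z)) field_differentiable (at (fst P))"
          by simp
        have even: "(\<lambda>(u, v). H (u, v) / v) (u, - v) = (\<lambda>(u, v). H (u, v) / v) (u, v)" for u v
        proof -
          have "H (u, - v) = - H (u, v)" by (simp add: H_def minus_divide_left)
          then show ?thesis by simp
        qed
        from even_function_descends[OF even P D]
        have "(\<lambda>z. H (z, csqrt (cubic x z)) / csqrt (cubic x z)) field_differentiable at (fst P)" by simp
        then show ?thesis by (simp add: P_def f_def [abs_def])
      qed
      then show ?thesis
        by (simp add: holomorphic_on_def field_differentiable_at_within)
    qed
  next
    fix e assume "e \<in> {u. cubic x u = 0}"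
    then have e: "cubic x e = 0" by simp
    obtain r t where r: "r > 0" and t: "t holomorphic_on ball 0 r" "\<And>\<zeta>. \<zeta> \<in> ball 0 r \<Longrightarrow> t \<zeta> \<noteq> 0"
      and unr: "\<And>\<zeta>. \<zeta> \<in> ball 0 r - {0} \<Longrightarrow> (e + \<zeta>\<^sup>2, \<zeta> * t \<zeta>) \<in> unramified x"
      and ex: "\<And>u v. (u, v) \<in> affine_curve x \<Longrightarrow> norm (u - e) < r\<^sup>2 \<Longrightarrow> \<exists>\<zeta>\<in>ball 0 r. u = e + \<zeta>\<^sup>2 \<and> v = \<zeta> * t \<zeta>"
      by (rule branch_point_param[OF x e]) blast
    let ?K = "\<lambda>\<zeta>. H (e + \<zeta>\<^sup>2, \<zeta> * t \<zeta>)" and ?K' = "\<lambda>\<zeta>. 2 * (l + m * (e + \<zeta>\<^sup>2)) / t \<zeta>"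
    have K: "(?K has_field_derivative ?K' \<zeta>) (at \<zeta>)" if "\<zeta> \<in> ball 0 r - {0}" for \<zeta>
    proof -
      let ?P = "(e + \<zeta>\<^sup>2, \<zeta> * t \<zeta>)"
      have "((\<lambda>\<zeta>. H (e + \<zeta>\<^sup>2, \<zeta> * t \<zeta>)) has_field_derivative ?\<theta> ?P * (2 * \<zeta>)) (at \<zeta>)"
      proof (rule primitive_at_chart[OF H unr])
        show "((\<lambda>\<zeta>. e + \<zeta>\<^sup>2) has_field_derivative 2 * \<zeta>) (at \<zeta>)" by (auto intro!: derivative_eq_intros)
        show "isCont (\<lambda>\<zeta>. \<zeta> * t \<zeta>) \<zeta>"
          using that t(1) by (intro continuous_intros)
            (auto simp: continuous_on_eq_continuous_at dest!: holomorphic_on_imp_continuous_on)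
        show "\<forall>\<^sub>F \<zeta> in nhds \<zeta>. (e + \<zeta>\<^sup>2, \<zeta> * t \<zeta>) \<in> affine_curve x"
          unfolding eventually_nhds using that unr subsetD[OF unramified_sub_affine]
          by (intro exI[of _ "ball 0 r - {0}"]) auto
      qed (use that unr in auto)
      then show ?thesis using that t(2)[of \<zeta>] by (simp add: elliptic_form_def mult.commute)
    qed
    have "continuous_on (cball 0 (r / 2)) ?K'"
      using r t by (intro continuous_intros continuous_on_subset[OF holomorphic_on_imp_continuous_on[OF t(1)]]) auto
    then have "compact (?K' ` cball 0 (r / 2))" by (intro compact_continuous_image) auto
    then obtain C where C: "\<And>\<zeta>. \<zeta> \<in> cball 0 (r / 2) \<Longrightarrow> norm (?K' \<zeta>) \<le> C"
      by (metis (no_types, lifting) bounded_iff compact_imp_bounded imageI)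
    obtain B where B: "\<And>\<zeta>. \<zeta> \<in> ball 0 (r / 3) - {0} \<Longrightarrow> norm (?K \<zeta>) \<le> B + (r / 3) * C / norm \<zeta> ^ 0"
    proof (rule punctured_disc_growth[of "r / 2" ?K ?K' C 0 "r / 3"])
      show "(?K has_field_derivative ?K' \<zeta>) (at \<zeta>)" if "\<zeta> \<in> ball 0 (r / 2) - {0}" for \<zeta>
        by (rule K) (use that r in auto)
      show "norm (?K' \<zeta>) \<le> C / norm \<zeta> ^ 0" if "\<zeta> \<in> ball 0 (r / 2) - {0}" for \<zeta>
        using C[of \<zeta>] that by simp
    qed (use r in auto)
    \<comment> \<open>The derivative of \<open>H\<close> in \<open>\<zeta>\<close> is bounded, hence
      so is \<open>H\<close> near the ramification point. Division by \<open>v\<close> is then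
      harmless, as \<open>(u - e) / v\<close> tends to 0.\<close>
    have bd: "norm ((u - e) * f u) \<le> (B + r / 3 * C) * norm ((u - e) / csqrt (cubic x u))"
      if u: "u \<in> ball e ((r / 3)\<^sup>2)" "u \<noteq> e" for u
    proof -
      define v where "v = csqrt (cubic x u)"
      have uv: "(u, v) \<in> affine_curve x" by (simp add: mem_affine_curve v_def)
      have lt: "norm (u - e) < (r / 3)\<^sup>2" using u by (simp add: dist_norm norm_minus_commute)
      also have "\<dots> \<le> r\<^sup>2" using r by (intro power_mono) auto
      finally obtain \<zeta> where \<zeta>: "\<zeta> \<in> ball 0 r" "u = e + \<zeta>\<^sup>2" "v = \<zeta> * t \<zeta>" using ex[OF uv] by blast
      have "norm \<zeta> ^ 2 < (r / 3)\<^sup>2" using lt \<zeta>(2) by (simp add: norm_power)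
      then have "norm \<zeta> < r / 3" using r by (intro power_less_imp_less_base[of "norm \<zeta>" 2 "r / 3"]) auto
      then have "norm (H (u, v)) \<le> B + r / 3 * C" using B[of \<zeta>] u(2) \<zeta> by auto
      then have "norm ((u - e) / v) * norm (H (u, v)) \<le> norm ((u - e) / v) * (B + r / 3 * C)"
        by (rule mult_left_mono) simp
      then show ?thesis by (simp add: f_def v_def norm_mult norm_divide mult_ac)
    qed
    show "((\<lambda>z. (z - e) * f z) \<longlongrightarrow> 0) (at e)"
    proof (rule Lim_null_comparison)
      show "\<forall>\<^sub>F u in at e. norm ((u - e) * f u) \<le> (B + r / 3 * C) * norm ((u - e) / csqrt (cubic x u))"
        unfolding eventually_at_topological
        by (rule exI[of _ "ball e ((r / 3)\<^sup>2)"]) (use bd r in auto)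
      have "((\<lambda>u. (B + r / 3 * C) * norm ((u - e) / csqrt (cubic x u))) \<longlongrightarrow> (B + r / 3 * C) * norm (0::complex)) (at e)"
        by (intro tendsto_intros over_csqrt_cubic_branch_point x e)
      then show "((\<lambda>u. (B + r / 3 * C) * norm ((u - e) / csqrt (cubic x u))) \<longlongrightarrow> 0) (at e)" by simp
    qed
  next
    obtain r t where r: "r > 0" and t: "t holomorphic_on ball 0 r" "\<And>\<zeta>. \<zeta> \<in> ball 0 r \<Longrightarrow> t \<zeta> \<noteq> 0"
      and unr: "\<And>\<zeta>. \<zeta> \<in> ball 0 r - {0} \<Longrightarrow> (1 / \<zeta>\<^sup>2, t \<zeta> / \<zeta> ^ 3) \<in> unramified x"
      and ex: "\<And>u v. (u, v) \<in> affine_curve x \<Longrightarrow> norm u > 1 / r\<^sup>2 \<Longrightarrow> \<exists>\<zeta>\<in>ball 0 r - {0}. u = 1 / \<zeta>\<^sup>2 \<and> v = t \<zeta> / \<zeta> ^ 3"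
      by (rule infinity_param[of x]) blast
    let ?K = "\<lambda>\<zeta>. H (1 / \<zeta>\<^sup>2, t \<zeta> / \<zeta> ^ 3)" and ?q = "\<lambda>\<zeta>. - 2 * (l * \<zeta>\<^sup>2 + m) / t \<zeta>"
    have K: "(?K has_field_derivative ?q \<zeta> / \<zeta>\<^sup>2) (at \<zeta>)" if "\<zeta> \<in> ball 0 r - {0}" for \<zeta>
    proof -
      let ?P = "(1 / \<zeta>\<^sup>2, t \<zeta> / \<zeta> ^ 3)"
      have "((\<lambda>\<zeta>. H (1 / \<zeta>\<^sup>2, t \<zeta> / \<zeta> ^ 3)) has_field_derivative ?\<theta> ?P * (- 2 / \<zeta> ^ 3)) (at \<zeta>)"
      proof (rule primitive_at_chart[OF H unr])
        show "((\<lambda>\<zeta>. 1 / \<zeta>\<^sup>2) has_field_derivative - 2 / \<zeta> ^ 3) (at \<zeta>)"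
          using that by (auto intro!: derivative_eq_intros simp: divide_simps power2_eq_square power3_eq_cube)
        show "isCont (\<lambda>\<zeta>. t \<zeta> / \<zeta> ^ 3) \<zeta>"
          using that t(1) by (intro continuous_intros)
            (auto simp: continuous_on_eq_continuous_at dest!: holomorphic_on_imp_continuous_on)
        show "\<forall>\<^sub>F \<zeta> in nhds \<zeta>. (1 / \<zeta>\<^sup>2, t \<zeta> / \<zeta> ^ 3) \<in> affine_curve x"
          unfolding eventually_nhds using that unr subsetD[OF unramified_sub_affine]
          by (intro exI[of _ "ball 0 r - {0}"]) auto
      qed (use that unr in auto)
      moreover have "?\<theta> ?P * (- 2 / \<zeta> ^ 3) = ?q \<zeta> / \<zeta>\<^sup>2"
        using that t(2)[of \<zeta>] by (simp add: elliptic_form_def divide_simps)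
      ultimately show ?thesis by simp
    qed
    have "continuous_on (cball 0 (r / 2)) ?q"
      using r t by (intro continuous_intros continuous_on_subset[OF holomorphic_on_imp_continuous_on[OF t(1)]]) auto
    then have "compact (?q ` cball 0 (r / 2))" by (intro compact_continuous_image) auto
    then obtain C where C: "\<And>\<zeta>. \<zeta> \<in> cball 0 (r / 2) \<Longrightarrow> norm (?q \<zeta>) \<le> C"
      by (metis (no_types, lifting) bounded_iff compact_imp_bounded imageI)
    obtain B where B: "\<And>\<zeta>. \<zeta> \<in> ball 0 (r / 3) - {0} \<Longrightarrow> norm (?K \<zeta>) \<le> B + (r / 3) * C / norm \<zeta> ^ 2"
    proof (rule punctured_disc_growth[of "r / 2" ?K "\<lambda>\<zeta>. ?q \<zeta> / \<zeta>\<^sup>2" C 2 "r / 3"])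
      show "(?K has_field_derivative ?q \<zeta> / \<zeta>\<^sup>2) (at \<zeta>)" if "\<zeta> \<in> ball 0 (r / 2) - {0}" for \<zeta>
        by (rule K) (use that r in auto)
      show "norm (?q \<zeta> / \<zeta>\<^sup>2) \<le> C / norm \<zeta> ^ 2" if "\<zeta> \<in> ball 0 (r / 2) - {0}" for \<zeta>
        unfolding norm_divide[of "?q \<zeta>"] norm_power by (rule divide_right_mono[OF C]) (use that in auto)
    qed (use r in auto)
    \<comment> \<open>Here \<open>H\<close> may grow like \<open>1 / norm \<zeta> ^ 2\<close>, that
      is like \<open>norm u\<close>, whereas \<open>v\<close> has order \<open>norm u\<close> to the
      power 3/2; so \<open>H / v\<close> still tends to 0.\<close>
    have bd: "norm (f u) \<le> B * norm (1 / csqrt (cubic x u)) + r / 3 * C * norm (u / csqrt (cubic x u))"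
      if u: "norm u > 1 / (r / 3)\<^sup>2" for u
    proof -
      define v where "v = csqrt (cubic x u)"
      have uv: "(u, v) \<in> affine_curve x" by (simp add: mem_affine_curve v_def)
      have "1 / r\<^sup>2 \<le> 1 / (r / 3)\<^sup>2" using r by (intro divide_left_mono power_mono mult_pos_pos zero_less_power) auto
      then have "norm u > 1 / r\<^sup>2" using u by simp
      then obtain \<zeta> where \<zeta>: "\<zeta> \<in> ball 0 r - {0}" "u = 1 / \<zeta>\<^sup>2" "v = t \<zeta> / \<zeta> ^ 3" using ex[OF uv] by blast
      have "1 / norm \<zeta> ^ 2 > 1 / (r / 3)\<^sup>2" using u \<zeta>(2) by (simp add: norm_divide norm_power)
      then have "norm \<zeta> ^ 2 < (r / 3)\<^sup>2" using r \<zeta>(1) by (simp add: divide_less_cancel field_simps)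
      then have "norm \<zeta> < r / 3" using r by (intro power_less_imp_less_base[of "norm \<zeta>" 2 "r / 3"]) auto
      then have "norm (H (u, v)) \<le> B + r / 3 * C / norm \<zeta> ^ 2" using B[of \<zeta>] \<zeta> by auto
      also have "r / 3 * C / norm \<zeta> ^ 2 = r / 3 * C * norm u" by (simp add: \<zeta>(2) norm_divide norm_power)
      finally have "norm (1 / v) * norm (H (u, v)) \<le> norm (1 / v) * (B + r / 3 * C * norm u)"
        by (rule mult_left_mono) simp
      then show ?thesis by (simp add: f_def v_def norm_mult norm_divide algebra_simps add_divide_distrib)
    qed
    show "(f \<longlongrightarrow> 0) at_infinity"
    proof (rule Lim_null_comparison)
      show "\<forall>\<^sub>F u in at_infinity. norm (f u) \<le> B * norm (1 / csqrt (cubic x u)) + r / 3 * C * norm (u / csqrt (cubic x u))"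
        unfolding eventually_at_infinity
        by (rule exI[of _ "1 / (r / 3)\<^sup>2 + 1"]) (use bd in force)
      have "((\<lambda>u. B * norm (1 / csqrt (cubic x u)) + r / 3 * C * norm (u / csqrt (cubic x u)))
          \<longlongrightarrow> B * norm (0::complex) + r / 3 * C * norm (0::complex)) at_infinity"
        by (intro tendsto_intros over_csqrt_cubic_infinity)
      then show "((\<lambda>u. B * norm (1 / csqrt (cubic x u)) + r / 3 * C * norm (u / csqrt (cubic x u))) \<longlongrightarrow> 0) at_infinity"
        by simp
    qed
  qed (use z in simp)
  have lin: "l + m * u = 0" if u: "cubic x u \<noteq> 0" for u
  proof -
    define P where "P = (u, csqrt (cubic x u))"
    have P: "P \<in> unramified x" using csqrt_cubic_unramified[OF u] by (simp add: P_def)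
    obtain r where r: "r > 0" "branch x P holomorphic_on ball (fst P) r"
      "\<And>z. z \<in> ball (fst P) r \<Longrightarrow> branch x P z \<noteq> 0 \<and> (z, branch x P z) \<in> unramified x"
      using branch_holomorphic[OF P] by blast
    have "H (z, branch x P z) = 0" if z: "z \<in> ball (fst P) r" for z
    proof -
      have *: "(z, branch x P z) \<in> unramified x" "branch x P z \<noteq> 0" using r(3)[OF z] by auto
      then have "cubic x z \<noteq> 0" by (auto simp: mem_unramified)
      then show ?thesis using f0[of z] Hf[OF *(1)] *(2) by simp
    qed
    then have "\<forall>\<^sub>F z in nhds (fst P). H (z, branch x P z) = 0"
      unfolding eventually_nhds using r(1) by (intro exI[of _ "ball (fst P) r"]) auto
    then have "((\<lambda>z. H (z, branch x P z)) has_field_derivative ?\<theta> P) (at (fst P)) \<longleftrightarrow>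
        ((\<lambda>z. 0) has_field_derivative ?\<theta> P) (at (fst P))"
      by (intro DERIV_cong_ev refl)
    then have "((\<lambda>z. 0) has_field_derivative ?\<theta> P) (at (fst P))"
      using H[OF P] by (simp only: primitive_at_def)
    then have "?\<theta> P = 0" by (rule DERIV_unique) (rule DERIV_const)
    then show ?thesis using u by (simp add: elliptic_form_def P_def)
  qed
  let ?S = "- {u. cubic x u = 0}"
  obtain u1 where u1: "u1 \<in> ?S" using infinite_imp_nonempty[OF unramified_infinite_base[of x]] by blast
  have "infinite (?S - {u1})" using unramified_infinite_base[of x] by simp
  from infinite_imp_nonempty[OF this] obtain u2 where u2: "u2 \<in> ?S - {u1}" by blast
  have lin12: "l + m * u1 = 0" "l + m * u2 = 0" "u2 \<noteq> u1" using lin[of u1] lin[of u2] u1 u2 by auto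
  have "m * (u1 - u2) = (l + m * u1) - (l + m * u2)" by (simp add: algebra_simps)
  then have "m = 0" using lin12 by simp
  with lin12(1) show ?thesis by simp
qed

section \<open>Even and odd parts of a differential\<close>

text \<open>The limit condition puts \<open>\<phi>\<close> eventually on the open sheet through
  \<open>P\<close>, where the prescribed \<open>u\<close>-coordinate determines the point.\<close>

lemma local_param_unramified:
  assumes "local_param x (Some P) \<phi>" "P \<in> unramified x"
  shows "fst (\<phi> \<zeta>) = fst P + \<zeta>"
    and "\<forall>\<^sub>F \<zeta> in at 0. \<phi> \<zeta> = (fst P + \<zeta>, branch x P (fst P + \<zeta>))"
proof -
  obtain y w where P: "P = (y, w)" "w \<noteq> 0" using assms(2) by (cases P) (auto simp: mem_unramified)
  show fst: "fst (\<phi> \<zeta>) = fst P + \<zeta>" for \<zeta>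
    using assms(1) P by (simp add: local_param_def)
  obtain r where r: "r > 0" "branch x P holomorphic_on ball (fst P) r"
    "\<And>z. z \<in> ball (fst P) r \<Longrightarrow> branch x P z \<noteq> 0 \<and> (z, branch x P z) \<in> unramified x"
    using branch_holomorphic[OF assms(2)] by blast
  have "openin (surface x) (Some ` sheet x P r)"
    unfolding openin_surface_Some using openin_sheet[OF assms(2) r(2)] r(3) by blast
  moreover have "Some P \<in> Some ` sheet x P r"
    using r(1) branch_base[OF assms(2)] by (auto simp: sheet_def image_iff intro!: bexI[of _ "fst P"])
  moreover have "limitin (surface x) (\<lambda>\<zeta>. Some (\<phi> \<zeta>)) (Some P) (at 0)"
    using assms(1) by (simp add: local_param_def)
  ultimately have "\<forall>\<^sub>F \<zeta> in at 0. Some (\<phi> \<zeta>) \<in> Some ` sheet x P r"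
    unfolding limitin_def by blast
  then show "\<forall>\<^sub>F \<zeta> in at 0. \<phi> \<zeta> = (fst P + \<zeta>, branch x P (fst P + \<zeta>))"
  proof eventually_elim
    case (elim \<zeta>)
    then obtain z where "\<phi> \<zeta> = (z, branch x P z)" by (auto simp: sheet_def)
    then show ?case using fst[of \<zeta>] by simp
  qed
qed

lemma eventually_nhds_shift:
  fixes a :: complex
  assumes "\<forall>\<^sub>F \<zeta> in at 0. Q (a + \<zeta>)"
  shows "\<forall>\<^sub>F z in at a. Q z"
proof -
  obtain d where d: "d > 0" "\<And>\<zeta>. \<zeta> \<noteq> 0 \<Longrightarrow> norm \<zeta> < d \<Longrightarrow> Q (a + \<zeta>)"
    using assms by (auto simp: eventually_at)
  then show ?thesis
    unfolding eventually_at using d(2)[of "z - a" for z] by (intro exI[of _ d]) (auto simp: dist_norm)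
qed

text \<open>Here \<open>du = d\<zeta>\<close>. The analytic \<open>g\<close> controls
  \<open>h\<close> only on a punctured neighbourhood; the value condition in
  \<open>holomorphic_at\<close> supplies the centre.\<close>

lemma holomorphic_at_unramified:
  assumes "holomorphic_at x h (Some P)" and P: "P \<in> unramified x"
  shows "(\<lambda>z. h (z, branch x P z)) field_differentiable at (fst P)"
proof -
  obtain \<phi> g where \<phi>: "local_param x (Some P) \<phi>" and g: "g analytic_on {0}"
    and ev: "\<forall>\<^sub>F \<zeta> in at 0. h (\<phi> \<zeta>) * deriv (fst \<circ> \<phi>) \<zeta> = g \<zeta>"
    and val: "\<forall>y w. Some P = Some (y, w) \<and> w \<noteq> 0 \<longrightarrow> h (y, w) = g 0"
    using assms(1) unfolding holomorphic_at_def by blast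
  note lp = local_param_unramified[OF \<phi> P]
  have "fst \<circ> \<phi> = (\<lambda>\<zeta>. fst P + \<zeta>)" using lp(1) by (simp add: fun_eq_iff)
  then have d: "deriv (fst \<circ> \<phi>) \<zeta> = 1" for \<zeta> by (auto intro!: DERIV_imp_deriv derivative_eq_intros)
  have "\<forall>\<^sub>F \<zeta> in at 0. h (fst P + \<zeta>, branch x P (fst P + \<zeta>)) = g (fst P + \<zeta> - fst P)"
    using ev lp(2) by eventually_elim (simp add: d)
  then have "\<forall>\<^sub>F z in at (fst P). h (z, branch x P z) = g (z - fst P)"
    by (rule eventually_nhds_shift)
  moreover have "h (fst P, branch x P (fst P)) = g (fst P - fst P)"
    using val P branch_base[OF P] by (cases P) (simp add: mem_unramified)
  ultimately have ev': "\<forall>\<^sub>F z in nhds (fst P). g (z - fst P) = h (z, branch x P z)"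
    by (auto simp: eventually_nhds_conv_at elim: eventually_mono)
  obtain D where "(g has_field_derivative D) (at (fst P - fst P))"
    using g analytic_on_imp_differentiable_at[of g "{0}" 0] by (auto simp: field_differentiable_def)
  then have "((\<lambda>z. g (z - fst P)) has_field_derivative D * 1) (at (fst P))"
    by (rule DERIV_chain2[where f = g and g = "\<lambda>z. z - fst P"]) (auto intro!: derivative_eq_intros)
  then have "((\<lambda>z. g (z - fst P)) has_field_derivative D) (at (fst P))" by simp
  moreover have "((\<lambda>z. g (z - fst P)) has_field_derivative D) (at (fst P)) \<longleftrightarrow>
      ((\<lambda>z. h (z, branch x P z)) has_field_derivative D) (at (fst P))"
    using ev' by (intro DERIV_cong_ev refl)
  ultimately show ?thesis unfolding field_differentiable_def by blast
qed

text \<open>The quotient \<open>q / p\<close> is continuous with values 1 and -1 on a punctured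
  disc, which is connected.\<close>

lemma square_eq_punctured_ball:
  fixes p q :: "complex \<Rightarrow> complex"
  assumes "continuous_on (ball 0 r - {0}) p" "continuous_on (ball 0 r - {0}) q"
    "\<And>\<zeta>. \<zeta> \<in> ball 0 r - {0} \<Longrightarrow> p \<zeta> \<noteq> 0 \<and> (q \<zeta>)\<^sup>2 = (p \<zeta>)\<^sup>2"
  obtains \<sigma> where "\<sigma> = 1 \<or> \<sigma> = -1" "\<And>\<zeta>. \<zeta> \<in> ball 0 r - {0} \<Longrightarrow> q \<zeta> = \<sigma> * p \<zeta>"
proof -
  let ?B = "ball (0::complex) r - {0}" and ?f = "\<lambda>\<zeta>. q \<zeta> / p \<zeta>"
  have val: "?f \<zeta> = 1 \<or> ?f \<zeta> = -1" if "\<zeta> \<in> ?B" for \<zeta>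
  proof -
    have "(?f \<zeta>)\<^sup>2 = 1\<^sup>2" using assms(3)[OF that] by (simp add: power_divide)
    then show ?thesis by (simp only: power2_eq_iff)
  qed
  have "connected ?B"
    by (intro path_connected_imp_connected path_connected_punctured_ball) simp
  moreover have "continuous_on ?B ?f" using assms by (intro continuous_intros) auto
  moreover have "finite (?f ` ?B)"
  proof (rule finite_subset)
    show "?f ` ?B \<subseteq> {1, -1}" using val by blast
  qed simp
  ultimately have "?f constant_on ?B" by (rule continuous_finite_range_constant)
  then obtain c where c: "\<And>\<zeta>. \<zeta> \<in> ?B \<Longrightarrow> ?f \<zeta> = c" unfolding constant_on_def by blast
  show ?thesis
  proof (cases "?B = {}")
    case True
    then show ?thesis using that[of 1] by blast
  next
    case False
    then have "c = 1 \<or> c = -1" using val c by fastforce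
    moreover have "q \<zeta> = c * p \<zeta>" if "\<zeta> \<in> ?B" for \<zeta>
      using c[OF that] assms(3)[OF that] by (simp add: divide_eq_eq)
    ultimately show ?thesis using that by blast
  qed
qed

text \<open>In the parameter \<open>\<zeta>\<close> one has \<open>v d\<zeta> = c t(\<zeta>) du\<close> at every ramification point, so that
  \<open>h v\<close> is bounded wherever \<open>h du\<close> is holomorphic.\<close>

lemma ramified_param_bound:
  assumes g: "g analytic_on {0}" and ev: "\<forall>\<^sub>F \<zeta> in at 0. h (\<phi> \<zeta>) * D \<zeta> = g \<zeta>"
    and r: "r > 0" "continuous_on (ball 0 r - {0}) (snd \<circ> \<phi>)" "\<And>\<zeta>. \<zeta> \<in> ball 0 r - {0} \<Longrightarrow> \<phi> \<zeta> \<in> affine_curve x"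
    and U: "\<And>\<zeta>. fst (\<phi> \<zeta>) = U \<zeta>" "\<And>\<zeta>. U (- \<zeta>) = U \<zeta>"
    and V: "continuous_on (ball 0 r - {0}) V" "\<And>\<zeta>. V (- \<zeta>) = - V \<zeta>"
    and UV: "\<And>\<zeta>. \<zeta> \<in> ball 0 r - {0} \<Longrightarrow> (U \<zeta>, V \<zeta>) \<in> unramified x \<and> V \<zeta> = c * D \<zeta> * t \<zeta>"
    and t: "isCont t 0"
  obtains C d where "d > 0" "d \<le> r" "\<And>\<zeta>. \<zeta> \<in> ball 0 d - {0} \<Longrightarrow> norm (h (U \<zeta>, V \<zeta>) * V \<zeta>) \<le> C"
proof -
  obtain \<sigma> where \<sigma>: "\<sigma> = 1 \<or> \<sigma> = -1" "\<And>\<zeta>. \<zeta> \<in> ball 0 r - {0} \<Longrightarrow> (snd \<circ> \<phi>) \<zeta> = \<sigma> * V \<zeta>"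
  proof (rule square_eq_punctured_ball[OF V(1) r(2)])
    show "V \<zeta> \<noteq> 0 \<and> ((snd \<circ> \<phi>) \<zeta>)\<^sup>2 = (V \<zeta>)\<^sup>2" if "\<zeta> \<in> ball 0 r - {0}" for \<zeta>
    proof -
      have "(U \<zeta>, snd (\<phi> \<zeta>)) \<in> affine_curve x" using r(3)[OF that] U(1)[of \<zeta>] by (metis prod.collapse)
      then show ?thesis using UV[OF that] by (auto simp: mem_affine_curve mem_unramified)
    qed
  qed blast
  have "isCont (\<lambda>\<zeta>. c * g \<zeta> * t \<zeta>) 0"
    using analytic_on_imp_differentiable_at[OF g, of 0] t
    by (intro continuous_intros) (auto simp: field_differentiable_imp_continuous_at)
  then have "\<forall>\<^sub>F \<zeta> in nhds 0. c * g \<zeta> * t \<zeta> \<in> ball (c * g 0 * t 0) 1"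
    by (intro isCont_eventually_mem) auto
  then obtain d1 where d1: "d1 > 0" "\<And>\<zeta>. norm \<zeta> < d1 \<Longrightarrow> dist (c * g 0 * t 0) (c * g \<zeta> * t \<zeta>) < 1"
    unfolding eventually_nhds_metric by auto
  obtain d2 where d2: "d2 > 0" "\<And>\<zeta>. \<zeta> \<noteq> 0 \<Longrightarrow> norm \<zeta> < d2 \<Longrightarrow> h (\<phi> \<zeta>) * D \<zeta> = g \<zeta>"
    using ev by (auto simp: eventually_at)
  define d where "d = min r (min d1 d2)"
  show ?thesis
  proof (rule that[of d])
    show "d > 0" "d \<le> r" using r d1 d2 by (auto simp: d_def)
    fix \<zeta> :: complex assume \<zeta>: "\<zeta> \<in> ball 0 d - {0}"
    \<comment> \<open>The given \<open>\<phi>\<close> equals the model parameter up to the sign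
      \<open>\<sigma>\<close> of its second coordinate. As \<open>U\<close> is even and
      \<open>V\<close> odd, evaluating \<open>\<phi>\<close> at \<open>\<sigma> * \<zeta>\<close>
      hits the model point exactly.\<close>
    define \<xi> where "\<xi> = \<sigma> * \<zeta>"
    have \<xi>: "\<xi> \<in> ball 0 r - {0}" "norm \<xi> < d1" "norm \<xi> < d2" "\<xi> \<noteq> 0" "norm \<xi> < d"
      using \<zeta> \<sigma>(1) by (auto simp: \<xi>_def d_def)
    have "t \<xi> * (c * D \<xi>) = V \<xi>" using UV[OF \<xi>(1)] by simp
    have UX: "U \<xi> = U \<zeta>" "V \<xi> = \<sigma> * V \<zeta>" using \<sigma>(1) U(2) V(2) by (auto simp: \<xi>_def)
    have "\<phi> \<xi> = (U \<zeta>, V \<zeta>)"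
      using U(1)[of \<xi>] \<sigma>(2)[OF \<xi>(1)] \<sigma>(1) UX by (auto simp: prod_eq_iff)
    then have "h (U \<zeta>, V \<zeta>) * D \<xi> = g \<xi>" using d2(2)[OF \<xi>(4,3)] by simp
    then have "h (U \<zeta>, V \<zeta>) * V \<xi> = c * g \<xi> * t \<xi>" using UV[OF \<xi>(1)] by (simp add: mult_ac)
    moreover have "norm (V \<xi>) = norm (V \<zeta>)" using \<sigma>(1) UX(2) by auto
    ultimately have "norm (h (U \<zeta>, V \<zeta>) * V \<zeta>) = norm (c * g \<xi> * t \<xi>)"
      by (metis norm_mult)
    also have "\<dots> \<le> norm (c * g 0 * t 0) + 1"
      using d1(2)[OF \<xi>(2)] norm_triangle_sub[of "c * g \<xi> * t \<xi>" "c * g 0 * t 0"]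
      by (simp add: dist_norm norm_minus_commute)
    finally show "norm (h (U \<zeta>, V \<zeta>) * V \<zeta>) \<le> norm (c * g 0 * t 0) + 1" .
  qed
qed

lemma holomorphic_at_branch_point_bound:
  assumes x: "x \<noteq> 0" "x \<noteq> 1" "cubic x e = 0" and h: "holomorphic_at x h (Some (e, 0))"
  obtains C \<epsilon> where "\<epsilon> > 0" "\<And>u v. (u, v) \<in> unramified x \<Longrightarrow> norm (u - e) < \<epsilon> \<Longrightarrow> norm (h (u, v) * v) \<le> C"
proof -
  obtain \<phi> g where \<phi>: "local_param x (Some (e, 0)) \<phi>" and g: "g analytic_on {0}"
    and ev: "\<forall>\<^sub>F \<zeta> in at 0. h (\<phi> \<zeta>) * deriv (fst \<circ> \<phi>) \<zeta> = g \<zeta>"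
    using h unfolding holomorphic_at_def by blast
  have fst: "fst (\<phi> \<zeta>) = e + \<zeta>\<^sup>2" for \<zeta> using \<phi> by (simp add: local_param_def)
  obtain r1 where r1: "r1 > 0" "(snd \<circ> \<phi>) holomorphic_on (ball 0 r1 - {0})" "\<And>\<zeta>. \<zeta> \<in> ball 0 r1 - {0} \<Longrightarrow> \<phi> \<zeta> \<in> affine_curve x"
    using \<phi> unfolding local_param_def by blast
  obtain r2 t where r2: "r2 > 0" and t: "t holomorphic_on ball 0 r2" "\<And>\<zeta>. \<zeta> \<in> ball 0 r2 \<Longrightarrow> t \<zeta> \<noteq> 0"
    and unr: "\<And>\<zeta>. \<zeta> \<in> ball 0 r2 - {0} \<Longrightarrow> (e + \<zeta>\<^sup>2, \<zeta> * t \<zeta>) \<in> unramified x"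
    and ex: "\<And>u v. (u, v) \<in> affine_curve x \<Longrightarrow> norm (u - e) < r2\<^sup>2 \<Longrightarrow> \<exists>\<zeta>\<in>ball 0 r2. u = e + \<zeta>\<^sup>2 \<and> v = \<zeta> * t \<zeta>"
    and even: "\<And>\<zeta>. t (- \<zeta>) = t \<zeta>"
    by (rule branch_point_param[OF x]) blast
  have "deriv (fst \<circ> \<phi>) \<zeta> = 2 * \<zeta>" for \<zeta>
    unfolding o_def fst by (auto intro!: DERIV_imp_deriv derivative_eq_intros)
  then have ev': "\<forall>\<^sub>F \<zeta> in at 0. h (\<phi> \<zeta>) * (2 * \<zeta>) = g \<zeta>" using ev by simp
  define r where "r = min r1 r2"
  obtain C d where d: "d > 0" "d \<le> r" "\<And>\<zeta>. \<zeta> \<in> ball 0 d - {0} \<Longrightarrow> norm (h (e + \<zeta>\<^sup>2, \<zeta> * t \<zeta>) * (\<zeta> * t \<zeta>)) \<le> C"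
  \<comment> \<open>Here \<open>v = \<zeta> t\<close> and \<open>du / d\<zeta> = 2 \<zeta>\<close>,
    hence the factor \<open>1 / 2\<close>.\<close>
  proof (rule ramified_param_bound[OF g ev', of r x "\<lambda>\<zeta>. e + \<zeta>\<^sup>2" "\<lambda>\<zeta>. \<zeta> * t \<zeta>" "1 / 2" t])
    show "r > 0" using r1 r2 by (simp add: r_def)
    show "continuous_on (ball 0 r - {0}) (snd \<circ> \<phi>)"
      by (rule continuous_on_subset[OF holomorphic_on_imp_continuous_on[OF r1(2)]]) (auto simp: r_def)
    show "\<phi> \<zeta> \<in> affine_curve x" if "\<zeta> \<in> ball 0 r - {0}" for \<zeta> using r1(3) that by (auto simp: r_def)
    show "continuous_on (ball 0 r - {0}) (\<lambda>\<zeta>. \<zeta> * t \<zeta>)"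
      by (intro continuous_intros continuous_on_subset[OF holomorphic_on_imp_continuous_on[OF t(1)]]) (auto simp: r_def)
    show "(e + \<zeta>\<^sup>2, \<zeta> * t \<zeta>) \<in> unramified x \<and> \<zeta> * t \<zeta> = 1 / 2 * (2 * \<zeta>) * t \<zeta>" if "\<zeta> \<in> ball 0 r - {0}" for \<zeta>
      using unr[of \<zeta>] that by (simp add: r_def)
    show "isCont t 0"
      using t(1) r2 by (metis centre_in_ball continuous_on_eq_continuous_at holomorphic_on_imp_continuous_on open_ball)
  qed (use fst even in auto)
  show ?thesis
  proof (rule that[of "d\<^sup>2" C])
    show "d\<^sup>2 > 0" using d(1) by simp
    fix u v assume uv: "(u, v) \<in> unramified x" "norm (u - e) < d\<^sup>2"
    have "d\<^sup>2 \<le> r2\<^sup>2" using d(1,2) by (intro power_mono) (auto simp: r_def)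
    then obtain \<zeta> where \<zeta>: "\<zeta> \<in> ball 0 r2" "u = e + \<zeta>\<^sup>2" "v = \<zeta> * t \<zeta>"
      using ex[of u v] uv subsetD[OF unramified_sub_affine] by force
    have "norm \<zeta> ^ 2 < d\<^sup>2" using uv(2) \<zeta>(2) by (simp add: norm_power)
    then have "norm \<zeta> < d" using d(1) by (intro power_less_imp_less_base[of "norm \<zeta>" 2 d]) auto
    moreover have "\<zeta> \<noteq> 0" using uv(1) \<zeta>(3) by (auto simp: mem_unramified)
    ultimately show "norm (h (u, v) * v) \<le> C" using d(3)[of \<zeta>] \<zeta> by simp
  qed
qed

lemma holomorphic_at_infinity_bound:
  assumes h: "holomorphic_at x h None"
  obtains C M where "\<And>u v. (u, v) \<in> unramified x \<Longrightarrow> norm u > M \<Longrightarrow> norm (h (u, v) * v) \<le> C"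
proof -
  obtain \<phi> g where \<phi>: "local_param x None \<phi>" and g: "g analytic_on {0}"
    and ev: "\<forall>\<^sub>F \<zeta> in at 0. h (\<phi> \<zeta>) * deriv (fst \<circ> \<phi>) \<zeta> = g \<zeta>"
    using h unfolding holomorphic_at_def by blast
  have fst: "fst (\<phi> \<zeta>) = 1 / \<zeta>\<^sup>2" for \<zeta> using \<phi> by (simp add: local_param_def)
  obtain r1 where r1: "r1 > 0" "(snd \<circ> \<phi>) holomorphic_on (ball 0 r1 - {0})" "\<And>\<zeta>. \<zeta> \<in> ball 0 r1 - {0} \<Longrightarrow> \<phi> \<zeta> \<in> affine_curve x"
    using \<phi> unfolding local_param_def by blast
  obtain r2 t where r2: "r2 > 0" and t: "t holomorphic_on ball 0 r2" "\<And>\<zeta>. \<zeta> \<in> ball 0 r2 \<Longrightarrow> t \<zeta> \<noteq> 0"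
    and unr: "\<And>\<zeta>. \<zeta> \<in> ball 0 r2 - {0} \<Longrightarrow> (1 / \<zeta>\<^sup>2, t \<zeta> / \<zeta> ^ 3) \<in> unramified x"
    and ex: "\<And>u v. (u, v) \<in> affine_curve x \<Longrightarrow> norm u > 1 / r2\<^sup>2 \<Longrightarrow> \<exists>\<zeta>\<in>ball 0 r2 - {0}. u = 1 / \<zeta>\<^sup>2 \<and> v = t \<zeta> / \<zeta> ^ 3"
    and even: "\<And>\<zeta>. t (- \<zeta>) = t \<zeta>"
    by (rule infinity_param[of x]) blast
  have "deriv (fst \<circ> \<phi>) \<zeta> = - 2 / \<zeta> ^ 3" if "\<zeta> \<noteq> 0" for \<zeta>
  proof -
    have "((\<lambda>\<zeta>. 1 / \<zeta>\<^sup>2) has_field_derivative - 2 / \<zeta> ^ 3) (at \<zeta>)"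
      using that by (auto intro!: derivative_eq_intros simp: divide_simps power2_eq_square power3_eq_cube)
    then show ?thesis unfolding o_def fst by (rule DERIV_imp_deriv)
  qed
  then have ev': "\<forall>\<^sub>F \<zeta> in at 0. h (\<phi> \<zeta>) * (- 2 / \<zeta> ^ 3) = g \<zeta>"
    using ev eventually_at_ball'[of 1 "0::complex" UNIV] by (auto elim: eventually_elim2)
  define r where "r = min r1 r2"
  obtain C d where d: "d > 0" "d \<le> r" "\<And>\<zeta>. \<zeta> \<in> ball 0 d - {0} \<Longrightarrow> norm (h (1 / \<zeta>\<^sup>2, t \<zeta> / \<zeta> ^ 3) * (t \<zeta> / \<zeta> ^ 3)) \<le> C"
  \<comment> \<open>At infinity \<open>v = t / \<zeta> ^ 3\<close> and
    \<open>du / d\<zeta> = - 2 / \<zeta> ^ 3\<close>, hence the factor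
    \<open>- 1 / 2\<close>.\<close>
  proof (rule ramified_param_bound[OF g ev', of r x "\<lambda>\<zeta>. 1 / \<zeta>\<^sup>2" "\<lambda>\<zeta>. t \<zeta> / \<zeta> ^ 3" "- 1 / 2" t])
    show "r > 0" using r1 r2 by (simp add: r_def)
    show "continuous_on (ball 0 r - {0}) (snd \<circ> \<phi>)"
      by (rule continuous_on_subset[OF holomorphic_on_imp_continuous_on[OF r1(2)]]) (auto simp: r_def)
    show "\<phi> \<zeta> \<in> affine_curve x" if "\<zeta> \<in> ball 0 r - {0}" for \<zeta> using r1(3) that by (auto simp: r_def)
    show "continuous_on (ball 0 r - {0}) (\<lambda>\<zeta>. t \<zeta> / \<zeta> ^ 3)"
      by (intro continuous_intros continuous_on_subset[OF holomorphic_on_imp_continuous_on[OF t(1)]]) (auto simp: r_def)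
    show "(1 / \<zeta>\<^sup>2, t \<zeta> / \<zeta> ^ 3) \<in> unramified x \<and> t \<zeta> / \<zeta> ^ 3 = - 1 / 2 * (- 2 / \<zeta> ^ 3) * t \<zeta>"
      if "\<zeta> \<in> ball 0 r - {0}" for \<zeta>
      using unr[of \<zeta>] that by (simp add: r_def)
    show "isCont t 0"
      using t(1) r2 by (metis centre_in_ball continuous_on_eq_continuous_at holomorphic_on_imp_continuous_on open_ball)
  qed (use fst even in auto)
  show ?thesis
  proof (rule that[of "1 / d\<^sup>2" C])
    fix u v assume uv: "(u, v) \<in> unramified x" "norm u > 1 / d\<^sup>2"
    have "1 / r2\<^sup>2 \<le> 1 / d\<^sup>2"
      using d(1,2) by (intro divide_left_mono power_mono mult_pos_pos zero_less_power) (auto simp: r_def)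
    then have "norm u > 1 / r2\<^sup>2" using uv(2) by linarith
    then obtain \<zeta> where \<zeta>: "\<zeta> \<in> ball 0 r2 - {0}" "u = 1 / \<zeta>\<^sup>2" "v = t \<zeta> / \<zeta> ^ 3"
      using ex[of u v] uv subsetD[OF unramified_sub_affine] by blast
    have "1 / norm \<zeta> ^ 2 > 1 / d\<^sup>2" using uv(2) \<zeta>(2) by (simp add: norm_divide norm_power)
    then have "norm \<zeta> ^ 2 < d\<^sup>2" using d(1) \<zeta>(1) by (simp add: divide_less_cancel field_simps)
    then have "norm \<zeta> < d" using d(1) by (intro power_less_imp_less_base[of "norm \<zeta>" 2 d]) auto
    then show "norm (h (u, v) * v) \<le> C" using d(3)[of \<zeta>] \<zeta> by simp
  qed
qed

section \<open>Splitting a differential under the exchange of sheets\<close>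

definition even_part :: "complex \<Rightarrow> (complex \<times> complex \<Rightarrow> complex) \<Rightarrow> complex \<Rightarrow> complex" where
  "even_part x h u = h (u, csqrt (cubic x u)) + h (u, - csqrt (cubic x u))"

text \<open>The factor \<open>v\<close> turns the odd combination into a function of
  \<open>u\<close>; a multiple of \<open>du / v\<close> becomes a constant. Like
  \<open>even_part\<close> it does not depend on which root \<open>csqrt\<close> picks, and both are
  twice the usual parts.\<close>

definition odd_part :: "complex \<Rightarrow> (complex \<times> complex \<Rightarrow> complex) \<Rightarrow> complex \<Rightarrow> complex" where
  "odd_part x h u = csqrt (cubic x u) * (h (u, csqrt (cubic x u)) - h (u, - csqrt (cubic x u)))"

lemma csqrt_cubic_cases:
  assumes "(u, v) \<in> affine_curve x"
  shows "csqrt (cubic x u) = v \<or> csqrt (cubic x u) = - v"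
proof -
  have "(csqrt (cubic x u))\<^sup>2 = v\<^sup>2" using assms by (simp add: mem_affine_curve)
  then show ?thesis by (simp only: power2_eq_iff)
qed

lemma even_odd_parts_eq:
  assumes "(u, v) \<in> affine_curve x"
  shows "even_part x h u = h (u, v) + h (u, - v)" "odd_part x h u = v * (h (u, v) - h (u, - v))"
  using csqrt_cubic_cases[OF assms] by (auto simp: even_part_def odd_part_def algebra_simps)

lemma even_odd_decomposition:
  assumes "(u, v) \<in> unramified x"
  shows "h (u, v) = (even_part x h u + odd_part x h u / v) / 2"
  using even_odd_parts_eq[of u v x h] assms subsetD[OF unramified_sub_affine assms]
  by (simp add: mem_unramified field_simps)

lemma conj_unramified: "(u, v) \<in> unramified x \<Longrightarrow> (u, - v) \<in> unramified x"
  by (simp add: mem_unramified)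

lemma branch_conj: "branch x (u, - v) z = - branch x (u, v) z"
  by (simp add: branch_def)

context
  fixes x h y
  assumes x: "x \<noteq> 0" "x \<noteq> 1"
    and hol: "\<And>u v. (u, v) \<in> unramified x \<Longrightarrow> u \<noteq> y \<Longrightarrow> holomorphic_at x h (Some (u, v))"
    and ram: "\<And>e. cubic x e = 0 \<Longrightarrow> holomorphic_at x h (Some (e, 0))" "holomorphic_at x h None"
begin

lemma even_odd_parts_holomorphic:
  "even_part x h holomorphic_on - ({u. cubic x u = 0} \<union> {y})"
  "odd_part x h holomorphic_on - ({u. cubic x u = 0} \<union> {y})"
proof -
  have "even_part x h field_differentiable at u \<and> odd_part x h field_differentiable at u"
    if u: "cubic x u \<noteq> 0" "u \<noteq> y" for u
  proof -
    define v where "v = csqrt (cubic x u)"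
    have P: "(u, v) \<in> unramified x" using csqrt_cubic_unramified[OF u(1)] by (simp add: v_def)
    have 1: "(\<lambda>z. h (z, branch x (u, v) z)) field_differentiable at u"
      using holomorphic_at_unramified[OF hol[OF P u(2)] P] by simp
    have 2: "(\<lambda>z. h (z, - branch x (u, v) z)) field_differentiable at u"
      using holomorphic_at_unramified[OF hol[OF conj_unramified[OF P] u(2)] conj_unramified[OF P]]
      by (simp add: branch_conj)
    have 3: "branch x (u, v) field_differentiable at u"
      using has_field_derivative_branch[OF P] by (auto simp: field_differentiable_def)
    have "(\<lambda>z. (\<lambda>(u, v). h (u, v) + h (u, - v)) (z, csqrt (cubic x z))) field_differentiable at (fst (u, v))"
      by (rule even_function_descends[OF _ P]) (use field_differentiable_add[OF 1 2] in auto)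
    moreover have "(\<lambda>z. (\<lambda>(u, v). v * (h (u, v) - h (u, - v))) (z, csqrt (cubic x z))) field_differentiable at (fst (u, v))"
      by (rule even_function_descends[OF _ P])
        (use field_differentiable_mult[OF 3 field_differentiable_diff[OF 1 2]] in \<open>auto simp: algebra_simps\<close>)
    ultimately show ?thesis
      by (simp add: even_part_def [abs_def] odd_part_def [abs_def])
  qed
  then show "even_part x h holomorphic_on - ({u. cubic x u = 0} \<union> {y})"
    "odd_part x h holomorphic_on - ({u. cubic x u = 0} \<union> {y})"
    by (auto simp: holomorphic_on_def intro: field_differentiable_at_within)
qed

text \<open>In terms of \<open>h v\<close> on the two sheets, the odd part is the sum of the two
  values and \<open>v\<close> times the even part is their difference.\<close>

lemma even_odd_parts_bound:
  assumes "cubic x u \<noteq> 0" "norm (h (u, csqrt (cubic x u)) * csqrt (cubic x u)) \<le> C"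
    "norm (h (u, - csqrt (cubic x u)) * - csqrt (cubic x u)) \<le> C"
  shows "norm (odd_part x h u) \<le> 2 * C" "norm (a * even_part x h u) \<le> 2 * C * norm (a / csqrt (cubic x u))"
proof -
  let ?v = "csqrt (cubic x u)"
  have "odd_part x h u = h (u, ?v) * ?v + h (u, - ?v) * - ?v" by (simp add: odd_part_def algebra_simps)
  then show "norm (odd_part x h u) \<le> 2 * C"
    using norm_triangle_ineq[of "h (u, ?v) * ?v" "h (u, - ?v) * - ?v"] assms by simp
  have "norm (h (u, ?v) * ?v - h (u, - ?v) * - ?v) \<le> 2 * C"
    using norm_triangle_ineq4[of "h (u, ?v) * ?v" "h (u, - ?v) * - ?v"] assms by simp
  then have "norm (even_part x h u * ?v) \<le> 2 * C" by (simp add: even_part_def algebra_simps)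
  then have "norm (a / ?v) * norm (even_part x h u * ?v) \<le> norm (a / ?v) * (2 * C)" by (rule mult_left_mono) simp
  moreover have "norm (a / ?v) * norm (even_part x h u * ?v) = norm (a * even_part x h u)"
    using assms(1) by (simp add: norm_mult norm_divide)
  ultimately show "norm (a * even_part x h u) \<le> 2 * C * norm (a / ?v)" by (simp add: mult.commute)
qed

lemma even_odd_parts_branch_point:
  assumes e: "cubic x e = 0"
  shows "((\<lambda>z. (z - e) * even_part x h z) \<longlongrightarrow> 0) (at e)" "((\<lambda>z. (z - e) * odd_part x h z) \<longlongrightarrow> 0) (at e)"
proof -
  obtain C \<epsilon> where C: "\<epsilon> > 0" "\<And>u v. (u, v) \<in> unramified x \<Longrightarrow> norm (u - e) < \<epsilon> \<Longrightarrow> norm (h (u, v) * v) \<le> C"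
    by (rule holomorphic_at_branch_point_bound[OF x e ram(1)[OF e]]) (rule that)
  have "finite {u. cubic x u = 0}"
  proof -
    have "{u. cubic x u = 0} = {0, 1, x}" by (auto simp: cubic_eq_0_iff)
    then show ?thesis by simp
  qed
  then have "open (- ({u. cubic x u = 0} - {e}))" by (intro open_Compl finite_imp_closed) simp
  then have "\<forall>\<^sub>F u in at e. u \<notin> {u. cubic x u = 0}"
    unfolding eventually_at_topological by (intro exI[of _ "- ({u. cubic x u = 0} - {e})"]) auto
  moreover have "\<forall>\<^sub>F u in at e. norm (u - e) < \<epsilon>"
    using C(1) by (auto simp: eventually_at dist_norm)
  ultimately have ev: "\<forall>\<^sub>F u in at e. norm (odd_part x h u) \<le> 2 * C \<and>
      norm ((u - e) * even_part x h u) \<le> 2 * C * norm ((u - e) / csqrt (cubic x u))"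
  proof eventually_elim
    case (elim u)
    then have nz: "cubic x u \<noteq> 0" by simp
    note P = csqrt_cubic_unramified[OF nz]
    note bd = even_odd_parts_bound[OF nz C(2)[OF P elim(2)] C(2)[OF conj_unramified[OF P] elim(2)]]
    show ?case using bd by blast
  qed
  show "((\<lambda>z. (z - e) * even_part x h z) \<longlongrightarrow> 0) (at e)"
  proof (rule Lim_null_comparison)
    show "\<forall>\<^sub>F u in at e. norm ((u - e) * even_part x h u) \<le> 2 * C * norm ((u - e) / csqrt (cubic x u))"
      using ev by eventually_elim blast
    have "((\<lambda>u. 2 * C * norm ((u - e) / csqrt (cubic x u))) \<longlongrightarrow> 2 * C * norm (0::complex)) (at e)"
      by (intro tendsto_intros over_csqrt_cubic_branch_point x e)
    then show "((\<lambda>u. 2 * C * norm ((u - e) / csqrt (cubic x u))) \<longlongrightarrow> 0) (at e)" by simp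
  qed
  show "((\<lambda>z. (z - e) * odd_part x h z) \<longlongrightarrow> 0) (at e)"
  proof (rule Lim_null_comparison)
    show "\<forall>\<^sub>F u in at e. norm ((u - e) * odd_part x h u) \<le> norm (u - e) * (2 * C)"
      using ev by eventually_elim (simp add: norm_mult mult_left_mono)
    have "((\<lambda>u. norm (u - e) * (2 * C)) \<longlongrightarrow> norm (e - e) * (2 * C)) (at e)" by (intro tendsto_intros)
    then show "((\<lambda>u. norm (u - e) * (2 * C)) \<longlongrightarrow> 0) (at e)" by simp
  qed
qed

text \<open>Holomorphy at infinity bounds \<open>h v\<close>. The even part gains a factor
  \<open>1 / v\<close> and decays, while the odd part is only bounded; this leaves the additive
  constant that a multiple of \<open>du / v\<close> produces.\<close>

lemma even_odd_parts_infinity: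
  shows "(even_part x h \<longlongrightarrow> 0) at_infinity" "\<exists>B. \<forall>\<^sub>F u in at_infinity. norm (odd_part x h u) \<le> B"
proof -
  obtain C M where C: "\<And>u v. (u, v) \<in> unramified x \<Longrightarrow> norm u > M \<Longrightarrow> norm (h (u, v) * v) \<le> C"
    by (rule holomorphic_at_infinity_bound[OF ram(2)]) (rule that)
  have ev: "\<forall>\<^sub>F u in at_infinity. norm (odd_part x h u) \<le> 2 * C \<and>
      norm (1 * even_part x h u) \<le> 2 * C * norm (1 / csqrt (cubic x u))"
    unfolding eventually_at_infinity
  proof (intro exI[of _ "max (\<bar>M\<bar> + 1) (norm x + 2)"] allI impI)
    fix u :: complex assume u: "max (\<bar>M\<bar> + 1) (norm x + 2) \<le> norm u"
    then have "norm u \<ge> norm x + 2" by simp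
    then have "norm u > 1" "norm u > norm x" using norm_ge_zero[of x] by linarith+
    then have "u \<noteq> 0" "u \<noteq> 1" "u \<noteq> x" by auto
    then have nz: "cubic x u \<noteq> 0" by (simp add: cubic_eq_0_iff)
    have M: "norm u > M" using u by linarith
    note P = csqrt_cubic_unramified[OF nz]
    note bd = even_odd_parts_bound[OF nz C[OF P M] C[OF conj_unramified[OF P] M]]
    show "norm (odd_part x h u) \<le> 2 * C \<and> norm (1 * even_part x h u) \<le> 2 * C * norm (1 / csqrt (cubic x u))"
      using bd by blast
  qed
  then show "\<exists>B. \<forall>\<^sub>F u in at_infinity. norm (odd_part x h u) \<le> B"
    by (intro exI[of _ "2 * C"]) (auto elim: eventually_mono)
  show "(even_part x h \<longlongrightarrow> 0) at_infinity"
  proof (rule Lim_null_comparison)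
    show "\<forall>\<^sub>F u in at_infinity. norm (even_part x h u) \<le> 2 * C * norm (1 / csqrt (cubic x u))"
      using ev by eventually_elim simp
    have "((\<lambda>u. 2 * C * norm (1 / csqrt (cubic x u))) \<longlongrightarrow> 2 * C * norm (0::complex)) at_infinity"
      by (intro tendsto_intros over_csqrt_cubic_infinity)
    then show "((\<lambda>u. 2 * C * norm (1 / csqrt (cubic x u))) \<longlongrightarrow> 0) at_infinity" by simp
  qed
qed

end

section \<open>Taylor coefficients along the curve\<close>

text \<open>The number of slots \<open>n\<close> and the weight \<open>m\<close> are kept apart
  because removing a part changes the weight but not the slots; the index set in \<open>L\<close> is
  the case \<open>n = m\<close>.\<close>

definition weighted_tuples :: "nat \<Rightarrow> nat \<Rightarrow> (nat \<Rightarrow> nat) set" where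
  "weighted_tuples n m = {p \<in> {1..n} \<rightarrow>\<^sub>E UNIV. (\<Sum>k=1..n. k * p k) = m}"

text \<open>The coefficient of \<open>t ^ m\<close> in \<open>exp (\<Sum>k=1..n. a k * t ^ k)\<close>.\<close>

definition exp_coeff :: "(nat \<Rightarrow> complex) \<Rightarrow> nat \<Rightarrow> nat \<Rightarrow> complex" where
  "exp_coeff a n m = (\<Sum>p\<in>weighted_tuples n m. \<Prod>k=1..n. a k ^ p k / fact (p k))"

lemma weighted_tuples_le:
  assumes "p \<in> weighted_tuples n m" "k \<in> {1..n}"
  shows "k * p k \<le> m"
proof -
  have "k * p k \<le> (\<Sum>k=1..n. k * p k)"
    by (rule member_le_sum) (use assms in auto)
  then show ?thesis using assms(1) by (simp add: weighted_tuples_def)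
qed

lemma finite_weighted_tuples: "finite (weighted_tuples n m)"
proof (rule finite_subset)
  show "weighted_tuples n m \<subseteq> {1..n} \<rightarrow>\<^sub>E {..m}"
  proof
    fix p assume p: "p \<in> weighted_tuples n m"
    have "p k \<le> m" if "k \<in> {1..n}" for k
    proof -
      have "1 * p k \<le> k * p k" using that by (intro mult_le_mono1) auto
      then show ?thesis using weighted_tuples_le[OF p that] by linarith
    qed
    then show "p \<in> {1..n} \<rightarrow>\<^sub>E {..m}" using p by (auto simp: weighted_tuples_def PiE_iff)
  qed
qed (simp add: finite_PiE)

text \<open>A part larger than the weight has multiplicity 0, so its slot contributes the factor
  1.\<close>

lemma exp_coeff_shrink:
  assumes "m \<le> n"
  shows "exp_coeff a n m = exp_coeff a m m"
proof -
  have z: "p k = 0" if "p \<in> weighted_tuples n m" "k \<in> {1..n} - {1..m}" for p k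
  proof (rule ccontr)
    assume "p k \<noteq> 0"
    then have "k \<le> k * p k" by simp
    also have "\<dots> \<le> m" using weighted_tuples_le[OF that(1), of k] that(2) by auto
    finally show False using that(2) by auto
  qed
  let ?i = "\<lambda>q. \<lambda>k\<in>{1..n}. if k \<le> m then q k else (0::nat)" and ?j = "\<lambda>p. restrict p {1..m}"
  have sumeq: "(\<Sum>k=1..n. k * p k) = (\<Sum>k=1..m. k * p k)" if "\<And>k. k \<in> {1..n} - {1..m} \<Longrightarrow> p k = 0" for p :: "nat \<Rightarrow> nat"
    by (rule sum.mono_neutral_right) (use assms that in auto)
  show ?thesis
    unfolding exp_coeff_def
  proof (rule sum.reindex_bij_witness[where i = ?i and j = ?j])
    fix p assume p: "p \<in> weighted_tuples n m"
    show "?i (?j p) = p"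
    proof
      fix k show "?i (?j p) k = p k"
        using z[OF p, of k] p by (auto simp: weighted_tuples_def PiE_iff extensional_def)
    qed
    have "(\<Sum>k=1..m. k * p k) = m" using sumeq[of p] z[OF p] p by (simp add: weighted_tuples_def)
    then show "?j p \<in> weighted_tuples m m" by (simp add: weighted_tuples_def)
    have "(\<Prod>k=1..n. a k ^ p k / fact (p k)) = (\<Prod>k=1..m. a k ^ p k / fact (p k))"
      by (rule prod.mono_neutral_right) (use assms z[OF p] in auto)
    then show "(\<Prod>k=1..m. a k ^ ?j p k / fact (?j p k)) = (\<Prod>k=1..n. a k ^ p k / fact (p k))" by simp
  next
    fix q assume q: "q \<in> weighted_tuples m m"
    show "?j (?i q) = q"
    proof
      fix k show "?j (?i q) k = q k"
        using q assms by (auto simp: weighted_tuples_def PiE_iff extensional_def)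
    qed
    have "(\<Sum>k=1..n. k * ?i q k) = (\<Sum>k=1..m. k * ?i q k)" by (rule sumeq) auto
    also have "\<dots> = (\<Sum>k=1..m. k * q k)" using assms by (intro sum.cong) auto
    finally show "?i q \<in> weighted_tuples n m" using q by (simp add: weighted_tuples_def)
  qed
qed

text \<open>Marking one of the \<open>p k\<close> parts of size \<open>k\<close> and removing it:
  the factor \<open>p k\<close> turns \<open>1 / fact (p k)\<close> into
  \<open>1 / fact (p k - 1)\<close> and one \<open>a k\<close> splits off.\<close>

lemma exp_coeff_marked:
  assumes "k \<in> {1..n}" "k \<le> m"
  shows "(\<Sum>p\<in>weighted_tuples n m. of_nat (p k) * (\<Prod>j=1..n. a j ^ p j / fact (p j))) = a k * exp_coeff a n (m - k)"
proof -
  let ?w = "\<lambda>p. \<Prod>j=1..n. a j ^ p j / fact (p j)"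
  have "(\<Sum>p\<in>weighted_tuples n m. of_nat (p k) * ?w p)
      = (\<Sum>p\<in>{p \<in> weighted_tuples n m. p k \<noteq> 0}. of_nat (p k) * ?w p)"
    by (rule sum.mono_neutral_right) (auto simp: finite_weighted_tuples)
  also have "\<dots> = (\<Sum>q\<in>weighted_tuples n (m - k). a k * ?w q)"
  proof (rule sum.reindex_bij_witness[where i = "\<lambda>q. q(k := q k + 1)" and j = "\<lambda>p. p(k := p k - 1)"])
    fix p assume "p \<in> {p \<in> weighted_tuples n m. p k \<noteq> 0}"
    then have p: "p \<in> weighted_tuples n m" "p k \<noteq> 0" by auto
    let ?q = "p(k := p k - 1)"
    show "?q(k := ?q k + 1) = p" using p(2) by auto
    have "(\<Sum>j=1..n. j * p j) = k * p k + (\<Sum>j\<in>{1..n} - {k}. j * p j)"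
      by (rule sum.remove) (use assms in auto)
    moreover have "(\<Sum>j=1..n. j * ?q j) = k * ?q k + (\<Sum>j\<in>{1..n} - {k}. j * ?q j)"
      by (rule sum.remove) (use assms in auto)
    moreover have "(\<Sum>j\<in>{1..n} - {k}. j * ?q j) = (\<Sum>j\<in>{1..n} - {k}. j * p j)"
      by (rule sum.cong) auto
    moreover have "k * p k = k * (p k - 1) + k" using p(2) by (cases "p k") auto
    moreover have "(\<Sum>j=1..n. j * p j) = m" using p(1) by (simp add: weighted_tuples_def)
    moreover have "?q k = p k - 1" by simp
    ultimately have "(\<Sum>j=1..n. j * ?q j) = m - k" by (simp only:) simp
    then show "?q \<in> weighted_tuples n (m - k)"
      using p(1) assms(1) by (auto simp: weighted_tuples_def PiE_iff extensional_def)
    have 1: "?w p = a k ^ p k / fact (p k) * (\<Prod>j\<in>{1..n} - {k}. a j ^ p j / fact (p j))"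
      by (rule prod.remove) (use assms in auto)
    have "?w ?q = a k ^ ?q k / fact (?q k) * (\<Prod>j\<in>{1..n} - {k}. a j ^ ?q j / fact (?q j))"
      by (rule prod.remove) (use assms in auto)
    also have "(\<Prod>j\<in>{1..n} - {k}. a j ^ ?q j / fact (?q j)) = (\<Prod>j\<in>{1..n} - {k}. a j ^ p j / fact (p j))"
      by (rule prod.cong) auto
    finally have 2: "?w ?q = a k ^ ?q k / fact (?q k) * (\<Prod>j\<in>{1..n} - {k}. a j ^ p j / fact (p j))" .
    have "of_nat (p k) * (a k ^ p k / fact (p k)) = a k * (a k ^ (p k - 1) / fact (p k - 1))"
      using p(2) by (cases "p k") (simp_all add: field_simps del: of_nat_Suc)
    then have "a k * ?w ?q = of_nat (p k) * (a k ^ p k / fact (p k)) * (\<Prod>j\<in>{1..n} - {k}. a j ^ p j / fact (p j))"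
      unfolding 2 by (simp only: fun_upd_same mult.assoc [symmetric])
    then show "a k * ?w ?q = of_nat (p k) * ?w p"
      unfolding 1 by (simp only: mult.assoc)
  next
    fix q assume q: "q \<in> weighted_tuples n (m - k)"
    let ?p = "q(k := q k + 1)"
    show "?p(k := ?p k - 1) = q" by auto
    have "(\<Sum>j=1..n. j * q j) = k * q k + (\<Sum>j\<in>{1..n} - {k}. j * q j)"
      by (rule sum.remove) (use assms in auto)
    moreover have "(\<Sum>j=1..n. j * ?p j) = k * ?p k + (\<Sum>j\<in>{1..n} - {k}. j * ?p j)"
      by (rule sum.remove) (use assms in auto)
    moreover have "(\<Sum>j\<in>{1..n} - {k}. j * ?p j) = (\<Sum>j\<in>{1..n} - {k}. j * q j)"
      by (rule sum.cong) auto
    moreover have "(\<Sum>j=1..n. j * q j) = m - k" using q by (simp add: weighted_tuples_def)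
    moreover have "k * ?p k = k * q k + k" by simp
    ultimately have "(\<Sum>j=1..n. j * ?p j) = m" using assms(2) by linarith
    then show "?p \<in> {p \<in> weighted_tuples n m. p k \<noteq> 0}"
      using q assms(1) by (auto simp: weighted_tuples_def PiE_iff extensional_def)
  qed
  finally show ?thesis by (simp add: exp_coeff_def sum_distrib_left)
qed

text \<open>Coefficientwise form of \<open>(exp f)' = f' * exp f\<close>.\<close>

lemma exp_coeff_recurrence:
  "of_nat l * exp_coeff a l l = (\<Sum>k=1..l. of_nat k * a k * exp_coeff a (l - k) (l - k))"
proof -
  let ?w = "\<lambda>p. \<Prod>j=1..l. a j ^ p j / fact (p j)"
  \<comment> \<open>On tuples of weight \<open>l\<close> the factor \<open>l\<close> is the weighted
    sum itself, which distributes over the parts.\<close>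
  have "of_nat l * exp_coeff a l l = (\<Sum>p\<in>weighted_tuples l l. of_nat (\<Sum>k=1..l. k * p k) * ?w p)"
    unfolding exp_coeff_def sum_distrib_left by (intro sum.cong refl) (simp add: weighted_tuples_def)
  also have "\<dots> = (\<Sum>p\<in>weighted_tuples l l. \<Sum>k=1..l. of_nat k * (of_nat (p k) * ?w p))"
    by (simp add: sum_distrib_right mult.assoc)
  also have "\<dots> = (\<Sum>k=1..l. of_nat k * (\<Sum>p\<in>weighted_tuples l l. of_nat (p k) * ?w p))"
    by (subst sum.swap) (simp add: sum_distrib_left)
  also have "\<dots> = (\<Sum>k=1..l. of_nat k * a k * exp_coeff a (l - k) (l - k))"
  proof (intro sum.cong refl)
    fix k assume "k \<in> {1..l}"
    then show "of_nat k * (\<Sum>p\<in>weighted_tuples l l. of_nat (p k) * ?w p) = of_nat k * a k * exp_coeff a (l - k) (l - k)"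
      using exp_coeff_marked[of k l l a] exp_coeff_shrink[of "l - k" l a] by (simp add: mult.assoc)
  qed
  finally show ?thesis .
qed

text \<open>\<open>taylor_coeff l x y / w\<close> is the coefficient of \<open>(u - y) ^ l\<close> in the expansion of
  \<open>1 / v\<close> at the point \<open>(y, w)\<close> of the curve.\<close>

definition taylor_coeff :: "nat \<Rightarrow> complex \<Rightarrow> complex \<Rightarrow> complex" where
  "taylor_coeff l x y = L l x y / fact l"

text \<open>With \<open>t = u - y\<close> each factor \<open>(u - e) / (y - e)\<close> of the cubic
  has logarithm \<open>- \<Sum> t ^ k / (k * (e - y) ^ k)\<close>. Thus minus half the sum over the
  three roots is the exponent with coefficients \<open>Sig k x y / (2 k)\<close>.\<close>

lemma taylor_coeff_eq: "taylor_coeff l x y = exp_coeff (\<lambda>k. Sig k x y / (2 * of_nat k)) l l"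
proof -
  have "fact l * (\<Prod>k=1..l. Sig k x y ^ p k) /
      (2 ^ (\<Sum>k=1..l. p k) * (\<Prod>k=1..l. fact (p k)) * (\<Prod>k=1..l. of_nat k ^ p k))
    = fact l * (\<Prod>k=1..l. (Sig k x y / (2 * of_nat k)) ^ p k / fact (p k))" for p :: "nat \<Rightarrow> nat"
    by (simp add: power_divide prod_dividef power_mult_distrib prod.distrib power_sum mult_ac)
  then show ?thesis
    by (simp add: taylor_coeff_def L_def exp_coeff_def weighted_tuples_def sum_distrib_left [symmetric])
qed

lemma taylor_coeff_0 [simp]: "taylor_coeff 0 x y = 1"
  by (simp add: taylor_coeff_def L_0)

lemma taylor_coeff_recurrence:
  "2 * of_nat l * taylor_coeff l x y = (\<Sum>k=1..l. Sig k x y * taylor_coeff (l - k) x y)"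
proof -
  have "2 * (of_nat l * taylor_coeff l x y) = 2 * (\<Sum>k=1..l. Sig k x y / 2 * taylor_coeff (l - k) x y)"
    unfolding taylor_coeff_eq exp_coeff_recurrence by (intro arg_cong[of _ _ "(*) 2"] sum.cong) auto
  also have "\<dots> = (\<Sum>k=1..l. Sig k x y * taylor_coeff (l - k) x y)"
    unfolding sum_distrib_left by (intro sum.cong) auto
  finally show ?thesis by (simp add: mult.assoc)
qed

section \<open>Partial derivatives of the Taylor coefficients\<close>

context
  fixes S c :: "nat \<Rightarrow> complex"
  assumes rec: "\<And>l. 2 * of_nat l * c l = (\<Sum>k=1..l. S k * c (l - k))"
begin

text \<open>The candidate for the \<open>y\<close>-derivative of \<open>c l\<close> is
  \<open>(l + 1) c (l + 1) - S 1 / 2 * c l\<close>: shifting the centre of \<open>w / v\<close>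
  raises the order, and the normalising \<open>w\<close> has logarithmic derivative
  \<open>- S 1 / 2\<close>. Since the \<open>y\<close>-derivative of \<open>S k\<close> is
  \<open>k S (k + 1)\<close>, the identity says that the candidate satisfies the differentiated
  recurrence.\<close>

lemma recurrence_derivative_y:
  "(\<Sum>k=1..l. S k * (of_nat (l - k + 1) * c (l - k + 1) - S 1 / 2 * c (l - k)) + of_nat k * S (k + 1) * c (l - k))
    = 2 * of_nat l * (of_nat (l + 1) * c (l + 1) - S 1 / 2 * c l)"
proof -
  have 1: "(\<Sum>k=1..l. S k * (of_nat (l - k + 1) * c (l - k + 1))) = (\<Sum>k=1..l+1. of_nat (l + 1 - k) * (S k * c (l + 1 - k)))"
  proof -
    have "(\<Sum>k=1..l. S k * (of_nat (l - k + 1) * c (l - k + 1))) = (\<Sum>k=1..l. of_nat (l + 1 - k) * (S k * c (l + 1 - k)))"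
      by (intro sum.cong refl) (auto simp: Suc_diff_le)
    then show ?thesis by simp
  qed
  have 2: "(\<Sum>k=1..l. of_nat k * S (k + 1) * c (l - k)) = (\<Sum>k=1..l+1. of_nat (k - 1) * (S k * c (l + 1 - k)))"
  proof -
    have "(\<Sum>k=1..l+1. of_nat (k - 1) * (S k * c (l + 1 - k))) = (\<Sum>k=0..l. of_nat k * (S (k + 1) * c (l - k)))"
      by (rule sum.reindex_bij_witness[where i = "\<lambda>k. k + 1" and j = "\<lambda>k. k - 1"]) auto
    also have "\<dots> = (\<Sum>k=1..l. of_nat k * (S (k + 1) * c (l - k)))"
      by (rule sum.mono_neutral_right) auto
    finally show ?thesis by (simp add: mult.assoc)
  qed
  have "(\<Sum>k=1..l+1. of_nat (l + 1 - k) * (S k * c (l + 1 - k))) + (\<Sum>k=1..l+1. of_nat (k - 1) * (S k * c (l + 1 - k)))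
      = (\<Sum>k=1..l+1. of_nat l * (S k * c (l + 1 - k)))"
    unfolding sum.distrib [symmetric]
  proof (intro sum.cong refl)
    fix k assume "k \<in> {1..l + 1}"
    then have "(of_nat (l + 1 - k) + of_nat (k - 1) :: complex) = of_nat l" by (simp flip: of_nat_add)
    then show "of_nat (l + 1 - k) * (S k * c (l + 1 - k)) + of_nat (k - 1) * (S k * c (l + 1 - k)) = of_nat l * (S k * c (l + 1 - k))"
      by (simp only: distrib_right [symmetric])
  qed
  also have "\<dots> = of_nat l * (2 * of_nat (l + 1) * c (l + 1))"
    unfolding rec by (simp only: sum_distrib_left)
  finally have 3: "(\<Sum>k=1..l+1. of_nat (l + 1 - k) * (S k * c (l + 1 - k))) + (\<Sum>k=1..l+1. of_nat (k - 1) * (S k * c (l + 1 - k)))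
      = of_nat l * (2 * of_nat (l + 1) * c (l + 1))" .
  have "(\<Sum>k=1..l. S k * (S 1 / 2 * c (l - k))) = S 1 / 2 * (2 * of_nat l * c l)"
    unfolding rec sum_distrib_left by (intro sum.cong) auto
  then have "(\<Sum>k=1..l. S k * (of_nat (l - k + 1) * c (l - k + 1) - S 1 / 2 * c (l - k)) + of_nat k * S (k + 1) * c (l - k))
    = of_nat l * (2 * of_nat (l + 1) * c (l + 1)) - S 1 / 2 * (2 * of_nat l * c l)"
    unfolding 3 [symmetric] 1 [symmetric] 2 [symmetric]
    by (simp only: sum.distrib sum_subtractf right_diff_distrib) simp
  then show ?thesis by (simp add: algebra_simps)
qed

text \<open>Likewise for \<open>x\<close>, with \<open>e = 1 / (x - y)\<close>: only the factor
  \<open>(1 - e t)\<close> to the power \<open>- 1 / 2\<close> of \<open>w / v\<close> depends on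
  \<open>x\<close>, and its logarithmic derivative has coefficients
  \<open>- e ^ (j + 1) / 2\<close>. The derivative of \<open>S k\<close> is
  \<open>- k e ^ (k + 1)\<close>.\<close>

lemma recurrence_derivative_x:
  "(\<Sum>k=1..l. S k * (- (1/2) * (\<Sum>s<l-k. c s * e ^ (l - k + 1 - s))) - of_nat k * e ^ (k + 1) * c (l - k))
    = 2 * of_nat l * (- (1/2) * (\<Sum>s<l. c s * e ^ (l + 1 - s)))"
proof -
  have "(\<Sum>k=1..l. S k * (\<Sum>s<l-k. c s * e ^ (l - k + 1 - s)))
      = (\<Sum>(k, s)\<in>(SIGMA k:{1..l}. {..<l-k}). S k * (c s * e ^ (l - k + 1 - s)))"
    unfolding sum_distrib_left by (rule sum.Sigma) auto
  also have "\<dots> = (\<Sum>(k, s)\<in>(SIGMA k:{1..l}. {..<l-k}). S k * (c s * e ^ (l + 1 - (k + s))))"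
  proof (intro sum.cong refl)
    fix z assume z: "z \<in> (SIGMA k:{1..l}. {..<l-k})"
    obtain k s' where ks: "z = (k, s')" by (cases z)
    then have "l - k + 1 - s' = l + 1 - (k + s')" using z by auto
    then show "(case z of (k, s) \<Rightarrow> S k * (c s * e ^ (l - k + 1 - s))) = (case z of (k, s) \<Rightarrow> S k * (c s * e ^ (l + 1 - (k + s))))"
      by (simp only: ks prod.case)
  qed
  \<comment> \<open>Collecting by \<open>q = k + s\<close> leaves as inner sum the recurrence for
    \<open>c q\<close>.\<close>
  also have "\<dots> = (\<Sum>(q, k)\<in>(SIGMA q:{..<l}. {1..q}). S k * (c (q - k) * e ^ (l + 1 - q)))"
    by (rule sum.reindex_bij_witness[where i = "\<lambda>(q, k). (k, q - k)" and j = "\<lambda>(k, s). (k + s, k)"]) auto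
  also have "\<dots> = (\<Sum>q<l. (\<Sum>k=1..q. S k * (c (q - k) * e ^ (l + 1 - q))))"
    by (simp add: sum.Sigma)
  also have "\<dots> = (\<Sum>q<l. 2 * of_nat q * c q * e ^ (l + 1 - q))"
    unfolding rec by (simp add: sum_distrib_right mult.assoc)
  finally have 1: "(\<Sum>k=1..l. S k * (\<Sum>s<l-k. c s * e ^ (l - k + 1 - s))) = (\<Sum>q<l. 2 * of_nat q * c q * e ^ (l + 1 - q))" .
  have 2: "(\<Sum>k=1..l. of_nat k * e ^ (k + 1) * c (l - k)) = (\<Sum>q<l. of_nat (l - q) * c q * e ^ (l + 1 - q))"
    by (rule sum.reindex_bij_witness[where i = "\<lambda>q. l - q" and j = "\<lambda>k. l - k"]) (auto simp: Suc_diff_le)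
  have "(\<Sum>k=1..l. S k * (- (1/2) * (\<Sum>s<l-k. c s * e ^ (l - k + 1 - s))) - of_nat k * e ^ (k + 1) * c (l - k))
      = - (1/2) * (\<Sum>k=1..l. S k * (\<Sum>s<l-k. c s * e ^ (l - k + 1 - s))) - (\<Sum>k=1..l. of_nat k * e ^ (k + 1) * c (l - k))"
    by (simp add: sum_subtractf sum_distrib_left mult_ac sum_negf)
  also have "\<dots> = - (\<Sum>q<l. of_nat q * c q * e ^ (l + 1 - q)) - (\<Sum>q<l. of_nat (l - q) * c q * e ^ (l + 1 - q))"
    unfolding 1 2 by (simp add: sum_distrib_left mult_ac sum_negf)
  also have "\<dots> = - (\<Sum>q<l. of_nat q * c q * e ^ (l + 1 - q) + of_nat (l - q) * c q * e ^ (l + 1 - q))"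
    by (simp add: sum.distrib)
  also have "(\<Sum>q<l. of_nat q * c q * e ^ (l + 1 - q) + of_nat (l - q) * c q * e ^ (l + 1 - q))
      = (\<Sum>q<l. of_nat l * (c q * e ^ (l + 1 - q)))"
    by (intro sum.cong refl) (auto simp: of_nat_diff algebra_simps)
  finally show ?thesis by (simp add: sum_distrib_left sum_negf mult_ac)
qed

end

lemma has_derivative_Sig:
  fixes x y :: complex
  assumes "y \<noteq> 0" "y \<noteq> 1" "y \<noteq> x"
  shows "((\<lambda>p. Sig k (fst p) (snd p)) has_derivative
    (\<lambda>h. of_nat k * Sig (k + 1) x y * snd h - of_nat k * (1 / (x - y)) ^ (k + 1) * fst h)) (at (x, y))"
proof -
  have D: "((\<lambda>z. 1 / z ^ k) has_field_derivative - of_nat k * (1 / z) ^ (k + 1)) (at z)" if "z \<noteq> 0" for z :: complex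
  proof -
    have "((\<lambda>z. 1 / z ^ k) has_field_derivative (0 * z ^ k - 1 * (of_nat k * z ^ (k - Suc 0))) / (z ^ k * z ^ k)) (at z)"
      using that by (auto intro!: derivative_eq_intros)
    moreover have "(0 * z ^ k - 1 * (of_nat k * z ^ (k - Suc 0))) / (z ^ k * z ^ k) = - of_nat k * (1 / z) ^ (k + 1)"
      using that by (cases k) (auto simp: divide_simps)
    ultimately show ?thesis by simp
  qed
  have comp: "((\<lambda>p. 1 / g p ^ k) has_derivative (\<lambda>h. - of_nat k * (1 / g (x, y)) ^ (k + 1) * g' h)) (at (x, y))"
    if "(g has_derivative g') (at (x, y))" "g (x, y) \<noteq> 0" for g g' :: "complex \<times> complex \<Rightarrow> complex"
    using has_derivative_compose[OF that(1), of "\<lambda>z. 1 / z ^ k"] D[OF that(2)] unfolding has_field_derivative_def by blast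
  have "((\<lambda>p. 1 / (- snd p) ^ k + 1 / (1 - snd p) ^ k + 1 / (fst p - snd p) ^ k) has_derivative
     (\<lambda>h. - of_nat k * (1 / (- y)) ^ (k + 1) * (- snd h) + - of_nat k * (1 / (1 - y)) ^ (k + 1) * (- snd h)
        + - of_nat k * (1 / (x - y)) ^ (k + 1) * (fst h - snd h))) (at (x, y))"
    by (intro has_derivative_add)
      (rule comp[of "\<lambda>p. - snd p" "\<lambda>h. - snd h", simplified fst_conv snd_conv]
        comp[of "\<lambda>p. 1 - snd p" "\<lambda>h. - snd h", simplified fst_conv snd_conv]
        comp[of "\<lambda>p. fst p - snd p" "\<lambda>h. fst h - snd h", simplified fst_conv snd_conv];
       (use assms in \<open>auto intro!: derivative_eq_intros\<close>))+
  moreover have "(\<lambda>h. - of_nat k * (1 / (- y)) ^ (k + 1) * (- snd h) + - of_nat k * (1 / (1 - y)) ^ (k + 1) * (- snd h)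
        + - of_nat k * (1 / (x - y)) ^ (k + 1) * (fst h - snd h))
     = (\<lambda>h. of_nat k * Sig (k + 1) x y * snd h - of_nat k * (1 / (x - y)) ^ (k + 1) * fst h)"
  proof
    fix h :: "complex \<times> complex"
    have Sig: "Sig (k + 1) x y = (1 / (- y)) ^ (k + 1) + (1 / (1 - y)) ^ (k + 1) + (1 / (x - y)) ^ (k + 1)"
      by (simp only: Sig_def power_one_over)
    have "- n * P * (- s) + - n * Q * (- s) + - n * R * (r - s) = n * (P + Q + R) * s - n * R * r"
      for n P Q R r s :: complex by (simp add: algebra_simps)
    then show "- of_nat k * (1 / (- y)) ^ (k + 1) * (- snd h) + - of_nat k * (1 / (1 - y)) ^ (k + 1) * (- snd h)
        + - of_nat k * (1 / (x - y)) ^ (k + 1) * (fst h - snd h)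
      = of_nat k * Sig (k + 1) x y * snd h - of_nat k * (1 / (x - y)) ^ (k + 1) * fst h"
      unfolding Sig .
  qed
  ultimately show ?thesis by (simp add: Sig_def)
qed

text \<open>Strong induction along the recurrence, whose differentiated form is solved by the
  candidates \<open>DX\<close> and \<open>DY\<close>; dividing by \<open>2 l\<close> recovers the
  derivative of the coefficient itself.\<close>

lemma has_derivative_taylor_coeff:
  fixes x y :: complex
  assumes "y \<noteq> 0" "y \<noteq> 1" "y \<noteq> x"
  shows "((\<lambda>p. taylor_coeff l (fst p) (snd p)) has_derivative
    (\<lambda>h. (- (1/2) * (\<Sum>s<l. taylor_coeff s x y * (1 / (x - y)) ^ (l + 1 - s))) * fst h
       + (of_nat (l + 1) * taylor_coeff (l + 1) x y - Sig 1 x y / 2 * taylor_coeff l x y) * snd h)) (at (x, y))"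
proof (induction l rule: less_induct)
  case (less l)
  define S where "S k = Sig k x y" for k
  define c where "c k = taylor_coeff k x y" for k
  define e where "e = 1 / (x - y)"
  define DX where "DX l = - (1/2) * (\<Sum>s<l. c s * e ^ (l + 1 - s))" for l
  define DY where "DY l = of_nat (l + 1) * c (l + 1) - S 1 / 2 * c l" for l
  have rec: "2 * of_nat l * c l = (\<Sum>k=1..l. S k * c (l - k))" for l
    unfolding c_def S_def by (rule taylor_coeff_recurrence)
  note IH = less.IH[folded S_def c_def e_def, folded DX_def DY_def]
  show ?case
    unfolding c_def [symmetric] S_def [symmetric] e_def [symmetric] DX_def [symmetric] DY_def [symmetric]
  proof (cases "l = 0")
    case True
    \<comment> \<open>For \<open>l = 0\<close> the coefficient is constant, and
      \<open>DY 0 = c 1 - S 1 / 2\<close> must vanish.\<close>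
    have "c 1 * 2 = S 1" using rec[of 1] by (simp add: c_def mult.commute)
    then have "DX 0 = 0" "DY 0 = 0" by (simp_all add: DX_def DY_def c_def)
    then show "((\<lambda>p. taylor_coeff l (fst p) (snd p)) has_derivative (\<lambda>h. DX l * fst h + DY l * snd h)) (at (x, y))"
      using True by simp
  next
    case False
    have eq: "taylor_coeff l (fst p) (snd p) =
        (\<Sum>k=1..l. Sig k (fst p) (snd p) * taylor_coeff (l - k) (fst p) (snd p)) * (1 / (2 * of_nat l))" for p
      using taylor_coeff_recurrence[of l "fst p" "snd p"] False by (simp add: field_simps)
    have "((\<lambda>p. Sig k (fst p) (snd p) * taylor_coeff (l - k) (fst p) (snd p)) has_derivative
        (\<lambda>h. (S k * DX (l - k) - of_nat k * e ^ (k + 1) * c (l - k)) * fst h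
            + (S k * DY (l - k) + of_nat k * S (k + 1) * c (l - k)) * snd h)) (at (x, y))"
      if "k \<in> {1..l}" for k
    proof -
      have lt: "l - k < l" using that by auto
      have "((\<lambda>p. Sig k (fst p) (snd p) * taylor_coeff (l - k) (fst p) (snd p)) has_derivative
        (\<lambda>h. Sig k (fst (x, y)) (snd (x, y)) * (DX (l - k) * fst h + DY (l - k) * snd h)
           + (of_nat k * Sig (k + 1) x y * snd h - of_nat k * (1 / (x - y)) ^ (k + 1) * fst h) * taylor_coeff (l - k) (fst (x, y)) (snd (x, y)))) (at (x, y))"
        by (rule has_derivative_mult[OF has_derivative_Sig[OF assms] IH[OF lt]])
      then show ?thesis
        by (rule has_derivative_eq_rhs) (simp add: fun_eq_iff S_def c_def e_def algebra_simps)
    qed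
    then have "((\<lambda>p. \<Sum>k=1..l. Sig k (fst p) (snd p) * taylor_coeff (l - k) (fst p) (snd p)) has_derivative
        (\<lambda>h. \<Sum>k=1..l. (S k * DX (l - k) - of_nat k * e ^ (k + 1) * c (l - k)) * fst h
            + (S k * DY (l - k) + of_nat k * S (k + 1) * c (l - k)) * snd h)) (at (x, y))"
      by (intro has_derivative_sum)
    moreover have "(\<lambda>h. \<Sum>k=1..l. (S k * DX (l - k) - of_nat k * e ^ (k + 1) * c (l - k)) * fst h
            + (S k * DY (l - k) + of_nat k * S (k + 1) * c (l - k)) * snd h)
        = (\<lambda>h. 2 * of_nat l * DX l * fst h + 2 * of_nat l * DY l * snd h)"
    proof
      have lin: "(\<Sum>k\<in>I. A k * r + B k * s) = sum A I * r + sum B I * s" for A B :: "nat \<Rightarrow> complex" and I r s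
        by (simp add: sum.distrib sum_distrib_right)
      have "(\<Sum>k=1..l. S k * DX (l - k) - of_nat k * e ^ (k + 1) * c (l - k)) = 2 * of_nat l * DX l"
        unfolding DX_def by (rule recurrence_derivative_x[OF rec])
      moreover have "(\<Sum>k=1..l. S k * DY (l - k) + of_nat k * S (k + 1) * c (l - k)) = 2 * of_nat l * DY l"
        unfolding DY_def by (rule recurrence_derivative_y[OF rec])
      ultimately show "(\<Sum>k=1..l. (S k * DX (l - k) - of_nat k * e ^ (k + 1) * c (l - k)) * fst h
            + (S k * DY (l - k) + of_nat k * S (k + 1) * c (l - k)) * snd h)
        = 2 * of_nat l * DX l * fst h + 2 * of_nat l * DY l * snd h" for h
        unfolding lin by (simp only:)
    qed
    ultimately have "((\<lambda>p. (\<Sum>k=1..l. Sig k (fst p) (snd p) * taylor_coeff (l - k) (fst p) (snd p)) * (1 / (2 * of_nat l))) has_derivative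
        (\<lambda>h. (2 * of_nat l * DX l * fst h + 2 * of_nat l * DY l * snd h) * (1 / (2 * of_nat l)))) (at (x, y))"
      by (intro has_derivative_mult_left) simp
    then show "((\<lambda>p. taylor_coeff l (fst p) (snd p)) has_derivative (\<lambda>h. DX l * fst h + DY l * snd h)) (at (x, y))"
      unfolding eq [symmetric] by (rule has_derivative_eq_rhs) (use False in \<open>simp add: fun_eq_iff field_simps\<close>)
  qed
qed

section \<open>Reduction of the differential of the second kind\<close>

lemma tendsto_zero_mult_bounded:
  fixes f g :: "'a \<Rightarrow> complex"
  assumes "(f \<longlongrightarrow> 0) F" "\<forall>\<^sub>F z in F. norm (g z) \<le> B"
  shows "((\<lambda>z. f z * g z) \<longlongrightarrow> 0) F"
proof (rule Lim_null_comparison)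
  show "\<forall>\<^sub>F z in F. norm (f z * g z) \<le> norm (f z) * B"
    using assms(2) by eventually_elim (simp add: norm_mult mult_left_mono)
  have "((\<lambda>z. norm (f z) * B) \<longlongrightarrow> norm (0::complex) * B) F" by (intro tendsto_intros assms(1))
  then show "((\<lambda>z. norm (f z) * B) \<longlongrightarrow> 0) F" by simp
qed

lemma finite_cubic_zeros: "finite {u. cubic x u = 0}"
proof -
  have "{u. cubic x u = 0} = {0, 1, x}" by (auto simp: cubic_eq_0_iff)
  then show ?thesis by simp
qed

text \<open>The difference quotient at a point \<open>p\<close> outside \<open>F\<close> tends to 0
  at infinity, so the version with a limit shows that it vanishes.\<close>

lemma Liouville_removable_bounded:
  assumes F: "finite F" and hol: "f holomorphic_on - F" and lim: "\<And>e. e \<in> F \<Longrightarrow> ((\<lambda>z. (z - e) * f z) \<longlongrightarrow> 0) (at e)"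
    and bd: "\<forall>\<^sub>F z in at_infinity. norm (f z) \<le> B"
  obtains c where "\<And>z. z \<notin> F \<Longrightarrow> f z = c"
proof -
  obtain p where p: "p \<notin> F" using F ex_new_if_finite[OF infinite_UNIV_char_0] by blast
  define k where "k z = (f z - f p) / (z - p)" for z
  have "k z = 0" if z: "z \<notin> insert p F" for z
  proof (rule Liouville_removable[where F = "insert p F" and f = k and l = 0 and z = z])
    show "finite (insert p F)" using F by simp
    show "k holomorphic_on - insert p F"
      unfolding k_def by (intro holomorphic_intros holomorphic_on_subset[OF hol]) auto
    show "((\<lambda>z. (z - e) * k z) \<longlongrightarrow> 0) (at e)" if "e \<in> insert p F" for e
    proof (cases "e = p")
      case True
      have "open (- F)" using F by (simp add: finite_imp_closed open_Compl)
      then have "isCont f p" using hol p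
        by (metis ComplI continuous_on_eq_continuous_at holomorphic_on_imp_continuous_on)
      then have "((\<lambda>z. f z - f p) \<longlongrightarrow> f p - f p) (at p)" by (intro tendsto_intros) (simp add: isCont_def)
      moreover have "\<forall>\<^sub>F z in at p. f z - f p = (z - p) * k z"
        by (auto simp: eventually_at_filter k_def)
      ultimately have "((\<lambda>z. (z - p) * k z) \<longlongrightarrow> f p - f p) (at p)" by (rule Lim_transform_eventually)
      then show ?thesis using True by simp
    next
      case False
      then have e: "e \<in> F" "e \<noteq> p" using that by auto
      have "((\<lambda>z. ((z - e) * f z - (z - e) * f p) / (z - p)) \<longlongrightarrow> (0 - (e - e) * f p) / (e - p)) (at e)"
        by (intro tendsto_intros lim e) (use e in auto)
      moreover have "((z - e) * f z - (z - e) * f p) / (z - p) = (z - e) * k z" for z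
        by (simp add: k_def algebra_simps diff_divide_distrib add_divide_distrib)
      ultimately show ?thesis by simp
    qed
    have "((\<lambda>z. (\<lambda>w. w / (1 - p * w)) (inverse z)) \<longlongrightarrow> (\<lambda>w. w / (1 - p * w)) 0) at_infinity"
      by (rule isCont_tendsto_compose[OF _ tendsto_inverse_0]) (auto intro!: continuous_intros)
    moreover have "\<forall>\<^sub>F z in at_infinity. (\<lambda>w. w / (1 - p * w)) (inverse z) = 1 / (z - p)"
      using eventually_not_equal_at_infinity[of 0]
      by eventually_elim (simp add: divide_simps)
    ultimately have "((\<lambda>z. 1 / (z - p)) \<longlongrightarrow> (\<lambda>w. w / (1 - p * w)) 0) at_infinity"
      by (rule Lim_transform_eventually)
    then have inv: "((\<lambda>z. 1 / (z - p)) \<longlongrightarrow> 0) at_infinity" by simp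
    have "\<forall>\<^sub>F z in at_infinity. norm (f z - f p) \<le> B + norm (f p)"
      using bd by eventually_elim (metis norm_triangle_ineq4 add_mono order_refl order_trans)
    from tendsto_zero_mult_bounded[OF inv this] show "(k \<longlongrightarrow> 0) at_infinity"
      by (simp add: k_def [abs_def])
  qed (use z in simp)
  then have "f z = f p" if "z \<notin> F" for z
    using that by (cases "z = p") (auto simp: k_def)
  then show ?thesis using that by blast
qed

definition cubic' :: "complex \<Rightarrow> complex \<Rightarrow> complex" where
  "cubic' x z = (z - 1) * (z - x) + z * (z - x) + z * (z - 1)"

lemma has_field_derivative_branch_ball:
  assumes P: "P \<in> unramified x" and hol: "branch x P holomorphic_on ball (fst P) r"
    and z: "z \<in> ball (fst P) r" "branch x P z \<noteq> 0"
  shows "(branch x P has_field_derivative cubic' x z / (2 * branch x P z)) (at z)"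
proof -
  obtain d where d: "(branch x P has_field_derivative d) (at z)"
    using holomorphic_on_deriv_exists[OF hol open_ball z(1)] .
  have "((\<lambda>z. (branch x P z)\<^sup>2) has_field_derivative 2 * branch x P z * d) (at z)"
    by (auto intro!: derivative_eq_intros d)
  then have "(cubic x has_field_derivative 2 * branch x P z * d) (at z)"
    by (simp add: branch_square[OF P])
  then have "2 * branch x P z * d = cubic' x z"
    unfolding cubic'_def using has_field_derivative_cubic DERIV_unique by blast
  then have "d = cubic' x z / (2 * branch x P z)" using z(2) by (simp add: field_simps)
  with d show ?thesis by simp
qed

lemma cubic'_eq:
  assumes "cubic x z \<noteq> 0"
  shows "cubic' x z = - Sig 1 x z * cubic x z"
proof -
  have nz: "z \<noteq> 0" "z - 1 \<noteq> 0" "z - x \<noteq> 0" using assms by (auto simp: cubic_def)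
  have "Sig 1 x z = 1 / (- z) + 1 / (- (z - 1)) + 1 / (- (z - x))" by (simp add: Sig_def)
  then have Sig: "- Sig 1 x z = 1 / z + 1 / (z - 1) + 1 / (z - x)" by (simp only: minus_divide_right [symmetric]) simp
  have "(1 / a + 1 / b + 1 / c) * (a * b * c) = b * c + a * c + a * b" if "a \<noteq> 0" "b \<noteq> 0" "c \<noteq> 0" for a b c :: complex
    using that by (simp add: field_simps)
  from this[OF nz] show ?thesis unfolding Sig cubic'_def cubic_def by simp
qed

text \<open>The quotient is the \<open>i\<close>-th Taylor coefficient of \<open>1 / v\<close> at
  the moving centre \<open>z\<close>, so its derivative is \<open>i + 1\<close> times the next one.
  The \<open>Sig 1\<close> term cancels against the derivative of the branch.\<close>

lemma has_field_derivative_taylor_over_branch: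
  assumes P: "P \<in> unramified x" and hol: "branch x P holomorphic_on ball (fst P) r"
    and z: "z \<in> ball (fst P) r" "branch x P z \<noteq> 0"
  shows "((\<lambda>z. taylor_coeff i x z / branch x P z) has_field_derivative
     of_nat (Suc i) * taylor_coeff (Suc i) x z / branch x P z) (at z)"
proof -
  have nz: "cubic x z \<noteq> 0" using branch_square[OF P, of z] z(2) by auto
  then have z3: "z \<noteq> 0" "z \<noteq> 1" "z \<noteq> x" by (auto simp: cubic_def)
  let ?c = "taylor_coeff i x z" and ?c' = "of_nat (Suc i) * taylor_coeff (Suc i) x z - Sig 1 x z / 2 * taylor_coeff i x z"
  have "((\<lambda>z. (x, z)) has_derivative (\<lambda>h. (0, h))) (at z)" by (auto intro!: derivative_eq_intros)
  from has_derivative_compose[OF this has_derivative_taylor_coeff[OF z3, of i]]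
  have "((\<lambda>z. taylor_coeff i x z) has_field_derivative ?c') (at z)"
    by (simp add: has_field_derivative_def)
  moreover note has_field_derivative_branch_ball[OF P hol z]
  ultimately have "((\<lambda>z. taylor_coeff i x z / branch x P z) has_field_derivative
     (?c' * branch x P z - ?c * (cubic' x z / (2 * branch x P z))) / (branch x P z * branch x P z)) (at z)"
    by (rule DERIV_divide) (rule z(2))
  moreover have "cubic' x z = - Sig 1 x z * (branch x P z * branch x P z)"
    using cubic'_eq[OF nz] branch_square[OF P, of z] by (simp add: power2_eq_square)
  then have "(?c' * branch x P z - ?c * (cubic' x z / (2 * branch x P z))) / (branch x P z * branch x P z)
      = of_nat (Suc i) * taylor_coeff (Suc i) x z / branch x P z"
  proof -
    assume eq: "cubic' x z = - Sig 1 x z * (branch x P z * branch x P z)"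
    have "cubic' x z / (2 * branch x P z) = - Sig 1 x z * branch x P z / 2"
      unfolding eq using z(2) by simp
    then have "?c' * branch x P z - ?c * (cubic' x z / (2 * branch x P z))
        = of_nat (Suc i) * taylor_coeff (Suc i) x z * branch x P z"
      by (simp add: algebra_simps)
    then show ?thesis using z(2) by simp
  qed
  ultimately show ?thesis by simp
qed

text \<open>\<open>polar_part n x (y, w)\<close> is the function \<open>r\<close> of \<open>u\<close> for which \<open>v r\<close> has principal part
  \<open>- 1 / ((n + 1) (u - y) ^ (n + 1))\<close> at \<open>(y, w)\<close>: a truncated expansion of \<open>1 / v\<close>.\<close>

definition polar_part :: "nat \<Rightarrow> complex \<Rightarrow> complex \<times> complex \<Rightarrow> complex \<Rightarrow> complex" where
  "polar_part n x Q u =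
     (\<Sum>i\<le>n. - (taylor_coeff i x (fst Q) / snd Q / of_nat (Suc n)) / (u - fst Q) ^ (n + 1 - i))"

definition polar_part' :: "nat \<Rightarrow> complex \<Rightarrow> complex \<times> complex \<Rightarrow> complex \<Rightarrow> complex" where
  "polar_part' n x Q u =
     (\<Sum>i\<le>n. of_nat (n + 1 - i) * (taylor_coeff i x (fst Q) / snd Q / of_nat (Suc n)) / (u - fst Q) ^ (n + 2 - i))"

lemma has_field_derivative_over_power:
  fixes y :: complex
  assumes "u \<noteq> y" "k > 0"
  shows "((\<lambda>u. - c / (u - y) ^ k) has_field_derivative of_nat k * c / (u - y) ^ (k + 1)) (at u)"
proof -
  have "((\<lambda>u. - c / (u - y) ^ k) has_field_derivative
      (0 * (u - y) ^ k - (- c) * (of_nat k * (u - y) ^ (k - 1))) / ((u - y) ^ k * (u - y) ^ k)) (at u)"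
    using assms by (auto intro!: derivative_eq_intros)
  moreover have "(0 * (u - y) ^ k - (- c) * (of_nat k * (u - y) ^ (k - 1))) / ((u - y) ^ k * (u - y) ^ k)
      = of_nat k * c / (u - y) ^ (k + 1)"
    using assms by (cases k) (auto simp: divide_simps)
  ultimately show ?thesis by simp
qed

lemma has_field_derivative_polar_part:
  assumes "u \<noteq> fst Q"
  shows "(polar_part n x Q has_field_derivative polar_part' n x Q u) (at u)"
proof -
  have "((\<lambda>u. \<Sum>i\<le>n. - (taylor_coeff i x (fst Q) / snd Q / of_nat (Suc n)) / (u - fst Q) ^ (n + 1 - i))
     has_field_derivative (\<Sum>i\<le>n. of_nat (n + 1 - i) * (taylor_coeff i x (fst Q) / snd Q / of_nat (Suc n)) / (u - fst Q) ^ (n + 1 - i + 1))) (at u)"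
    by (intro DERIV_sum has_field_derivative_over_power assms) auto
  moreover have "(\<Sum>i\<le>n. of_nat (n + 1 - i) * (taylor_coeff i x (fst Q) / snd Q / of_nat (Suc n)) / (u - fst Q) ^ (n + 1 - i + 1)) = polar_part' n x Q u"
    unfolding polar_part'_def by (intro sum.cong refl) (simp add: Suc_diff_le)
  ultimately show ?thesis unfolding polar_part_def [abs_def] by simp
qed

text \<open>\<open>polar_part\<close> truncates the expansion of \<open>1 / v\<close>, so
  multiplying by \<open>v\<close> leaves the pure pole plus the Taylor remainder divided by
  \<open>(z - y) ^ (n + 1)\<close>. That is bounded, and Riemann's theorem extends it to
  \<open>B\<close>.\<close>

lemma polar_part_regular:
  assumes P: "P \<in> unramified x"
  obtains r B where "r > 0" "branch x P holomorphic_on ball (fst P) r" "B holomorphic_on ball (fst P) r"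
    "\<And>z. z \<in> ball (fst P) r \<Longrightarrow> branch x P z \<noteq> 0 \<and> (z, branch x P z) \<in> unramified x"
    "\<And>z. z \<in> ball (fst P) r - {fst P} \<Longrightarrow>
      branch x P z * polar_part n x P z = B z - 1 / (of_nat (Suc n) * (z - fst P) ^ (n + 1))"
proof -
  obtain r where r: "r > 0" "branch x P holomorphic_on ball (fst P) r"
    "\<And>z. z \<in> ball (fst P) r \<Longrightarrow> branch x P z \<noteq> 0 \<and> (z, branch x P z) \<in> unramified x"
    using branch_holomorphic[OF P] by blast
  define y where "y = fst P"
  \<comment> \<open>\<open>f i\<close> is the \<open>i\<close>-th derivative of
    \<open>1 / branch x P\<close>.\<close>
  define f where "f i z = fact i * (taylor_coeff i x z / branch x P z)" for i z
  have f: "(f i has_field_derivative f (Suc i) z) (at z)" if "z \<in> ball y r" for i z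
  proof -
    have "((\<lambda>z. fact i * (taylor_coeff i x z / branch x P z)) has_field_derivative
      fact i * (of_nat (Suc i) * taylor_coeff (Suc i) x z / branch x P z)) (at z)"
      by (intro DERIV_cmult has_field_derivative_taylor_over_branch[OF P r(2)])
        (use that r(3) in \<open>auto simp: y_def\<close>)
    moreover have "fact i * (of_nat (Suc i) * taylor_coeff (Suc i) x z / branch x P z) = f (Suc i) z"
      by (simp add: f_def algebra_simps)
    moreover have "f i = (\<lambda>z. fact i * (taylor_coeff i x z / branch x P z))" by (rule ext) (simp only: f_def)
    ultimately show ?thesis by (simp only:)
  qed
  have "continuous_on (cball y (r / 2)) (f (Suc n))"
  proof (intro continuous_at_imp_continuous_on ballI)
    fix z assume "z \<in> cball y (r / 2)"
    then have "z \<in> ball y r" using r(1) by auto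
    then show "isCont (f (Suc n)) z" using f DERIV_isCont by blast
  qed
  then have "compact (f (Suc n) ` cball y (r / 2))" by (intro compact_continuous_image) auto
  then obtain C where C: "\<And>z. z \<in> cball y (r / 2) \<Longrightarrow> norm (f (Suc n) z) \<le> C"
    by (metis bounded_iff compact_imp_bounded imageI)
  have taylor: "norm (f 0 z - (\<Sum>i\<le>n. f i y * (z - y) ^ i / fact i)) \<le> C * norm (z - y) ^ Suc n / fact n"
    if "z \<in> cball y (r / 2)" for z
  proof (rule complex_Taylor[of "cball y (r / 2)" n f C y z])
    show "(f i has_field_derivative f (Suc i) z) (at z within cball y (r / 2))" if "z \<in> cball y (r / 2)" for i z
      by (rule has_field_derivative_at_within[OF f]) (use that r(1) in auto)
  qed (use C that r(1) in auto)
  let ?B0 = "\<lambda>z. branch x P z * polar_part n x P z + 1 / (of_nat (Suc n) * (z - y) ^ (n + 1))"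
  have polar: "polar_part n x P z = - (\<Sum>i\<le>n. f i y * (z - y) ^ i / fact i) / (of_nat (Suc n) * (z - y) ^ (n + 1))"
    if "z \<noteq> y" for z
  proof -
    have "polar_part n x P z = (\<Sum>i\<le>n. - (f i y * (z - y) ^ i / fact i) / (of_nat (Suc n) * (z - y) ^ (n + 1)))"
      unfolding polar_part_def
    proof (intro sum.cong refl)
      fix i assume "i \<in> {..n}"
      then have "(z - y) ^ (n + 1) = (z - y) ^ i * (z - y) ^ (n + 1 - i)" by (simp flip: power_add)
      then show "- (taylor_coeff i x (fst P) / snd P / of_nat (Suc n)) / (z - fst P) ^ (n + 1 - i)
          = - (f i y * (z - y) ^ i / fact i) / (of_nat (Suc n) * (z - y) ^ (n + 1))"
        using that by (simp add: f_def y_def branch_base[OF P] del: of_nat_Suc)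
    qed
    then show ?thesis by (simp only: sum_negf sum_divide_distrib [symmetric] minus_divide_left [symmetric])
  qed
  have B0: "?B0 z = branch x P z / of_nat (Suc n) * ((f 0 z - (\<Sum>i\<le>n. f i y * (z - y) ^ i / fact i)) / (z - y) ^ (n + 1))"
    if "z \<in> ball y r - {y}" for z
  proof -
    have "branch x P z \<noteq> 0" "z - y \<noteq> 0" using that r(3) by (auto simp: y_def)
    moreover have "b * (- S / (N * D)) + 1 / (N * D) = b / N * ((1 / b - S) / D)"
      if "b \<noteq> 0" "N \<noteq> 0" "D \<noteq> 0" for b S N D :: complex
      using that by (simp add: field_simps)
    moreover have "f 0 z = 1 / branch x P z" by (simp add: f_def)
    moreover have "z \<noteq> y" using that by simp
    ultimately show ?thesis unfolding polar[OF \<open>z \<noteq> y\<close>] by (simp del: of_nat_Suc)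
  qed
  have "?B0 holomorphic_on ball y r - {y}"
  proof (intro holomorphic_intros holomorphic_on_subset[OF r(2)])
    show "polar_part n x P holomorphic_on ball y r - {y}"
      using has_field_derivative_polar_part[of _ P n x]
      by (auto simp: holomorphic_on_def y_def field_differentiable_def intro: has_field_derivative_at_within)
  qed (auto simp: y_def simp del: of_nat_Suc)
  moreover have "\<exists>B. \<forall>\<^sub>F z in at y. norm (?B0 z) \<le> B"
  proof -
    have "isCont (\<lambda>z. branch x P z / of_nat (Suc n)) y"
      unfolding y_def by (intro continuous_intros branch_isCont[OF P]) (simp del: of_nat_Suc)
    then have "\<forall>\<^sub>F z in nhds y. branch x P z / of_nat (Suc n) \<in> ball (branch x P y / of_nat (Suc n)) 1"
      by (intro isCont_eventually_mem) auto
    then have 1: "\<forall>\<^sub>F z in at y. norm (branch x P z / of_nat (Suc n)) \<le> norm (branch x P y / of_nat (Suc n)) + 1"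
      unfolding eventually_nhds_conv_at
      by (auto elim!: eventually_mono simp: dist_norm simp del: of_nat_Suc)
        (smt (verit) norm_minus_commute norm_triangle_sub)
    have 2: "\<forall>\<^sub>F z in at y. z \<in> cball y (r / 2) - {y}"
      using r(1) by (auto simp: eventually_at dist_commute intro!: exI[of _ "r / 2"])
    have "\<forall>\<^sub>F z in at y. norm (?B0 z) \<le> (norm (branch x P y / of_nat (Suc n)) + 1) * (C / fact n)"
      using 1 2
    proof eventually_elim
      case (elim z)
      then have z: "z \<in> ball y r - {y}" using r(1) by auto
      have "norm ((f 0 z - (\<Sum>i\<le>n. f i y * (z - y) ^ i / fact i)) / (z - y) ^ (n + 1)) \<le> C / fact n"
      proof -
        have "norm (z - y) ^ Suc n > 0" using z by simp
        then show ?thesis using taylor[of z] elim(2)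
          by (simp add: norm_divide norm_power pos_divide_le_eq del: power_Suc)
      qed
      then show ?case unfolding B0[OF z] norm_mult
        by (intro mult_mono elim(1)) auto
    qed
    then show ?thesis by blast
  qed
  ultimately obtain B where B: "B holomorphic_on ball y r" "\<And>z. z \<in> ball y r - {y} \<Longrightarrow> B z = ?B0 z"
    using holomorphic_on_extend_bounded[of ?B0 "ball y r" y] r(1) by auto
  show ?thesis
    by (rule that[OF r(1,2) _ r(3)]) (use B in \<open>auto simp: y_def simp del: of_nat_Suc\<close>)
qed

text \<open>With \<open>r\<close> the polar part this is \<open>v\<close> times the
  \<open>u\<close>-derivative of \<open>v r\<close>: an even expression, so it contains only
  \<open>cubic\<close> and its derivative.\<close>

definition reduced_form :: "nat \<Rightarrow> complex \<Rightarrow> complex \<times> complex \<Rightarrow> complex \<Rightarrow> complex" where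
  "reduced_form n x Q u = cubic' x u / 2 * polar_part n x Q u + cubic x u * polar_part' n x Q u"

text \<open>The term with \<open>(u - y) ^ k\<close> in the denominator behaves like
  \<open>(3 / 2 - k)\<close> times \<open>u\<close> to the power \<open>2 - k\<close>. So only
  \<open>k = 1\<close>, that is \<open>i = n\<close>, grows, like \<open>u / 2\<close>, with the
  coefficient minus the \<open>n\<close>-th Taylor coefficient of \<open>1 / v\<close> divided by
  \<open>n + 1\<close>.\<close>

lemma reduced_form_infinity:
  "\<exists>B. \<forall>\<^sub>F u in at_infinity. norm (reduced_form n x Q u + taylor_coeff n x (fst Q) / snd Q / of_nat (Suc n) * u / 2) \<le> B"
proof -
  define y where "y = fst Q"
  define \<rho> where "\<rho> i = - (taylor_coeff i x y / snd Q / of_nat (Suc n))" for i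
  define T where "T k u = cubic' x u / 2 / (u - y) ^ k - of_nat k * cubic x u / (u - y) ^ (k + 1)" for k u
  \<comment> \<open>The coefficient of \<open>u\<close> in the growth of \<open>T k\<close>; it is
    nonzero only for \<open>k = 1\<close>.\<close>
  define \<epsilon> :: "nat \<Rightarrow> complex" where "\<epsilon> k = (if k = 1 then 1 / 2 else 0)" for k
  have red: "reduced_form n x Q u = (\<Sum>i\<le>n. \<rho> i * T (n + 1 - i) u)" for u
  proof -
    have gen: "c' / 2 * (r / d ^ k) + c * (of_nat k * (- r) / d ^ (k + 1))
        = r * (c' / 2 / d ^ k - of_nat k * c / d ^ (k + 1))" for c c' r d :: complex and k
      by (simp add: right_diff_distrib mult_ac)
    have "reduced_form n x Q u = (\<Sum>i\<le>n. cubic' x u / 2 * (\<rho> i / (u - y) ^ (n + 1 - i)) +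
        cubic x u * (of_nat (n + 1 - i) * (- \<rho> i) / (u - y) ^ (n + 2 - i)))"
      by (simp only: reduced_form_def polar_part_def polar_part'_def \<rho>_def y_def sum_distrib_left sum.distrib minus_minus)
    also have "\<dots> = (\<Sum>i\<le>n. \<rho> i * T (n + 1 - i) u)"
    proof (intro sum.cong refl)
      fix i assume "i \<in> {..n}"
      then have "n + 2 - i = n + 1 - i + 1" by auto
      then show "cubic' x u / 2 * (\<rho> i / (u - y) ^ (n + 1 - i)) +
        cubic x u * (of_nat (n + 1 - i) * (- \<rho> i) / (u - y) ^ (n + 2 - i)) = \<rho> i * T (n + 1 - i) u"
        by (simp only: T_def gen)
    qed
    finally show ?thesis .
  qed
  let ?\<sigma> = "\<lambda>w. 3 - 2 * (1 + x) * w + x * w\<^sup>2" and ?\<tau> = "\<lambda>w. (1 - w) * (1 - x * w)"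
  have lim: "\<exists>l. ((\<lambda>u. T k u - \<epsilon> k * u) \<longlongrightarrow> l) at_infinity" if "k \<ge> 1" for k
  proof -
    obtain K where K: "isCont K 0" "\<And>w. w \<noteq> 0 \<Longrightarrow> 1 - y * w \<noteq> 0 \<Longrightarrow> K w = T k (inverse w) - \<epsilon> k * inverse w"
    proof (cases "k = 1")
      case True
      let ?K = "\<lambda>w. (- y / 2 + (- x / 2 + (1 + x) * y - y\<^sup>2 / 2) * w - x * y / 2 * w\<^sup>2) / (1 - y * w)\<^sup>2"
      show ?thesis
      proof (rule that[of ?K])
        show "isCont ?K 0" by (intro continuous_intros) auto
        fix w assume w: "w \<noteq> 0" "1 - y * w \<noteq> 0"
        have iw: "inverse w - y = (1 - y * w) / w" using w by (simp add: field_simps)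
        have c': "cubic' x (inverse w) = ?\<sigma> w / w\<^sup>2" using w by (simp add: cubic'_def field_simps power2_eq_square)
        have c: "cubic x (inverse w) = ?\<tau> w / w ^ 3" using w by (simp add: cubic_def field_simps power3_eq_cube)
        have "T 1 (inverse w) - inverse w / 2 = (?\<sigma> w / 2 * (1 - y * w) - ?\<tau> w - (1 - y * w)\<^sup>2 / 2) / (w * (1 - y * w)\<^sup>2)"
          unfolding T_def iw c c' using w by (simp add: divide_simps power2_eq_square power3_eq_cube) (simp add: algebra_simps)
        also have "?\<sigma> w / 2 * (1 - y * w) - ?\<tau> w - (1 - y * w)\<^sup>2 / 2
            = w * (- y / 2 + (- x / 2 + (1 + x) * y - y\<^sup>2 / 2) * w - x * y / 2 * w\<^sup>2)"
          by (simp add: power2_eq_square field_simps)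
        finally show "?K w = T k (inverse w) - \<epsilon> k * inverse w" using True w by (simp add: \<epsilon>_def)
      qed
    next
      case False
      with that obtain j where j: "k = j + 2" using \<open>k \<ge> 1\<close> by (metis One_nat_def Suc_1 le_antisym not_less_eq_eq le_Suc_ex add.commute)
      let ?K = "\<lambda>w. w ^ j * (?\<sigma> w / 2 / (1 - y * w) ^ k - of_nat k * ?\<tau> w / (1 - y * w) ^ (k + 1))"
      show ?thesis
      proof (rule that[of ?K])
        show "isCont ?K 0" by (intro continuous_intros) auto
        fix w assume w: "w \<noteq> 0" "1 - y * w \<noteq> 0"
        have iw: "inverse w - y = (1 - y * w) / w" using w by (simp add: field_simps)
        have c': "cubic' x (inverse w) = ?\<sigma> w / w\<^sup>2" using w by (simp add: cubic'_def field_simps power2_eq_square)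
        have c: "cubic x (inverse w) = ?\<tau> w / w ^ 3" using w by (simp add: cubic_def field_simps power3_eq_cube)
        define S T' D where "S = ?\<sigma> w" and "T' = ?\<tau> w" and "D = 1 - y * w"
        have "T k (inverse w) = S / w\<^sup>2 / 2 / (D / w) ^ k - of_nat k * (T' / w ^ 3) / (D / w) ^ (k + 1)"
          unfolding T_def iw c c' S_def T'_def D_def ..
        also have "\<dots> = w ^ j * (S / 2 / D ^ k - of_nat k * T' / D ^ (k + 1))"
          using w unfolding D_def [symmetric] j
          by (simp add: power_divide power_add power2_eq_square power3_eq_cube right_diff_distrib mult_ac)
        finally show "?K w = T k (inverse w) - \<epsilon> k * inverse w" using False by (simp add: \<epsilon>_def S_def T'_def D_def)
      qed
    qed
    have "((\<lambda>u. K (inverse u)) \<longlongrightarrow> K 0) at_infinity"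
      by (rule isCont_tendsto_compose[OF K(1) tendsto_inverse_0])
    moreover have "\<forall>\<^sub>F u in at_infinity. K (inverse u) = T k u - \<epsilon> k * u"
      using eventually_not_equal_at_infinity[of 0] eventually_not_equal_at_infinity[of y]
    proof eventually_elim
      case (elim u)
      then have "1 - y * inverse u \<noteq> 0" by (auto simp: field_simps)
      then show ?case using K(2)[of "inverse u"] elim by simp
    qed
    ultimately show ?thesis by (blast intro: Lim_transform_eventually)
  qed
  then obtain l where l: "\<And>k. k \<ge> 1 \<Longrightarrow> ((\<lambda>u. T k u - \<epsilon> k * u) \<longlongrightarrow> l k) at_infinity" by metis
  have "((\<lambda>u. \<Sum>i\<le>n. \<rho> i * (T (n + 1 - i) u - \<epsilon> (n + 1 - i) * u)) \<longlongrightarrow> (\<Sum>i\<le>n. \<rho> i * l (n + 1 - i))) at_infinity"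
    by (intro tendsto_intros l) auto
  moreover have "(\<Sum>i\<le>n. \<rho> i * (T (n + 1 - i) u - \<epsilon> (n + 1 - i) * u)) = reduced_form n x Q u - \<rho> n * u / 2" for u
  proof -
    have "(\<Sum>i\<le>n. \<rho> i * (\<epsilon> (n + 1 - i) * u)) = (\<Sum>i\<in>{n}. \<rho> i * (\<epsilon> (n + 1 - i) * u))"
      by (rule sum.mono_neutral_right) (auto simp: \<epsilon>_def)
    then show ?thesis by (simp add: right_diff_distrib sum_subtractf red \<epsilon>_def)
  qed
  ultimately have "((\<lambda>u. reduced_form n x Q u - \<rho> n * u / 2) \<longlongrightarrow> (\<Sum>i\<le>n. \<rho> i * l (n + 1 - i))) at_infinity" by simp
  then have "\<forall>\<^sub>F u in at_infinity. dist (reduced_form n x Q u - \<rho> n * u / 2) (\<Sum>i\<le>n. \<rho> i * l (n + 1 - i)) < 1"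
    by (rule tendstoD) simp
  then have "\<forall>\<^sub>F u in at_infinity. norm (reduced_form n x Q u - \<rho> n * u / 2) \<le> norm (\<Sum>i\<le>n. \<rho> i * l (n + 1 - i)) + 1"
  proof eventually_elim
    case (elim u)
    then show ?case
      using norm_triangle_sub[of "reduced_form n x Q u - \<rho> n * u / 2" "\<Sum>i\<le>n. \<rho> i * l (n + 1 - i)"]
      by (simp add: dist_norm)
  qed
  moreover have "reduced_form n x Q u - \<rho> n * u / 2 = reduced_form n x Q u + taylor_coeff n x (fst Q) / snd Q / of_nat (Suc n) * u / 2" for u
    by (simp add: \<rho>_def y_def)
  ultimately show ?thesis by (intro exI) simp
qed

lemma eventually_bounded_isCont:
  fixes f :: "complex \<Rightarrow> complex"
  assumes "isCont f a"
  shows "\<exists>B. \<forall>\<^sub>F z in at a. norm (f z) \<le> B"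
proof -
  have "\<forall>\<^sub>F z in nhds a. f z \<in> ball (f a) 1"
    using assms by (intro isCont_eventually_mem) auto
  then have "\<forall>\<^sub>F z in at a. norm (f z) \<le> norm (f a) + 1"
    unfolding eventually_nhds_conv_at
    by (auto elim!: eventually_mono simp: dist_norm) (smt (verit) norm_minus_commute norm_triangle_sub)
  then show ?thesis by blast
qed

text \<open>The even part extends to an entire function with limit 0 and the odd part to a bounded
  one, so only a constant over \<open>v\<close> remains.\<close>

lemma holomorphic_differential_eq:
  assumes x: "x \<noteq> 0" "x \<noteq> 1" and hol: "\<And>P. P \<in> topspace (surface x) \<Longrightarrow> holomorphic_at x h P"
  obtains c where "\<And>P. P \<in> unramified x \<Longrightarrow> h P = elliptic_form c 0 P"
proof -
  have h1: "holomorphic_at x h (Some (u, v))" if "(u, v) \<in> unramified x" "u \<noteq> 0" for u v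
    using hol[of "Some (u, v)"] that unramified_sub_affine by (auto simp: topspace_surface)
  have h2: "holomorphic_at x h (Some (e, 0))" if "cubic x e = 0" for e
    using hol[of "Some (e, 0)"] that by (auto simp: topspace_surface mem_affine_curve)
  have h3: "holomorphic_at x h None" using hol[of None] by (simp add: topspace_surface)
  \<comment> \<open>The parts are allowed one exceptional value \<open>y\<close>. Taking the branch
    value 0 adds nothing to the exceptional set.\<close>
  have F: "{u. cubic x u = 0} \<union> {0} = {u. cubic x u = 0}" by (auto simp: cubic_def)
  have hol': "even_part x h holomorphic_on - {u. cubic x u = 0}" "odd_part x h holomorphic_on - {u. cubic x u = 0}"
    using even_odd_parts_holomorphic[OF x h1 h2 h3, of 0] unfolding F by auto
  have bp: "((\<lambda>z. (z - e) * even_part x h z) \<longlongrightarrow> 0) (at e)" "((\<lambda>z. (z - e) * odd_part x h z) \<longlongrightarrow> 0) (at e)"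
    if "e \<in> {u. cubic x u = 0}" for e
    using even_odd_parts_branch_point[OF x h1 h2 h3, of 0 e] that by auto
  have inf: "(even_part x h \<longlongrightarrow> 0) at_infinity" "\<exists>B. \<forall>\<^sub>F u in at_infinity. norm (odd_part x h u) \<le> B"
    using even_odd_parts_infinity[OF x h1 h2 h3, of 0] by auto
  have even: "even_part x h z = 0" if "z \<notin> {u. cubic x u = 0}" for z
    by (rule Liouville_removable[OF finite_cubic_zeros[of x] hol'(1) bp(1) inf(1) that])
  obtain B where B: "\<forall>\<^sub>F u in at_infinity. norm (odd_part x h u) \<le> B" using inf(2) by blast
  obtain c where c: "\<And>z. z \<notin> {u. cubic x u = 0} \<Longrightarrow> odd_part x h z = c"
    by (rule Liouville_removable_bounded[OF finite_cubic_zeros[of x] hol'(2) bp(2) B]) (assumption | rule that)+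
  have "h P = elliptic_form (c / 2) 0 P" if P: "P \<in> unramified x" for P
  proof -
    obtain u v where uv: "P = (u, v)" by (cases P)
    have "u \<notin> {u. cubic x u = 0}" using P by (auto simp: uv mem_unramified)
    then show ?thesis
      using even_odd_decomposition[of u v x h] P even c by (simp add: uv elliptic_form_def)
  qed
  then show ?thesis by (rule that)
qed

lemma second_kind_expansion:
  assumes \<phi>: "local_param x (Some Q) \<phi>" and Q: "Q \<in> unramified x"
    and O: "(\<lambda>\<zeta>. W (\<phi> \<zeta>) - 1 / (fst (\<phi> \<zeta>) - fst Q) ^ k) \<in> O[at 0](\<lambda>_. 1)"
  obtains C where "\<forall>\<^sub>F z in at (fst Q). norm (W (z, branch x Q z) - 1 / (z - fst Q) ^ k) \<le> C"
proof -
  obtain C where "\<forall>\<^sub>F \<zeta> in at 0. norm (W (\<phi> \<zeta>) - 1 / (fst (\<phi> \<zeta>) - fst Q) ^ k) \<le> C * norm (1::complex)"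
    using O by (elim landau_o.bigE)
  then have "\<forall>\<^sub>F \<zeta> in at 0. norm (W (fst Q + \<zeta>, branch x Q (fst Q + \<zeta>)) - 1 / (fst Q + \<zeta> - fst Q) ^ k) \<le> C"
    using local_param_unramified(2)[OF \<phi> Q] by eventually_elim simp
  then have "\<forall>\<^sub>F z in at (fst Q). norm (W (z, branch x Q z) - 1 / (z - fst Q) ^ k) \<le> C"
    by (rule eventually_nhds_shift)
  then show ?thesis by (rule that)
qed

text \<open>The pole sits on one sheet only. Hence twice the even part is the pure pole in
  \<open>u\<close>, and twice the odd part times \<open>v\<close> is \<open>reduced_form\<close>
  plus an affine function of \<open>u\<close>, both by Liouville. The first pieces are the
  derivatives of explicit functions; the affine one is the elliptic form.\<close>

lemma second_kind_primitive:
  fixes n :: nat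
  assumes x: "x \<noteq> 0" "x \<noteq> 1" and Q: "Q \<in> unramified x"
    and hol: "\<And>P. P \<in> topspace (surface x) \<Longrightarrow> P \<noteq> Some Q \<Longrightarrow> holomorphic_at x W P"
    and ex: "\<forall>\<^sub>F z in at (fst Q). norm (W (z, branch x Q z) - 1 / (z - fst Q) ^ (n + 2)) \<le> C"
  obtains l H where "\<And>P. P \<in> unramified x \<Longrightarrow> P \<noteq> Q \<Longrightarrow> primitive_at x
     (\<lambda>P. W P - elliptic_form l (taylor_coeff n x (fst Q) / (4 * of_nat (Suc n) * snd Q)) P) H P"
proof -
  obtain y w where yw: "Q = (y, w)" by (cases Q)
  have fQ: "fst Q = y" "snd Q = w" by (simp_all add: yw)
  have w0: "w \<noteq> 0" and cy: "cubic x y \<noteq> 0" using Q by (auto simp: yw mem_unramified)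
  let ?b = "branch x Q"
  have h1: "holomorphic_at x W (Some (u, v))" if "(u, v) \<in> unramified x" "(u, v) \<noteq> Q" for u v
    using hol[of "Some (u, v)"] that unramified_sub_affine by (auto simp: topspace_surface)
  have h1': "holomorphic_at x W (Some (u, v))" if "(u, v) \<in> unramified x" "u \<noteq> y" for u v
    using h1[of u v] that by (auto simp: yw)
  have h2: "holomorphic_at x W (Some (e, 0))" if "cubic x e = 0" for e
    using hol[of "Some (e, 0)"] that w0 by (auto simp: topspace_surface mem_affine_curve yw)
  have h3: "holomorphic_at x W None" using hol[of None] by (simp add: topspace_surface)
  let ?Z = "{u. cubic x u = 0}"
  let ?F = "?Z \<union> {y}"
  have finF: "finite ?F" using finite_cubic_zeros[of x] by simp
  have eo_hol: "even_part x W holomorphic_on - ?F" "odd_part x W holomorphic_on - ?F"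
    using even_odd_parts_holomorphic[OF x h1' h2 h3, of y] by auto
  have eo_bp: "((\<lambda>z. (z - e) * even_part x W z) \<longlongrightarrow> 0) (at e)" "((\<lambda>z. (z - e) * odd_part x W z) \<longlongrightarrow> 0) (at e)"
    if "cubic x e = 0" for e
    using even_odd_parts_branch_point[OF x h1' h2 h3, of y e] that by auto
  have eo_inf: "(even_part x W \<longlongrightarrow> 0) at_infinity" "\<exists>B. \<forall>\<^sub>F u in at_infinity. norm (odd_part x W u) \<le> B"
    using even_odd_parts_infinity[OF x h1' h2 h3, of y] by auto
  obtain r B where r: "r > 0" "?b holomorphic_on ball (fst Q) r" "B holomorphic_on ball (fst Q) r"
    "\<And>z. z \<in> ball (fst Q) r \<Longrightarrow> ?b z \<noteq> 0 \<and> (z, ?b z) \<in> unramified x"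
    "\<And>z. z \<in> ball (fst Q) r - {fst Q} \<Longrightarrow>
      ?b z * polar_part n x Q z = B z - 1 / (of_nat (Suc n) * (z - fst Q) ^ (n + 1))"
    by (rule polar_part_regular[OF Q, of n]) (rule that)
  note r = r[unfolded fQ(1)]
  define B' where "B' = deriv B"
  have B': "(B has_field_derivative B' z) (at z)" if "z \<in> ball y r" for z
    using r(3) that by (simp add: B'_def holomorphic_derivI)
  have contB': "isCont B' y"
    using holomorphic_deriv[OF r(3) open_ball] r(1) unfolding B'_def
    by (metis centre_in_ball continuous_on_eq_continuous_at holomorphic_on_imp_continuous_on open_ball)
  define pole where "pole z = 1 / (z - y) ^ (n + 2)" for z
  have Dpole: "((\<lambda>z. - 1 / (of_nat (Suc n) * (z - y) ^ (n + 1))) has_field_derivative pole z) (at z)" if "z \<noteq> y" for z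
  proof -
    have "((\<lambda>z. - (1 / of_nat (Suc n)) / (z - y) ^ (n + 1)) has_field_derivative
        of_nat (n + 1) * (1 / of_nat (Suc n)) / (z - y) ^ (n + 1 + 1)) (at z)"
      by (rule has_field_derivative_over_power[OF that]) simp
    then show ?thesis by (simp add: pole_def del: of_nat_Suc)
  qed
  \<comment> \<open>The derivative of \<open>v\<close> times the polar part, computed by the product
    rule and from its regular expansion.\<close>
  have red: "reduced_form n x Q z = ?b z * (B' z + pole z)" if z: "z \<in> ball y r - {y}" for z
  proof -
    have b0: "?b z \<noteq> 0" using r(4) z by blast
    have z': "z \<in> ball (fst Q) r" using z by (simp add: fQ)
    have Db: "(?b has_field_derivative cubic' x z / (2 * ?b z)) (at z)"
      by (rule has_field_derivative_branch_ball[OF Q _ z' b0]) (use r(2) in \<open>simp add: fQ\<close>)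
    have D1: "((\<lambda>z. ?b z * polar_part n x Q z) has_field_derivative
       cubic' x z / (2 * ?b z) * polar_part n x Q z + polar_part' n x Q z * ?b z) (at z)"
      by (rule DERIV_mult[OF Db has_field_derivative_polar_part]) (use z in \<open>simp add: fQ\<close>)
    have D2: "((\<lambda>z. B z + - 1 / (of_nat (Suc n) * (z - y) ^ (n + 1))) has_field_derivative B' z + pole z) (at z)"
      by (rule DERIV_add[OF B' Dpole]) (use z in auto)
    have ev: "\<forall>\<^sub>F z in nhds z. ?b z * polar_part n x Q z = B z + - 1 / (of_nat (Suc n) * (z - y) ^ (n + 1))"
      unfolding eventually_nhds using z r(5)
      by (intro exI[of _ "ball y r - {y}"]) (auto simp del: of_nat_Suc)
    have "cubic' x z / (2 * ?b z) * polar_part n x Q z + polar_part' n x Q z * ?b z = B' z + pole z"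
      by (rule DERIV_unique[OF DERIV_cong_ev[OF refl ev refl, THEN iffD1, OF D1] D2])
    then have "?b z * (B' z + pole z) = ?b z * (cubic' x z / (2 * ?b z) * polar_part n x Q z + polar_part' n x Q z * ?b z)"
      by simp
    also have "\<dots> = cubic' x z / 2 * polar_part n x Q z + (?b z)\<^sup>2 * polar_part' n x Q z"
      using b0 by (simp add: field_simps power2_eq_square)
    finally show ?thesis by (simp add: reduced_form_def branch_square[OF Q])
  qed
  have near: "\<forall>\<^sub>F z in at y. z \<in> ball y r - {y}"
    using r(1) by (auto simp: eventually_at dist_commute)
  have conjQ: "(y, - w) \<in> unramified x" "(y, - w) \<noteq> Q" using Q w0 by (auto simp: yw mem_unramified)
  have "(\<lambda>z. W (z, - ?b z)) field_differentiable at y"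
    using holomorphic_at_unramified[OF h1[OF conjQ] conjQ(1)] by (simp add: branch_conj yw)
  then have contW: "isCont (\<lambda>z. W (z, - ?b z)) y" by (rule field_differentiable_imp_continuous_at)
  obtain C2 where C2: "\<forall>\<^sub>F z in at y. norm (W (z, - ?b z)) \<le> C2" using eventually_bounded_isCont[OF contW] by blast
  obtain C3 where C3: "\<forall>\<^sub>F z in at y. norm (B' z) \<le> C3" using eventually_bounded_isCont[OF contB'] by blast
  have ex': "\<forall>\<^sub>F z in at y. norm (W (z, ?b z) - pole z) \<le> C" using ex by (simp add: pole_def fQ)
  have zy: "((\<lambda>z. z - y) \<longlongrightarrow> 0) (at y)"
  proof -
    have "((\<lambda>z. z - y) \<longlongrightarrow> y - y) (at y)" by (intro tendsto_intros)
    then show ?thesis by simp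
  qed
  have bcurve: "(z, ?b z) \<in> affine_curve x" for z by (simp add: mem_affine_curve branch_square[OF Q])

  \<comment> \<open>Near \<open>y\<close> the pole of \<open>W\<close> on the sheet of
    \<open>Q\<close> is subtracted, and \<open>W\<close> is regular on the other sheet, so the
    difference is bounded there.\<close>
  have "even_part x W z - pole z = 0" if z: "z \<notin> ?F" for z
  proof (rule Liouville_removable[where f = "\<lambda>z. even_part x W z - pole z" and l = 0 and z = z, OF finF])
    show "(\<lambda>z. even_part x W z - pole z) holomorphic_on - ?F"
      unfolding pole_def by (intro holomorphic_intros eo_hol(1)) auto
    show "((\<lambda>z. (z - e) * (even_part x W z - pole z)) \<longlongrightarrow> 0) (at e)" if "e \<in> ?F" for e
    proof (cases "e = y")
      case True
      have "\<forall>\<^sub>F z in at y. norm (even_part x W z - pole z) \<le> C + C2"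
        using ex' C2
      proof eventually_elim
        case (elim z)
        have "even_part x W z - pole z = (W (z, ?b z) - pole z) + W (z, - ?b z)"
          using even_odd_parts_eq(1)[OF bcurve[of z], of W] by simp
        then show ?case using elim by (metis norm_triangle_le add_mono)
      qed
      from tendsto_zero_mult_bounded[OF zy this] show ?thesis using True by simp
    next
      case False
      then have e: "cubic x e = 0" using that by simp
      have "((\<lambda>z. (z - e) * even_part x W z - (z - e) * pole z) \<longlongrightarrow> 0 - (e - e) * (1 / (e - y) ^ (n + 2))) (at e)"
        unfolding pole_def by (intro tendsto_intros eo_bp(1)[OF e]) (use False in auto)
      then show ?thesis by (simp add: right_diff_distrib)
    qed
    have "((\<lambda>z. (\<lambda>s. (s / (1 - y * s)) ^ (n + 2)) (inverse z)) \<longlongrightarrow> (\<lambda>s. (s / (1 - y * s)) ^ (n + 2)) 0) at_infinity"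
      by (rule isCont_tendsto_compose[OF _ tendsto_inverse_0]) (auto intro!: continuous_intros)
    moreover have "\<forall>\<^sub>F z in at_infinity. (\<lambda>s. (s / (1 - y * s)) ^ (n + 2)) (inverse z) = pole z"
      using eventually_not_equal_at_infinity[of 0]
    proof eventually_elim
      case (elim z)
      have "inverse z / (1 - y * inverse z) = 1 / (z - y)" using elim by (simp add: divide_simps)
      then show ?case by (simp only: pole_def power_one_over)
    qed
    ultimately have "(pole \<longlongrightarrow> (\<lambda>s. (s / (1 - y * s)) ^ (n + 2)) 0) at_infinity"
      by (rule Lim_transform_eventually)
    then have "(pole \<longlongrightarrow> 0) at_infinity" by simp
    from tendsto_diff[OF eo_inf(1) this] show "((\<lambda>z. even_part x W z - pole z) \<longlongrightarrow> 0) at_infinity" by simp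
  qed (use z in simp)
  then have even: "even_part x W z = pole z" if "z \<notin> ?F" for z using that by simp

  \<comment> \<open>\<open>reduced_form\<close> grows like \<open>- \<tau> * z / 2\<close>, so
    adding \<open>\<tau> * z / 2\<close> makes the comparison with the bounded odd part admissible.
    Passing from \<open>odd_part\<close> to \<open>W\<close> halves this once more, whence
    \<open>\<tau> / 4\<close>.\<close>
  define \<tau> where "\<tau> = taylor_coeff n x y / w / of_nat (Suc n)"
  have contr: "(\<lambda>z. reduced_form n x Q z) holomorphic_on - {y}"
    unfolding reduced_form_def polar_part_def polar_part'_def cubic'_def
    by (intro holomorphic_intros) (auto simp: fQ)
  obtain B1 where B1: "\<forall>\<^sub>F z in at_infinity. norm (odd_part x W z) \<le> B1" using eo_inf(2) by blast
  obtain B2 where B2: "\<forall>\<^sub>F z in at_infinity. norm (reduced_form n x Q z + \<tau> * z / 2) \<le> B2"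
    using reduced_form_infinity[of n x Q] by (auto simp: \<tau>_def fQ)
  have bnd: "\<forall>\<^sub>F z in at_infinity. norm (odd_part x W z - (reduced_form n x Q z + \<tau> * z / 2)) \<le> B1 + B2"
    using B1 B2 by eventually_elim (metis norm_triangle_ineq4 add_mono order_trans)
  have lim: "((\<lambda>z. (z - e) * (odd_part x W z - (reduced_form n x Q z + \<tau> * z / 2))) \<longlongrightarrow> 0) (at e)" if "e \<in> ?F" for e
  proof (cases "e = y")
    case True
    \<comment> \<open>After \<open>red\<close> the poles cancel: the comparison function is
      \<open>v\<close> times \<open>?X\<close>, which is bounded at \<open>y\<close>, minus a
      polynomial.\<close>
    let ?X = "\<lambda>z. (W (z, ?b z) - pole z) - W (z, - ?b z) - B' z"
    have X: "\<forall>\<^sub>F z in at y. norm (?X z) \<le> C + C2 + C3"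
      using ex' C2 C3
    proof eventually_elim
      case (elim z)
      have "norm (?X z) \<le> norm (W (z, ?b z) - pole z) + norm (W (z, - ?b z)) + norm (B' z)"
        by (meson norm_triangle_ineq4 add_right_mono order_trans)
      then show ?case using elim by linarith
    qed
    have "isCont ?b y" using branch_isCont[OF Q] by (simp add: fQ)
    then have "((\<lambda>z. (z - y) * ?b z) \<longlongrightarrow> 0 * ?b y) (at y)" by (intro tendsto_mult zy) (simp add: isCont_def)
    then have "((\<lambda>z. (z - y) * ?b z) \<longlongrightarrow> 0) (at y)" by simp
    from tendsto_zero_mult_bounded[OF this X]
    have "((\<lambda>z. (z - y) * ?b z * ?X z - (z - y) * (\<tau> * z / 2)) \<longlongrightarrow> 0 - 0 * (\<tau> * y / 2)) (at y)"
      by (intro tendsto_intros zy) auto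
    moreover have "\<forall>\<^sub>F z in at y. (z - y) * ?b z * ?X z - (z - y) * (\<tau> * z / 2)
        = (z - y) * (odd_part x W z - (reduced_form n x Q z + \<tau> * z / 2))"
      using near
    proof eventually_elim
      case (elim z)
      have odd: "odd_part x W z = ?b z * (W (z, ?b z) - W (z, - ?b z))" using even_odd_parts_eq(2)[OF bcurve[of z], of W] .
      show ?case unfolding red[OF elim] odd by (simp add: algebra_simps)
    qed
    ultimately have "((\<lambda>z. (z - y) * (odd_part x W z - (reduced_form n x Q z + \<tau> * z / 2))) \<longlongrightarrow> 0 - 0 * (\<tau> * y / 2)) (at y)"
      by (rule Lim_transform_eventually)
    then show ?thesis using True by simp
  next
    case False
    then have e: "cubic x e = 0" using that by simp
    have "isCont (reduced_form n x Q) e"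
      using contr False by (metis Compl_iff continuous_on_eq_continuous_at holomorphic_on_imp_continuous_on open_Compl closed_singleton singletonD)
    then have "((\<lambda>z. (z - e) * odd_part x W z - (z - e) * (reduced_form n x Q z + \<tau> * z / 2)) \<longlongrightarrow> 0 - (e - e) * (reduced_form n x Q e + \<tau> * e / 2)) (at e)"
      by (intro tendsto_intros eo_bp(2)[OF e]) (auto simp: isCont_def)
    then show ?thesis by (simp add: right_diff_distrib)
  qed
  have oh: "(\<lambda>z. odd_part x W z - (reduced_form n x Q z + \<tau> * z / 2)) holomorphic_on - ?F"
    by (intro holomorphic_intros eo_hol(2) holomorphic_on_subset[OF contr]) auto
  obtain c0 where c0: "\<And>z. z \<notin> ?F \<Longrightarrow> odd_part x W z - (reduced_form n x Q z + \<tau> * z / 2) = c0"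
    by (rule Liouville_removable_bounded[OF finF oh lim bnd]) (assumption | rule that)+

  let ?e = "elliptic_form (c0 / 2) (\<tau> / 4)"
  have diff: "W (u, v) - ?e (u, v) = (pole u + reduced_form n x Q u / v) / 2"
    if uv: "(u, v) \<in> unramified x" "u \<noteq> y" for u v
  proof -
    have v: "v \<noteq> 0" "u \<notin> ?F" using uv by (auto simp: mem_unramified)
    have "odd_part x W u = reduced_form n x Q u + \<tau> * u / 2 + c0" using c0[OF v(2)] by (simp add: algebra_simps)
    then have "W (u, v) = (pole u + (reduced_form n x Q u + \<tau> * u / 2 + c0) / v) / 2"
      using even_odd_decomposition[OF uv(1), of W] even[OF v(2)] by simp
    then show ?thesis by (simp add: elliptic_form_def add_divide_distrib)
  qed
  \<comment> \<open>At the conjugate point over \<open>y\<close> the two poles in the formula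
    cancel, and \<open>- B y / 2\<close> is the value that makes \<open>H\<close> continuous on that
    sheet.\<close>
  define H where "H = (\<lambda>(u, v). if u = y then - B y / 2 else
      (- 1 / (of_nat (Suc n) * (u - y) ^ (n + 1)) + v * polar_part n x Q u) / 2)"
  have prim: "primitive_at x (\<lambda>P. W P - ?e P) H P" if P: "P \<in> unramified x" "P \<noteq> Q" for P
  proof -
    obtain u v where uv: "P = (u, v)" by (cases P)
    have v0: "v \<noteq> 0" "v\<^sup>2 = cubic x u" using P by (auto simp: uv mem_unramified)
    show ?thesis
    proof (cases "u = y")
      case False
      let ?s = "branch x P"
      have su: "?s u = v" using branch_base[OF P(1)] by (simp add: uv)
      have Ds: "(?s has_field_derivative cubic' x u / (2 * v)) (at u)"
        using has_field_derivative_branch[OF P(1)] by (simp add: uv cubic'_def)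
      have "((\<lambda>z. (- 1 / (of_nat (Suc n) * (z - y) ^ (n + 1)) + ?s z * polar_part n x Q z) / 2) has_field_derivative
          (pole u + (cubic' x u / (2 * v) * polar_part n x Q u + polar_part' n x Q u * ?s u)) / 2) (at u)"
        by (intro DERIV_cdivide DERIV_add Dpole DERIV_mult[OF Ds] has_field_derivative_polar_part)
          (use False in \<open>auto simp: fQ\<close>)
      moreover have "cubic' x u / (2 * v) * polar_part n x Q u + polar_part' n x Q u * ?s u = reduced_form n x Q u / v"
        using v0(1) unfolding reduced_form_def su v0(2) [symmetric] by (simp add: field_simps power2_eq_square)
      moreover have "\<forall>\<^sub>F z in nhds u. z \<in> - {y}"
        using False by (intro eventually_nhds_in_open) auto
      then have "\<forall>\<^sub>F z in nhds u. (- 1 / (of_nat (Suc n) * (z - y) ^ (n + 1)) + ?s z * polar_part n x Q z) / 2 = H (z, ?s z)"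
        by eventually_elim (simp add: H_def)
      ultimately have "((\<lambda>z. H (z, ?s z)) has_field_derivative (pole u + reduced_form n x Q u / v) / 2) (at u)"
        by (simp only: DERIV_cong_ev[OF refl _ refl])
      moreover have "W P - ?e P = (pole u + reduced_form n x Q u / v) / 2"
        using diff[of u v] P(1) False by (simp add: uv)
      ultimately show ?thesis by (simp only: primitive_at_def uv fst_conv)
    next
      case True
      have "v = - w"
        using P Q True by (auto simp: uv yw mem_unramified) (metis power2_eq_iff)
      then have Pe: "P = (y, - w)" using uv True by simp
      have br: "branch x P z = - ?b z" for z by (simp add: Pe branch_conj yw)
      have HB: "H (z, branch x P z) = - B z / 2" if z: "z \<in> ball y r" for z
      proof (cases "z = y")
        case False
        then have "?b z * polar_part n x Q z = B z - 1 / (of_nat (Suc n) * (z - y) ^ (n + 1))" using r(5) z by blast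
        then show ?thesis using False by (simp add: H_def br del: of_nat_Suc) 
      qed (simp add: H_def)
      have "((\<lambda>z. - B z / 2) has_field_derivative - B' y / 2) (at y)"
        using B'[of y] r(1) by (auto intro!: derivative_eq_intros)
      moreover have "\<forall>\<^sub>F z in nhds y. - B z / 2 = H (z, branch x P z)"
        unfolding eventually_nhds using HB r(1) by (intro exI[of _ "ball y r"]) auto
      ultimately have DH: "((\<lambda>z. H (z, branch x P z)) has_field_derivative - B' y / 2) (at y)"
        by (simp only: DERIV_cong_ev[OF refl _ refl])
      have "isCont ?b y" "?b y = w" using branch_isCont[OF Q] branch_base[OF Q] by (simp_all add: fQ)
      then have "isCont (\<lambda>z. W (z, - ?b z) - ?e (z, - ?b z)) y"
        using contW w0 unfolding elliptic_form_def by (auto intro!: continuous_intros)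
      then have lim1: "((\<lambda>z. W (z, - ?b z) - ?e (z, - ?b z)) \<longlongrightarrow> W (y, - w) - ?e (y, - w)) (at y)"
        \<comment> \<open>The identity for the derivative is known only on the punctured sheet; at
          the conjugate point it follows by comparing two limits, since \<open>W\<close> is regular
          there.\<close>
        using \<open>?b y = w\<close> by (simp add: isCont_def)
      have "((\<lambda>z. - B' z / 2) \<longlongrightarrow> - B' y / 2) (at y)"
        using contB' by (intro tendsto_intros) (simp_all add: isCont_def)
      moreover have "\<forall>\<^sub>F z in at y. - B' z / 2 = W (z, - ?b z) - ?e (z, - ?b z)"
        using near
      proof eventually_elim
        case (elim z)
        have b: "?b z \<noteq> 0" "(z, ?b z) \<in> unramified x" using r(4) elim by blast+
        have "W (z, - ?b z) - ?e (z, - ?b z) = (pole z + reduced_form n x Q z / (- ?b z)) / 2"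
          by (rule diff[OF conj_unramified[OF b(2)]]) (use elim in auto)
        also have "\<dots> = - B' z / 2" unfolding red[OF elim] using b(1) by (simp add: field_simps)
        finally show ?case by simp
      qed
      ultimately have "((\<lambda>z. W (z, - ?b z) - ?e (z, - ?b z)) \<longlongrightarrow> - B' y / 2) (at y)"
        by (rule Lim_transform_eventually)
      with lim1 have "W (y, - w) - ?e (y, - w) = - B' y / 2" by (rule LIM_unique)
      then show ?thesis using DH by (simp add: primitive_at_def Pe)
    qed
  qed
  have "\<tau> / 4 = taylor_coeff n x (fst Q) / (4 * of_nat (Suc n) * snd Q)" by (simp add: \<tau>_def fQ mult_ac del: of_nat_Suc)
  with prim show ?thesis by (intro that[of "c0 / 2" H]) simp
qed

text \<open>Up to an exact differential on the complement of \<open>Q\<close>, the whole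
  differential is an elliptic form: \<open>A * \<omega>\<close> only changes \<open>l\<close>.
  Nothing about \<open>l\<close> is recorded, since the two period equations will eliminate
  it.\<close>

lemma period_equation:
  assumes x: "x \<noteq> 0" "x \<noteq> 1" and Q: "Q \<in> unramified x"
    and \<omega>: "normalized_holomorphic x a \<omega>" and W: "normalized_second_kind n x a Q W"
  obtains l where "\<And>\<gamma> I. curve_loop x \<gamma> \<Longrightarrow> has_period x (\<lambda>P. W P + A * \<omega> P) (homology_class x \<gamma>) I \<Longrightarrow>
     I = curve_integral \<gamma> (elliptic_form l (taylor_coeff n x (fst Q) / (4 * of_nat (Suc n) * snd Q)))"
proof -
  define m where "m = taylor_coeff n x (fst Q) / (4 * of_nat (Suc n) * snd Q)"
  obtain c where c: "\<And>P. P \<in> unramified x \<Longrightarrow> \<omega> P = elliptic_form c 0 P"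
    by (rule holomorphic_differential_eq[OF x, of \<omega>]) (use \<omega> in \<open>auto simp: normalized_holomorphic_def\<close>)
  obtain \<phi> where \<phi>: "local_param x (Some Q) \<phi>" "(\<lambda>\<zeta>. W (\<phi> \<zeta>) - 1 / (fst (\<phi> \<zeta>) - fst Q) ^ (n + 2)) \<in> O[at 0](\<lambda>_. 1)"
    using W unfolding normalized_second_kind_def by blast
  obtain C where C: "\<forall>\<^sub>F z in at (fst Q). norm (W (z, branch x Q z) - 1 / (z - fst Q) ^ (n + 2)) \<le> C"
    by (rule second_kind_expansion[OF \<phi>(1) Q \<phi>(2)]) (rule that)
  obtain l H where H: "\<And>P. P \<in> unramified x \<Longrightarrow> P \<noteq> Q \<Longrightarrow> primitive_at x (\<lambda>P. W P - elliptic_form l m P) H P"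
    unfolding m_def
    by (rule second_kind_primitive[OF x Q _ C]) (use W in \<open>auto simp: normalized_second_kind_def intro: that\<close>)
  define \<Omega> where "\<Omega> P = W P + A * \<omega> P" for P
  have prim: "primitive_at x (\<lambda>P. \<Omega> P - elliptic_form (l + A * c) m P) H P" if P: "P \<in> unramified x" "P \<noteq> Q" for P
  proof -
    have "\<Omega> P - elliptic_form (l + A * c) m P = W P - elliptic_form l m P"
      using c[OF P(1)] by (simp add: \<Omega>_def elliptic_form_def add_divide_distrib)
    then show ?thesis using H[OF P] by (simp add: primitive_at_def)
  qed
  \<comment> \<open>\<open>has_period\<close> supplies a loop along which the differential is
    holomorphic; the genuine pole shows that this loop misses \<open>Q\<close>, so the primitive
    exists along all of it.\<close>
  have pole: "\<not> holomorphic_at x \<Omega> (Some Q)"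
  proof
    assume "holomorphic_at x \<Omega> (Some Q)"
    then have 1: "isCont (\<lambda>z. \<Omega> (z, branch x Q z)) (fst Q)"
      by (intro field_differentiable_imp_continuous_at holomorphic_at_unramified Q)
    obtain r where r: "r > 0" "\<And>z. z \<in> ball (fst Q) r \<Longrightarrow> branch x Q z \<noteq> 0 \<and> (z, branch x Q z) \<in> unramified x"
      by (rule branch_holomorphic[OF Q]) (rule that)
    have "snd Q \<noteq> 0" using Q by (cases Q) (simp add: mem_unramified)
    then have 2: "isCont (\<lambda>z. A * (c / branch x Q z)) (fst Q)"
      using branch_isCont[OF Q] branch_base[OF Q] by (intro continuous_intros) auto
    obtain B1 where B1: "\<forall>\<^sub>F z in at (fst Q). norm (\<Omega> (z, branch x Q z) - A * (c / branch x Q z)) \<le> B1"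
      using eventually_bounded_isCont[OF isCont_diff[OF 1 2]] by blast
    have near: "\<forall>\<^sub>F z in at (fst Q). z \<in> ball (fst Q) r - {fst Q}"
      using r(1) by (auto simp: eventually_at dist_commute)
    have "\<forall>\<^sub>F z in at (fst Q). norm (1 / (z - fst Q) ^ (n + 2)) \<le> B1 + C"
      using B1 C near
    proof eventually_elim
      case (elim z)
      have "\<omega> (z, branch x Q z) = c / branch x Q z" using c[of "(z, branch x Q z)"] r(2)[of z] elim(3) by (simp add: elliptic_form_def)
      then have "W (z, branch x Q z) = \<Omega> (z, branch x Q z) - A * (c / branch x Q z)" by (simp add: \<Omega>_def)
      then show ?case using elim(1,2) norm_triangle_ineq4[of "W (z, branch x Q z)" "W (z, branch x Q z) - 1 / (z - fst Q) ^ (n + 2)"] by simp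
    qed
    moreover have "((\<lambda>z. (z - fst Q) ^ (n + 2)) \<longlongrightarrow> (fst Q - fst Q) ^ (n + 2)) (at (fst Q))" by (intro tendsto_intros)
    then have "((\<lambda>z. (z - fst Q) ^ (n + 2)) \<longlongrightarrow> 0) (at (fst Q))" by simp
    ultimately have "((\<lambda>z. (z - fst Q) ^ (n + 2) * (1 / (z - fst Q) ^ (n + 2))) \<longlongrightarrow> 0) (at (fst Q))"
      by (intro tendsto_zero_mult_bounded)
    moreover have "\<forall>\<^sub>F z in at (fst Q). (z - fst Q) ^ (n + 2) * (1 / (z - fst Q) ^ (n + 2)) = 1"
      by (auto simp: eventually_at_filter)
    ultimately have "((\<lambda>z. 1::complex) \<longlongrightarrow> 0) (at (fst Q))" by (rule Lim_transform_eventually)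
    then show False by (simp add: tendsto_const_iff)
  qed
  show ?thesis
  proof (rule that[of "l + A * c"])
    fix \<gamma> I assume \<gamma>: "curve_loop x \<gamma>" and "has_period x (\<lambda>P. W P + A * \<omega> P) (homology_class x \<gamma>) I"
    then obtain \<gamma>' where \<gamma>': "curve_loop x \<gamma>'" "homology_class x \<gamma>' = homology_class x \<gamma>"
      "\<And>t. t \<in> {0..1} \<Longrightarrow> holomorphic_at x \<Omega> (Some (\<gamma>' t))" "curve_integral \<gamma>' \<Omega> = I"
      unfolding has_period_def \<Omega>_def [abs_def, symmetric] by blast
    have "primitive_at x (\<lambda>P. \<Omega> P - elliptic_form (l + A * c) m P) H (\<gamma>' t)" if "t \<in> {0..1}" for t
      using prim[of "\<gamma>' t"] curve_loopD(3)[OF \<gamma>'(1) that] \<gamma>'(3)[OF that] pole by metis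
    from curve_integral_primitive[OF \<gamma>'(1) this]
    have 0: "((\<lambda>\<tau>. (\<Omega> (\<gamma>' \<tau>) - elliptic_form (l + A * c) m (\<gamma>' \<tau>)) * vector_derivative (fst \<circ> \<gamma>') (at \<tau> within {0..1})) has_integral 0) {0..1}" .
    from has_integral_add[OF 0 integrable_integral[OF elliptic_form_integrable[OF x \<gamma>'(1), of "l + A * c" m]]]
    have "((\<lambda>\<tau>. \<Omega> (\<gamma>' \<tau>) * vector_derivative (fst \<circ> \<gamma>') (at \<tau> within {0..1}))
        has_integral curve_integral \<gamma>' (elliptic_form (l + A * c) m)) {0..1}"
      by (simp add: curve_integral_def algebra_simps)
    then have "I = curve_integral \<gamma>' (elliptic_form (l + A * c) m)"
      using \<gamma>'(4) by (simp add: curve_integral_def integral_unique)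
    \<comment> \<open>Only now is the loop exchanged. The prescribed \<open>\<gamma>\<close> may run
      through \<open>Q\<close>, where the elliptic form is regular.\<close>
    also have "\<dots> = curve_integral \<gamma> (elliptic_form (l + A * c) m)"
      by (rule elliptic_integral_homologous[OF x \<gamma>'(1) \<gamma> \<gamma>'(2)])
    finally show "I = curve_integral \<gamma> (elliptic_form (l + A * c) (taylor_coeff n x (fst Q) / (4 * of_nat (Suc n) * snd Q)))"
      by (simp only: m_def)
  qed
qed

section \<open>The Picard--Fuchs equation of the periods\<close>

text \<open>The local lift as a function of both the modulus and the point, normalised at the
  reference modulus \<open>x0\<close>; for \<open>x = x0\<close> it is
  \<open>branch x0 P\<close>.\<close>

definition sheet_root :: "complex \<Rightarrow> complex \<times> complex \<Rightarrow> complex \<Rightarrow> complex \<Rightarrow> complex" where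
  "sheet_root x0 P x z = snd P * csqrt (cubic x z / cubic x0 (fst P))"

lemma continuous_on_sheet_root:
  assumes "\<And>x z. x \<in> U \<Longrightarrow> z \<in> V \<Longrightarrow> cubic x z / cubic x0 (fst P) \<notin> \<real>\<^sub>\<le>\<^sub>0" "cubic x0 (fst P) \<noteq> 0"
  shows "continuous_on (U \<times> V) (\<lambda>(x, z). sheet_root x0 P x z)"
proof -
  have c: "continuous_on (U \<times> V) (\<lambda>p. case p of (x, z) \<Rightarrow> cubic x z / cubic x0 (fst P))"
    unfolding cubic_def case_prod_beta using assms(2)[unfolded cubic_def] by (auto intro!: continuous_intros)
  have cs: "continuous_on (- \<real>\<^sub>\<le>\<^sub>0) csqrt" by (auto intro!: continuous_on_csqrt)
  have "(\<lambda>p. case p of (x, z) \<Rightarrow> cubic x z / cubic x0 (fst P)) ` (U \<times> V) \<subseteq> - \<real>\<^sub>\<le>\<^sub>0"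
    using assms(1) by auto
  from continuous_on_compose2[OF cs c this]
  have "continuous_on (U \<times> V) (\<lambda>p. csqrt (case p of (x, z) \<Rightarrow> cubic x z / cubic x0 (fst P)))" .
  then show ?thesis
    unfolding sheet_root_def case_prod_beta by (intro continuous_intros) 
qed

lemma sheet_root_domain:
  assumes "P \<in> unramified x0"
  obtains r where "r > 0" "\<And>x z. x \<in> ball x0 r \<Longrightarrow> z \<in> ball (fst P) r \<Longrightarrow> cubic x z / cubic x0 (fst P) \<notin> \<real>\<^sub>\<le>\<^sub>0"
proof -
  have c0: "cubic x0 (fst P) \<noteq> 0" using assms by (cases P) (auto simp: mem_unramified)
  have "isCont (\<lambda>p. case p of (x, z) \<Rightarrow> cubic x z / cubic x0 (fst P)) (x0, fst P)"
    unfolding cubic_def case_prod_beta using c0 by (intro continuous_intros) (simp_all add: cubic_def)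
  then have "\<forall>\<^sub>F p in nhds (x0, fst P). (case p of (x, z) \<Rightarrow> cubic x z / cubic x0 (fst P)) \<in> - \<real>\<^sub>\<le>\<^sub>0"
    using c0 by (intro isCont_eventually_mem) auto
  then obtain d where d: "d > 0" "\<And>p. dist p (x0, fst P) < d \<Longrightarrow> (case p of (x, z) \<Rightarrow> cubic x z / cubic x0 (fst P)) \<notin> \<real>\<^sub>\<le>\<^sub>0"
    unfolding eventually_nhds_metric by auto
  show ?thesis
  proof (rule that[of "d / 2"])
    fix x z assume "x \<in> ball x0 (d / 2)" "z \<in> ball (fst P) (d / 2)"
    then have "dist x x0 + dist z (fst P) < d" by (simp add: dist_commute)
    moreover have "dist (x, z) (x0, fst P) \<le> dist x x0 + dist z (fst P)"
      unfolding dist_Pair_Pair by (rule sqrt_sum_squares_le_sum) auto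
    ultimately show "cubic x z / cubic x0 (fst P) \<notin> \<real>\<^sub>\<le>\<^sub>0" using d(2)[of "(x, z)"] by auto
  qed (use d in simp)
qed

lemma unramified_base:
  assumes P: "P \<in> unramified x0"
  shows "cubic x0 (fst P) \<noteq> 0" "(snd P)\<^sup>2 = cubic x0 (fst P)" "snd P \<noteq> 0"
proof -
  obtain u v where uv: "P = (u, v)" by (cases P)
  have "v\<^sup>2 = cubic x0 u" "v \<noteq> 0" using P by (auto simp: uv mem_unramified)
  then show "(snd P)\<^sup>2 = cubic x0 (fst P)" "snd P \<noteq> 0" by (simp_all add: uv)
  then show "cubic x0 (fst P) \<noteq> 0" by (metis power_eq_0_iff)
qed

context
  fixes x0 x z :: complex and P
  assumes P: "P \<in> unramified x0" and dom: "cubic x z / cubic x0 (fst P) \<notin> \<real>\<^sub>\<le>\<^sub>0"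
begin

lemmas cubic_base = unramified_base[OF P]

lemma sheet_root_square: "(sheet_root x0 P x z)\<^sup>2 = cubic x z"
  using cubic_base by (simp add: sheet_root_def power_mult_distrib)

lemma sheet_root_nonzero: "sheet_root x0 P x z \<noteq> 0" "cubic x z \<noteq> 0" "z \<noteq> x"
proof -
  show "cubic x z \<noteq> 0" using dom by auto
  then show "sheet_root x0 P x z \<noteq> 0" "z \<noteq> x" using sheet_root_square by (auto simp: cubic_def)
qed

lemma has_field_derivative_csqrt_scaled:
  fixes z0 :: complex
  assumes "(f has_field_derivative D) (at z0)" "f z0 = cubic x z"
  shows "((\<lambda>z. snd P * csqrt (f z / cubic x0 (fst P))) has_field_derivative D / (2 * sheet_root x0 P x z)) (at z0)"
proof -
  have d': "f z0 / cubic x0 (fst P) \<notin> \<real>\<^sub>\<le>\<^sub>0" using dom assms(2) by simp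
  have s0: "csqrt (f z0 / cubic x0 (fst P)) \<noteq> 0" using d' by auto
  have "((\<lambda>z. snd P * csqrt (f z / cubic x0 (fst P))) has_field_derivative
     snd P * (inverse (2 * csqrt (f z0 / cubic x0 (fst P))) * (D / cubic x0 (fst P)))) (at z0)"
    by (intro DERIV_cmult DERIV_chain2[where f = csqrt and g = "\<lambda>z. f z / cubic x0 (fst P)", OF has_field_derivative_csqrt[OF d'] DERIV_cdivide[OF assms(1)]])
  moreover have "snd P * (inverse (2 * csqrt (f z0 / cubic x0 (fst P))) * (D / cubic x0 (fst P)))
     = D / (2 * sheet_root x0 P x z)"
    using cubic_base s0 by (simp add: sheet_root_def assms(2) field_simps power2_eq_square flip: cubic_base(2))
  ultimately show ?thesis by simp
qed

lemma has_field_derivative_sheet_root: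
  "(sheet_root x0 P x has_field_derivative cubic' x z / (2 * sheet_root x0 P x z)) (at z)"
  using has_field_derivative_csqrt_scaled[of "cubic x" "cubic' x z" z] has_field_derivative_cubic[of x z]
  unfolding sheet_root_def [abs_def] cubic'_def by simp

lemma has_field_derivative_sheet_root_parameter:
  "((\<lambda>x. sheet_root x0 P x z) has_field_derivative - sheet_root x0 P x z / (2 * (z - x))) (at x)"
proof -
  have "((\<lambda>x. cubic x z) has_field_derivative - (z * (z - 1))) (at x)"
    unfolding cubic_def by (auto intro!: derivative_eq_intros)
  from has_field_derivative_csqrt_scaled[OF this refl]
  have "((\<lambda>x. sheet_root x0 P x z) has_field_derivative - (z * (z - 1)) / (2 * sheet_root x0 P x z)) (at x)"
    unfolding sheet_root_def .
  moreover have "- (z * (z - 1)) / (2 * sheet_root x0 P x z) = - sheet_root x0 P x z / (2 * (z - x))"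
  proof -
    have "sheet_root x0 P x z * sheet_root x0 P x z = z * (z - 1) * (z - x)"
      using sheet_root_square by (simp add: power2_eq_square cubic_def)
    then have "- 2 * (z * (z - 1) * (z - x)) = - 2 * (sheet_root x0 P x z * sheet_root x0 P x z)" by simp
    then have "- (z * (z - 1)) * (2 * (z - x)) = - sheet_root x0 P x z * (2 * sheet_root x0 P x z)"
      by (simp only: mult_ac mult_minus_left mult_minus_right)
    then show ?thesis using sheet_root_nonzero by (subst frac_eq_eq) auto
  qed
  ultimately show ?thesis by simp
qed

text \<open>At fixed \<open>z\<close> the root is proportional to the square root of
  \<open>z - x\<close>, so each derivative in \<open>x\<close> divides by \<open>z - x\<close>, with
  factors 1/2 and 3/2.\<close>

lemma has_field_derivative_inverse_sheet_root_parameter: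
  "((\<lambda>x. 1 / sheet_root x0 P x z) has_field_derivative 1 / (2 * (z - x) * sheet_root x0 P x z)) (at x)"
  "((\<lambda>x. 1 / (2 * (z - x) * sheet_root x0 P x z)) has_field_derivative 3 / (4 * (z - x)\<^sup>2 * sheet_root x0 P x z)) (at x)"
proof -
  define s where "s = sheet_root x0 P x z"
  define d where "d = z - x"
  have nz: "s \<noteq> 0" "d \<noteq> 0" using sheet_root_nonzero by (auto simp: s_def d_def)
  note D = has_field_derivative_sheet_root_parameter
  have "((\<lambda>x. 1 / sheet_root x0 P x z) has_field_derivative - (inverse s * (- s / (2 * d)) * inverse s)) (at x)"
    using DERIV_inverse'[OF D] sheet_root_nonzero by (simp add: s_def d_def divide_inverse)
  moreover have "- (inverse s * (- s / (2 * d)) * inverse s) = 1 / (2 * d * s)"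
    using nz by (simp add: field_simps)
  ultimately show "((\<lambda>x. 1 / sheet_root x0 P x z) has_field_derivative 1 / (2 * (z - x) * sheet_root x0 P x z)) (at x)"
    by (simp add: s_def d_def)
  have "((\<lambda>x. 2 * (z - x)) has_field_derivative - 2) (at x)"
    by (auto intro!: derivative_eq_intros)
  from DERIV_mult[OF this D] have "((\<lambda>x. 2 * (z - x) * sheet_root x0 P x z) has_field_derivative
      - 2 * s + - s / (2 * d) * (2 * d)) (at x)"
    by (simp add: s_def d_def)
  also have "- 2 * s + - s / (2 * d) * (2 * d) = - 3 * s" using nz by simp
  finally have D2: "((\<lambda>x. 2 * (z - x) * sheet_root x0 P x z) has_field_derivative - 3 * s) (at x)" .
  have "((\<lambda>x. 1 / (2 * (z - x) * sheet_root x0 P x z)) has_field_derivative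
      - (inverse (2 * d * s) * (- 3 * s) * inverse (2 * d * s))) (at x)"
    using DERIV_inverse'[OF D2] nz by (simp add: s_def d_def divide_inverse)
  moreover have "- (inverse (2 * d * s) * (- 3 * s) * inverse (2 * d * s)) = 3 / (4 * d\<^sup>2 * s)"
    using nz by (simp add: field_simps power2_eq_square)
  ultimately show "((\<lambda>x. 1 / (2 * (z - x) * sheet_root x0 P x z)) has_field_derivative
      3 / (4 * (z - x)\<^sup>2 * sheet_root x0 P x z)) (at x)"
    by (simp add: s_def d_def)
qed

text \<open>The first identity says that the Picard-Fuchs operator applied to \<open>1 / v\<close>
  gives an exact differential. The second expresses \<open>u / v\<close> through
  \<open>1 / v\<close> and its \<open>x\<close>-derivative up to an exact term, so the period of
  \<open>u du / v\<close> is \<open>x E + 2 x (x - 1) E'\<close>.\<close>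

lemma has_field_derivative_exact_terms:
  "((\<lambda>z. sheet_root x0 P x z / (2 * (z - x)\<^sup>2)) has_field_derivative
     x * (1 - x) * (3 / (4 * (z - x)\<^sup>2 * sheet_root x0 P x z)) + (1 - 2 * x) * (1 / (2 * (z - x) * sheet_root x0 P x z))
       - 1 / sheet_root x0 P x z / 4) (at z)" (is ?A)
  "((\<lambda>z. 2 * sheet_root x0 P x z / (z - x)) has_field_derivative
     z / sheet_root x0 P x z - x * (1 / sheet_root x0 P x z) - 2 * x * (x - 1) * (1 / (2 * (z - x) * sheet_root x0 P x z))) (at z)" (is ?B)
proof -
  define s where "s = sheet_root x0 P x z"
  define d where "d = z - x"
  have z: "z = x + d" by (simp add: d_def)
  have s0: "s \<noteq> 0" "d \<noteq> 0" using sheet_root_nonzero by (auto simp: s_def d_def)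
  have s2: "s * s = (x + d) * (x + d - 1) * d"
    using sheet_root_square by (simp add: power2_eq_square s_def cubic_def z)
  have c': "cubic' x z = (x + d - 1) * d + (x + d) * d + (x + d) * (x + d - 1)" by (simp add: cubic'_def z)
  have A: "((\<lambda>z. sheet_root x0 P x z / (2 * (z - x)\<^sup>2)) has_field_derivative
     (cubic' x z / (2 * s) * (2 * d\<^sup>2) - s * (4 * d)) / (2 * d\<^sup>2 * (2 * d\<^sup>2))) (at z)"
  proof -
    have "((\<lambda>z. 2 * (z - x)\<^sup>2) has_field_derivative 4 * d) (at z)"
      unfolding d_def by (auto intro!: derivative_eq_intros)
    from DERIV_divide[OF has_field_derivative_sheet_root this] show ?thesis using s0 by (simp add: s_def d_def)
  qed
  have "(cubic' x z / (2 * s) * (2 * d\<^sup>2) - s * (4 * d)) / (2 * d\<^sup>2 * (2 * d\<^sup>2))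
     = (cubic' x z * d - 4 * (s * s)) / (4 * d * d * d * s)"
    using s0 by (simp add: field_simps power2_eq_square)
  also have "\<dots> = (3 * x * (1 - x) + 2 * (1 - 2 * x) * d - d * d) * d / (4 * d * d * d * s)"
    unfolding s2 c' by (simp add: algebra_simps)
  also have "\<dots> = x * (1 - x) * (3 / (4 * d\<^sup>2 * s)) + (1 - 2 * x) * (1 / (2 * d * s)) - 1 / s / 4"
    using s0 by (simp add: field_simps power2_eq_square)
  finally show ?A using A unfolding s_def d_def by simp
  have B: "((\<lambda>z. 2 * sheet_root x0 P x z / (z - x)) has_field_derivative
     (cubic' x z / s * d - 2 * s) / (d * d)) (at z)"
  proof -
    have "((\<lambda>z. z - x) has_field_derivative 1) (at z)" by (auto intro!: derivative_eq_intros)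
    from DERIV_divide[OF DERIV_cmult[OF has_field_derivative_sheet_root, of 2] this]
    show ?thesis using s0 by (simp add: s_def d_def)
  qed
  have "(cubic' x z / s * d - 2 * s) / (d * d) = (cubic' x z * d - 2 * (s * s)) / (d * d * s)"
    using s0 by (simp add: field_simps)
  also have "\<dots> = (d * d - x * (x - 1)) * d / (d * d * s)"
    unfolding s2 c' by (simp add: algebra_simps)
  also have "\<dots> = z / s - x * (1 / s) - 2 * x * (x - 1) * (1 / (2 * d * s))"
    using s0 by (simp add: field_simps z)
  finally show ?B using B unfolding s_def d_def by simp
qed

end

section \<open>Periods as functions of the modulus\<close>

lemma has_field_derivative_linepath_integral:
  fixes f f' :: "complex \<Rightarrow> complex \<Rightarrow> complex"
  assumes D: "\<And>x z. x \<in> U \<Longrightarrow> z \<in> V \<Longrightarrow> ((\<lambda>x. f x z) has_field_derivative f' x z) (at x)"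
    and cont: "continuous_on (U \<times> V) (\<lambda>(x, z). f x z)" "continuous_on (U \<times> V) (\<lambda>(x, z). f' x z)"
    and seg: "closed_segment p q \<subseteq> V" and U: "open U" "convex U" "x \<in> U"
  shows "((\<lambda>x. contour_integral (linepath p q) (f x)) has_field_derivative contour_integral (linepath p q) (f' x)) (at x)"
proof -
  have lp: "linepath p q t \<in> V" if "t \<in> cbox 0 1" for t
    using seg that linepath_image_01[of p q] by auto
  have cont': "continuous_on (U \<times> cbox 0 1) (\<lambda>(x, t). g x (linepath p q t) * (q - p))"
    if g: "continuous_on (U \<times> V) (\<lambda>(x, z). g x z)" for g :: "complex \<Rightarrow> complex \<Rightarrow> complex"
  proof -
    have "continuous_on (U \<times> cbox 0 1) (\<lambda>w. (fst w, linepath p q (snd w)))"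
      by (intro continuous_intros continuous_on_compose2[OF continuous_on_linepath[of UNIV]]) auto
    then have "continuous_on (U \<times> cbox 0 1) (\<lambda>w. case (fst w, linepath p q (snd w)) of (x, z) \<Rightarrow> g x z)"
      by (rule continuous_on_compose2[OF g]) (use lp in auto)
    then show ?thesis unfolding case_prod_beta by (intro continuous_intros) simp
  qed
  have "((\<lambda>x. integral (cbox 0 1) (\<lambda>t. f x (linepath p q t) * (q - p))) has_field_derivative
      integral (cbox 0 1) (\<lambda>t. f' x (linepath p q t) * (q - p))) (at x within U)"
  proof (rule leibniz_rule_field_derivative[OF _ _ _ U(3,2)])
    show "((\<lambda>x. f x (linepath p q t) * (q - p)) has_field_derivative f' x (linepath p q t) * (q - p)) (at x within U)"
      if "x \<in> U" "t \<in> cbox 0 1" for x t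
      using DERIV_cmult_right[OF D[OF that(1) lp[OF that(2)]], of "q - p"] by (rule has_field_derivative_at_within)
    show "(\<lambda>t. f x (linepath p q t) * (q - p)) integrable_on cbox 0 1" if "x \<in> U" for x
    proof (rule integrable_continuous)
      have "continuous_on (cbox 0 1) (\<lambda>t. (x, t))" by (intro continuous_intros)
      then have "continuous_on (cbox 0 1) (\<lambda>t. case (x, t) of (x, t) \<Rightarrow> f x (linepath p q t) * (q - p))"
        by (rule continuous_on_compose2[OF cont'[OF cont(1)]]) (use that in auto)
      then show "continuous_on (cbox 0 1) (\<lambda>t. f x (linepath p q t) * (q - p))" by simp
    qed
    show "continuous_on (U \<times> cbox 0 1) (\<lambda>(x, t). f' x (linepath p q t) * (q - p))"
      by (rule cont'[OF cont(2)])
  qed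
  then show ?thesis
    using at_within_open[OF U(3,1)] by (simp add: contour_integral_integral)
qed

text \<open>The point lies on the curve, so the radicand is the square of \<open>v / snd P\<close>,
  and \<open>csqrt\<close> returns the root in the right half plane.\<close>

lemma sheet_root_eq:
  assumes "P \<in> unramified x0" "(u, v) \<in> affine_curve x" "Re (v / snd P) > 0"
  shows "sheet_root x0 P x u = v"
proof -
  obtain z w where zw: "P = (z, w)" by (cases P)
  have w: "w\<^sup>2 = cubic x0 z" "w \<noteq> 0" using assms(1) by (auto simp: zw mem_unramified)
  have "cubic x u / cubic x0 z = (v / w)\<^sup>2"
    using assms(2) w by (simp add: mem_affine_curve power_divide)
  moreover have "csqrt ((v / w)\<^sup>2) = v / w" using assms(3) by (intro csqrt_square) (simp add: zw)
  ultimately show ?thesis using w by (simp add: sheet_root_def zw)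
qed

lemma continuous_on_section:
  assumes "continuous_on (U \<times> V) (\<lambda>(x, z). f x z)" "x \<in> U"
  shows "continuous_on V (f x)"
proof -
  have "continuous_on V (\<lambda>z. (x, z))" by (intro continuous_intros)
  moreover have "(\<lambda>z. (x, z)) ` V \<subseteq> U \<times> V" using assms(2) by auto
  ultimately have "continuous_on V (\<lambda>z. case (x, z) of (x, z) \<Rightarrow> f x z)"
    by (rule continuous_on_compose2[OF assms(1)])
  then show ?thesis by simp
qed

text \<open>The two exact terms integrated over a segment leave boundary values at \<open>p\<close>
  and \<open>q\<close>. These are recorded, since they cancel only after all pieces of the loop are
  put together.\<close>

lemma picard_fuchs_piece:
  assumes P: "P \<in> unramified x0" and r: "r > 0"
    and dom: "\<And>x z. x \<in> ball x0 r \<Longrightarrow> z \<in> ball (fst P) r1 \<Longrightarrow> cubic x z / cubic x0 (fst P) \<notin> \<real>\<^sub>\<le>\<^sub>0"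
    and pq: "p \<in> ball (fst P) r1" "q \<in> ball (fst P) r1"
  obtains E E' E'' where
    "\<And>x. x \<in> ball x0 r \<Longrightarrow> (E has_field_derivative E' x) (at x)"
    "\<And>x. x \<in> ball x0 r \<Longrightarrow> (E' has_field_derivative E'' x) (at x)"
    "\<And>x. x \<in> ball x0 r \<Longrightarrow> x * (1 - x) * E'' x + (1 - 2 * x) * E' x - E x / 4
       = sheet_root x0 P x q / (2 * (q - x)\<^sup>2) - sheet_root x0 P x p / (2 * (p - x)\<^sup>2)"
    "\<And>x l m. x \<in> ball x0 r \<Longrightarrow> ((\<lambda>z. (l + m * z) / sheet_root x0 P x z) has_contour_integral
       l * E x + m * (x * E x + 2 * x * (x - 1) * E' x +
         (2 * sheet_root x0 P x q / (q - x) - 2 * sheet_root x0 P x p / (p - x)))) (linepath p q)"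
proof -
  let ?U = "ball x0 r" and ?V = "ball (fst P) r1"
  let ?S = "sheet_root x0 P"
  let ?f = "\<lambda>x z. 1 / ?S x z" and ?f1 = "\<lambda>x z. 1 / (2 * (z - x) * ?S x z)"
    and ?f2 = "\<lambda>x z. 3 / (4 * (z - x)\<^sup>2 * ?S x z)"
  have nz: "?S x z \<noteq> 0" "z \<noteq> x" if "x \<in> ?U" "z \<in> ?V" for x z
    using sheet_root_nonzero[OF P dom[OF that]] by auto
  have seg: "closed_segment p q \<subseteq> ?V" using pq by (intro closed_segment_subset) auto
  have c: "continuous_on (?U \<times> ?V) (\<lambda>w. ?S (fst w) (snd w))"
  proof -
    have "continuous_on (?U \<times> ?V) (\<lambda>(x, z). ?S x z)"
      by (rule continuous_on_sheet_root[OF dom unramified_base(1)[OF P]])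
    then show ?thesis by (simp only: case_prod_beta')
  qed
  have cf: "continuous_on (?U \<times> ?V) (\<lambda>(x, z). ?f x z)" "continuous_on (?U \<times> ?V) (\<lambda>(x, z). ?f1 x z)"
    "continuous_on (?U \<times> ?V) (\<lambda>(x, z). ?f2 x z)"
    unfolding case_prod_beta using nz by (auto intro!: continuous_intros c)
  let ?ci = "\<lambda>f. contour_integral (linepath p q) f"
  define E where "E x = ?ci (?f x)" for x
  define E' where "E' x = ?ci (?f1 x)" for x
  define E'' where "E'' x = ?ci (?f2 x)" for x
  have D1: "(E has_field_derivative E' x) (at x)" if "x \<in> ?U" for x
    unfolding E_def [abs_def] E'_def
    by (rule has_field_derivative_linepath_integral[OF _ cf(1,2) seg open_ball convex_ball that])
      (rule has_field_derivative_inverse_sheet_root_parameter(1)[OF P dom])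
  have D2: "(E' has_field_derivative E'' x) (at x)" if "x \<in> ?U" for x
    unfolding E'_def [abs_def] E''_def
    by (rule has_field_derivative_linepath_integral[OF _ cf(2,3) seg open_ball convex_ball that])
      (rule has_field_derivative_inverse_sheet_root_parameter(2)[OF P dom])
  have hci: "(g x has_contour_integral ?ci (g x)) (linepath p q)"
    if "continuous_on (?U \<times> ?V) (\<lambda>(x, z). g x z)" "x \<in> ?U" for g :: "complex \<Rightarrow> complex \<Rightarrow> complex" and x
    by (intro has_contour_integral_integral contour_integrable_continuous_linepath
        continuous_on_subset[OF continuous_on_section[OF that] seg])
  have prim: "(g' has_contour_integral g q - g p) (linepath p q)"
    if "\<And>z. z \<in> ?V \<Longrightarrow> (g has_field_derivative g' z) (at z)" for g g'
  proof -
    have "(g' has_contour_integral g (pathfinish (linepath p q)) - g (pathstart (linepath p q))) (linepath p q)"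
      by (rule contour_integral_primitive[of ?V]) (use that seg in \<open>auto intro: has_field_derivative_at_within\<close>)
    then show ?thesis by simp
  qed
  show ?thesis
  proof (rule that[OF D1 D2])
    fix x assume x: "x \<in> ?U"
    note I = hci[OF cf(1) x, folded E_def] hci[OF cf(2) x, folded E'_def] hci[OF cf(3) x, folded E''_def]
    have "((\<lambda>z. x * (1 - x) * ?f2 x z + (1 - 2 * x) * ?f1 x z - ?f x z / 4) has_contour_integral
       x * (1 - x) * E'' x + (1 - 2 * x) * E' x - E x / 4) (linepath p q)"
      by (intro has_contour_integral_add has_contour_integral_diff has_contour_integral_lmul has_contour_integral_div I)
    moreover have "((\<lambda>z. x * (1 - x) * ?f2 x z + (1 - 2 * x) * ?f1 x z - ?f x z / 4) has_contour_integral
       ?S x q / (2 * (q - x)\<^sup>2) - ?S x p / (2 * (p - x)\<^sup>2)) (linepath p q)"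
      by (rule prim) (rule has_field_derivative_exact_terms(1)[OF P dom[OF x]])
    ultimately show "x * (1 - x) * E'' x + (1 - 2 * x) * E' x - E x / 4
       = ?S x q / (2 * (q - x)\<^sup>2) - ?S x p / (2 * (p - x)\<^sup>2)"
      by (rule has_contour_integral_unique)
    fix l m
    have "((\<lambda>z. z / ?S x z - x * ?f x z - 2 * x * (x - 1) * ?f1 x z) has_contour_integral
       2 * ?S x q / (q - x) - 2 * ?S x p / (p - x)) (linepath p q)"
      by (rule prim) (rule has_field_derivative_exact_terms(2)[OF P dom[OF x]])
    then have "((\<lambda>z. l * ?f x z + m * (x * ?f x z + 2 * x * (x - 1) * ?f1 x z
         + (z / ?S x z - x * ?f x z - 2 * x * (x - 1) * ?f1 x z))) has_contour_integral
       l * E x + m * (x * E x + 2 * x * (x - 1) * E' x + (2 * ?S x q / (q - x) - 2 * ?S x p / (p - x)))) (linepath p q)"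
      by (intro has_contour_integral_add has_contour_integral_lmul I)
    moreover have "(\<lambda>z. l * ?f x z + m * (x * ?f x z + 2 * x * (x - 1) * ?f1 x z
         + (z / ?S x z - x * ?f x z - 2 * x * (x - 1) * ?f1 x z))) = (\<lambda>z. (l + m * z) / ?S x z)"
      by (simp add: add_divide_distrib)
    ultimately show "((\<lambda>z. (l + m * z) / ?S x z) has_contour_integral
       l * E x + m * (x * E x + 2 * x * (x - 1) * E' x + (2 * ?S x q / (q - x) - 2 * ?S x p / (p - x)))) (linepath p q)"
      by simp
  qed
qed

text \<open>On short arcs the lift stays on one sheet for all moduli near \<open>x0\<close>, so the
  segment computation applies. Bisection glues the arcs, the functions \<open>E\<close> add up, and
  the boundary terms telescope around the closed loop.\<close>

lemma picard_fuchs: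
  assumes X: "open X" "x0 \<in> X"
    and loop: "\<And>x. x \<in> X \<Longrightarrow> curve_loop x (a x)"
    and proj: "\<And>x t. x \<in> X \<Longrightarrow> t \<in> {0..1} \<Longrightarrow> fst (a x t) = \<alpha> t"
    and cont: "continuous_on (X \<times> {0..1}) (\<lambda>(x, t). a x t)"
  obtains r E E' E'' where "r > 0" "ball x0 r \<subseteq> X"
    "\<And>x. x \<in> ball x0 r \<Longrightarrow> (E has_field_derivative E' x) (at x)"
    "\<And>x. x \<in> ball x0 r \<Longrightarrow> (E' has_field_derivative E'' x) (at x)"
    "\<And>x. x \<in> ball x0 r \<Longrightarrow> x * (1 - x) * E'' x + (1 - 2 * x) * E' x - E x / 4 = 0"
    "\<And>x l m. x \<in> ball x0 r \<Longrightarrow> curve_integral (a x) (elliptic_form l m)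
       = l * E x + m * (x * E x + 2 * x * (x - 1) * E' x)"
proof -
  define G where "G x t = snd (a x t) / (2 * (fst (a x t) - x)\<^sup>2)" for x t
  define K where "K x t = 2 * snd (a x t) / (fst (a x t) - x)" for x t
  let ?I = "\<lambda>l m x \<tau>. elliptic_form l m (a x \<tau>) * vector_derivative (fst \<circ> a x) (at \<tau> within {0..1})"
  \<comment> \<open>The radius is part of the relation and shrinks when arcs are joined; finitely
    many joins keep it positive. The boundary terms depend on the end points only, which is what
    makes \<open>R\<close> additive.\<close>
  define R where "R s t r E E' E'' \<longleftrightarrow> r > 0 \<and> ball x0 r \<subseteq> X \<and> (\<forall>x\<in>ball x0 r.
     (E has_field_derivative E' x) (at x) \<and> (E' has_field_derivative E'' x) (at x) \<and>
     x * (1 - x) * E'' x + (1 - 2 * x) * E' x - E x / 4 = G x t - G x s \<and>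
     (\<forall>l m. (?I l m x has_integral l * E x + m * (x * E x + 2 * x * (x - 1) * E' x + (K x t - K x s))) {s..t}))"
    for s t r and E E' E'' :: "complex \<Rightarrow> complex"
  have "0 \<le> (0::real) \<and> (0::real) \<le> 1 \<and> (1::real) \<le> 1 \<longrightarrow> (\<exists>r E E' E''. R 0 1 r E E' E'')"
  proof (rule Bolzano[where P = "\<lambda>s t. 0 \<le> s \<and> s \<le> t \<and> t \<le> 1 \<longrightarrow> (\<exists>r E E' E''. R s t r E E' E'')" and a = 0 and b = 1])
    fix s t u :: real
    assume st: "0 \<le> s \<and> s \<le> t \<and> t \<le> 1 \<longrightarrow> (\<exists>r E E' E''. R s t r E E' E'')"
      and tu: "0 \<le> t \<and> t \<le> u \<and> u \<le> 1 \<longrightarrow> (\<exists>r E E' E''. R t u r E E' E'')" and le: "s \<le> t" "t \<le> u"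
    show "0 \<le> s \<and> s \<le> u \<and> u \<le> 1 \<longrightarrow> (\<exists>r E E' E''. R s u r E E' E'')"
    proof
      assume su: "0 \<le> s \<and> s \<le> u \<and> u \<le> 1"
      have "\<exists>r E E' E''. R s t r E E' E''" "\<exists>r E E' E''. R t u r E E' E''"
        using st tu su le by auto
      then obtain r1 E1 E1' E1'' r2 E2 E2' E2'' where 1: "R s t r1 E1 E1' E1''" and 2: "R t u r2 E2 E2' E2''"
        by (elim exE) (rule that)
      have "R s u (min r1 r2) (\<lambda>x. E1 x + E2 x) (\<lambda>x. E1' x + E2' x) (\<lambda>x. E1'' x + E2'' x)"
        unfolding R_def
      proof (intro conjI ballI allI)
        show "min r1 r2 > 0" "ball x0 (min r1 r2) \<subseteq> X" using 1 2 by (auto simp: R_def)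
      next
        fix x assume "x \<in> ball x0 (min r1 r2)"
        then have x: "x \<in> ball x0 r1" "x \<in> ball x0 r2" by auto
        note 1 = 1[unfolded R_def, THEN conjunct2, THEN conjunct2, rule_format, OF x(1)]
        note 2 = 2[unfolded R_def, THEN conjunct2, THEN conjunct2, rule_format, OF x(2)]
        show "((\<lambda>x. E1 x + E2 x) has_field_derivative E1' x + E2' x) (at x)"
          "((\<lambda>x. E1' x + E2' x) has_field_derivative E1'' x + E2'' x) (at x)"
          using 1 2 by (auto intro!: DERIV_add)
        have "x * (1 - x) * (E1'' x + E2'' x) + (1 - 2 * x) * (E1' x + E2' x) - (E1 x + E2 x) / 4
          = (x * (1 - x) * E1'' x + (1 - 2 * x) * E1' x - E1 x / 4) + (x * (1 - x) * E2'' x + (1 - 2 * x) * E2' x - E2 x / 4)"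
          by (simp add: algebra_simps add_divide_distrib)
        also have "\<dots> = (G x t - G x s) + (G x u - G x t)" using 1 2 by (simp only:)
        finally show "x * (1 - x) * (E1'' x + E2'' x) + (1 - 2 * x) * (E1' x + E2' x) - (E1 x + E2 x) / 4 = G x u - G x s"
          by simp
        fix l m
        have "(?I l m x has_integral (l * E1 x + m * (x * E1 x + 2 * x * (x - 1) * E1' x + (K x t - K x s)))
           + (l * E2 x + m * (x * E2 x + 2 * x * (x - 1) * E2' x + (K x u - K x t)))) {s..u}"
          using 1 2 by (intro has_integral_combine[OF le]) blast+
        then show "(?I l m x has_integral l * (E1 x + E2 x) +
            m * (x * (E1 x + E2 x) + 2 * x * (x - 1) * (E1' x + E2' x) + (K x u - K x s))) {s..u}"
          by (rule back_subst[where P = "\<lambda>v. (?I l m x has_integral v) {s..u}"]) (simp add: algebra_simps)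
      qed
      then show "\<exists>r E E' E''. R s u r E E' E''" by blast
    qed
  next
    fix \<tau> :: real assume \<tau>: "0 \<le> \<tau>" "\<tau> \<le> 1"
    define P where "P = a x0 \<tau>"
    have P: "P \<in> unramified x0" using curve_loopD(3)[OF loop[OF X(2)]] \<tau> by (simp add: P_def)
    have w0: "snd P \<noteq> 0" by (rule unramified_base(3)[OF P])
    obtain r1 where r1: "r1 > 0" "\<And>x z. x \<in> ball x0 r1 \<Longrightarrow> z \<in> ball (fst P) r1 \<Longrightarrow> cubic x z / cubic x0 (fst P) \<notin> \<real>\<^sub>\<le>\<^sub>0"
      by (rule sheet_root_domain[OF P]) (rule that)
    obtain r2 where r2: "r2 > 0" "ball x0 r2 \<subseteq> X" using X open_contains_ball by blast
    \<comment> \<open>The half plane condition fixes the sheet: a point of the curve in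
      \<open>N\<close> is the value of \<open>sheet_root\<close> over its \<open>u\<close>.\<close>
    define N where "N = {p. fst p \<in> ball (fst P) r1 \<and> Re (snd p / snd P) > 0}"
    have "open ((\<lambda>p::complex \<times> complex. fst p) -` ball (fst P) r1 \<inter> (\<lambda>p::complex \<times> complex. Re (snd p / snd P)) -` {0<..})"
      using w0 by (intro open_Int open_vimage open_ball open_greaterThan continuous_intros) auto
    then have oN: "open N" by (simp add: N_def vimage_def Int_def)
    have aN: "a x0 \<tau> \<in> N" using r1(1) w0 by (simp add: N_def P_def)
    have "((\<lambda>(x, t). a x t) \<longlongrightarrow> (case (x0, \<tau>) of (x, t) \<Rightarrow> a x t)) (at (x0, \<tau>) within X \<times> {0..1})"
      using cont X(2) \<tau> unfolding continuous_on_def by auto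
    then have "\<forall>\<^sub>F p in at (x0, \<tau>) within X \<times> {0..1}. (case p of (x, t) \<Rightarrow> a x t) \<in> N"
      using oN aN by (auto simp: tendsto_def)
    then obtain d where d: "d > 0" "\<And>x t. x \<in> X \<Longrightarrow> t \<in> {0..1} \<Longrightarrow> (x, t) \<noteq> (x0, \<tau>) \<Longrightarrow> dist (x, t) (x0, \<tau>) < d \<Longrightarrow> a x t \<in> N"
      unfolding eventually_at by fastforce
    define r where "r = min (min r1 r2) (d / 2)"
    have r: "r > 0" "ball x0 r \<subseteq> X" "ball x0 r \<subseteq> ball x0 r1" using r1 r2 d by (auto simp: r_def)
    have mem: "a x t \<in> N" if "x \<in> ball x0 r" "t \<in> {0..1}" "\<bar>t - \<tau>\<bar> < d / 2" for x t
    proof (cases "(x, t) = (x0, \<tau>)")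
      case False
      have "dist (x, t) (x0, \<tau>) \<le> dist x x0 + dist t \<tau>"
        unfolding dist_Pair_Pair by (rule sqrt_sum_squares_le_sum) auto
      also have "\<dots> < d" using that by (simp add: r_def dist_commute[of x x0] dist_real_def)
      finally show ?thesis using d(2) False that r(2) by blast
    qed (use aN in simp)
    have "\<exists>r E E' E''. R s t r E E' E''" if st: "s \<le> \<tau>" "\<tau> \<le> t" "t - s < d / 2" "0 \<le> s" "t \<le> 1" for s t
    proof -
      have le: "s \<le> t" using st by simp
      have at01: "\<sigma> \<in> {0..1}" "\<bar>\<sigma> - \<tau>\<bar> < d / 2" if "\<sigma> \<in> {s..t}" for \<sigma>
        using that[unfolded atLeastAtMost_iff] st by (simp, linarith)
      have \<alpha>: "\<alpha> \<sigma> \<in> ball (fst P) r1" if "\<sigma> \<in> {s..t}" for \<sigma>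
      proof -
        have "a x0 \<sigma> \<in> N" using mem[of x0 \<sigma>] at01[OF that] r(1) by simp
        then show ?thesis using proj[OF X(2) at01(1)[OF that]] by (simp add: N_def)
      qed
      have root: "sheet_root x0 P x (\<alpha> \<sigma>) = snd (a x \<sigma>)" if x: "x \<in> ball x0 r" and \<sigma>: "\<sigma> \<in> {s..t}" for x \<sigma>
      proof (rule sheet_root_eq[OF P])
        have xX: "x \<in> X" using x r(2) by blast
        have "a x \<sigma> \<in> unramified x" by (rule curve_loopD(3)[OF loop[OF xX] at01(1)[OF \<sigma>]])
        then have "(fst (a x \<sigma>), snd (a x \<sigma>)) \<in> affine_curve x" using unramified_sub_affine by auto
        then show "(\<alpha> \<sigma>, snd (a x \<sigma>)) \<in> affine_curve x" using proj[OF xX at01(1)[OF \<sigma>]] by simp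
        show "Re (snd (a x \<sigma>) / snd P) > 0" using mem[OF x at01[OF \<sigma>]] by (simp add: N_def)
      qed
      have dom: "cubic x z / cubic x0 (fst P) \<notin> \<real>\<^sub>\<le>\<^sub>0" if "x \<in> ball x0 r" "z \<in> ball (fst P) r1" for x z
        using r1(2) r(3) that by blast
      have ends: "s \<in> {s..t}" "t \<in> {s..t}" using le by auto
      obtain E E' E'' where E: "\<And>x. x \<in> ball x0 r \<Longrightarrow> (E has_field_derivative E' x) (at x)"
        "\<And>x. x \<in> ball x0 r \<Longrightarrow> (E' has_field_derivative E'' x) (at x)"
        "\<And>x. x \<in> ball x0 r \<Longrightarrow> x * (1 - x) * E'' x + (1 - 2 * x) * E' x - E x / 4
           = sheet_root x0 P x (\<alpha> t) / (2 * (\<alpha> t - x)\<^sup>2) - sheet_root x0 P x (\<alpha> s) / (2 * (\<alpha> s - x)\<^sup>2)"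
        "\<And>x l m. x \<in> ball x0 r \<Longrightarrow> ((\<lambda>z. (l + m * z) / sheet_root x0 P x z) has_contour_integral
           l * E x + m * (x * E x + 2 * x * (x - 1) * E' x + (2 * sheet_root x0 P x (\<alpha> t) / (\<alpha> t - x)
             - 2 * sheet_root x0 P x (\<alpha> s) / (\<alpha> s - x)))) (linepath (\<alpha> s) (\<alpha> t))"
        by (rule picard_fuchs_piece[OF P r(1) dom \<alpha>[OF ends(1)] \<alpha>[OF ends(2)]]) (assumption | rule that)+
      have "R s t r E E' E''"
        unfolding R_def
      proof (intro conjI ballI allI r(1,2) E(1,2))
        fix x assume x: "x \<in> ball x0 r"
        have xX: "x \<in> X" using x r(2) by blast
        have f: "fst (a x \<sigma>) = \<alpha> \<sigma>" if "\<sigma> \<in> {s..t}" for \<sigma> using proj[OF xX at01(1)[OF that]] .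
        show "x * (1 - x) * E'' x + (1 - 2 * x) * E' x - E x / 4 = G x t - G x s"
          unfolding E(3)[OF x] G_def root[OF x ends(1)] root[OF x ends(2)] f[OF ends(1)] f[OF ends(2)] ..
        fix l m
        have S: "sheet_root x0 P x field_differentiable at z" "sheet_root x0 P x z \<noteq> 0" if "z \<in> ball (fst P) r1" for z
          using has_field_derivative_sheet_root[OF P dom[OF x that]] sheet_root_nonzero(1)[OF P dom[OF x that]]
          by (auto simp: field_differentiable_def)
        then have "sheet_root x0 P x holomorphic_on ball (fst P) r1"
          by (auto simp: holomorphic_on_def intro: field_differentiable_at_within)
        then have "(\<lambda>z. (l + m * z) / sheet_root x0 P x z) holomorphic_on ball (fst P) r1"
          using S(2) by (intro holomorphic_intros)
        \<comment> \<open>Through this primitive the integral along the arc equals the one along its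
          chord. The chord has the same end points for all \<open>x\<close>, as the projection of
          the loop is fixed.\<close>
        then obtain F where F: "\<And>z. z \<in> ball (fst P) r1 \<Longrightarrow> (F has_field_derivative (l + m * z) / sheet_root x0 P x z) (at z)"
          by (rule holomorphic_on_ball_primitive) (rule that)
        have pr: "primitive_at x (elliptic_form l m) (\<lambda>p. F (fst p)) (a x \<sigma>)" if "\<sigma> \<in> {s..t}" for \<sigma>
          using F[OF \<alpha>[OF that]] unfolding primitive_at_def elliptic_form_def root[OF x that] f[OF that] by simp
        have "(?I l m x has_integral F (fst (a x t)) - F (fst (a x s))) {s..t}"
          by (rule has_integral_primitive[OF loop[OF xX] st(4) le st(5) pr])
        moreover have "((\<lambda>z. (l + m * z) / sheet_root x0 P x z) has_contour_integral
            F (pathfinish (linepath (\<alpha> s) (\<alpha> t))) - F (pathstart (linepath (\<alpha> s) (\<alpha> t)))) (linepath (\<alpha> s) (\<alpha> t))"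
        proof (rule contour_integral_primitive[of "ball (fst P) r1"])
          have "closed_segment (\<alpha> s) (\<alpha> t) \<subseteq> ball (fst P) r1"
            using \<alpha>[OF ends(1)] \<alpha>[OF ends(2)] by (intro closed_segment_subset) auto
          then show "path_image (linepath (\<alpha> s) (\<alpha> t)) \<subseteq> ball (fst P) r1" by simp
        qed (use F in \<open>auto intro: has_field_derivative_at_within\<close>)
        from has_contour_integral_unique[OF this E(4)[OF x]]
        have "F (fst (a x t)) - F (fst (a x s)) = l * E x + m * (x * E x + 2 * x * (x - 1) * E' x + (K x t - K x s))"
          unfolding K_def root[OF x ends(1)] root[OF x ends(2)] f[OF ends(1)] f[OF ends(2)] by simp
        ultimately show "(?I l m x has_integral l * E x + m * (x * E x + 2 * x * (x - 1) * E' x + (K x t - K x s))) {s..t}"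
          by simp
      qed
      then show ?thesis by blast
    qed
    then show "\<exists>d>0. \<forall>s t. s \<le> \<tau> \<and> \<tau> \<le> t \<and> t - s < d \<longrightarrow> (0 \<le> s \<and> s \<le> t \<and> t \<le> 1 \<longrightarrow> (\<exists>r E E' E''. R s t r E E' E''))"
      using d(1) by (intro exI[of _ "d / 2"]) simp
  qed simp
  then obtain r E E' E'' where R: "R 0 1 r E E' E''" by (elim impE exE) (simp, rule that)
  show ?thesis
  proof (rule that[of r E E' E''])
    show "r > 0" "ball x0 r \<subseteq> X" using R by (auto simp: R_def)
    fix x assume x: "x \<in> ball x0 r"
    note Rx = R[unfolded R_def, THEN conjunct2, THEN conjunct2, rule_format, OF x]
    show "(E has_field_derivative E' x) (at x)" "(E' has_field_derivative E'' x) (at x)" using Rx by auto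
    have "x \<in> X" using R x by (auto simp: R_def)
    then have closed: "a x 0 = a x 1" using curve_loopD(2)[OF loop] by blast
    \<comment> \<open>The loop closes on the curve itself, not just in projection, so the boundary
      values agree in both coordinates.\<close>
    then have GK: "G x 1 - G x 0 = 0" "K x 1 - K x 0 = 0" by (simp_all add: G_def K_def)
    show "x * (1 - x) * E'' x + (1 - 2 * x) * E' x - E x / 4 = 0" using Rx unfolding GK by blast
    fix l m
    have "(?I l m x has_integral l * E x + m * (x * E x + 2 * x * (x - 1) * E' x + 0)) {0..1}"
      using Rx unfolding GK by blast
    then show "curve_integral (a x) (elliptic_form l m) = l * E x + m * (x * E x + 2 * x * (x - 1) * E' x)"
      unfolding curve_integral_def by (simp add: integral_unique)
  qed
qed

section \<open>The differential equation for the pole\<close>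

text \<open>Only differentiability of \<open>g\<close> at the single point is needed, because a
  continuous solution \<open>y\<close> is already given. The linearisation first yields a Lipschitz
  bound at \<open>x\<close>, and with it the error terms become small relative to
  \<open>t - x\<close>.\<close>

lemma implicit_has_field_derivative:
  fixes g :: "complex \<times> complex \<Rightarrow> complex" and y m :: "complex \<Rightarrow> complex"
  assumes g: "(g has_derivative (\<lambda>h. p * fst h + q * snd h)) (at (x, y x))" and q: "q \<noteq> 0"
    and y: "isCont y x" and m: "(m has_field_derivative m') (at x)"
    and ev: "\<forall>\<^sub>F t in nhds x. g (t, y t) = m t"
  shows "(y has_field_derivative (m' - p) / q) (at x)"
proof -
  have lim: "((\<lambda>t. (t, y t)) \<longlongrightarrow> (x, y x)) (at x)"
    using y by (intro tendsto_intros) (simp add: isCont_def)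
  define C where "C = (norm (m' - p) + norm q) / (norm q / 2)"
  have q0: "norm q > 0" using q by simp
  have C0: "C \<ge> 0" by (simp add: C_def)
  have gx: "g (x, y x) = m x" using ev by (rule eventually_nhds_x_imp_x)
  have key: "\<forall>\<^sub>F t in at x. norm (q * (y t - y x) - (m' - p) * (t - x)) \<le> e * (2 * norm (t - x) + norm (y t - y x))"
    if e: "e > 0" for e
  proof -
    have "\<forall>\<^sub>F P in at (x, y x). norm (g P - g (x, y x) - (p * fst (P - (x, y x)) + q * snd (P - (x, y x)))) \<le> e * norm (P - (x, y x))"
      using g e unfolding has_derivative_within_alt2 by blast
    then have "\<forall>\<^sub>F P in nhds (x, y x). norm (g P - g (x, y x) - (p * fst (P - (x, y x)) + q * snd (P - (x, y x)))) \<le> e * norm (P - (x, y x))"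
      by (simp add: eventually_nhds_conv_at)
    from eventually_compose_filterlim[OF this lim]
    have 1: "\<forall>\<^sub>F t in at x. norm (g (t, y t) - g (x, y x) - (p * (t - x) + q * (y t - y x))) \<le> e * norm ((t, y t) - (x, y x))"
      by simp
    have 2: "\<forall>\<^sub>F t in at x. norm (m t - m x - m' * (t - x)) \<le> e * norm (t - x)"
      using m e unfolding has_field_derivative_def has_derivative_within_alt2 by blast
    have 3: "\<forall>\<^sub>F t in at x. g (t, y t) = m t" using ev by (simp add: eventually_nhds_conv_at)
    from 1 2 3 show ?thesis
    proof eventually_elim
      case (elim t)
      have "norm ((t, y t) - (x, y x)) \<le> norm (t - x) + norm (y t - y x)"
        by (simp add: norm_Pair sqrt_sum_squares_le_sum)
      then have "e * norm ((t, y t) - (x, y x)) \<le> e * (norm (t - x) + norm (y t - y x))" using e by simp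
      then have 4: "norm (m t - m x - (p * (t - x) + q * (y t - y x))) \<le> e * (norm (t - x) + norm (y t - y x))"
        using elim(1,3) gx by simp
      have "q * (y t - y x) - (m' - p) * (t - x) = (m t - m x - m' * (t - x)) - (m t - m x - (p * (t - x) + q * (y t - y x)))"
        by (simp add: algebra_simps)
      then have "norm (q * (y t - y x) - (m' - p) * (t - x)) \<le>
          norm (m t - m x - m' * (t - x)) + norm (m t - m x - (p * (t - x) + q * (y t - y x)))"
        by (simp only: norm_triangle_ineq4)
      then show ?case using elim(2) 4 by (simp add: algebra_simps)
    qed
  qed
  \<comment> \<open>With error level \<open>norm q / 2\<close> half of
    \<open>norm q * norm (y t - y x)\<close> is absorbed by the left side.\<close>
  have lip: "\<forall>\<^sub>F t in at x. norm (y t - y x) \<le> C * norm (t - x)"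
    using key[OF half_gt_zero[OF q0]]
  proof eventually_elim
    case (elim t)
    moreover have "norm (q * (y t - y x)) \<le> norm (q * (y t - y x) - (m' - p) * (t - x)) + norm ((m' - p) * (t - x))"
      using norm_triangle_ineq[of "q * (y t - y x) - (m' - p) * (t - x)" "(m' - p) * (t - x)"] by simp
    ultimately have "norm q * norm (y t - y x) \<le> norm q / 2 * (2 * norm (t - x) + norm (y t - y x)) + norm (m' - p) * norm (t - x)"
      by (simp add: norm_mult)
    then have "norm (y t - y x) * (norm q / 2) \<le> (norm (m' - p) + norm q) * norm (t - x)"
      by (simp add: algebra_simps)
    then show ?case
      using q0 by (simp add: C_def pos_le_divide_eq algebra_simps)
  qed
  have "(y has_derivative (*) ((m' - p) / q)) (at x)"
    unfolding has_derivative_within_alt2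
  proof (intro conjI allI impI bounded_linear_mult_right)
    fix e :: real assume e: "e > 0"
    define e' where "e' = e * norm q / (2 + C)"
    have e': "e' > 0" using e q0 C0 by (simp add: e'_def)
    show "\<forall>\<^sub>F t in at x. norm (y t - y x - (m' - p) / q * (t - x)) \<le> e * norm (t - x)"
      using key[OF e'] lip
    proof eventually_elim
      case (elim t)
      have "norm q * norm (y t - y x - (m' - p) / q * (t - x)) = norm (q * (y t - y x) - (m' - p) * (t - x))"
        using q by (simp add: right_diff_distrib flip: norm_mult)
      also have "\<dots> \<le> e' * (2 * norm (t - x) + norm (y t - y x))" by (rule elim(1))
      also have "\<dots> \<le> e' * (2 * norm (t - x) + C * norm (t - x))" using elim(2) e' by (intro mult_left_mono) auto
      also have "\<dots> = e' * (2 + C) * norm (t - x)" by (simp add: algebra_simps)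
      also have "\<dots> = norm q * (e * norm (t - x))" using C0 by (simp add: e'_def)
      finally show ?case using q0 by simp
    qed
  qed
  then show ?thesis by (simp add: has_field_derivative_def)
qed

text \<open>If \<open>T\<close> lists the Taylor coefficients of \<open>1 / v\<close> at
  \<open>y\<close> and \<open>d = x - y\<close>, this is the \<open>l\<close>-th coefficient of
  \<open>1 / ((x - u) v)\<close>, which is minus twice the \<open>x\<close>-derivative of
  \<open>1 / v\<close>.\<close>

definition polar_sum :: "nat \<Rightarrow> (nat \<Rightarrow> complex) \<Rightarrow> complex \<Rightarrow> complex" where
  "polar_sum l T d = (\<Sum>s\<le>l. T s * (1 / d) ^ (l + 1 - s))"

text \<open>The quotient is the \<open>l\<close>-th Taylor coefficient of \<open>1 / v\<close> for a
  varying curve: moving the centre yields \<open>(l + 1) T (l + 1)\<close>, moving the modulus the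
  coefficient of \<open>1 / (2 (u - x) v)\<close>. The derivatives of the normalising root remove
  the \<open>Sig 1\<close> term and add the summand \<open>s = l\<close>.\<close>

lemma has_derivative_taylor_over_root:
  fixes x :: complex
  assumes P: "P \<in> unramified x"
  defines "T \<equiv> \<lambda>l. taylor_coeff l x (fst P) / snd P"
  shows "((\<lambda>p. taylor_coeff l (fst p) (snd p) / sheet_root x P (fst p) (snd p)) has_derivative
    (\<lambda>h. (- polar_sum l T (x - fst P) / 2) * fst h + (of_nat (l + 1) * T (l + 1)) * snd h)) (at (x, fst P))"
proof -
  obtain y w where yw: "P = (y, w)" by (cases P)
  have base: "cubic x y \<noteq> 0" "w\<^sup>2 = cubic x y" "w \<noteq> 0" using unramified_base[OF P] by (simp_all add: yw)
  have ne: "y \<noteq> 0" "y \<noteq> 1" "y \<noteq> x" using base(1) by (auto simp: cubic_def)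
  have q: "((\<lambda>p. cubic (fst p) (snd p) / cubic x y) has_derivative
     (\<lambda>h. (- (y * (y - 1)) * fst h + cubic' x y * snd h) / cubic x y)) (at (x, y))"
  proof (rule bounded_linear.has_derivative[OF bounded_linear_divide])
    show "((\<lambda>p. cubic (fst p) (snd p)) has_derivative (\<lambda>h. - (y * (y - 1)) * fst h + cubic' x y * snd h)) (at (x, y))"
      unfolding cubic_def cubic'_def
      by (auto intro!: derivative_eq_intros simp: fun_eq_iff algebra_simps)
  qed
  have "(csqrt has_field_derivative 1 / 2) (at (cubic (fst (x, y)) (snd (x, y)) / cubic x y))"
    using has_field_derivative_csqrt[of 1] base(1) by simp
  then have "(csqrt has_derivative (*) (1 / 2)) (at (cubic (fst (x, y)) (snd (x, y)) / cubic x y))"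
    by (simp only: has_field_derivative_def)
  from has_derivative_mult_right[OF has_derivative_compose[OF q this], of w]
  have S: "((\<lambda>p. sheet_root x P (fst p) (snd p)) has_derivative
     (\<lambda>h. w * (1 / 2 * ((- (y * (y - 1)) * fst h + cubic' x y * snd h) / cubic x y)))) (at (x, y))"
    by (simp add: sheet_root_def yw)
  have root: "sheet_root x P x y = w" using base(1) by (simp add: sheet_root_def yw)
  let ?c = "\<lambda>l. taylor_coeff l x y"
  let ?\<sigma> = "\<Sum>s<l. ?c s * (1 / (x - y)) ^ (l + 1 - s)"
  have "((\<lambda>p. taylor_coeff l (fst p) (snd p) / sheet_root x P (fst p) (snd p)) has_derivative
    (\<lambda>h. (((- (1/2) * ?\<sigma>) * fst h + (of_nat (l + 1) * ?c (l + 1) - Sig 1 x y / 2 * ?c l) * snd h) * w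
      - ?c l * (w * (1 / 2 * ((- (y * (y - 1)) * fst h + cubic' x y * snd h) / cubic x y)))) / (w * w))) (at (x, y))"
    using has_derivative_divide'[OF has_derivative_taylor_coeff[OF ne, of l] S] base(3)
    by (simp add: root)
  moreover have "(((- (1/2) * ?\<sigma>) * u + (of_nat (l + 1) * ?c (l + 1) - Sig 1 x y / 2 * ?c l) * v) * w
      - ?c l * (w * (1 / 2 * ((- (y * (y - 1)) * u + cubic' x y * v) / cubic x y)))) / (w * w)
    = (- polar_sum l T (x - y) / 2) * u + (of_nat (l + 1) * T (l + 1)) * v" for u v
  proof -
    have "y * (y - 1) / cubic x y = 1 / (y - x)"
      unfolding cubic_def using ne by (intro nonzero_divide_mult_cancel_left) simp
    then have "y * (y - 1) / cubic x y = - (1 / (x - y))" by (metis minus_diff_eq minus_divide_right)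
    moreover have "cubic' x y / cubic x y = - Sig 1 x y"
      using cubic'_eq[of x y] base(1) by simp
    moreover have "(- (y * (y - 1)) * u + cubic' x y * v) / cubic x y
        = - (y * (y - 1) / cubic x y) * u + cubic' x y / cubic x y * v"
      by (simp add: add_divide_distrib diff_divide_distrib)
    ultimately have 1: "(- (y * (y - 1)) * u + cubic' x y * v) / cubic x y = 1 / (x - y) * u - Sig 1 x y * v"
      by simp
    have 2: "polar_sum l T (x - y) = (?\<sigma> + ?c l * (1 / (x - y))) / w"
      unfolding polar_sum_def T_def yw lessThan_Suc_atMost[symmetric] sum.lessThan_Suc
      by (simp add: add_divide_distrib sum_divide_distrib)
    have 3: "T (l + 1) = ?c (l + 1) / w" by (simp add: T_def yw)
    show ?thesis unfolding 1 2 3 using base(3)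
      by (simp add: field_simps)
  qed
  ultimately show ?thesis by (simp add: yw)
qed

text \<open>The two period conditions are linear equations for \<open>l\<close> and the coefficient
  of \<open>u\<close>. Cramer's rule with a constant determinant makes the latter a constant
  combination of \<open>E\<close> and \<open>F\<close>, hence a solution of the same linear
  equation.\<close>

lemma period_potential:
  assumes X: "open X" "X \<subseteq> - {0, 1}" and x0: "x0 \<in> X"
    and basis: "\<And>x. x \<in> X \<Longrightarrow> canonical_basis x (a x) (b x)"
    and proj: "\<And>x t. x \<in> X \<Longrightarrow> t \<in> {0..1} \<Longrightarrow> fst (a x t) = \<alpha> t"
      "\<And>x t. x \<in> X \<Longrightarrow> t \<in> {0..1} \<Longrightarrow> fst (b x t) = \<beta> t"
    and cont: "continuous_on (X \<times> {0..1}) (\<lambda>(x, t). a x t)" "continuous_on (X \<times> {0..1}) (\<lambda>(x, t). b x t)"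
    and Q: "\<And>x. x \<in> X \<Longrightarrow> Q0 x \<in> unramified x"
    and \<omega>: "\<And>x. x \<in> X \<Longrightarrow> normalized_holomorphic x (a x) (\<omega> x)"
    and W: "\<And>x. x \<in> X \<Longrightarrow> normalized_second_kind n x (a x) (Q0 x) (W x)"
    and per: "\<And>x. x \<in> X \<Longrightarrow> has_period x (\<lambda>P. W x P + A * \<omega> x P) (homology_class x (a x)) Ca"
      "\<And>x. x \<in> X \<Longrightarrow> has_period x (\<lambda>P. W x P + A * \<omega> x P) (homology_class x (b x)) Cb"
  obtains r M M' M'' where "r > 0" "ball x0 r \<subseteq> X"
    "\<And>x. x \<in> ball x0 r \<Longrightarrow> taylor_coeff n x (fst (Q0 x)) / snd (Q0 x) = M x"
    "\<And>x. x \<in> ball x0 r \<Longrightarrow> (M has_field_derivative M' x) (at x)"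
    "\<And>x. x \<in> ball x0 r \<Longrightarrow> (M' has_field_derivative M'' x) (at x)"
    "\<And>x. x \<in> ball x0 r \<Longrightarrow> x * (1 - x) * M'' x + (1 - 2 * x) * M' x - M x / 4 = 0"
proof -
  have la: "curve_loop x (a x)" and lb: "curve_loop x (b x)" if "x \<in> X" for x
    using basis[OF that] by (auto simp: canonical_basis_def)
  obtain r1 E E' E'' where E: "r1 > 0" "ball x0 r1 \<subseteq> X"
    "\<And>x. x \<in> ball x0 r1 \<Longrightarrow> (E has_field_derivative E' x) (at x)"
    "\<And>x. x \<in> ball x0 r1 \<Longrightarrow> (E' has_field_derivative E'' x) (at x)"
    "\<And>x. x \<in> ball x0 r1 \<Longrightarrow> x * (1 - x) * E'' x + (1 - 2 * x) * E' x - E x / 4 = 0"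
    "\<And>x l m. x \<in> ball x0 r1 \<Longrightarrow> curve_integral (a x) (elliptic_form l m) = l * E x + m * (x * E x + 2 * x * (x - 1) * E' x)"
    by (rule picard_fuchs[OF X(1) x0 la proj(1) cont(1)]) (assumption | rule that)+
  obtain r2 F F' F'' where F: "r2 > 0" "ball x0 r2 \<subseteq> X"
    "\<And>x. x \<in> ball x0 r2 \<Longrightarrow> (F has_field_derivative F' x) (at x)"
    "\<And>x. x \<in> ball x0 r2 \<Longrightarrow> (F' has_field_derivative F'' x) (at x)"
    "\<And>x. x \<in> ball x0 r2 \<Longrightarrow> x * (1 - x) * F'' x + (1 - 2 * x) * F' x - F x / 4 = 0"
    "\<And>x l m. x \<in> ball x0 r2 \<Longrightarrow> curve_integral (b x) (elliptic_form l m) = l * F x + m * (x * F x + 2 * x * (x - 1) * F' x)"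
    by (rule picard_fuchs[OF X(1) x0 lb proj(2) cont(2)]) (assumption | rule that)+
  define r where "r = min r1 r2"
  have r: "r > 0" "ball x0 r \<subseteq> X" and r12: "ball x0 r \<subseteq> ball x0 r1" "ball x0 r \<subseteq> ball x0 r2"
    using E(1,2) F(1) by (auto simp: r_def)
  note rE = E(3-6)[OF subsetD[OF r12(1)]] and rF = F(3-6)[OF subsetD[OF r12(2)]]
  \<comment> \<open>The determinant of the periods of \<open>du / v\<close> and
    \<open>u du / v\<close> reduces to a Wronskian of \<open>E\<close> and \<open>F\<close>: the
    summands \<open>x E\<close> and \<open>x F\<close> cancel.\<close>
  define D where "D x = 2 * (x * (x - 1) * (E' x * F x - F' x * E x))" for x
  have "(D has_field_derivative 0) (at x)" if x: "x \<in> ball x0 r" for x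
  proof -
    have "((\<lambda>x. x * (x - 1)) has_field_derivative (2 * x - 1)) (at x)"
      by (auto intro!: derivative_eq_intros)
    from DERIV_cmult[OF DERIV_mult[OF this DERIV_diff[OF DERIV_mult[OF rE(2)[OF x] rF(1)[OF x]] DERIV_mult[OF rF(2)[OF x] rE(1)[OF x]]]], of 2]
    have "(D has_field_derivative 2 * ((2 * x - 1) * (E' x * F x - F' x * E x)
      + (E'' x * F x + F' x * E' x - (F'' x * E x + E' x * F' x)) * (x * (x - 1)))) (at x)"
      unfolding D_def [abs_def] .
    moreover have "2 * ((2 * x - 1) * (E' x * F x - F' x * E x)
      + (E'' x * F x + F' x * E' x - (F'' x * E x + E' x * F' x)) * (x * (x - 1)))
      = 2 * (E x * (x * (1 - x) * F'' x + (1 - 2 * x) * F' x - F x / 4) - F x * (x * (1 - x) * E'' x + (1 - 2 * x) * E' x - E x / 4))"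
      by (simp add: algebra_simps)
    ultimately show ?thesis using rE(3)[OF x] rF(3)[OF x] by simp
  qed
  then have "\<exists>c. \<forall>x\<in>ball x0 r. D x = c"
    by (intro has_field_derivative_zero_constant) (auto intro: has_field_derivative_at_within)
  then obtain c where c: "\<And>x. x \<in> ball x0 r \<Longrightarrow> D x = c" by blast
  have x0r: "x0 \<in> ball x0 r" using r by simp
  have x01: "x0 \<noteq> 0" "x0 \<noteq> 1" using x0 X(2) by auto
  have nondeg: "l = 0 \<and> m = 0"
    if "l * E x0 + m * (x0 * E x0 + 2 * x0 * (x0 - 1) * E' x0) = 0" "l * F x0 + m * (x0 * F x0 + 2 * x0 * (x0 - 1) * F' x0) = 0" for l m
    using elliptic_periods_nondegenerate[OF x01 basis[OF x0], of l m] that rE(4)[OF x0r] rF(4)[OF x0r] by simp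
  have c0: "c \<noteq> 0"
  proof
    assume "c = 0"
    then have D0: "2 * (x0 * (x0 - 1) * (E' x0 * F x0 - F' x0 * E x0)) = 0" using c[OF x0r] by (simp add: D_def)
    \<comment> \<open>A zero determinant makes each row, with entries exchanged and one sign
      changed, a kernel vector. Nondegeneracy then gives \<open>E x0 = F x0 = 0\<close>, and so a
      kernel vector \<open>(1, 0)\<close>.\<close>
    have "F x0 * (x0 * E x0 + 2 * x0 * (x0 - 1) * E' x0) - E x0 * (x0 * F x0 + 2 * x0 * (x0 - 1) * F' x0)
       = 2 * (x0 * (x0 - 1) * (E' x0 * F x0 - F' x0 * E x0))"
      by (simp add: algebra_simps)
    then have det: "F x0 * (x0 * E x0 + 2 * x0 * (x0 - 1) * E' x0) = E x0 * (x0 * F x0 + 2 * x0 * (x0 - 1) * F' x0)"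
      by (simp only: D0 right_minus_eq)
    have "- E x0 = 0" "- F x0 = 0"
      using nondeg[of "x0 * E x0 + 2 * x0 * (x0 - 1) * E' x0" "- E x0"] nondeg[of "x0 * F x0 + 2 * x0 * (x0 - 1) * F' x0" "- F x0"] det
      by (auto simp: algebra_simps)
    then show False using nondeg[of 1 0] by simp
  qed
  define k where "k = 4 * of_nat (Suc n) / c"
  show ?thesis
  proof (rule that[of r "\<lambda>x. k * (Ca * F x - Cb * E x)" "\<lambda>x. k * (Ca * F' x - Cb * E' x)" "\<lambda>x. k * (Ca * F'' x - Cb * E'' x)", OF r])
    fix x assume x: "x \<in> ball x0 r"
    then have xX: "x \<in> X" using r by blast
    then have x01: "x \<noteq> 0" "x \<noteq> 1" using X(2) by auto
    define \<mu> where "\<mu> = taylor_coeff n x (fst (Q0 x)) / (4 * of_nat (Suc n) * snd (Q0 x))"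
    have "\<exists>l. \<forall>\<gamma> I. curve_loop x \<gamma> \<longrightarrow> has_period x (\<lambda>P. W x P + A * \<omega> x P) (homology_class x \<gamma>) I \<longrightarrow>
       I = curve_integral \<gamma> (elliptic_form l \<mu>)"
      unfolding \<mu>_def by (rule period_equation[OF x01 Q[OF xX] \<omega>[OF xX] W[OF xX], of A]) blast
    then obtain l where "\<forall>\<gamma> I. curve_loop x \<gamma> \<longrightarrow> has_period x (\<lambda>P. W x P + A * \<omega> x P) (homology_class x \<gamma>) I \<longrightarrow>
       I = curve_integral \<gamma> (elliptic_form l \<mu>)" ..
    note l = this[rule_format]
    have C: "Ca = l * E x + \<mu> * (x * E x + 2 * x * (x - 1) * E' x)" "Cb = l * F x + \<mu> * (x * F x + 2 * x * (x - 1) * F' x)"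
      using l[OF la[OF xX] per(1)[OF xX]] l[OF lb[OF xX] per(2)[OF xX]] rE(4)[OF x] rF(4)[OF x] by simp_all
    \<comment> \<open>This combination eliminates the unknown coefficient \<open>l\<close>.\<close>
    have "Ca * F x - Cb * E x = \<mu> * D x" unfolding C D_def by (simp add: algebra_simps)
    then have "k * (Ca * F x - Cb * E x) = 4 * of_nat (Suc n) * \<mu>" using c[OF x] c0 by (simp add: k_def)
    then show "taylor_coeff n x (fst (Q0 x)) / snd (Q0 x) = k * (Ca * F x - Cb * E x)"
      by (simp add: \<mu>_def del: of_nat_Suc)
    show "((\<lambda>x. k * (Ca * F x - Cb * E x)) has_field_derivative k * (Ca * F' x - Cb * E' x)) (at x)"
      by (intro DERIV_cmult DERIV_diff rE[OF x] rF[OF x])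
    show "((\<lambda>x. k * (Ca * F' x - Cb * E' x)) has_field_derivative k * (Ca * F'' x - Cb * E'' x)) (at x)"
      by (intro DERIV_cmult DERIV_diff rE[OF x] rF[OF x])
    have "x * (1 - x) * (k * (Ca * F'' x - Cb * E'' x)) + (1 - 2 * x) * (k * (Ca * F' x - Cb * E' x)) - k * (Ca * F x - Cb * E x) / 4
      = k * (Ca * (x * (1 - x) * F'' x + (1 - 2 * x) * F' x - F x / 4) - Cb * (x * (1 - x) * E'' x + (1 - 2 * x) * E' x - E x / 4))"
      by (simp add: field_simps)
    then show "x * (1 - x) * (k * (Ca * F'' x - Cb * E'' x)) + (1 - 2 * x) * (k * (Ca * F' x - Cb * E' x)) - k * (Ca * F x - Cb * E x) / 4 = 0"
      using rE(3)[OF x] rF(3)[OF x] by simp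
  qed
qed

section \<open>Differentiation along the moving pole\<close>

lemma sum_partial_sums:
  fixes f :: "nat \<Rightarrow> complex"
  shows "(\<Sum>s\<le>n. \<Sum>j\<le>s. f j) = (\<Sum>j\<le>n. of_nat (n + 1 - j) * f j)"
proof (induction n)
  case (Suc n)
  have "(\<Sum>j\<le>n. of_nat (Suc n + 1 - j) * f j) = (\<Sum>j\<le>n. of_nat (n + 1 - j) * f j) + (\<Sum>j\<le>n. f j)"
    unfolding sum.distrib[symmetric] by (intro sum.cong) (auto simp: Suc_diff_le algebra_simps)
  then show ?case using Suc by (simp add: algebra_simps)
qed simp

lemma polar_sum_weighted:
  "(\<Sum>s\<le>n. of_nat (s + 1) * T (s + 1) * e ^ (n + 1 - s)) + (\<Sum>s\<le>n. of_nat (n + 1 - s) * T s * e ^ (n + 2 - s))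
    = of_nat (n + 1) * (\<Sum>s\<le>n + 1. T s * e ^ (n + 2 - s))" for T :: "nat \<Rightarrow> complex"
proof -
  have "(\<Sum>s\<le>n + 1. of_nat s * T s * e ^ (n + 2 - s)) = (\<Sum>s\<le>n. of_nat (s + 1) * T (s + 1) * e ^ (n + 1 - s))"
    using sum.atMost_Suc_shift[of "\<lambda>s. of_nat s * T s * e ^ (n + 2 - s)" n] by simp
  moreover have "(\<Sum>s\<le>n + 1. of_nat (n + 1 - s) * T s * e ^ (n + 2 - s)) = (\<Sum>s\<le>n. of_nat (n + 1 - s) * T s * e ^ (n + 2 - s))"
    by simp
  moreover have "(\<Sum>s\<le>n + 1. of_nat s * T s * e ^ (n + 2 - s)) + (\<Sum>s\<le>n + 1. of_nat (n + 1 - s) * T s * e ^ (n + 2 - s))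
    = of_nat (n + 1) * (\<Sum>s\<le>n + 1. T s * e ^ (n + 2 - s))"
    unfolding sum.distrib[symmetric] sum_distrib_left
  proof (intro sum.cong refl)
    fix s assume "s \<in> {..n + 1}"
    then have "(of_nat (n + 1) :: complex) = of_nat s + of_nat (n + 1 - s)" by (simp flip: of_nat_add)
    then show "of_nat s * T s * e ^ (n + 2 - s) + of_nat (n + 1 - s) * T s * e ^ (n + 2 - s) = of_nat (n + 1) * (T s * e ^ (n + 2 - s))"
      by (simp only: distrib_right mult.assoc)
  qed
  ultimately show ?thesis by simp
qed

text \<open>At fixed \<open>u\<close> the \<open>x\<close>-derivative of
  \<open>1 / ((x - u) v)\<close> is \<open>- 3 / 2\<close> times \<open>1 / ((x - u)^2 v)\<close>,
  and the coefficients of \<open>1 / (x - u)^2\<close> carry the weights \<open>n + 1 - j\<close>.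
  The term with \<open>y'\<close> comes from shifting the centre, as for any Taylor
  coefficient.\<close>

lemma has_field_derivative_polar_sum:
  fixes T :: "nat \<Rightarrow> complex \<Rightarrow> complex"
  assumes T: "\<And>s. (T s has_field_derivative
      of_nat (s + 1) * T (s + 1) x * y' - polar_sum s (\<lambda>l. T l x) (x - y x) / 2) (at x)"
    and y: "(y has_field_derivative y') (at x)" and d0: "x - y x \<noteq> 0"
  shows "((\<lambda>t. polar_sum n (\<lambda>l. T l t) (t - y t)) has_field_derivative
     of_nat (n + 1) * polar_sum (n + 1) (\<lambda>l. T l x) (x - y x) * y'
       - 3 / 2 * (\<Sum>j\<le>n. of_nat (n + 1 - j) * T j x * (1 / (x - y x)) ^ (n + 2 - j))) (at x)"
proof -
  define e where "e = 1 / (x - y x)"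
  let ?A = "\<lambda>s. polar_sum s (\<lambda>l. T l x) (x - y x)"
  have "((\<lambda>t. t - y t) has_field_derivative 1 - y') (at x)" by (intro DERIV_diff DERIV_ident y)
  from DERIV_inverse'[OF this d0] have "((\<lambda>t. 1 / (t - y t)) has_field_derivative - (e * (1 - y') * e)) (at x)"
    by (simp add: e_def inverse_eq_divide)
  from DERIV_power[OF this] have
    "((\<lambda>t. (1 / (t - y t)) ^ k) has_field_derivative of_nat k * (- (e * (1 - y') * e) * e ^ (k - 1))) (at x)" for k
    by (simp add: e_def)
  moreover have "of_nat k * (- (e * (1 - y') * e) * e ^ (k - 1)) = - of_nat k * (1 - y') * e ^ (k + 1)" if "k > 0" for k
    using that by (cases k) (simp_all add: mult_ac del: of_nat_Suc)
  ultimately have pow: "((\<lambda>t. (1 / (t - y t)) ^ k) has_field_derivative - of_nat k * (1 - y') * e ^ (k + 1)) (at x)" if "k > 0" for k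
    using that by metis
  have "((\<lambda>t. \<Sum>s\<le>n. T s t * (1 / (t - y t)) ^ (n + 1 - s)) has_field_derivative
     (\<Sum>s\<le>n. (of_nat (s + 1) * T (s + 1) x * y' - ?A s / 2) * e ^ (n + 1 - s)
       + - of_nat (n + 1 - s) * (1 - y') * e ^ (n + 1 - s + 1) * T s x)) (at x)"
  proof (intro DERIV_sum)
    fix s assume "s \<in> {..n}"
    then have "n + 1 - s > 0" by simp
    from DERIV_mult[OF T[of s] pow[OF this]]
    show "((\<lambda>t. T s t * (1 / (t - y t)) ^ (n + 1 - s)) has_field_derivative
      (of_nat (s + 1) * T (s + 1) x * y' - ?A s / 2) * e ^ (n + 1 - s)
       + - of_nat (n + 1 - s) * (1 - y') * e ^ (n + 1 - s + 1) * T s x) (at x)"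
      by (simp only: e_def)
  qed
  moreover have "(\<Sum>s\<le>n. (of_nat (s + 1) * T (s + 1) x * y' - ?A s / 2) * e ^ (n + 1 - s)
       + - of_nat (n + 1 - s) * (1 - y') * e ^ (n + 1 - s + 1) * T s x)
    = of_nat (n + 1) * ?A (n + 1) * y' - 3 / 2 * (\<Sum>j\<le>n. of_nat (n + 1 - j) * T j x * e ^ (n + 2 - j))"
  proof -
    let ?p = "\<lambda>s. of_nat (s + 1) * T (s + 1) x * e ^ (n + 1 - s)" and ?q = "\<lambda>s. of_nat (n + 1 - s) * T s x * e ^ (n + 2 - s)"
      and ?u = "\<lambda>s. ?A s * e ^ (n + 1 - s)"
    have "(of_nat (s + 1) * T (s + 1) x * y' - ?A s / 2) * e ^ (n + 1 - s)
       + - of_nat (n + 1 - s) * (1 - y') * e ^ (n + 1 - s + 1) * T s x = (?p s + ?q s) * y' - ?q s - ?u s / 2" if "s \<le> n" for s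
    proof -
      have "n + 1 - s + 1 = n + 2 - s" using that by simp
      then show ?thesis by (simp only:) (simp add: algebra_simps)
    qed
    then have "(\<Sum>s\<le>n. (of_nat (s + 1) * T (s + 1) x * y' - ?A s / 2) * e ^ (n + 1 - s)
       + - of_nat (n + 1 - s) * (1 - y') * e ^ (n + 1 - s + 1) * T s x) = (\<Sum>s\<le>n. (?p s + ?q s) * y' - ?q s - ?u s / 2)"
      by (intro sum.cong) auto
    also have "\<dots> = (sum ?p {..n} + sum ?q {..n}) * y' - sum ?q {..n} - sum ?u {..n} / 2"
      by (simp only: sum_subtractf sum.distrib sum_distrib_right[symmetric] sum_divide_distrib[symmetric])
    also have "sum ?p {..n} + sum ?q {..n} = of_nat (n + 1) * ?A (n + 1)"
    proof -
      have A: "?A (n + 1) = (\<Sum>s\<le>n + 1. T s x * e ^ (n + 2 - s))"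
        by (simp only: polar_sum_def e_def add.assoc one_add_one)
      show ?thesis unfolding A by (rule polar_sum_weighted[where T = "\<lambda>l. T l x"])
    qed
    also have "sum ?u {..n} = (\<Sum>s\<le>n. \<Sum>j\<le>s. T j x * e ^ (n + 2 - j))"
    proof (intro sum.cong refl)
      fix s assume s: "s \<in> {..n}"
      have "?u s = (\<Sum>j\<le>s. T j x * e ^ (s + 1 - j) * e ^ (n + 1 - s))"
        by (simp only: polar_sum_def e_def sum_distrib_right)
      also have "\<dots> = (\<Sum>j\<le>s. T j x * e ^ (n + 2 - j))"
      proof (intro sum.cong refl)
        fix j assume "j \<in> {..s}"
        then have "n + 2 - j = (s + 1 - j) + (n + 1 - s)" using s by simp
        then show "T j x * e ^ (s + 1 - j) * e ^ (n + 1 - s) = T j x * e ^ (n + 2 - j)" by (simp only: power_add mult.assoc)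
      qed
      finally show "?u s = (\<Sum>j\<le>s. T j x * e ^ (n + 2 - j))" .
    qed
    also have "\<dots> = sum ?q {..n}" unfolding sum_partial_sums by (simp only: mult.assoc)
    finally show ?thesis by (simp add: algebra_simps)
  qed
  ultimately show ?thesis unfolding polar_sum_def e_def by simp
qed

lemma sheet_root_along:
  assumes Q: "isCont Q0 x" "Q0 x \<in> unramified x" and ev: "\<forall>\<^sub>F t in nhds x. Q0 t \<in> unramified t"
  shows "\<forall>\<^sub>F t in nhds x. sheet_root x (Q0 x) t (fst (Q0 t)) = snd (Q0 t)"
proof -
  have w0: "snd (Q0 x) \<noteq> 0" by (rule unramified_base(3)[OF Q(2)])
  have "isCont (\<lambda>t. Re (snd (Q0 t) / snd (Q0 x))) x" using Q(1) w0 by (intro isCont_Re isCont_divide) (auto intro: continuous_intros)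
  then have "\<forall>\<^sub>F t in nhds x. Re (snd (Q0 t) / snd (Q0 x)) \<in> {0<..}"
    by (rule isCont_eventually_mem[OF _ open_greaterThan]) (use w0 in simp)
  with ev show ?thesis
  proof eventually_elim
    case (elim t)
    then show ?case using subsetD[OF unramified_sub_affine elim(1)] by (intro sheet_root_eq[OF Q(2)]) auto
  qed
qed

text \<open>The middle claim is the source of the differentiability of the pole position: only
  continuity of \<open>Q0\<close> and a differentiable value of \<open>T n\<close> are assumed, and
  \<open>T (n + 1) x\<close> is the nonzero partial derivative up to the factor
  \<open>n + 1\<close>.\<close>

lemma taylor_derivatives_along:
  assumes Q: "isCont Q0 x" "Q0 x \<in> unramified x" and ev: "\<forall>\<^sub>F t in nhds x. Q0 t \<in> unramified t"
  defines "T \<equiv> \<lambda>l t. taylor_coeff l t (fst (Q0 t)) / snd (Q0 t)"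
  shows "((\<lambda>t. fst (Q0 t)) has_field_derivative y') (at x) \<Longrightarrow>
      (T l has_field_derivative of_nat (l + 1) * T (l + 1) x * y' - polar_sum l (\<lambda>l. T l x) (x - fst (Q0 x)) / 2) (at x)"
    and "(M has_field_derivative m') (at x) \<Longrightarrow> \<forall>\<^sub>F t in nhds x. T n t = M t \<Longrightarrow> T (n + 1) x \<noteq> 0 \<Longrightarrow>
      ((\<lambda>t. fst (Q0 t)) has_field_derivative
        (m' + polar_sum n (\<lambda>l. T l x) (x - fst (Q0 x)) / 2) / (of_nat (n + 1) * T (n + 1) x)) (at x)"
    and "isCont (T l) x"
proof -
  define g where "g l p = taylor_coeff l (fst p) (snd p) / sheet_root x (Q0 x) (fst p) (snd p)" for l p
  let ?A = "\<lambda>l. polar_sum l (\<lambda>l. T l x) (x - fst (Q0 x))"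
  have D: "(g l has_derivative (\<lambda>h. (- ?A l / 2) * fst h + (of_nat (l + 1) * T (l + 1) x) * snd h)) (at (x, fst (Q0 x)))" for l
    unfolding g_def [abs_def] T_def by (rule has_derivative_taylor_over_root[OF Q(2)])
  have eq: "\<forall>\<^sub>F t in nhds x. g l (t, fst (Q0 t)) = T l t" for l
    using sheet_root_along[OF Q ev] by eventually_elim (simp add: g_def T_def)
  have cont: "isCont (\<lambda>t. fst (Q0 t)) x" using Q(1) by (intro continuous_intros)
  have "isCont (\<lambda>t. g l (t, fst (Q0 t))) x"
    by (rule isCont_o2[where g = "g l" and f = "\<lambda>t. (t, fst (Q0 t))", OF _ has_derivative_continuous[OF D]]) (intro continuous_intros cont)
  then show "isCont (T l) x" using isCont_cong[OF eq[of l]] by simp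
  show "((\<lambda>t. fst (Q0 t)) has_field_derivative
        (m' + ?A n / 2) / (of_nat (n + 1) * T (n + 1) x)) (at x)"
    if M: "(M has_field_derivative m') (at x)" "\<forall>\<^sub>F t in nhds x. T n t = M t" "T (n + 1) x \<noteq> 0"
  proof -
    have e: "\<forall>\<^sub>F t in nhds x. g n (t, fst (Q0 t)) = M t" using eq[of n] M(2) by eventually_elim simp
    have "of_nat (n + 1) * T (n + 1) x \<noteq> 0" using M(3) by (simp del: of_nat_Suc of_nat_add)
    from implicit_has_field_derivative[OF D this cont M(1) e] show ?thesis by simp
  qed
  show "(T l has_field_derivative of_nat (l + 1) * T (l + 1) x * y' - ?A l / 2) (at x)"
    if y: "((\<lambda>t. fst (Q0 t)) has_field_derivative y') (at x)"
  proof -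
    have "((\<lambda>t. (t, fst (Q0 t))) has_derivative (\<lambda>h. (h, y' * h))) (at x)"
      using y unfolding has_field_derivative_def by (intro has_derivative_Pair has_derivative_ident)
    from has_derivative_compose[OF this D[of l]]
    have "((\<lambda>t. g l (t, fst (Q0 t))) has_derivative (\<lambda>h. - ?A l / 2 * h + of_nat (l + 1) * T (l + 1) x * (y' * h))) (at x)"
      by simp
    moreover have "(\<lambda>h. - ?A l / 2 * h + of_nat (l + 1) * T (l + 1) x * (y' * h)) = (*) (of_nat (l + 1) * T (l + 1) x * y' - ?A l / 2)"
      by (rule ext) (simp add: left_diff_distrib mult.assoc)
    ultimately have "((\<lambda>t. g l (t, fst (Q0 t))) has_field_derivative of_nat (l + 1) * T (l + 1) x * y' - ?A l / 2) (at x)"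
      by (simp only: has_field_derivative_def)
    then show ?thesis using DERIV_cong_ev[OF refl eq[of l] refl] by blast
  qed
qed

lemma sum_strict_partial_sums:
  fixes f :: "nat \<Rightarrow> complex"
  shows "(\<Sum>s\<in>{1..<n}. \<Sum>j<s. f j) = (\<Sum>j<n. of_nat (n - j) * f j) - (\<Sum>j<n. f j)"
proof -
  have "(\<Sum>s<n. \<Sum>j<s. f j) + (\<Sum>j<n. f j) = (\<Sum>j<n. of_nat (n - j) * f j)"
  proof (induction n)
    case (Suc n)
    have "(\<Sum>j<n. of_nat (Suc n - j) * f j) = (\<Sum>j<n. of_nat (n - j) * f j) + (\<Sum>j<n. f j)"
      unfolding sum.distrib[symmetric] by (intro sum.cong) (auto simp: Suc_diff_le algebra_simps)
    then show ?case using Suc by (simp add: algebra_simps)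
  qed simp
  moreover have "(\<Sum>s<n. \<Sum>j<s. f j) = (\<Sum>s\<in>{1..<n}. \<Sum>j<s. f j)"
    by (intro sum.mono_neutral_right) (auto simp: Suc_le_eq)
  ultimately show ?thesis by (simp add: algebra_simps)
qed

text \<open>Both sides are compared after expanding everything in \<open>1 / (x - y)\<close>; the coefficient of each
  \<open>T k\<close> with \<open>k < n\<close> then is \<open>- 1 - (n - k) / 2 - (n - 1 - k) / 4 = - 3 (n + 1 - k) / 4\<close>.\<close>

lemma second_order_equation:
  fixes T \<Lambda> :: "nat \<Rightarrow> complex" and x y y' y'' w :: complex
  assumes x: "x \<noteq> 0" "x \<noteq> 1" "x \<noteq> y" and w: "w \<noteq> 0" and T1: "T (n + 1) \<noteq> 0"
    and \<Lambda>: "\<And>l. \<Lambda> l = fact l * w * T l"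
    and M': "M' = of_nat (n + 1) * T (n + 1) * y' - polar_sum n T (x - y) / 2"
    and M'': "M'' = of_nat (n + 1) * (T (n + 1) * y'' + (of_nat (n + 2) * T (n + 2) * y' - polar_sum (n + 1) T (x - y) / 2) * y')
      - (of_nat (n + 1) * polar_sum (n + 1) T (x - y) * y' - 3 / 2 * (\<Sum>j\<le>n. of_nat (n + 1 - j) * T j * (1 / (x - y)) ^ (n + 2 - j))) / 2"
    and ode: "x * (1 - x) * M'' + (1 - 2 * x) * M' - T n / 4 = 0"
  shows "y'' =
        - y'\<^sup>2 * (\<Lambda> (n + 2) / \<Lambda> (n + 1))
        - y' * (1 / x + 1 / (x - 1) + 1 / (y - x))
        + y' * (fact (n + 1) / ((x - y) ^ (n + 2) * \<Lambda> (n + 1)))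
            * (\<Sum>s\<le>n. \<Lambda> s * (x - y) ^ s / fact s)
        + fact n * (1 / x + 1 / (x - 1) + 2 / (y - x)) / (2 * (x - y) ^ (n + 1) * \<Lambda> (n + 1))
            * (\<Sum>s<n. \<Lambda> s * (x - y) ^ s / fact s)
        - fact n / (2 * (x - y) ^ (n + 2) * \<Lambda> (n + 1))
            * (\<Sum>s<n. of_nat (n - s) * \<Lambda> s * (x - y) ^ s / fact s)
        - fact n / (4 * (x - y) ^ (n + 2) * \<Lambda> (n + 1))
            * (\<Sum>s\<in>{1..<n}. \<Sum>k<s. \<Lambda> k * (x - y) ^ k / fact k)
        - \<Lambda> n / (4 * \<Lambda> (n + 1))
            * (2 / (y - x) * (1 / x + 1 / (x - 1)) + 3 / (y - x)\<^sup>2 + 1 / (x - 1) - 1 / x)"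
proof -
  define d where "d = x - y"
  define e where "e = 1 / d"
  define N where "N = (of_nat (n + 1) :: complex)"
  define q where "q = 1 / x + 1 / (x - 1)"
  define k where "k = 1 / (x - 1) - 1 / x"
  define g where "g = 1 / T (n + 1)"
  \<comment> \<open>Multiplication by \<open>f\<close> makes the coefficient of \<open>y''\<close>
    in the equation for \<open>T n\<close> equal to 1.\<close>
  define f where "f = g / N"
  have d0: "d \<noteq> 0" using x by (simp add: d_def)
  have N0: "N \<noteq> 0" unfolding N_def by (metis Suc_eq_plus1 of_nat_neq_0)
  have ed: "e * d = 1" and gT: "g * T (n + 1) = 1" and fN: "f * N = g"
    using d0 T1 N0 by (simp_all add: e_def g_def f_def)
  have yx: "1 / (y - x) = - e" "2 / (y - x) = - 2 * e" "3 / (y - x)\<^sup>2 = 3 * e\<^sup>2"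
  proof -
    have "y - x = - d" by (simp add: d_def)
    then show "1 / (y - x) = - e" "2 / (y - x) = - 2 * e" "3 / (y - x)\<^sup>2 = 3 * e\<^sup>2"
      by (simp_all add: e_def power_divide)
  qed
  \<comment> \<open>All sums on either side become combinations of \<open>U\<close>, the plain sum
    of these terms, and \<open>V\<close>, the sum weighted by \<open>n - s\<close>; what is left is
    a linear comparison.\<close>
  define h where "h s = T s * e ^ (n + 2 - s)" for s
  define U where "U = (\<Sum>s<n. h s)"
  define V where "V = (\<Sum>s<n. of_nat (n - s) * h s)"
  have split: "{..n} = insert n {..<n}" by auto
  have A0: "polar_sum n T d = d * U + T n * e"
  proof -
    have "(\<Sum>s<n. T s * e ^ (n + 1 - s)) = d * U"
      unfolding U_def h_def sum_distrib_left
    proof (intro sum.cong refl)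
      fix s assume "s \<in> {..<n}"
      then have "n + 2 - s = Suc (n + 1 - s)" by simp
      then have eq: "d * (T s * e ^ (n + 2 - s)) = (e * d) * (T s * e ^ (n + 1 - s))" by (simp only: power_Suc mult_ac)
      show "T s * e ^ (n + 1 - s) = d * (T s * e ^ (n + 2 - s))" unfolding eq ed by simp
    qed
    then show ?thesis by (simp add: polar_sum_def e_def[symmetric] split)
  qed
  have A1: "polar_sum (n + 1) T d = U + T n * e\<^sup>2 + T (n + 1) * e"
    by (simp add: polar_sum_def e_def[symmetric] split U_def h_def)
  have B: "(\<Sum>j\<le>n. of_nat (n + 1 - j) * T j * e ^ (n + 2 - j)) = V + U + T n * e\<^sup>2"
  proof -
    have "(\<Sum>j<n. of_nat (n + 1 - j) * T j * e ^ (n + 2 - j)) = V + U"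
      unfolding U_def V_def h_def sum.distrib[symmetric]
      by (intro sum.cong) (auto simp: Suc_diff_le algebra_simps)
    then show ?thesis by (simp add: split)
  qed
  \<comment> \<open>Every sum of the statement thus carries the factor
    \<open>w * d ^ (n + 2)\<close>, which cancels against its prefactor.\<close>
  have summand: "\<Lambda> s * d ^ s / fact s = w * d ^ (n + 2) * h s" if "s \<le> n" for s
  proof -
    have "d ^ (n + 2) = d ^ s * d ^ (n + 2 - s)" using that by (simp flip: power_add)
    then have "w * d ^ (n + 2) * h s = w * T s * d ^ s * (e * d) ^ (n + 2 - s)"
      by (simp add: h_def power_mult_distrib)
    then have eq: "w * d ^ (n + 2) * h s = w * T s * d ^ s" by (simp only: ed power_one mult_1_right)
    show ?thesis unfolding eq by (simp add: \<Lambda>)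
  qed
  have sums: "(\<Sum>s\<le>n. \<Lambda> s * d ^ s / fact s) = w * d ^ (n + 2) * (U + T n * e\<^sup>2)"
    "(\<Sum>s<n. \<Lambda> s * d ^ s / fact s) = w * d ^ (n + 2) * U"
    "(\<Sum>s<n. of_nat (n - s) * \<Lambda> s * d ^ s / fact s) = w * d ^ (n + 2) * V"
    "(\<Sum>s\<in>{1..<n}. \<Sum>k<s. \<Lambda> k * d ^ k / fact k) = w * d ^ (n + 2) * (V - U)"
  proof -
    show 2: "(\<Sum>s<n. \<Lambda> s * d ^ s / fact s) = w * d ^ (n + 2) * U"
      unfolding U_def sum_distrib_left by (intro sum.cong refl summand) simp
    have "\<Lambda> n * d ^ n / fact n = w * d ^ (n + 2) * (T n * e\<^sup>2)" using summand[of n] by (simp add: h_def)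
    then show "(\<Sum>s\<le>n. \<Lambda> s * d ^ s / fact s) = w * d ^ (n + 2) * (U + T n * e\<^sup>2)"
      using 2 by (simp add: split distrib_left)
    have 3: "(\<Sum>s<n. of_nat (n - s) * (\<Lambda> s * d ^ s / fact s)) = w * d ^ (n + 2) * V"
      unfolding V_def sum_distrib_left
    proof (intro sum.cong refl)
      fix s assume "s \<in> {..<n}"
      then show "of_nat (n - s) * (\<Lambda> s * d ^ s / fact s) = w * d ^ (n + 2) * (of_nat (n - s) * h s)"
        using summand[of s] by (simp only: mult_ac lessThan_iff less_imp_le_nat)
    qed
    then show "(\<Sum>s<n. of_nat (n - s) * \<Lambda> s * d ^ s / fact s) = w * d ^ (n + 2) * V"
      by (simp add: mult.assoc)
    show "(\<Sum>s\<in>{1..<n}. \<Sum>k<s. \<Lambda> k * d ^ k / fact k) = w * d ^ (n + 2) * (V - U)"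
      unfolding sum_strict_partial_sums 2 3 by (simp add: right_diff_distrib)
  qed
  have \<Lambda>1: "\<Lambda> (n + 1) = N * fact n * w * T (n + 1)" by (simp add: \<Lambda> N_def)
  have \<Lambda>2: "\<Lambda> (n + 2) = of_nat (n + 2) * N * fact n * w * T (n + 2)"
    by (simp add: \<Lambda> N_def numeral_2_eq_2)
  have F0: "(fact n :: complex) \<noteq> 0" by simp
  have dn: "d ^ (n + 2) \<noteq> 0" "d ^ (n + 1) \<noteq> 0" using d0 by simp_all
  have c1: "\<Lambda> (n + 2) / \<Lambda> (n + 1) = of_nat (n + 2) * T (n + 2) * g"
    unfolding \<Lambda>1 \<Lambda>2 g_def using w T1 N0 F0 by (simp add: divide_simps del: of_nat_add of_nat_Suc)
  have c2: "\<Lambda> n / (4 * \<Lambda> (n + 1)) = f * T n / 4"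
    unfolding \<Lambda>1 \<Lambda>[of n] f_def g_def using w T1 N0 F0 by (simp add: divide_simps)
  have c3: "fact n / (a * d ^ (n + 2) * \<Lambda> (n + 1)) * (w * d ^ (n + 2) * z) = f * z / a" for a z
    unfolding \<Lambda>1 f_def g_def using w T1 N0 F0 dn by (cases "a = 0") (simp_all add: divide_simps del: power_Suc)
  have c4: "y' * (fact (n + 1) / (d ^ (n + 2) * \<Lambda> (n + 1))) * (w * d ^ (n + 2) * z) = y' * (g * z)" for z
  proof -
    have "(fact (n + 1) :: complex) = N * fact n" by (simp add: N_def)
    then show ?thesis
      unfolding \<Lambda>1 g_def using w T1 N0 F0 dn by (simp add: divide_simps del: power_Suc fact_Suc)
  qed
  have c5: "fact n * z / (2 * d ^ (n + 1) * \<Lambda> (n + 1)) * (w * d ^ (n + 2) * U) = z / 2 * f * (d * U)" for z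
  proof -
    have "d ^ (n + 2) = d * d ^ (n + 1)" by simp
    then show ?thesis
      unfolding \<Lambda>1 f_def g_def using w T1 N0 F0 dn by (simp add: divide_simps del: power_Suc)
  qed
  \<comment> \<open>The Picard-Fuchs equation divided by \<open>x * (1 - x)\<close>; the rational
    coefficients become \<open>1 / x + 1 / (x - 1)\<close> and \<open>k / 4\<close>, exactly the
    expressions in the statement.\<close>
  have qk: "M'' + q * M' + k / 4 * T n = 0"
  proof -
    have "x * (1 - x) \<noteq> 0" using x by simp
    moreover have "x * (1 - x) * q = 1 - 2 * x" "x * (1 - x) * k = - 1"
      using x by (simp_all add: q_def k_def field_simps)
    then have "x * (1 - x) * (M'' + q * M' + k / 4 * T n) = x * (1 - x) * M'' + (1 - 2 * x) * M' - T n / 4"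
      by (simp add: distrib_left flip: mult.assoc)
    ultimately show ?thesis using ode by (metis mult_eq_0_iff)
  qed
  have gA1: "g * polar_sum (n + 1) T d = g * (U + T n * e\<^sup>2) + e"
    unfolding A1 using gT by (simp add: distrib_left mult.assoc[symmetric])
  have fd: "(q + - 2 * e) / 2 * f * (d * U) = q / 2 * f * (d * U) - f * U"
  proof -
    have "e * f * (d * U) = (e * d) * (f * U)" by (simp add: mult_ac)
    then have "e * f * (d * U) = f * U" using ed by simp
    then show ?thesis by (simp add: add_divide_distrib diff_divide_distrib left_diff_distrib)
  qed
  have fM': "f * M' = y' - f * (d * U + T n * e) / 2"
  proof -
    have "f * M' = (f * N) * T (n + 1) * y' - f * polar_sum n T d / 2"
      unfolding M' N_def d_def by (simp add: right_diff_distrib mult.assoc)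
    then show ?thesis unfolding fN gT A0 by simp
  qed
  have fM'': "f * M'' = y'' + of_nat (n + 2) * T (n + 2) * g * y'\<^sup>2 - (g * polar_sum (n + 1) T d) * y' + 3 / 4 * (f * (V + U + T n * e\<^sup>2))"
  proof -
    have "f * M'' = (f * N) * T (n + 1) * y'' + (f * N) * (of_nat (n + 2) * T (n + 2)) * (y' * y')
       - (f * N) * polar_sum (n + 1) T d * y' + 3 / 4 * (f * (\<Sum>j\<le>n. of_nat (n + 1 - j) * T j * e ^ (n + 2 - j)))"
      unfolding M'' N_def d_def[symmetric] e_def[symmetric]
      by (simp add: algebra_simps diff_divide_distrib add_divide_distrib del: of_nat_add of_nat_Suc)
    then show ?thesis unfolding fN gT B by (simp add: power2_eq_square mult_ac del: of_nat_add of_nat_Suc)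
  qed
  have "f * (M'' + q * M' + k / 4 * T n) = 0" unfolding qk by simp
  then have "f * M'' + q * (f * M') + k / 4 * (f * T n) = 0" by (simp add: algebra_simps)
  then have y'': "y'' = - (of_nat (n + 2) * T (n + 2) * g * y'\<^sup>2) + (g * (U + T n * e\<^sup>2) + e) * y' - 3 / 4 * (f * (V + U + T n * e\<^sup>2))
     - q * (y' - f * (d * U + T n * e) / 2) - k / 4 * (f * T n)"
    unfolding fM' fM'' gA1 by (simp add: algebra_simps del: of_nat_add of_nat_Suc)
  have k': "X + 1 / (x - 1) - 1 / x = X + k" for X by (simp add: k_def)
  show ?thesis
    unfolding d_def[symmetric] sums q_def[symmetric] yx k' c1 c2 c3 c4 c5 fd y''
    using c3[of 1]
    by (simp add: algebra_simps add_divide_distrib diff_divide_distrib power2_eq_square del: of_nat_add of_nat_Suc)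
qed

text \<open>Where \<open>L (n + 1)\<close> is nonzero the right side is meaningful and the relation
  for T_n can be solved for the pole. Analyticity is asserted along with the equation, so that both
  \<open>deriv\<close> terms are genuine derivatives of a function assumed only continuous.\<close>

theorem theorem1:
  fixes n :: nat and A :: complex and X :: "complex set"
    and \<alpha> \<beta> :: "real \<Rightarrow> complex"
    and a b :: "complex \<Rightarrow> real \<Rightarrow> complex \<times> complex"
    and \<omega> W \<Omega> :: "complex \<Rightarrow> complex \<times> complex \<Rightarrow> complex"
    and Q0 :: "complex \<Rightarrow> complex \<times> complex"
    and y0 :: "complex \<Rightarrow> complex"
    and Ca Cb :: complex
  assumes "open X" and "simply_connected X" and "X \<subseteq> - {0, 1}"
    and "\<And>x. x \<in> X \<Longrightarrow> canonical_basis x (a x) (b x)"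
    and "\<And>x t. x \<in> X \<Longrightarrow> t \<in> {0..1} \<Longrightarrow> fst (a x t) = \<alpha> t \<and> fst (b x t) = \<beta> t"
    and "continuous_on (X \<times> {0..1}) (\<lambda>(x, t). a x t)"
    and "continuous_on (X \<times> {0..1}) (\<lambda>(x, t). b x t)"
    and "\<And>x. x \<in> X \<Longrightarrow> Q0 x \<in> unramified x"
    and "continuous_on X Q0"
    and "\<And>x. x \<in> X \<Longrightarrow> normalized_holomorphic x (a x) (\<omega> x)"
    and "\<And>x. x \<in> X \<Longrightarrow> normalized_second_kind n x (a x) (Q0 x) (W x)"
    and "\<And>x P. \<Omega> x P = W x P + A * \<omega> x P"
    and "\<And>x. x \<in> X \<Longrightarrow> has_period x (\<Omega> x) (homology_class x (a x)) Ca"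
    and "\<And>x. x \<in> X \<Longrightarrow> has_period x (\<Omega> x) (homology_class x (b x)) Cb"
    and "\<And>x. y0 x = fst (Q0 x)"
  shows "\<forall>x\<in>X. L (n + 1) x (y0 x) \<noteq> 0 \<longrightarrow>
    y0 analytic_on {x} \<and>
    (let y = y0 x; y' = deriv y0 x; y'' = deriv (deriv y0) x; \<Lambda> = (\<lambda>l. L l x y) in
      y'' =
        - y'\<^sup>2 * (\<Lambda> (n + 2) / \<Lambda> (n + 1))
        - y' * (1 / x + 1 / (x - 1) + 1 / (y - x))
        + y' * (fact (n + 1) / ((x - y) ^ (n + 2) * \<Lambda> (n + 1)))
            * (\<Sum>s\<le>n. \<Lambda> s * (x - y) ^ s / fact s)
        + fact n * (1 / x + 1 / (x - 1) + 2 / (y - x)) / (2 * (x - y) ^ (n + 1) * \<Lambda> (n + 1))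
            * (\<Sum>s<n. \<Lambda> s * (x - y) ^ s / fact s)
        - fact n / (2 * (x - y) ^ (n + 2) * \<Lambda> (n + 1))
            * (\<Sum>s<n. of_nat (n - s) * \<Lambda> s * (x - y) ^ s / fact s)
        - fact n / (4 * (x - y) ^ (n + 2) * \<Lambda> (n + 1))
            * (\<Sum>s\<in>{1..<n}. \<Sum>k<s. \<Lambda> k * (x - y) ^ k / fact k)
        - \<Lambda> n / (4 * \<Lambda> (n + 1))
            * (2 / (y - x) * (1 / x + 1 / (x - 1)) + 3 / (y - x)\<^sup>2 + 1 / (x - 1) - 1 / x))"
proof (intro ballI impI)
  fix x assume xX: "x \<in> X" and L0: "L (n + 1) x (y0 x) \<noteq> 0"
  note oX = assms(1) and X01 = assms(3) and unr = assms(8)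
  have y0: "y0 = (\<lambda>t. fst (Q0 t))" using assms(15) by (rule ext)
  have \<Omega>: "\<Omega> t = (\<lambda>P. W t P + A * \<omega> t P)" for t using assms(12) by (rule ext)
  have proj: "fst (a t s) = \<alpha> s" "fst (b t s) = \<beta> s" if "t \<in> X" "s \<in> {0..1}" for t s
    using assms(5)[OF that] by simp_all
  obtain r M M' M'' where r: "r > 0" "ball x r \<subseteq> X"
    and M: "\<And>t. t \<in> ball x r \<Longrightarrow> taylor_coeff n t (fst (Q0 t)) / snd (Q0 t) = M t"
      "\<And>t. t \<in> ball x r \<Longrightarrow> (M has_field_derivative M' t) (at t)"
      "\<And>t. t \<in> ball x r \<Longrightarrow> (M' has_field_derivative M'' t) (at t)"
      "\<And>t. t \<in> ball x r \<Longrightarrow> t * (1 - t) * M'' t + (1 - 2 * t) * M' t - M t / 4 = 0"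
    by (rule period_potential[OF oX X01 xX assms(4) proj assms(6,7) unr assms(10,11)
          assms(13)[unfolded \<Omega>] assms(14)[unfolded \<Omega>]]) (assumption | rule that)+
  define T where "T l t = taylor_coeff l t (fst (Q0 t)) / snd (Q0 t)" for l t
  have cQ: "isCont Q0 t" if "t \<in> X" for t
    using assms(9) oX that by (simp add: continuous_on_eq_continuous_at)
  have ev: "\<forall>\<^sub>F s in nhds t. Q0 s \<in> unramified s" if "t \<in> X" for t
    using eventually_nhds_in_open[OF oX that] by eventually_elim (rule unr)
  note along = taylor_derivatives_along[OF cQ unr ev, folded T_def]
  have w0: "snd (Q0 x) \<noteq> 0" by (rule unramified_base(3)[OF unr[OF xX]])
  have "T (n + 1) x \<in> - {0}" using L0 w0 by (simp add: T_def taylor_coeff_def y0 del: fact_Suc)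
  with along(3)[OF xX xX xX, of "n + 1"] have "\<forall>\<^sub>F t in nhds x. T (n + 1) t \<in> - {0}"
    by (intro isCont_eventually_mem) auto
  \<comment> \<open>A second derivative at \<open>x\<close> needs the first one nearby, so the
    nonvanishing is spread to a disc by continuity of the Taylor coefficients along the
    pole.\<close>
  then obtain \<delta> where \<delta>: "\<delta> > 0" "\<And>t. dist t x < \<delta> \<Longrightarrow> T (n + 1) t \<noteq> 0"
    unfolding eventually_nhds_metric by auto
  define \<rho> where "\<rho> = min r \<delta>"
  have \<rho>: "\<rho> > 0" "x \<in> ball x \<rho>" using r(1) \<delta>(1) by (simp_all add: \<rho>_def)
  have sub: "t \<in> ball x r" "t \<in> X" "T (n + 1) t \<noteq> 0" if "t \<in> ball x \<rho>" for t
    using that r(2) \<delta>(2)[of t] by (auto simp: \<rho>_def dist_commute)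
  define Y where "Y t = (M' t + polar_sum n (\<lambda>l. T l t) (t - y0 t) / 2) / (of_nat (n + 1) * T (n + 1) t)" for t
  have Dy: "(y0 has_field_derivative Y t) (at t)" if t: "t \<in> ball x \<rho>" for t
  proof -
    note t' = sub[OF t]
    have "\<forall>\<^sub>F s in nhds t. T n s = M s"
      using eventually_nhds_in_open[OF open_ball t'(1)] by eventually_elim (simp add: T_def M(1))
    from along(2)[OF t'(2) t'(2) t'(2) M(2)[OF t'(1)] this t'(3)] show ?thesis
      unfolding Y_def y0 .
  qed
  \<comment> \<open>Complex differentiability on a disc already provides the second derivative, so
    the quotient \<open>Y\<close> itself need not be differentiated.\<close>
  have hol: "y0 holomorphic_on ball x \<rho>"
    unfolding holomorphic_on_open[OF open_ball] using Dy by blast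
  have dy: "deriv y0 t = Y t" if "t \<in> ball x \<rho>" for t
    using Dy[OF that] by (rule DERIV_imp_deriv)
  have D2: "(deriv y0 has_field_derivative deriv (deriv y0) x) (at x)"
    by (rule holomorphic_derivI[OF holomorphic_deriv[OF hol open_ball] open_ball \<rho>(2)])
  have D1: "(y0 has_field_derivative deriv y0 x) (at x)" using Dy[OF \<rho>(2)] dy[OF \<rho>(2)] by simp
  have M'_eq: "M' t = of_nat (n + 1) * T (n + 1) t * deriv y0 t - polar_sum n (\<lambda>l. T l t) (t - y0 t) / 2"
    if t: "t \<in> ball x \<rho>" for t
    unfolding dy[OF t] Y_def using sub(3)[OF t] by (simp del: of_nat_add of_nat_Suc)
  have DT: "(T s has_field_derivative of_nat (s + 1) * T (s + 1) x * deriv y0 x - polar_sum s (\<lambda>l. T l x) (x - y0 x) / 2) (at x)" for s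
    using along(1)[OF xX xX xX, of "deriv y0 x" s] D1 unfolding y0 .
  have ne: "x \<noteq> 0" "x \<noteq> 1" "x \<noteq> y0 x"
    using X01 xX unramified_base(1)[OF unr[OF xX]] by (auto simp: cubic_def y0)
  \<comment> \<open>The relation \<open>M'_eq\<close> holds on a whole disc and is differentiated
    there. As \<open>M'\<close> also has derivative \<open>M'' x\<close>, uniqueness of derivatives
    produces the formula for \<open>M'' x\<close>.\<close>
  have "(M' has_field_derivative of_nat (n + 1) * (T (n + 1) x * deriv (deriv y0) x
      + (of_nat (n + 2) * T (n + 2) x * deriv y0 x - polar_sum (n + 1) (\<lambda>l. T l x) (x - y0 x) / 2) * deriv y0 x)
      - (of_nat (n + 1) * polar_sum (n + 1) (\<lambda>l. T l x) (x - y0 x) * deriv y0 x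
        - 3 / 2 * (\<Sum>j\<le>n. of_nat (n + 1 - j) * T j x * (1 / (x - y0 x)) ^ (n + 2 - j))) / 2) (at x)"
  proof -
    have d0: "x - y0 x \<noteq> 0" using ne by simp
    have DT1: "(T (n + 1) has_field_derivative of_nat (n + 2) * T (n + 2) x * deriv y0 x
        - polar_sum (n + 1) (\<lambda>l. T l x) (x - y0 x) / 2) (at x)"
      using DT[of "n + 1"] by (simp add: numeral_2_eq_2)
    note D = DERIV_diff[OF DERIV_cmult[OF DERIV_mult[OF DT1 D2], of "of_nat (n + 1)"]
        DERIV_cdivide[OF has_field_derivative_polar_sum[OF DT D1 d0, of n], of 2]]
    have "\<forall>\<^sub>F t in nhds x. of_nat (n + 1) * (T (n + 1) t * deriv y0 t) - polar_sum n (\<lambda>l. T l t) (t - y0 t) / 2 = M' t"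
      using eventually_nhds_in_open[OF open_ball \<rho>(2)] by eventually_elim (simp only: M'_eq mult.assoc)
    from DERIV_cong_ev[OF refl this refl, THEN iffD1, OF D] show ?thesis
      by (simp only: add.commute mult.commute)
  qed
  from DERIV_unique[OF M(3)[OF sub(1)[OF \<rho>(2)]] this]
  have M''_eq: "M'' x = of_nat (n + 1) * (T (n + 1) x * deriv (deriv y0) x
      + (of_nat (n + 2) * T (n + 2) x * deriv y0 x - polar_sum (n + 1) (\<lambda>l. T l x) (x - y0 x) / 2) * deriv y0 x)
      - (of_nat (n + 1) * polar_sum (n + 1) (\<lambda>l. T l x) (x - y0 x) * deriv y0 x
        - 3 / 2 * (\<Sum>j\<le>n. of_nat (n + 1 - j) * T j x * (1 / (x - y0 x)) ^ (n + 2 - j))) / 2" .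
  have \<Lambda>: "L l x (y0 x) = fact l * snd (Q0 x) * T l x" for l
    using w0 by (simp add: T_def taylor_coeff_def y0)
  have "y0 analytic_on {x}" unfolding analytic_at using hol \<rho>(2) open_ball by blast
  moreover note second_order_equation[where T = "\<lambda>l. T l x" and \<Lambda> = "\<lambda>l. L l x (y0 x)", OF ne w0 sub(3)[OF \<rho>(2)] \<Lambda>
    M'_eq[OF \<rho>(2)] M''_eq]
  moreover have "x * (1 - x) * M'' x + (1 - 2 * x) * M' x - T n x / 4 = 0"
    using M(1,4)[OF sub(1)[OF \<rho>(2)]] by (simp add: T_def)
  ultimately show "y0 analytic_on {x} \<and>
    (let y = y0 x; y' = deriv y0 x; y'' = deriv (deriv y0) x; \<Lambda> = (\<lambda>l. L l x y) in
      y'' =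
        - y'\<^sup>2 * (\<Lambda> (n + 2) / \<Lambda> (n + 1))
        - y' * (1 / x + 1 / (x - 1) + 1 / (y - x))
        + y' * (fact (n + 1) / ((x - y) ^ (n + 2) * \<Lambda> (n + 1)))
            * (\<Sum>s\<le>n. \<Lambda> s * (x - y) ^ s / fact s)
        + fact n * (1 / x + 1 / (x - 1) + 2 / (y - x)) / (2 * (x - y) ^ (n + 1) * \<Lambda> (n + 1))
            * (\<Sum>s<n. \<Lambda> s * (x - y) ^ s / fact s)
        - fact n / (2 * (x - y) ^ (n + 2) * \<Lambda> (n + 1))
            * (\<Sum>s<n. of_nat (n - s) * \<Lambda> s * (x - y) ^ s / fact s)
        - fact n / (4 * (x - y) ^ (n + 2) * \<Lambda> (n + 1))
            * (\<Sum>s\<in>{1..<n}. \<Sum>k<s. \<Lambda> k * (x - y) ^ k / fact k)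
        - \<Lambda> n / (4 * \<Lambda> (n + 1))
            * (2 / (y - x) * (1 / x + 1 / (x - 1)) + 3 / (y - x)\<^sup>2 + 1 / (x - 1) - 1 / x))"
    unfolding Let_def by blast
qed

end
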